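(* Let $\mathbb{F}$ be an algebraically closed field of characteristic zero and let $\Gamma_3$ be the fine grading, with universal group $G_3=\mathbb{Z}_2\times\mathbb{Z}^4$, on the Lie algebra $\mathfrak{g}(S_8,S_2)$ of type $E_6$ described in the context. Identify the Weyl group $\mathcal{W}(\Gamma_3)$ with a subgroup of $\mathrm{Aut}(G_3)$, and elements of $\mathrm{Aut}(G_3)$ with their matrices (by columns, in $1+4$ blocks) relative to the canonical basis of $G_3$. Then $$\mathcal{W}(\Gamma_3)=\left\{\begin{pmatrix}\bar1&(a\ \ b\ \ a\ \ b)\\0&A\end{pmatrix}\;\middle|\; A\in\mathcal{W}_{\mathfrak{f}_4},\ a,b\in\mathbb{Z}_2\right\},$$ where $\mathcal{W}_{\mathfrak{f}_4}$ is the Weyl group of the Cartan grading of $\mathfrak{f}_4$ (the simple Lie algebra of type $F_4$), generated by $$s_1=\begin{pmatrix}0&-1&1&-1\\1&-1&1&0\\0&0&1&0\\0&0&0&1\end{pmatrix},\quad s_2=\begin{pmatrix}-1&1&0&-1\\0&1&0&0\\0&0&1&0\\0&0&0&1\end{pmatrix},$$ $$s_3=\begin{pmatrix}0&0&1&-1\\0&1&0&0\\1&0&0&1\\0&0&0&1\end{pmatrix},\quad s_4=\begin{pmatrix}1&0&-1&1\\0&1&-1&0\\0&0&0&-1\\0&0&1&-1\end{pmatrix}.$$ Thus $\mathcal{W}(\Gamma_3)\cong\mathbb{Z}_2^2\rtimes\mathcal{W}_{\mathfrak{f}_4}\cong\mathbb{Z}_2^2\rtimes((\mathbb{Z}_2^3\rtimes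 S_4)\rtimes S_3)$, where $S_n$ denotes the symmetric group on $n$ elements.
   Context: **Gradings.** For an abelian group $G$, a $G$-grading on an algebra $A$ is a decomposition $\Gamma: A=\bigoplus_{g\in G}A_g$ with $A_gA_h\subseteq A_{g+h}$; $\mathrm{Supp}\,\Gamma=\{g:A_g\ne0\}$. It is fine if it has no proper refinement (a decomposition graded by some abelian group whose components are contained in components of $\Gamma$, some properly). The universal group of $\Gamma$ is the abelian group $G$ realizing $\Gamma$ such that for any other realization over a group $H$ there is a unique homomorphism $G\to H$ restricting to the identity on the support. $\mathrm{Aut}(\Gamma)$ is the group of algebra automorphisms permuting the components, $\mathrm{Stab}(\Gamma)$ the subgroup fixing every component, and $\mathcal{W}(\Gamma)=\mathrm{Aut}(\Gamma)/\mathrm{Stab}(\Gamma)$. Each $f\in\mathrm{Aut}(\Gamma)$ induces $\alpha_f\in\mathrm{Aut}(G)$ ($G$ universal) with $f(A_s)=A_{\alpha_f(s)}$ for $s\in\mathrm{Supp}\,\Gamma$, which identifies $\mathcal{W}(\Gamma)$ with a subgroup of $\mathrm{Aut}(G)$. For $G=\mathbb{Z}_p^m\times\mathbb{Z}^n$, the matrix of $\alpha\in\mathrm{Aut}(G)$ has as $j$-th column the coordinates of the image of the $j$-th canonical basis element; its first $m$ rows have entries in $\mathbb{Z}_p$ and the last $n$ rows in $\mathbb{Z}$. **Algebras.** $\mathcal{C}$ is the split octonion algebra over $\mathbb{F}$ with multiplicative norm $q$, polar form $q(x,y)=q(x+y)-q(x)-q(y)$, and involution $\bar x=q(x,1)1-x$.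 It has a canonical basis $B=\{e_1,e_2,u_0,u_1,u_2,v_0,v_1,v_2\}$ with $e_i^2=e_i$, $e_1e_2=e_2e_1=0$, $e_1+e_2=1$, $e_1u_i=u_i=u_ie_2$, $e_2v_i=v_i=v_ie_1$, $u_iv_i=-e_1$, $v_iu_i=-e_2$, $u_iu_{i+1}=-u_{i+1}u_i=v_{i+2}$, $v_iv_{i+1}=-v_{i+1}v_i=u_{i+2}$ (indices mod 3), all other products of basis elements being zero. $S_8$ is $\mathcal{C}$ with the new product $x*y=\bar x\bar y$; $S_2$ is $\mathbb{F}\oplus\mathbb{F}$ (norm $q(a,b)=ab$, involution the swap) with the new product $x*y=\bar x\bar y$. For $S=S_8,S_2$: $\mathfrak{tri}(S)=\{(d_0,d_1,d_2)\in\mathfrak{o}(S,q)^3: d_0(x*y)=d_1(x)*y+x*d_2(y)\ \forall x,y\}$, $\vartheta(d_0,d_1,d_2)=(d_2,d_0,d_1)$, $t_{x,y}=(\sigma_{x,y},\frac12q(x,y)\mathrm{id}-r_xl_y,\frac12q(x,y)\mathrm{id}-l_xr_y)\in\mathfrak{tri}(S)$, where $\sigma_{x,y}(z)=q(x,z)y-q(y,z)x$, $l_x(z)=x*z$, $r_x(z)=z*x$. $\mathfrak{g}(S_8,S_2)=\mathfrak{tri}(S_8)\oplus\mathfrak{tri}(S_2)\oplus\bigoplus_{i=0}^2\iota_i(S_8\otimes S_2)$, with each $\iota_i(S_8\otimes S_2)$ a copy of $S_8\otimes S_2$; $\mathfrak{tri}(S_8)\oplus\mathfrak{tri}(S_2)$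 is a subalgebra, $[(d_0,d_1,d_2),\iota_i(x\otimes x')]=\iota_i(d_i(x)\otimes x')$, $[(d_0',d_1',d_2'),\iota_i(x\otimes x')]=\iota_i(x\otimes d_i'(x'))$, $[\iota_i(x\otimes x'),\iota_{i+1}(y\otimes y')]=\iota_{i+2}((x*y)\otimes(x'*y'))$, $[\iota_i(x\otimes x'),\iota_i(y\otimes y')]=q(x',y')\vartheta^i(t_{x,y})+q(x,y)\vartheta^i(t_{x',y'})$ (indices mod 3). It is a Lie algebra of type $E_6$. **The grading $\Gamma_3$.** The $\mathbb{Z}_2$-component of the degree is given by the order two automorphism $\varrho$ extending the swap of $S_2$: $\varrho(\iota_i(x\otimes x'))=\iota_i(x\otimes\bar x')$, identity on $\mathfrak{tri}(S_8)$, conjugation by the swap on $\mathfrak{tri}(S_2)$ ($\pm1$ eigenspaces have degree $\bar0,\bar1$). The $\mathbb{Z}^4$-component: let $a_1,a_2,g_1,g_2$ be the canonical basis of $\mathbb{Z}^4$ (in this order), $a_0=-a_1-a_2$, $g_0=-g_1-g_2$. For $s\in S_2$ and $i$ mod 3: $\deg\iota_i(e_1\otimes s)=a_i=-\deg\iota_i(e_2\otimes s)$; $\deg\iota_i(u_i\otimes s)=g_i=-\deg\iota_i(v_i\otimes s)$; $\deg\iota_i(u_{i+1}\otimes s)=a_{i+2}+g_{i+1}=-\deg\iota_i(v_{i+1}\otimes s)$; $\deg\iota_i(u_{i+2}\otimes s)=-a_{i+1}+g_{i+2}=-\deg\iota_i(v_{i+2}\otimes s)$; $\mathfrak{tri}(S_2)$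 has degree $0$; $\deg t_{x,y}=\deg\iota_0(x\otimes s)+\deg\iota_0(y\otimes s)$ for $x,y\in B$. The restriction of this $\mathbb{Z}^4$-grading to the fixed subalgebra of $\varrho$, which is isomorphic to $\mathfrak{f}_4$, is the Cartan grading of $\mathfrak{f}_4$; $\mathcal{W}_{\mathfrak{f}_4}\le\mathrm{GL}_4(\mathbb{Z})$ is its Weyl group in the basis $a_1,a_2,g_1,g_2$. *)

theory Defs
  imports
    "HOL-Analysis.Analysis"
    "HOL-Algebra.Sym_Groups"
    "HOL-Algebra.Elementary_Groups"
    "HOL-Algebra.Coset"
    "HOL-Algebra.Bij"
    "HOL-Library.Function_Algebras"
begin

section \<open>Gradings and their Weyl groups\<close>

text \<open>
  A (not necessarily associative) algebra over a field of type 'k: a subspace alg_carrier of an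
  ambient additive group of type 'v, with scalar multiplication and product.  Only the values on
  the carrier matter.
\<close>

record ('k, 'v) algebra_struct =
  alg_carrier :: "'v set"
  alg_scale :: "'k \<Rightarrow> 'v \<Rightarrow> 'v"
  alg_mult :: "'v \<Rightarrow> 'v \<Rightarrow> 'v"

definition group_grading ::
  "('k::field, 'v::ab_group_add) algebra_struct \<Rightarrow> ('g::ab_group_add \<Rightarrow> 'v set) \<Rightarrow> bool" where
  "group_grading L A \<longleftrightarrow>
     (\<forall>g. module.subspace (alg_scale L) (A g) \<and> A g \<subseteq> alg_carrier L) \<and>
     (\<forall>x \<in> alg_carrier L.
        \<exists>!c. finite {g. c g \<noteq> 0} \<and> (\<forall>g. c g \<in> A g) \<and> x = (\<Sum>g | c g \<noteq> 0. c g)) \<and>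
     (\<forall>g h. \<forall>x \<in> A g. \<forall>y \<in> A h. alg_mult L x y \<in> A (g + h))"

definition grading_supp :: "('g \<Rightarrow> 'v::zero set) \<Rightarrow> 'g set" where
  "grading_supp A = {g. A g \<noteq> {0}}"

definition hom_components :: "('g \<Rightarrow> 'v::zero set) \<Rightarrow> 'v set set" where
  "hom_components A = A ` grading_supp A"

definition proper_refinement :: "('h \<Rightarrow> 'v::zero set) \<Rightarrow> ('g \<Rightarrow> 'v set) \<Rightarrow> bool" where
  "proper_refinement B A \<longleftrightarrow>
     (\<forall>X \<in> hom_components B. \<exists>Y \<in> hom_components A. X \<subseteq> Y) \<and>
     (\<exists>X \<in> hom_components B. \<exists>Y \<in> hom_components A. X \<subset> Y)"

text \<open>
  Fineness and universality quantify over all abelian groups.  HOL cannot quantify over types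
  inside a formula, so the group is a type argument; a theorem in which 'h is a free type
  variable covers every abelian group.
\<close>

definition fine_grading ::
  "'h::ab_group_add itself \<Rightarrow> ('k::field, 'v::ab_group_add) algebra_struct \<Rightarrow>
     ('g::ab_group_add \<Rightarrow> 'v set) \<Rightarrow> bool" where
  "fine_grading TYPE('h) L A \<longleftrightarrow>
     group_grading L A \<and> \<not> (\<exists>B :: 'h \<Rightarrow> 'v set. group_grading L B \<and> proper_refinement B A)"

text \<open>
  A realization over 'h is an 'h-grading B with the same components as A; a homomorphism f is the
  identity on the support if it sends the degree of each component in A to its degree in B.
\<close>

definition universal_group ::
  "'h::ab_group_add itself \<Rightarrow> ('k::field, 'v::ab_group_add) algebra_struct \<Rightarrow>
     ('g::ab_group_add \<Rightarrow> 'v set) \<Rightarrow> bool" where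
  "universal_group TYPE('h) L A \<longleftrightarrow>
     group_grading L A \<and>
     (\<forall>B :: 'h \<Rightarrow> 'v set. group_grading L B \<and> hom_components B = hom_components A \<longrightarrow>
        (\<exists>!f. (\<forall>x y. f (x + y) = f x + f y) \<and> (\<forall>s \<in> grading_supp A. B (f s) = A s)))"

definition algebra_auts ::
  "('k::field, 'v::ab_group_add) algebra_struct \<Rightarrow> ('v \<Rightarrow> 'v) set" where
  "algebra_auts L = {f \<in> Bij (alg_carrier L).
     (\<forall>x \<in> alg_carrier L. \<forall>y \<in> alg_carrier L. f (x + y) = f x + f y) \<and>
     (\<forall>c. \<forall>x \<in> alg_carrier L. f (alg_scale L c x) = alg_scale L c (f x)) \<and>
     (\<forall>x \<in> alg_carrier L. \<forall>y \<in> alg_carrier L. f (alg_mult L x y) = alg_mult L (f x) (f y))}"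

definition grading_auts ::
  "('k::field, 'v::ab_group_add) algebra_struct \<Rightarrow> ('g \<Rightarrow> 'v set) \<Rightarrow> ('v \<Rightarrow> 'v) monoid" where
  "grading_auts L A = (BijGroup (alg_carrier L))
     \<lparr>carrier := {f \<in> algebra_auts L. bij_betw (image f) (hom_components A) (hom_components A)}\<rparr>"

definition grading_stab ::
  "('k::field, 'v::ab_group_add) algebra_struct \<Rightarrow> ('g \<Rightarrow> 'v set) \<Rightarrow> ('v \<Rightarrow> 'v) set" where
  "grading_stab L A = {f \<in> carrier (grading_auts L A). \<forall>X \<in> hom_components A. f ` X = X}"

definition weyl_group ::
  "('k::field, 'v::ab_group_add) algebra_struct \<Rightarrow> ('g \<Rightarrow> 'v set) \<Rightarrow> ('v \<Rightarrow> 'v) set monoid" where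
  "weyl_group L A = grading_auts L A Mod grading_stab L A"

definition additive_group :: "'g::ab_group_add monoid" where
  "additive_group = \<lparr>carrier = UNIV, monoid.mult = (+), one = 0\<rparr>"

definition induces :: "('g::ab_group_add \<Rightarrow> 'v::zero set) \<Rightarrow> ('v \<Rightarrow> 'v) \<Rightarrow> ('g \<Rightarrow> 'g) \<Rightarrow> bool" where
  "induces A f \<alpha> \<longleftrightarrow>
     \<alpha> \<in> carrier (AutoGroup additive_group) \<and> (\<forall>s \<in> grading_supp A. f ` A s = A (\<alpha> s))"

definition induced_aut ::
  "('g::ab_group_add \<Rightarrow> 'v::zero set) \<Rightarrow> ('v \<Rightarrow> 'v) \<Rightarrow> ('g \<Rightarrow> 'g)" where
  "induced_aut A f = (THE \<alpha>. induces A f \<alpha>)"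

definition weyl_embedding ::
  "('g::ab_group_add \<Rightarrow> 'v::zero set) \<Rightarrow> ('v \<Rightarrow> 'v) set \<Rightarrow> ('g \<Rightarrow> 'g)" where
  "weyl_embedding A X = the_elem (induced_aut A ` X)"

text \<open>The Weyl group is identified, via the induced maps, with a group of automorphisms of 'g.\<close>

definition weyl_identification ::
  "('k::field, 'v::ab_group_add) algebra_struct \<Rightarrow> ('g::ab_group_add \<Rightarrow> 'v set) \<Rightarrow> bool" where
  "weyl_identification L A \<longleftrightarrow>
     (\<forall>f \<in> carrier (grading_auts L A). \<exists>!\<alpha>. induces A f \<alpha>) \<and>
     weyl_embedding A \<in> mon (weyl_group L A) (AutoGroup additive_group)"

definition weyl_image ::
  "('k::field, 'v::ab_group_add) algebra_struct \<Rightarrow> ('g::ab_group_add \<Rightarrow> 'v set) \<Rightarrow> ('g \<Rightarrow> 'g) set"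
  where
  "weyl_image L A = weyl_embedding A ` carrier (weyl_group L A)"


section \<open>Split octonions and the symmetric composition algebras\<close>

text \<open>Indices modulo 3 are elements of the numeral type 3.\<close>

datatype oct_basis = Oe1 | Oe2 | Ou "3" | Ov "3"

instance oct_basis :: finite
proof
  have "(UNIV :: oct_basis set) = {Oe1, Oe2} \<union> range Ou \<union> range Ov"
    by (auto intro: oct_basis.exhaust)
  then show "finite (UNIV :: oct_basis set)"
    by (metis finite.emptyI finite.insertI finite_Un finite_imageI finite_class.finite_UNIV)
qed

type_synonym 'k oct = "'k ^ oct_basis"

fun oct_basis_mult :: "oct_basis \<Rightarrow> oct_basis \<Rightarrow> 'k::field oct" where
  "oct_basis_mult Oe1 Oe1 = axis Oe1 1"
| "oct_basis_mult Oe1 Oe2 = 0"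
| "oct_basis_mult Oe1 (Ou i) = axis (Ou i) 1"
| "oct_basis_mult Oe1 (Ov i) = 0"
| "oct_basis_mult Oe2 Oe1 = 0"
| "oct_basis_mult Oe2 Oe2 = axis Oe2 1"
| "oct_basis_mult Oe2 (Ou i) = 0"
| "oct_basis_mult Oe2 (Ov i) = axis (Ov i) 1"
| "oct_basis_mult (Ou i) Oe1 = 0"
| "oct_basis_mult (Ou i) Oe2 = axis (Ou i) 1"
| "oct_basis_mult (Ov i) Oe1 = axis (Ov i) 1"
| "oct_basis_mult (Ov i) Oe2 = 0"
| "oct_basis_mult (Ou i) (Ov j) = (if i = j then - axis Oe1 1 else 0)"
| "oct_basis_mult (Ov i) (Ou j) = (if i = j then - axis Oe2 1 else 0)"
| "oct_basis_mult (Ou i) (Ou j) =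
     (if j = i + 1 then axis (Ov (i + 2)) 1 else if i = j + 1 then - axis (Ov (j + 2)) 1 else 0)"
| "oct_basis_mult (Ov i) (Ov j) =
     (if j = i + 1 then axis (Ou (i + 2)) 1 else if i = j + 1 then - axis (Ou (j + 2)) 1 else 0)"

definition oct_mult :: "'k::field oct \<Rightarrow> 'k oct \<Rightarrow> 'k oct" where
  "oct_mult x y = (\<Sum>a\<in>UNIV. \<Sum>b\<in>UNIV. (x $ a * y $ b) *s oct_basis_mult a b)"

definition oct_one :: "'k::field oct" where
  "oct_one = axis Oe1 1 + axis Oe2 1"

text \<open>
  The multiplicative norm in coordinates: the e's and the pairs u_i, v_i are hyperbolic pairs.
\<close>

definition oct_norm :: "'k::field oct \<Rightarrow> 'k" where
  "oct_norm x = x $ Oe1 * x $ Oe2 + (\<Sum>i\<in>UNIV. x $ Ou i * x $ Ov i)"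

definition polar :: "('k::field ^ 'n \<Rightarrow> 'k) \<Rightarrow> 'k ^ 'n \<Rightarrow> 'k ^ 'n \<Rightarrow> 'k" where
  "polar n x y = n (x + y) - n x - n y"

definition oct_conj :: "'k::field oct \<Rightarrow> 'k oct" where
  "oct_conj x = polar oct_norm x oct_one *s oct_one - x"

definition S8_mult :: "'k::field oct \<Rightarrow> 'k oct \<Rightarrow> 'k oct" where
  "S8_mult x y = oct_mult (oct_conj x) (oct_conj y)"

definition S2_norm :: "'k::field ^ 2 \<Rightarrow> 'k" where
  "S2_norm x = x $ 1 * x $ 2"

definition S2_swap :: "'k::field ^ 2 \<Rightarrow> 'k ^ 2" where
  "S2_swap x = vector [x $ 2, x $ 1]"

definition S2_mult :: "'k::field ^ 2 \<Rightarrow> 'k ^ 2 \<Rightarrow> 'k ^ 2" where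
  "S2_mult x y = (\<chi> i. S2_swap x $ i * S2_swap y $ i)"

abbreviation q8 :: "'k::field oct \<Rightarrow> 'k oct \<Rightarrow> 'k" where
  "q8 \<equiv> polar oct_norm"

abbreviation q2 :: "'k::field ^ 2 \<Rightarrow> 'k ^ 2 \<Rightarrow> 'k" where
  "q2 \<equiv> polar S2_norm"


section \<open>Triality Lie algebras\<close>

definition orth_lie :: "('k::field ^ 'n \<Rightarrow> 'k ^ 'n \<Rightarrow> 'k) \<Rightarrow> ('k ^ 'n \<Rightarrow> 'k ^ 'n) set" where
  "orth_lie q = {d. Vector_Spaces.linear (*s) (*s) d \<and> (\<forall>x y. q (d x) y + q x (d y) = 0)}"

text \<open>A triple is a function on the type 3.\<close>

definition tri ::
  "('k::field ^ 'n \<Rightarrow> 'k ^ 'n \<Rightarrow> 'k ^ 'n) \<Rightarrow> ('k ^ 'n \<Rightarrow> 'k ^ 'n \<Rightarrow> 'k) \<Rightarrow>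
     (3 \<Rightarrow> 'k ^ 'n \<Rightarrow> 'k ^ 'n) set" where
  "tri st q = {d. (\<forall>i. d i \<in> orth_lie q) \<and> (\<forall>x y. d 0 (st x y) = st (d 1 x) y + st x (d 2 y))}"

definition tri_t ::
  "('k::field ^ 'n \<Rightarrow> 'k ^ 'n \<Rightarrow> 'k ^ 'n) \<Rightarrow> ('k ^ 'n \<Rightarrow> 'k ^ 'n \<Rightarrow> 'k) \<Rightarrow>
     'k ^ 'n \<Rightarrow> 'k ^ 'n \<Rightarrow> 3 \<Rightarrow> 'k ^ 'n \<Rightarrow> 'k ^ 'n" where
  "tri_t st q x y i =
     (if i = 0 then (\<lambda>z. q x z *s y - q y z *s x)
      else if i = 1 then (\<lambda>z. (q x y / 2) *s z - st (st y z) x)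
      else (\<lambda>z. (q x y / 2) *s z - st x (st z y)))"

text \<open>The i-th power of (d0, d1, d2) |-> (d2, d0, d1), which has order three.\<close>

definition theta :: "3 \<Rightarrow> (3 \<Rightarrow> 'd) \<Rightarrow> 3 \<Rightarrow> 'd" where
  "theta i d = (\<lambda>j. d (j - i))"


section \<open>The Lie algebra g(S8, S2)\<close>

text \<open>
  The tensor product of S8 and S2 is realized by coordinates in the product basis.
\<close>

type_synonym 'k tens = "'k ^ (oct_basis \<times> 2)"

definition tensor :: "'k::field oct \<Rightarrow> 'k ^ 2 \<Rightarrow> 'k tens" where
  "tensor x y = (\<chi> p. x $ fst p * y $ snd p)"

definition tensor_map :: "('k::field oct \<Rightarrow> 'k oct) \<Rightarrow> ('k ^ 2 \<Rightarrow> 'k ^ 2) \<Rightarrow> 'k tens \<Rightarrow> 'k tens" where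
  "tensor_map f g z = (\<Sum>(a, b)\<in>UNIV. (z $ (a, b)) *s tensor (f (axis a 1)) (g (axis b 1)))"

definition tensor_mult :: "'k::field tens \<Rightarrow> 'k tens \<Rightarrow> 'k tens" where
  "tensor_mult z w = (\<Sum>(a, b)\<in>UNIV. \<Sum>(c, d)\<in>UNIV. (z $ (a, b) * w $ (c, d)) *s
     tensor (S8_mult (axis a 1) (axis c 1)) (S2_mult (axis b 1) (axis d 1)))"

type_synonym 'k gvec =
  "(3 \<Rightarrow> 'k oct \<Rightarrow> 'k oct) \<times> (3 \<Rightarrow> 'k ^ 2 \<Rightarrow> 'k ^ 2) \<times> (3 \<Rightarrow> 'k tens)"

definition iota :: "3 \<Rightarrow> 'k::field tens \<Rightarrow> 'k gvec" where
  "iota i z = (0, 0, (\<lambda>j. if j = i then z else 0))"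

definition in_tri8 :: "(3 \<Rightarrow> 'k::field oct \<Rightarrow> 'k oct) \<Rightarrow> 'k gvec" where
  "in_tri8 d = (d, 0, 0)"

definition in_tri2 :: "(3 \<Rightarrow> 'k::field ^ 2 \<Rightarrow> 'k ^ 2) \<Rightarrow> 'k gvec" where
  "in_tri2 d = (0, d, 0)"

definition gscale :: "'k::field \<Rightarrow> 'k gvec \<Rightarrow> 'k gvec" where
  "gscale k = (\<lambda>(d, d', z). (\<lambda>i x. k *s d i x, \<lambda>i x. k *s d' i x, \<lambda>i. k *s z i))"

definition commutator :: "('v \<Rightarrow> 'v) \<Rightarrow> ('v \<Rightarrow> 'v) \<Rightarrow> 'v \<Rightarrow> 'v::minus" where
  "commutator f g x = f (g x) - g (f x)"

text \<open>
  The next two functions are the components in tri(S8) and tri(S2) of the bracket of two elements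
  of the i-th copy of the tensor product, extended bilinearly from pure tensors.
\<close>

definition iota_br8 :: "3 \<Rightarrow> 'k::field tens \<Rightarrow> 'k tens \<Rightarrow> 3 \<Rightarrow> 'k oct \<Rightarrow> 'k oct" where
  "iota_br8 i z w j x = (\<Sum>(a, b)\<in>UNIV. \<Sum>(c, d)\<in>UNIV.
     (z $ (a, b) * w $ (c, d) * q2 (axis b 1) (axis d 1)) *s
       theta i (tri_t S8_mult q8 (axis a 1) (axis c 1)) j x)"

definition iota_br2 :: "3 \<Rightarrow> 'k::field tens \<Rightarrow> 'k tens \<Rightarrow> 3 \<Rightarrow> 'k ^ 2 \<Rightarrow> 'k ^ 2" where
  "iota_br2 i z w j x = (\<Sum>(a, b)\<in>UNIV. \<Sum>(c, d)\<in>UNIV.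
     (z $ (a, b) * w $ (c, d) * q8 (axis a 1) (axis c 1)) *s
       theta i (tri_t S2_mult q2 (axis b 1) (axis d 1)) j x)"

text \<open>
  In the last component, the products of the copies k+1 and k+2 land in the copy k.
\<close>

definition gbracket :: "'k::field gvec \<Rightarrow> 'k gvec \<Rightarrow> 'k gvec" where
  "gbracket = (\<lambda>(d, d', z) (e, e', w).
     (\<lambda>j. commutator (d j) (e j) + (\<Sum>i\<in>UNIV. iota_br8 i (z i) (w i) j),
      \<lambda>j. commutator (d' j) (e' j) + (\<Sum>i\<in>UNIV. iota_br2 i (z i) (w i) j),
      \<lambda>k. tensor_map (d k) id (w k) - tensor_map (e k) id (z k)
        + tensor_map id (d' k) (w k) - tensor_map id (e' k) (z k)
        + tensor_mult (z (k + 1)) (w (k + 2)) - tensor_mult (w (k + 1)) (z (k + 2))))"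

definition g_S8_S2 :: "('k::field, 'k gvec) algebra_struct" where
  "g_S8_S2 = \<lparr>alg_carrier = tri S8_mult q8 \<times> tri S2_mult q2 \<times> UNIV,
     alg_scale = gscale, alg_mult = gbracket\<rparr>"


section \<open>The gradings\<close>

definition rho :: "'k::field gvec \<Rightarrow> 'k gvec" where
  "rho = (\<lambda>(d, d', z).
     (d, \<lambda>i. S2_swap \<circ> d' i \<circ> S2_swap, \<lambda>i. tensor_map id S2_swap (z i)))"

text \<open>Coordinates in int^4 are with respect to a1, a2, g1, g2.\<close>

definition deg_a :: "3 \<Rightarrow> int ^ 4" where
  "deg_a i = (if i = 1 then vector [1, 0, 0, 0] else if i = 2 then vector [0, 1, 0, 0]
              else vector [-1, -1, 0, 0])"

definition deg_g :: "3 \<Rightarrow> int ^ 4" where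
  "deg_g i = (if i = 1 then vector [0, 0, 1, 0] else if i = 2 then vector [0, 0, 0, 1]
              else vector [0, 0, -1, -1])"

text \<open>The degree of the i-th copy of u_j tensor s (its negative for v_j).\<close>

definition deg_u :: "3 \<Rightarrow> 3 \<Rightarrow> int ^ 4" where
  "deg_u i j = (if j = i then deg_g i
                else if j = i + 1 then deg_a (i + 2) + deg_g (i + 1)
                else - deg_a (i + 1) + deg_g (i + 2))"

fun deg_iota :: "3 \<Rightarrow> oct_basis \<Rightarrow> int ^ 4" where
  "deg_iota i Oe1 = deg_a i"
| "deg_iota i Oe2 = - deg_a i"
| "deg_iota i (Ou j) = deg_u i j"
| "deg_iota i (Ov j) = - deg_u i j"

definition Z4_generators :: "int ^ 4 \<Rightarrow> 'k::field gvec set" where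
  "Z4_generators v =
     {iota i (tensor (axis b 1) s) |i b s. deg_iota i b = v} \<union>
     {in_tri2 d |d. d \<in> tri S2_mult q2 \<and> v = 0} \<union>
     {in_tri8 (tri_t S8_mult q8 (axis b 1) (axis c 1)) |b c. deg_iota 0 b + deg_iota 0 c = v}"

definition Z4_component :: "int ^ 4 \<Rightarrow> 'k::field gvec set" where
  "Z4_component v = module.span gscale (Z4_generators v)"

text \<open>The type 2 is the ring of integers modulo 2.\<close>

type_synonym G3 = "2 \<times> (int ^ 4)"

definition Gamma3 :: "G3 \<Rightarrow> 'k::field gvec set" where
  "Gamma3 = (\<lambda>(k, v). {x \<in> Z4_component v. rho x = (if k = 0 then x else - x)})"

definition f4 :: "('k::field, 'k gvec) algebra_struct" where
  "f4 = g_S8_S2\<lparr>alg_carrier := {x \<in> alg_carrier g_S8_S2. rho x = x}\<rparr>"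

definition f4_cartan_grading :: "int ^ 4 \<Rightarrow> 'k::field gvec set" where
  "f4_cartan_grading v = Z4_component v \<inter> alg_carrier f4"


section \<open>Matrices\<close>

text \<open>A 1+4 block matrix: upper left entry, upper right row, lower left column, lower right block.\<close>

datatype block_matrix = Block "2" "2 ^ 4" "int ^ 4" "int ^ 4 ^ 4"

definition G3_matrix :: "(G3 \<Rightarrow> G3) \<Rightarrow> block_matrix" where
  "G3_matrix \<alpha> = Block
     (fst (\<alpha> (1, 0)))
     (\<chi> j. fst (\<alpha> (0, axis j 1)))
     (snd (\<alpha> (1, 0)))
     (\<chi> i j. snd (\<alpha> (0, axis j 1)) $ i)"

definition GL4Z :: "(int ^ 4 ^ 4) monoid" where
  "GL4Z = \<lparr>carrier = {A. invertible A}, monoid.mult = (**), one = mat 1\<rparr>"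

definition W_f4 :: "'k::field itself \<Rightarrow> (int ^ 4 ^ 4) set" where
  "W_f4 TYPE('k) =
     matrix ` weyl_image (f4 :: ('k, 'k gvec) algebra_struct) f4_cartan_grading"

definition W_f4_group :: "'k::field itself \<Rightarrow> (int ^ 4 ^ 4) monoid" where
  "W_f4_group TYPE('k) = GL4Z\<lparr>carrier := W_f4 TYPE('k)\<rparr>"

definition f4_s1 :: "int ^ 4 ^ 4" where
  "f4_s1 = vector [vector [0, -1, 1, -1], vector [1, -1, 1, 0],
                vector [0, 0, 1, 0], vector [0, 0, 0, 1]]"

definition f4_s2 :: "int ^ 4 ^ 4" where
  "f4_s2 = vector [vector [-1, 1, 0, -1], vector [0, 1, 0, 0],
                vector [0, 0, 1, 0], vector [0, 0, 0, 1]]"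

definition f4_s3 :: "int ^ 4 ^ 4" where
  "f4_s3 = vector [vector [0, 0, 1, -1], vector [0, 1, 0, 0],
                vector [1, 0, 0, 1], vector [0, 0, 0, 1]]"

definition f4_s4 :: "int ^ 4 ^ 4" where
  "f4_s4 = vector [vector [1, 0, -1, 1], vector [0, 1, -1, 0],
                vector [0, 0, 0, -1], vector [0, 0, 1, -1]]"


section \<open>Semidirect products\<close>

definition group_action_by_auts ::
  "('b, 'y) monoid_scheme \<Rightarrow> ('a, 'x) monoid_scheme \<Rightarrow> ('b \<Rightarrow> 'a \<Rightarrow> 'a) \<Rightarrow> bool" where
  "group_action_by_auts H N \<phi> \<longleftrightarrow> \<phi> \<in> hom H (AutoGroup N)"

definition semidirect ::
  "('a, 'x) monoid_scheme \<Rightarrow> ('b \<Rightarrow> 'a \<Rightarrow> 'a) \<Rightarrow> ('b, 'y) monoid_scheme \<Rightarrow> ('a \<times> 'b) monoid" where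
  "semidirect N \<phi> H =
     \<lparr>carrier = carrier N \<times> carrier H,
      monoid.mult = (\<lambda>(n, h) (n', h'). (n \<otimes>\<^bsub>N\<^esub> \<phi> h n', h \<otimes>\<^bsub>H\<^esub> h')),
      one = (\<one>\<^bsub>N\<^esub>, \<one>\<^bsub>H\<^esub>)\<rparr>"

definition Z2_pow2 :: "(int \<times> int) monoid" where
  "Z2_pow2 = integer_mod_group 2 \<times>\<times> integer_mod_group 2"

definition Z2_pow3 :: "(int \<times> int \<times> int) monoid" where
  "Z2_pow3 = integer_mod_group 2 \<times>\<times> integer_mod_group 2 \<times>\<times> integer_mod_group 2"

end

theory Submission
  imports Defs
begin

text \<open>
  The degrees are read in the root lattice Z^4 of F4 with its Weyl-invariant quadratic form: the
  degrees of the root vectors in the three copies of S8 are the 24 vectors of norm 1 (short roots).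
  Every grading in which these root vectors are homogeneous is determined by their degrees, and the
  nonzero brackets force these to come from a homomorphism of Z2 x Z^4; this gives both fineness
  and universality.  A short root has homogeneous components in both Z2-degrees, a long root only
  in degree 0.  Hence an induced automorphism preserves the short roots, so it acts on Z^4 by an
  isometry, and its Z2-valued part vanishes on the long roots, which leaves the rows (a b a b).
  Conversely, the four generating isometries lift to signed permutations of the canonical bases
  that respect the triality product, and the rows (a b a b) come from multiplying the two halves of
  the three copies by c and 1/c, with c in {1, i, -i} and i^2 = -1.
\<close>

section \<open>Gradings in general\<close>

text \<open>The lattice is that of the Hurwitz quaternions. Its vectors of even norm form a
  sublattice of index 4, and the degrees of the three copies lie in the three other classes. Both
  extensions in the answer come from this quotient Z2^2: since v1 + v3 and v2 + v4 modulo 2 are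
  coordinates on it, its characters are the rows (a b a b); and the action of the isometries on its
  three nonzero classes is the S3 on top of Z2^3 : S4. The obstacle is that an induced automorphism
  is only known to preserve the support, while it has to be an isometry. Preserving norm 1 is
  enough, because the Gram matrix of the canonical basis can be recovered from the knowledge of
  which sums and differences of basis vectors are short. For f4 there is no Z2-degree to recognize
  short roots; there they are the nonzero support vectors v for which v + r and v - r lie in the
  support for some nonzero r. The scalars 1, i, -i multiply to 1, which is what the products between
  the three copies demand.\<close>

locale ambient_algebra = module "alg_scale L"
  for L :: "('k::field, 'v::ab_group_add) algebra_struct" +
  assumes carrier_subspace: "subspace (alg_carrier L)"
    and mult_closed: "\<lbrakk>x \<in> alg_carrier L; y \<in> alg_carrier L\<rbrakk> \<Longrightarrow> alg_mult L x y \<in> alg_carrier L"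
begin

abbreviation C where "C \<equiv> alg_carrier L"

lemma zero_C: "0 \<in> C" and add_C: "x \<in> C \<Longrightarrow> y \<in> C \<Longrightarrow> x + y \<in> C"
  and scale_C: "x \<in> C \<Longrightarrow> alg_scale L c x \<in> C"
  using carrier_subspace by (auto simp: subspace_def)

text \<open>Applying \<open>P h\<close> to any finite decomposition of x leaves only its term of
  degree h, so the decomposition is unique; it exists because the finitely many projections indexed
  by F add up to x. Both concrete gradings are obtained in this way.\<close>

lemma group_gradingI:
  fixes A :: "'g::ab_group_add \<Rightarrow> 'v set" and P :: "'g \<Rightarrow> 'v \<Rightarrow> 'v"
  assumes sub: "\<And>g. subspace (A g)" and carr: "\<And>g. A g \<subseteq> C" and fin: "finite F"
    and PA: "\<And>x g. x \<in> C \<Longrightarrow> P g x \<in> A g"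
    and sum: "\<And>x. x \<in> C \<Longrightarrow> (\<Sum>g\<in>F. P g x) = x"
    and out: "\<And>x g. x \<in> C \<Longrightarrow> g \<notin> F \<Longrightarrow> P g x = 0"
    and add: "\<And>x y g. x \<in> C \<Longrightarrow> y \<in> C \<Longrightarrow> P g (x + y) = P g x + P g y"
    and proj: "\<And>x g h. x \<in> A h \<Longrightarrow> P g x = (if g = h then x else 0)"
    and mult: "\<And>x y g h. x \<in> A g \<Longrightarrow> y \<in> A h \<Longrightarrow> alg_mult L x y \<in> A (g + h)"
  shows "group_grading L A"
  unfolding group_grading_def
proof (intro conjI allI ballI)
  fix x assume x: "x \<in> C"
  have P0: "P g 0 = 0" for g
    using proj[of 0 0 g] subspace_0[OF sub] by (auto split: if_splits)
  show "\<exists>!c. finite {g. c g \<noteq> 0} \<and> (\<forall>g. c g \<in> A g) \<and> x = (\<Sum>g | c g \<noteq> 0. c g)"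
  proof (rule ex1I[of _ "\<lambda>g. P g x"], intro conjI allI)
    have sb: "{g. P g x \<noteq> 0} \<subseteq> F" using out[OF x] by auto
    then show "finite {g. P g x \<noteq> 0}" using fin finite_subset by auto
    show "P g x \<in> A g" for g using PA x by auto
    show "x = (\<Sum>g | P g x \<noteq> 0. P g x)"
      using sum[OF x] sum.mono_neutral_left[OF fin sb, of "\<lambda>g. P g x"] by auto
  next
    fix c assume c: "finite {g. c g \<noteq> 0} \<and> (\<forall>g. c g \<in> A g) \<and> x = (\<Sum>g | c g \<noteq> 0. c g)"
    have cC: "c g \<in> C" for g using c carr by blast
    have "sum c S \<in> C \<and> P h (sum c S) = (\<Sum>g\<in>S. P h (c g))" if "finite S" for S h
      using that by induction (simp_all add: cC add_C add P0 zero_C)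
    then have "P h x = (\<Sum>g | c g \<noteq> 0. P h (c g))" for h
      using conjunct1[OF c] conjunct2[OF conjunct2[OF c]] by simp
    moreover have "(\<Sum>g | c g \<noteq> 0. P h (c g)) = (\<Sum>g | c g \<noteq> 0. if g = h then c g else 0)" for h
    proof -
      have "P h (c g) = (if h = g then c g else 0)" for g using proj[of "c g" g h] c by blast
      then show ?thesis by (auto intro: sum.cong)
    qed
    ultimately have "P h x = c h" for h
      using conjunct1[OF c] by (simp add: sum.delta')
    then show "c = (\<lambda>g. P g x)" by (simp add: fun_eq_iff)
  qed
qed (use sub carr mult in auto)

end

locale graded_algebra = ambient_algebra L
  for L :: "('k::field, 'v::ab_group_add) algebra_struct" +
  fixes A :: "'g::ab_group_add \<Rightarrow> 'v set"
  assumes grading: "group_grading L A"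
begin

lemma comp_subspace: "subspace (A g)" and comp_carrier: "A g \<subseteq> C"
  and comp_mult: "x \<in> A g \<Longrightarrow> y \<in> A h \<Longrightarrow> alg_mult L x y \<in> A (g + h)"
  and decomposition:
    "x \<in> C \<Longrightarrow> \<exists>!c. finite {g. c g \<noteq> 0} \<and> (\<forall>g. c g \<in> A g) \<and> x = (\<Sum>g | c g \<noteq> 0. c g)"
  using grading by (auto simp: group_grading_def)

lemma comp_zero: "0 \<in> A g"
  using comp_subspace subspace_0 by auto

text \<open>If x lay in two components, the two one-term families would be different decompositions
  of it.\<close>

lemma comp_disjoint:
  assumes "x \<in> A g" "x \<in> A h" "x \<noteq> 0"
  shows "g = h"
proof -
  let ?c = "\<lambda>g g'. if g' = g then x else 0"
  let ?Q = "\<lambda>c. finite {g. c g \<noteq> 0} \<and> (\<forall>g. c g \<in> A g) \<and> x = (\<Sum>g | c g \<noteq> 0. c g)"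
  have "{g'. ?c k g' \<noteq> 0} = {k}" for k using assms(3) by auto
  then have Q: "?Q (?c k)" if "x \<in> A k" for k
    unfolding \<open>{g'. ?c k g' \<noteq> 0} = {k}\<close> using that comp_zero by simp
  have "x \<in> C" using comp_carrier assms(1) by (rule subsetD)
  then have "\<exists>!c. ?Q c" by (rule decomposition)
  then obtain c where u: "\<And>c'. ?Q c' \<Longrightarrow> c' = c" by (elim ex1E) blast
  have "?c g = ?c h" using u[OF Q[OF assms(1)]] u[OF Q[OF assms(2)]] by (rule trans[OF _ sym])
  from fun_cong[OF this, of g] assms(3) show ?thesis by (auto split: if_splits)
qed

lemma supp_comp_ex: "s \<in> grading_supp A \<longleftrightarrow> (\<exists>x \<in> A s. x \<noteq> 0)"
proof -
  have "A s = {0} \<longleftrightarrow> (\<forall>x \<in> A s. x = 0)" using comp_zero[of s] by (metis empty_iff subset_singletonD subset_singleton_iff subsetI singleton_iff)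
  then show ?thesis unfolding grading_supp_def by simp
qed

lemma comp_eq_iff: "s \<in> grading_supp A \<Longrightarrow> A s = A t \<longleftrightarrow> s = t"
  unfolding supp_comp_ex using comp_disjoint[of _ s t] by metis

lemma aut_Bij: "f \<in> algebra_auts L \<Longrightarrow> f \<in> Bij C"
  and aut_add: "f \<in> algebra_auts L \<Longrightarrow> x \<in> C \<Longrightarrow> y \<in> C \<Longrightarrow> f (x + y) = f x + f y"
  and aut_scale: "f \<in> algebra_auts L \<Longrightarrow> x \<in> C \<Longrightarrow> f (alg_scale L c x) = alg_scale L c (f x)"
  and aut_mult: "f \<in> algebra_auts L \<Longrightarrow> x \<in> C \<Longrightarrow> y \<in> C
    \<Longrightarrow> f (alg_mult L x y) = alg_mult L (f x) (f y)"
  by (auto simp: algebra_auts_def)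

lemma aut_zero: "f \<in> algebra_auts L \<Longrightarrow> f 0 = 0"
  using aut_add[of f 0 0] zero_C by auto

lemma aut_image: "f \<in> algebra_auts L \<Longrightarrow> f ` C = C"
  and aut_inj: "f \<in> algebra_auts L \<Longrightarrow> inj_on f C"
  and aut_closed: "f \<in> algebra_auts L \<Longrightarrow> x \<in> C \<Longrightarrow> f x \<in> C"
  using aut_Bij[of f] by (auto simp: Bij_def bij_betw_def)

lemma aut_sum:
  assumes "f \<in> algebra_auts L" "finite S" "\<And>g. g \<in> S \<Longrightarrow> c g \<in> C"
  shows "sum c S \<in> C \<and> f (sum c S) = (\<Sum>g\<in>S. f (c g))"
  using assms(2,3)
  by (induction S) (auto simp: aut_zero[OF assms(1)] aut_add[OF assms(1)] zero_C add_C)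

text \<open>Restricted to the carrier because elements of \<open>Bij\<close> are extensional; this
  is the inverse computed in \<open>BijGroup\<close>.\<close>

abbreviation aut_inv :: "('v \<Rightarrow> 'v) \<Rightarrow> 'v \<Rightarrow> 'v" where
  "aut_inv f \<equiv> restrict (inv_into C f) C"

lemma aut_inv_left: "f \<in> algebra_auts L \<Longrightarrow> x \<in> C \<Longrightarrow> aut_inv f (f x) = x"
  using aut_inj[of f] aut_closed[of f] by auto

lemma aut_inv_right: "f \<in> algebra_auts L \<Longrightarrow> x \<in> C \<Longrightarrow> f (aut_inv f x) = x"
  using aut_image[of f] by (auto simp: f_inv_into_f)

lemma aut_inv_closed: "f \<in> algebra_auts L \<Longrightarrow> x \<in> C \<Longrightarrow> aut_inv f x \<in> C"
  using aut_image[of f] by (auto simp: inv_into_into)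

lemma image_aut_inv_left: "f \<in> algebra_auts L \<Longrightarrow> X \<subseteq> C \<Longrightarrow> aut_inv f ` f ` X = X"
  unfolding image_image by (subst image_cong[OF refl, of _ _ "\<lambda>x. x"]) (auto intro!: aut_inv_left simp del: restrict_apply)

lemma image_aut_inv_right: "f \<in> algebra_auts L \<Longrightarrow> X \<subseteq> C \<Longrightarrow> f ` aut_inv f ` X = X"
  unfolding image_image by (subst image_cong[OF refl, of _ _ "\<lambda>x. x"]) (auto intro!: aut_inv_right simp del: restrict_apply)

lemma aut_inverse:
  assumes f: "f \<in> algebra_auts L"
  shows "aut_inv f \<in> algebra_auts L"
proof -
  have eqI: "aut_inv f x = y" if "y \<in> C" "f y = x" for x y
    using that aut_inv_left[OF f] by blast
  note inv = aut_inv_right[OF f] aut_inv_closed[OF f]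
  show ?thesis
    unfolding algebra_auts_def mem_Collect_eq
  proof (intro conjI ballI allI)
    show "aut_inv f \<in> Bij C" using aut_Bij[OF f] by (rule restrict_inv_into_Bij)
    fix x assume x: "x \<in> C"
    show "aut_inv f (alg_scale L c x) = alg_scale L c (aut_inv f x)" for c
      by (rule eqI) (use x in \<open>simp_all only: inv scale_C aut_scale[OF f]\<close>)
    fix y assume y: "y \<in> C"
    show "aut_inv f (x + y) = aut_inv f x + aut_inv f y"
      by (rule eqI) (use x y in \<open>simp_all only: inv add_C aut_add[OF f]\<close>)
    show "aut_inv f (alg_mult L x y) = alg_mult L (aut_inv f x) (aut_inv f y)"
      by (rule eqI) (use x y in \<open>simp_all only: inv mult_closed aut_mult[OF f]\<close>)
  qed
qed

lemma aut_compose: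
  assumes f: "f \<in> algebra_auts L" and g: "g \<in> algebra_auts L"
  shows "compose C f g \<in> algebra_auts L"
  unfolding algebra_auts_def mem_Collect_eq using f g
  by (auto simp: compose_Bij aut_Bij compose_eq add_C scale_C mult_closed aut_closed
      aut_add aut_scale aut_mult)

lemma hom_comp_carrier: "X \<in> hom_components A \<Longrightarrow> X \<subseteq> C"
  using comp_carrier by (auto simp: hom_components_def)

lemma image_compose: "X \<subseteq> C \<Longrightarrow> compose C f g ` X = f ` g ` X"
  unfolding image_image by (rule image_cong) (auto simp: compose_eq)

lemma grading_auts_carrier: "carrier (grading_auts L A) =
    {f \<in> algebra_auts L. bij_betw (image f) (hom_components A) (hom_components A)}"
  by (simp add: grading_auts_def)

lemma subgroup_grading_auts: "subgroup (carrier (grading_auts L A)) (BijGroup C)"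
proof (rule group.subgroupI[OF group_BijGroup])
  let ?H = "hom_components A"
  show "carrier (grading_auts L A) \<subseteq> carrier (BijGroup C)"
    by (auto simp: grading_auts_carrier BijGroup_def algebra_auts_def)
  have "(\<lambda>x\<in>C. x) \<in> algebra_auts L"
    by (auto simp: algebra_auts_def id_Bij add_C scale_C mult_closed)
  moreover have "image (\<lambda>x\<in>C. x) X = X" if "X \<in> ?H" for X
    using hom_comp_carrier[OF that] by force
  then have "bij_betw (image (\<lambda>x\<in>C. x)) ?H ?H"
    by (subst bij_betw_cong[of _ _ id]) auto
  ultimately show "carrier (grading_auts L A) \<noteq> {}"
    by (auto simp: grading_auts_carrier)
next
  let ?H = "hom_components A"
  fix f assume "f \<in> carrier (grading_auts L A)"
  then have f: "f \<in> algebra_auts L" and b: "bij_betw (image f) ?H ?H"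
    by (auto simp: grading_auts_carrier)
  have "bij_betw (image (aut_inv f)) ?H ?H"
  proof (rule bij_betw_byWitness[of _ "image f"])
    show "\<forall>X\<in>?H. f ` aut_inv f ` X = X"
      using image_aut_inv_right[OF f] hom_comp_carrier by blast
    show "\<forall>X\<in>?H. aut_inv f ` f ` X = X" using image_aut_inv_left[OF f] hom_comp_carrier by blast
    show "image f ` ?H \<subseteq> ?H" using b by (auto simp: bij_betw_def)
    show "image (aut_inv f) ` ?H \<subseteq> ?H"
    proof
      fix X assume "X \<in> image (aut_inv f) ` ?H"
      then obtain Y where "Y \<in> ?H" "X = aut_inv f ` Y" by blast
      moreover then obtain Z where "Z \<in> ?H" "Y = f ` Z" using b by (blast dest: bij_betw_imp_surj_on)
      ultimately show "X \<in> ?H" using image_aut_inv_left[OF f] hom_comp_carrier by simp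
    qed
  qed
  then show "inv\<^bsub>BijGroup C\<^esub> f \<in> carrier (grading_auts L A)"
    using aut_inverse[OF f] by (simp add: inv_BijGroup aut_Bij[OF f] grading_auts_carrier)
next
  let ?H = "hom_components A"
  fix f g assume "f \<in> carrier (grading_auts L A)" "g \<in> carrier (grading_auts L A)"
  then have f: "f \<in> algebra_auts L" and b: "bij_betw (image f) ?H ?H"
    and g: "g \<in> algebra_auts L" and b': "bij_betw (image g) ?H ?H"
    by (auto simp: grading_auts_carrier)
  have "bij_betw (image f \<circ> image g) ?H ?H" using b b' bij_betw_trans by blast
  then have "bij_betw (image (compose C f g)) ?H ?H"
    by (subst bij_betw_cong[of _ _ "image f \<circ> image g"]) (auto simp: image_compose hom_comp_carrier)
  then show "f \<otimes>\<^bsub>BijGroup C\<^esub> g \<in> carrier (grading_auts L A)"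
    using aut_compose[OF f g] aut_Bij f g by (simp add: BijGroup_def grading_auts_carrier)
qed

lemma group_grading_auts: "group (grading_auts L A)"
  using subgroup.subgroup_is_group[OF subgroup_grading_auts group_BijGroup]
  by (simp add: grading_auts_def)

lemma grading_auts_mult:
  "\<lbrakk>f \<in> carrier (grading_auts L A); g \<in> carrier (grading_auts L A)\<rbrakk>
    \<Longrightarrow> f \<otimes>\<^bsub>grading_auts L A\<^esub> g = compose C f g"
  by (auto simp: grading_auts_def BijGroup_def aut_Bij)

text \<open>Decompositions correspond under the bijection f. If f also permutes the components, the
  transported grading is a second realization over the same group, and to such realizations
  universality is applied.\<close>

lemma transport_grading:
  assumes f: "f \<in> algebra_auts L"
  shows "group_grading L (\<lambda>g. f ` A g)"
  unfolding group_grading_def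
proof (intro conjI allI ballI)
  have c: "x \<in> A g \<Longrightarrow> x \<in> C" for x g using comp_carrier by blast
  show "subspace (f ` A g)" for g
    unfolding subspace_def
  proof (intro conjI ballI allI)
    show "0 \<in> f ` A g" using aut_zero[OF f] comp_zero image_eqI by metis
    fix k z assume "z \<in> f ` A g"
    then obtain x where x: "x \<in> A g" "z = f x" by blast
    then have "alg_scale L k z = f (alg_scale L k x)" using aut_scale[OF f] c by simp
    then show "alg_scale L k z \<in> f ` A g" using subspace_scale[OF comp_subspace] x by blast
    fix z' assume "z' \<in> f ` A g"
    then obtain x' where x': "x' \<in> A g" "z' = f x'" by blast
    then have "z + z' = f (x + x')" using aut_add[OF f] c x by simp
    then show "z + z' \<in> f ` A g" using subspace_add[OF comp_subspace] x x' by blast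
  qed
  show "f ` A g \<subseteq> C" for g using c aut_closed[OF f] by blast
  fix g h x y assume "x \<in> f ` A g" "y \<in> f ` A h"
  then obtain x' y' where "x' \<in> A g" "y' \<in> A h" "x = f x'" "y = f y'" by blast
  moreover then have "alg_mult L x y = f (alg_mult L x' y')" using aut_mult[OF f] c by simp
  ultimately show "alg_mult L x y \<in> f ` A (g + h)" using comp_mult by blast
next
  fix x assume x: "x \<in> C"
  define y where "y = inv_into C f x"
  have y: "y \<in> C" "f y = x"
    using x aut_image[OF f] by (auto simp: y_def inv_into_into f_inv_into_f)
  have f0: "f z = 0 \<longleftrightarrow> z = 0" if "z \<in> C" for z
    using that aut_inj[OF f] aut_zero[OF f] zero_C by (metis inj_onD)
  have c: "x \<in> A g \<Longrightarrow> x \<in> C" for x g using comp_carrier by auto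
  let ?Q = "\<lambda>A x c. finite {g. c g \<noteq> 0} \<and> (\<forall>g. c g \<in> A g) \<and> x = (\<Sum>g | c g \<noteq> 0. c g)"
  obtain b where b: "?Q A y b" and u: "\<And>b'. ?Q A y b' \<Longrightarrow> b' = b"
    using decomposition[OF y(1)] by blast
  have fb: "f (b g) = 0 \<longleftrightarrow> b g = 0" for g using b c f0 by blast
  show "\<exists>!c. ?Q (\<lambda>g. f ` A g) x c"
  proof (rule ex1I[of _ "\<lambda>g. f (b g)"])
    have "f y = (\<Sum>g | b g \<noteq> 0. f (b g))"
      using b aut_sum[OF f, of "{g. b g \<noteq> 0}" b] c by auto
    then show "?Q (\<lambda>g. f ` A g) x (\<lambda>g. f (b g))"
      using b y by (auto simp: fb)
  next
    fix d assume d: "?Q (\<lambda>g. f ` A g) x d"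
    define e where "e g = inv_into C f (d g)" for g
    have "\<exists>z \<in> A g. d g = f z" for g using d by auto
    then have e: "e g \<in> A g" "f (e g) = d g" for g
      using aut_inj[OF f] c unfolding e_def by (metis inv_into_f_f)+
    have e0: "e g \<noteq> 0 \<longleftrightarrow> d g \<noteq> 0" for g using e c f0 by metis
    have s: "(\<Sum>g | d g \<noteq> 0. e g) \<in> C \<and> f (\<Sum>g | d g \<noteq> 0. e g) = (\<Sum>g | d g \<noteq> 0. f (e g))"
      by (rule aut_sum[OF f]) (use d e c in auto)
    then have "f (\<Sum>g | d g \<noteq> 0. e g) = f y" using d e y by auto
    then have "(\<Sum>g | d g \<noteq> 0. e g) = y" using s y inj_onD[OF aut_inj[OF f]] by blast
    then have "?Q A y e" using d e by (auto simp: e0)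
    then have "e = b" by (rule u)
    then show "d = (\<lambda>g. f (b g))" using e by auto
  qed
qed

end

section \<open>The automorphism group of an additive group\<close>

lemma additive_group_simps [simp]: "carrier additive_group = UNIV"
  "x \<otimes>\<^bsub>additive_group\<^esub> y = x + y" "\<one>\<^bsub>additive_group\<^esub> = 0"
  by (auto simp: additive_group_def)

lemma group_additive_group: "group (additive_group :: 'g::ab_group_add monoid)"
  by (rule groupI) (auto simp: add.assoc intro: exI[of _ "- x" for x])

lemma AutoGroup_additive_carrier: "carrier (AutoGroup (additive_group :: 'g::ab_group_add monoid)) =
    {\<alpha>. bij \<alpha> \<and> (\<forall>x y. \<alpha> (x + y) = \<alpha> x + \<alpha> y)}"
  by (auto simp: AutoGroup_def auto_def Bij_def hom_def)

lemma AutoGroup_additive_mult: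
  "\<alpha> \<in> carrier (AutoGroup (additive_group :: 'g::ab_group_add monoid)) \<Longrightarrow>
   \<beta> \<in> carrier (AutoGroup additive_group) \<Longrightarrow> \<alpha> \<otimes>\<^bsub>AutoGroup additive_group\<^esub> \<beta> = \<alpha> \<circ> \<beta>"
  by (auto simp: AutoGroup_def BijGroup_def auto_def compose_def fun_eq_iff)

lemma AutoGroup_additive_one: "\<one>\<^bsub>AutoGroup (additive_group :: 'g::ab_group_add monoid)\<^esub> = id"
  by (auto simp: AutoGroup_def BijGroup_def fun_eq_iff)

lemma group_AutoGroup_additive: "group (AutoGroup (additive_group :: 'g::ab_group_add monoid))"
  using group.AutoGroup[OF group_additive_group] .

text \<open>Universality is stated over the grading group itself because the realizations to which
  it is applied are the grading moved by its own automorphisms.\<close>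

locale universal_graded_algebra = graded_algebra L A
  for L :: "('k::field, 'v::ab_group_add) algebra_struct" and A :: "'g::ab_group_add \<Rightarrow> 'v set" +
  assumes universal: "universal_group TYPE('g) L A"
begin

abbreviation Aut where "Aut \<equiv> grading_auts L A"

lemma realization_hom:
  assumes "group_grading L B" "hom_components B = hom_components A"
  shows "\<exists>!f :: 'g \<Rightarrow> 'g. (\<forall>x y. f (x + y) = f x + f y) \<and> (\<forall>s \<in> grading_supp A. B (f s) = A s)"
  using universal assms by (auto simp: universal_group_def)

lemma image_hom_component:
  "f \<in> carrier Aut \<Longrightarrow> s \<in> grading_supp A \<Longrightarrow> f ` A s \<in> hom_components A"
  unfolding grading_auts_carrier hom_components_def by (blast dest: bij_betwE)

lemma inverse_in_Aut: "f \<in> carrier Aut \<Longrightarrow> aut_inv f \<in> carrier Aut"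
  using subgroup.m_inv_closed[OF subgroup_grading_auts, of f] inv_BijGroup[of f C]
  by (simp add: grading_auts_carrier aut_Bij)

lemma hom_components_transport:
  assumes g: "g \<in> carrier Aut"
  shows "hom_components (\<lambda>s. g ` A s) = hom_components A"
proof -
  have ga: "g \<in> algebra_auts L" using g by (auto simp: grading_auts_carrier)
  have "g ` X = {0} \<longleftrightarrow> X = {0}" if "X \<subseteq> C" for X
  proof
    assume *: "g ` X = {0}"
    have "x = 0" if "x \<in> X" for x
    proof -
      have "g x = g 0" using that * aut_zero[OF ga] by auto
      then show ?thesis using inj_onD[OF aut_inj[OF ga]] \<open>X \<subseteq> C\<close> that zero_C by blast
    qed
    moreover have "X \<noteq> {}" using * by blast
    ultimately show "X = {0}" by blast
  next
    assume "X = {0}"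
    then show "g ` X = {0}" using aut_zero[OF ga] by simp
  qed
  then have "grading_supp (\<lambda>s. g ` A s) = grading_supp A"
    using comp_carrier by (simp add: grading_supp_def)
  then have "hom_components (\<lambda>s. g ` A s) = image g ` hom_components A"
    by (simp add: hom_components_def image_image)
  then show ?thesis
    using g by (auto simp: grading_auts_carrier bij_betw_def)
qed

text \<open>That the support generates the group is available only through universality: both maps
  satisfy the condition that determines a unique homomorphism for the realization obtained by moving
  the grading with the inverse of f.\<close>

lemma hom_eqI:
  assumes "\<And>x y. \<alpha> (x + y) = \<alpha> x + \<alpha> y" "\<And>x y. \<beta> (x + y) = \<beta> x + \<beta> y"
    "\<And>s. s \<in> grading_supp A \<Longrightarrow> \<alpha> s = \<beta> s" and im: "\<And>s. s \<in> grading_supp A \<Longrightarrow> A (\<alpha> s) = f ` A s"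
    and f: "f \<in> carrier Aut"
  shows "\<alpha> = \<beta>"
proof -
  let ?g = "aut_inv f"
  let ?P = "\<lambda>\<alpha> :: 'g \<Rightarrow> 'g. (\<forall>x y. \<alpha> (x + y) = \<alpha> x + \<alpha> y) \<and> (\<forall>s \<in> grading_supp A. ?g ` A (\<alpha> s) = A s)"
  have g: "?g \<in> carrier Aut" using inverse_in_Aut[OF f] .
  have fa: "f \<in> algebra_auts L" and ga: "?g \<in> algebra_auts L"
    using f g by (auto simp: grading_auts_carrier)
  have hc: "hom_components (\<lambda>g. ?g ` A g) = hom_components A"
    using hom_components_transport[OF g] .
  have "?g ` A (\<alpha> s) = A s" "?g ` A (\<beta> s) = A s" if "s \<in> grading_supp A" for s
    unfolding im[OF that] assms(3)[OF that, symmetric] by (rule image_aut_inv_left[OF fa comp_carrier])+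
  then have "?P \<alpha>" "?P \<beta>" using assms(1,2) by blast+
  moreover obtain \<gamma> where "\<And>\<delta>. ?P \<delta> \<Longrightarrow> \<delta> = \<gamma>"
    using realization_hom[OF transport_grading[OF ga] hc] by (elim ex1E) blast
  ultimately show ?thesis by metis
qed

lemma induces_unique:
  assumes "f \<in> carrier Aut" "induces A f \<alpha>" "induces A f \<beta>"
  shows "\<alpha> = \<beta>"
proof (rule hom_eqI[of \<alpha> \<beta> f])
  fix s assume s: "s \<in> grading_supp A"
  have a: "f ` A s = A (\<alpha> s)" "f ` A s = A (\<beta> s)" using assms s by (auto simp: induces_def)
  have "f ` A s \<in> hom_components A" using assms(1) s by (rule image_hom_component)
  then have "\<alpha> s \<in> grading_supp A"
    unfolding a(1) by (auto simp: hom_components_def grading_supp_def)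
  then show "\<alpha> s = \<beta> s" using a comp_eq_iff[of "\<alpha> s" "\<beta> s"] by simp
qed (use assms in \<open>auto simp: induces_def AutoGroup_additive_carrier\<close>)

text \<open>The grading moved by the inverse of f is a realization. Its homomorphism sends s to the
  degree of the component that the inverse of f maps onto \<open>A s\<close>, which is the image of
  \<open>A s\<close> under f.\<close>

lemma induced_hom:
  assumes f: "f \<in> carrier Aut"
  shows "\<exists>\<phi> :: 'g \<Rightarrow> 'g. (\<forall>x y. \<phi> (x + y) = \<phi> x + \<phi> y) \<and>
    (\<forall>s \<in> grading_supp A. f ` A s = A (\<phi> s) \<and> \<phi> s \<in> grading_supp A)"
proof -
  let ?g = "aut_inv f"
  have g: "?g \<in> carrier Aut" using inverse_in_Aut[OF f] .
  have fa: "f \<in> algebra_auts L" and ga: "?g \<in> algebra_auts L"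
    using f g by (auto simp: grading_auts_carrier)
  note fg = image_aut_inv_right[OF fa]
  obtain \<phi> :: "'g \<Rightarrow> 'g" where "\<forall>x y. \<phi> (x + y) = \<phi> x + \<phi> y"
    and p: "\<And>s. s \<in> grading_supp A \<Longrightarrow> ?g ` A (\<phi> s) = A s"
    using realization_hom[OF transport_grading[OF ga] hom_components_transport[OF g]] by auto
  moreover have "f ` A s = A (\<phi> s)" if "s \<in> grading_supp A" for s
    unfolding p[OF that, symmetric] by (rule fg[OF comp_carrier])
  moreover have "\<phi> s \<in> grading_supp A" if "s \<in> grading_supp A" for s
    unfolding grading_supp_def mem_Collect_eq
  proof
    assume "A (\<phi> s) = {0}"
    then have "A s = ?g ` {0}" using p[OF that] by (simp only:)
    also have "\<dots> = {0}" unfolding image_insert image_empty aut_zero[OF ga] ..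
    finally have "A s = {0}" .
    then show False using that by (simp add: grading_supp_def)
  qed
  ultimately show ?thesis by blast
qed

lemma induces_ex:
  assumes f: "f \<in> carrier Aut"
  shows "\<exists>\<alpha>. induces A f \<alpha>"
proof -
  let ?g = "aut_inv f"
  have g: "?g \<in> carrier Aut" using inverse_in_Aut[OF f] .
  have fa: "f \<in> algebra_auts L" using f by (auto simp: grading_auts_carrier)
  note fg = image_aut_inv_right[OF fa] image_aut_inv_left[OF fa]
  obtain \<phi> :: "'g \<Rightarrow> 'g" where p: "\<And>x y. \<phi> (x + y) = \<phi> x + \<phi> y"
    "\<And>s. s \<in> grading_supp A \<Longrightarrow> f ` A s = A (\<phi> s)"
    "\<And>s. s \<in> grading_supp A \<Longrightarrow> \<phi> s \<in> grading_supp A"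
    using induced_hom[OF f] by blast
  obtain \<psi> :: "'g \<Rightarrow> 'g" where q: "\<And>x y. \<psi> (x + y) = \<psi> x + \<psi> y"
    "\<And>s. s \<in> grading_supp A \<Longrightarrow> ?g ` A s = A (\<psi> s)"
    "\<And>s. s \<in> grading_supp A \<Longrightarrow> \<psi> s \<in> grading_supp A"
    using induced_hom[OF g] by blast
  have one: "(\<lambda>x\<in>C. x) \<in> carrier Aut"
    using subgroup.one_closed[OF subgroup_grading_auts] by (simp add: BijGroup_def)
  have "A (\<psi> (\<phi> s)) = A s" "A (\<phi> (\<psi> s)) = A s" if "s \<in> grading_supp A" for s
    using fg[OF comp_carrier[of s]] p(2,3)[OF that] q(2,3)[OF that]
      p(2)[OF q(3)[OF that]] q(2)[OF p(3)[OF that]] by simp_all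
  then have "s = \<psi> (\<phi> s)" "s = \<phi> (\<psi> s)" if "s \<in> grading_supp A" for s
    using comp_eq_iff[OF that, of "\<psi> (\<phi> s)"] comp_eq_iff[OF that, of "\<phi> (\<psi> s)"] that by simp_all
  moreover have "A s = (\<lambda>x\<in>C. x) ` A s" for s
    by (subst image_cong[OF refl, of _ _ "\<lambda>x. x"]) (use comp_carrier in auto)
  \<comment> \<open>Both composites fix the support, so \<open>hom_eqI\<close> with the identity
    automorphism makes them the identity. This upgrades the homomorphism to an automorphism of the
    group.\<close>
  ultimately have "id = \<psi> \<circ> \<phi>" "id = \<phi> \<circ> \<psi>"
    by (intro hom_eqI[OF _ _ _ _ one]; simp add: p q)+
  then have "bij \<phi>" by (metis o_bij)
  then show ?thesis using p by (auto simp: induces_def AutoGroup_additive_carrier)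
qed

lemma induces_induced_aut: "f \<in> carrier Aut \<Longrightarrow> induces A f (induced_aut A f)"
  unfolding induced_aut_def using induces_ex induces_unique by (metis theI)

lemma induced_aut_eqI: "f \<in> carrier Aut \<Longrightarrow> induces A f \<alpha> \<Longrightarrow> induced_aut A f = \<alpha>"
  using induces_induced_aut induces_unique by blast

lemma induces_supp:
  assumes "f \<in> carrier Aut" "induces A f \<alpha>" "s \<in> grading_supp A"
  shows "\<alpha> s \<in> grading_supp A"
proof -
  have "f ` A s \<in> hom_components A" using assms(1,3) by (rule image_hom_component)
  moreover have "f ` A s = A (\<alpha> s)" using assms by (auto simp: induces_def)
  ultimately show ?thesis by (auto simp: hom_components_def grading_supp_def)
qed

lemma induced_group_hom:
  "group_hom Aut (AutoGroup (additive_group :: 'g monoid)) (induced_aut A)"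
proof (rule group_hom.intro[OF group_grading_auts group_AutoGroup_additive], unfold_locales,
    rule homI)
  show "induced_aut A f \<in> carrier (AutoGroup additive_group)" if "f \<in> carrier Aut" for f
    using induces_induced_aut[OF that] by (auto simp: induces_def)
  fix f g assume f: "f \<in> carrier Aut" and g: "g \<in> carrier Aut"
  note * = induces_induced_aut[OF f] induces_induced_aut[OF g] induces_supp[OF g]
  have "f \<otimes>\<^bsub>Aut\<^esub> g \<in> carrier Aut"
    using f g group.is_monoid[OF group_grading_auts] by (simp add: monoid.m_closed)
  moreover have "induces A (f \<otimes>\<^bsub>Aut\<^esub> g) (induced_aut A f \<circ> induced_aut A g)"
    using * by (auto simp: grading_auts_mult[OF f g] induces_def image_compose comp_carrier
        AutoGroup_additive_carrier bij_comp)
  ultimately show "induced_aut A (f \<otimes>\<^bsub>Aut\<^esub> g) =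
      induced_aut A f \<otimes>\<^bsub>AutoGroup additive_group\<^esub> induced_aut A g"
    using * by (subst AutoGroup_additive_mult) (auto simp: induces_def intro: induced_aut_eqI)
qed

text \<open>By uniqueness of the induced map, fixing every component means inducing the identity.
  The embedding of the quotient is then an instance of the first isomorphism theorem.\<close>

lemma stab_eq_kernel:
  "grading_stab L A = kernel Aut (AutoGroup (additive_group :: 'g monoid)) (induced_aut A)"
proof -
  have "(\<forall>X \<in> hom_components A. f ` X = X) \<longleftrightarrow> induced_aut A f = id" if f: "f \<in> carrier Aut" for f
  proof
    assume "\<forall>X \<in> hom_components A. f ` X = X"
    then have "induces A f id"
      by (auto simp: induces_def AutoGroup_additive_carrier hom_components_def)
    then show "induced_aut A f = id" using induced_aut_eqI[OF f] by auto
  next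
    assume "induced_aut A f = id"
    then show "\<forall>X \<in> hom_components A. f ` X = X"
      using induces_induced_aut[OF f] by (auto simp: induces_def hom_components_def)
  qed
  then show ?thesis
    by (auto simp: grading_stab_def kernel_def AutoGroup_additive_one)
qed

theorem weyl_identification: "weyl_identification L A"
proof -
  interpret group_hom Aut "AutoGroup (additive_group :: 'g monoid)" "induced_aut A"
    by (rule induced_group_hom)
  show ?thesis
    unfolding weyl_identification_def weyl_group_def mon_def
    using induces_ex induces_unique FactGroup_hom FactGroup_inj_on
    by (auto simp: stab_eq_kernel weyl_embedding_def[abs_def])
qed

text \<open>\<open>induced_aut\<close> is constant on the cosets of its kernel, so
  \<open>the_elem\<close> in \<open>weyl_embedding\<close> picks the common value. From here on
  single automorphisms replace cosets.\<close>

lemma weyl_image_eq: "weyl_image L A = {\<alpha>. \<exists>f \<in> carrier Aut. induces A f \<alpha>}"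
proof -
  interpret group_hom Aut "AutoGroup (additive_group :: 'g monoid)" "induced_aut A"
    by (rule induced_group_hom)
  let ?K = "kernel Aut (AutoGroup (additive_group :: 'g monoid)) (induced_aut A)"
  have "the_elem (induced_aut A ` (?K #>\<^bsub>Aut\<^esub> f)) = induced_aut A f" if "f \<in> carrier Aut" for f
  proof -
    have "induced_aut A ` (?K #>\<^bsub>Aut\<^esub> f) = {induced_aut A f}"
      using that by (auto simp: kernel_def r_coset_def image_iff)
    then show ?thesis by simp
  qed
  then have "weyl_image L A = induced_aut A ` carrier Aut"
    by (force simp: weyl_image_def weyl_group_def weyl_embedding_def stab_eq_kernel FactGroup_def
        RCOSETS_def image_iff)
  also have "\<dots> = {\<alpha>. \<exists>f \<in> carrier Aut. induces A f \<alpha>}"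
    using induces_induced_aut induced_aut_eqI by (auto simp: image_iff)
  finally show ?thesis .
qed

lemma subgroup_weyl_image: "subgroup (weyl_image L A) (AutoGroup (additive_group :: 'g monoid))"
proof -
  interpret group_hom Aut "AutoGroup (additive_group :: 'g monoid)" "induced_aut A"
    by (rule induced_group_hom)
  have "weyl_image L A = induced_aut A ` carrier Aut"
    using induces_induced_aut induced_aut_eqI by (auto simp: image_iff weyl_image_eq)
  then show ?thesis using img_is_subgroup by simp
qed

lemma weyl_group_iso:
  "weyl_group L A \<cong> AutoGroup (additive_group :: 'g monoid) \<lparr>carrier := weyl_image L A\<rparr>"
proof -
  have m: "weyl_embedding A \<in> mon (weyl_group L A) (AutoGroup (additive_group :: 'g monoid))"
    using weyl_identification by (auto simp: weyl_identification_def)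
  then have "weyl_embedding A \<in> iso (weyl_group L A)
      (AutoGroup (additive_group :: 'g monoid) \<lparr>carrier := weyl_image L A\<rparr>)"
    by (auto simp: mon_def iso_def hom_def weyl_image_def bij_betw_def)
  then show ?thesis by (auto simp: is_iso_def)
qed

end

section \<open>Semidirect products\<close>

lemma group_action_by_autsD:
  assumes "group_action_by_auts H N \<phi>" "group N" "group H"
  shows "x \<in> carrier H \<Longrightarrow> y \<in> carrier N \<Longrightarrow> \<phi> x y \<in> carrier N"
    and "x \<in> carrier H \<Longrightarrow> y \<in> carrier N \<Longrightarrow> y' \<in> carrier N \<Longrightarrow> \<phi> x (y \<otimes>\<^bsub>N\<^esub> y') = \<phi> x y \<otimes>\<^bsub>N\<^esub> \<phi> x y'"
    and "x \<in> carrier H \<Longrightarrow> x' \<in> carrier H \<Longrightarrow> y \<in> carrier N \<Longrightarrow> \<phi> (x \<otimes>\<^bsub>H\<^esub> x') y = \<phi> x (\<phi> x' y)"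
    and "y \<in> carrier N \<Longrightarrow> \<phi> \<one>\<^bsub>H\<^esub> y = y"
proof -
  have h: "\<phi> \<in> hom H (AutoGroup N)" using assms by (simp add: group_action_by_auts_def)
  have a: "\<phi> x \<in> hom N N \<inter> Bij (carrier N)" if "x \<in> carrier H" for x
    using hom_in_carrier[OF h that] by (simp add: AutoGroup_def auto_def)
  then show c: "x \<in> carrier H \<Longrightarrow> y \<in> carrier N \<Longrightarrow> \<phi> x y \<in> carrier N" for x y
    by (auto simp: hom_def)
  show "x \<in> carrier H \<Longrightarrow> y \<in> carrier N \<Longrightarrow> y' \<in> carrier N \<Longrightarrow> \<phi> x (y \<otimes>\<^bsub>N\<^esub> y') = \<phi> x y \<otimes>\<^bsub>N\<^esub> \<phi> x y'"
    using a by (auto simp: hom_def)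
  show "x \<in> carrier H \<Longrightarrow> x' \<in> carrier H \<Longrightarrow> y \<in> carrier N \<Longrightarrow> \<phi> (x \<otimes>\<^bsub>H\<^esub> x') y = \<phi> x (\<phi> x' y)"
    using a[of x] a[of x'] hom_mult[OF h, of x x']
    by (simp add: AutoGroup_def BijGroup_def compose_eq)
  have "\<phi> \<one>\<^bsub>H\<^esub> = \<one>\<^bsub>AutoGroup N\<^esub>" using hom_one[OF h assms(3) group.AutoGroup[OF assms(2)]] .
  then show "y \<in> carrier N \<Longrightarrow> \<phi> \<one>\<^bsub>H\<^esub> y = y" by (simp add: AutoGroup_def BijGroup_def)
qed

lemma group_semidirect:
  assumes act: "group_action_by_auts H N \<phi>" and N: "group N" and H: "group H"
  shows "group (semidirect N \<phi> H)"
proof -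
  interpret N: group N by fact
  interpret H: group H by fact
  note a = group_action_by_autsD[OF act N H]
  have one: "\<phi> x \<one>\<^bsub>N\<^esub> = \<one>\<^bsub>N\<^esub>" if "x \<in> carrier H" for x
    using a(2)[OF that N.one_closed N.one_closed] a(1)[OF that N.one_closed]
    by (simp add: N.l_cancel_one')
  show ?thesis
  proof (rule groupI)
    fix p assume "p \<in> carrier (semidirect N \<phi> H)"
    then obtain y x where p: "p = (y, x)" "y \<in> carrier N" "x \<in> carrier H"
      by (auto simp: semidirect_def)
    let ?q = "(\<phi> (inv\<^bsub>H\<^esub> x) (inv\<^bsub>N\<^esub> y), inv\<^bsub>H\<^esub> x)"
    have "\<phi> (inv\<^bsub>H\<^esub> x) (inv\<^bsub>N\<^esub> y) \<otimes>\<^bsub>N\<^esub> \<phi> (inv\<^bsub>H\<^esub> x) y = \<one>\<^bsub>N\<^esub>"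
      using a(2)[of "inv\<^bsub>H\<^esub> x" "inv\<^bsub>N\<^esub> y" y] p one[of "inv\<^bsub>H\<^esub> x"] by simp
    then show "\<exists>q \<in> carrier (semidirect N \<phi> H). q \<otimes>\<^bsub>semidirect N \<phi> H\<^esub> p = \<one>\<^bsub>semidirect N \<phi> H\<^esub>"
      using p a(1) by (intro bexI[of _ ?q]) (auto simp: semidirect_def)
  qed (auto simp: semidirect_def a N.m_assoc H.m_assoc)
qed

text \<open>An internal semidirect product whose factors are given by embeddings: the action is
  conjugation pulled back along the injection n, and the pair (y, x) goes to n y times h x. The
  assumption \<open>trivial\<close> says that the two images meet only in the identity.\<close>

lemma semidirect_of_homs:
  assumes N: "group N" and H: "group H" and G: "group G"
    and n: "n \<in> hom N G" "inj_on n (carrier N)" and h: "h \<in> hom H G" "inj_on h (carrier H)"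
    and normal: "\<And>x y. x \<in> carrier H \<Longrightarrow> y \<in> carrier N \<Longrightarrow>
      h x \<otimes>\<^bsub>G\<^esub> n y \<otimes>\<^bsub>G\<^esub> inv\<^bsub>G\<^esub> (h x) \<in> n ` carrier N"
    and trivial: "\<And>x y. x \<in> carrier H \<Longrightarrow> y \<in> carrier N \<Longrightarrow> n y = h x \<Longrightarrow> x = \<one>\<^bsub>H\<^esub>"
    and full: "\<And>g. g \<in> carrier G \<Longrightarrow> \<exists>y \<in> carrier N. \<exists>x \<in> carrier H. g = n y \<otimes>\<^bsub>G\<^esub> h x"
  shows "\<exists>\<phi>. group_action_by_auts H N \<phi> \<and> semidirect N \<phi> H \<cong> G"
proof -
  interpret N: group N by fact
  interpret H: group H by fact
  interpret G: group G by fact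
  interpret n: group_hom N G n by unfold_locales (rule n(1))
  interpret h: group_hom H G h by unfold_locales (rule h(1))
  \<comment> \<open>Restricted to the carrier since \<open>AutoGroup\<close> consists of extensional
    maps.\<close>
  define \<phi> where "\<phi> x = (\<lambda>y \<in> carrier N. inv_into (carrier N) n (h x \<otimes>\<^bsub>G\<^esub> n y \<otimes>\<^bsub>G\<^esub> inv\<^bsub>G\<^esub> (h x)))" for x
  have c: "\<phi> x y \<in> carrier N" and e: "n (\<phi> x y) = h x \<otimes>\<^bsub>G\<^esub> n y \<otimes>\<^bsub>G\<^esub> inv\<^bsub>G\<^esub> (h x)"
    if "x \<in> carrier H" "y \<in> carrier N" for x y
    using normal[OF that] that by (auto simp: \<phi>_def f_inv_into_f inv_into_into)
  have eqI: "y = y'" if "n y = n y'" "y \<in> carrier N" "y' \<in> carrier N" for y y'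
    using inj_onD[OF n(2)] that by blast
  have mult: "\<phi> x (y \<otimes>\<^bsub>N\<^esub> y') = \<phi> x y \<otimes>\<^bsub>N\<^esub> \<phi> x y'"
    if "x \<in> carrier H" "y \<in> carrier N" "y' \<in> carrier N" for x y y'
    by (rule eqI) (use that c in \<open>simp_all add: e G.m_assoc G.inv_solve_left\<close>)
  have comp: "\<phi> (x \<otimes>\<^bsub>H\<^esub> x') y = \<phi> x (\<phi> x' y)"
    if "x \<in> carrier H" "x' \<in> carrier H" "y \<in> carrier N" for x x' y
    by (rule eqI) (use that c in \<open>simp_all add: e G.m_assoc G.inv_mult_group\<close>)
  have one: "\<phi> \<one>\<^bsub>H\<^esub> y = y" if "y \<in> carrier N" for y
    by (rule eqI) (use that c in \<open>simp_all add: e\<close>)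
  have bij: "\<phi> x \<in> Bij (carrier N)" if "x \<in> carrier H" for x
  proof -
    have i: "\<phi> (inv\<^bsub>H\<^esub> x) (\<phi> x y) = y" "\<phi> x (\<phi> (inv\<^bsub>H\<^esub> x) y) = y" if "y \<in> carrier N" for y
      using \<open>x \<in> carrier H\<close> that comp[of "inv\<^bsub>H\<^esub> x" x y] comp[of x "inv\<^bsub>H\<^esub> x" y] one by simp_all
    have "bij_betw (\<phi> x) (carrier N) (carrier N)"
      by (rule bij_betw_byWitness[of _ "\<phi> (inv\<^bsub>H\<^esub> x)"]) (use that c i in auto)
    then show ?thesis by (simp add: Bij_def \<phi>_def)
  qed
  have act: "group_action_by_auts H N \<phi>"
    unfolding group_action_by_auts_def
  proof (rule homI)
    show au: "\<phi> x \<in> carrier (AutoGroup N)" if "x \<in> carrier H" for x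
      using that bij c mult by (simp add: AutoGroup_def auto_def hom_def)
    fix x x' assume x: "x \<in> carrier H" "x' \<in> carrier H"
    have "\<phi> (x \<otimes>\<^bsub>H\<^esub> x') = compose (carrier N) (\<phi> x) (\<phi> x')"
      by (rule extensionalityI[of _ "carrier N"])
        (use x comp bij[THEN Bij_imp_extensional] in \<open>simp_all add: compose_eq\<close>)
    then show "\<phi> (x \<otimes>\<^bsub>H\<^esub> x') = \<phi> x \<otimes>\<^bsub>AutoGroup N\<^esub> \<phi> x'"
      using bij x by (simp add: AutoGroup_def BijGroup_def)
  qed
  have cancel: "inv\<^bsub>G\<^esub> a \<otimes>\<^bsub>G\<^esub> (a \<otimes>\<^bsub>G\<^esub> b) = b" if "a \<in> carrier G" "b \<in> carrier G" for a b
    using that by (simp add: G.m_assoc[symmetric])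
  let ?F = "\<lambda>(y, x). n y \<otimes>\<^bsub>G\<^esub> h x"
  have "?F \<in> hom (semidirect N \<phi> H) G"
    by (rule homI) (auto simp: semidirect_def c e G.m_assoc cancel)
  moreover have "bij_betw ?F (carrier (semidirect N \<phi> H)) (carrier G)"
  proof (rule bij_betw_imageI)
    have "y = y' \<and> x = x'"
      if "y \<in> carrier N" "x \<in> carrier H" "y' \<in> carrier N" "x' \<in> carrier H"
        "n y \<otimes>\<^bsub>G\<^esub> h x = n y' \<otimes>\<^bsub>G\<^esub> h x'" for x x' y y'
    proof -
      have "n y = n y' \<otimes>\<^bsub>G\<^esub> h x' \<otimes>\<^bsub>G\<^esub> inv\<^bsub>G\<^esub> (h x)"
        using that by (subst G.inv_solve_right) simp_all
      then have "n (inv\<^bsub>N\<^esub> y' \<otimes>\<^bsub>N\<^esub> y) = h (x' \<otimes>\<^bsub>H\<^esub> inv\<^bsub>H\<^esub> x)"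
        using that by (simp add: G.m_assoc cancel)
      then have "x' \<otimes>\<^bsub>H\<^esub> inv\<^bsub>H\<^esub> x = \<one>\<^bsub>H\<^esub>"
        using that by (intro trivial[of _ "inv\<^bsub>N\<^esub> y' \<otimes>\<^bsub>N\<^esub> y"] H.m_closed N.m_closed H.inv_closed N.inv_closed)
      then have "x = x'" using that by (metis H.inv_closed H.inv_equality H.inv_inv)
      then show ?thesis using that eqI by auto
    qed
    then show "inj_on ?F (carrier (semidirect N \<phi> H))"
      by (auto simp: inj_on_def semidirect_def)
    show "?F ` carrier (semidirect N \<phi> H) = carrier G"
      using full by (fastforce simp: semidirect_def)
  qed
  ultimately have "semidirect N \<phi> H \<cong> G" by (auto simp: is_iso_def iso_def)
  then show ?thesis using act by blast
qed

text \<open>The new action is the old one precomposed with an isomorphism from H' to H.\<close>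

lemma semidirect_transport:
  assumes act: "group_action_by_auts H N \<phi>" and N: "group N" and H: "group H" and H': "group H'"
    and iso: "H \<cong> H'"
  shows "\<exists>\<omega>. group_action_by_auts H' N \<omega> \<and> semidirect N \<phi> H \<cong> semidirect N \<omega> H'"
proof -
  obtain f where f: "f \<in> iso H' H"
    using group.iso_sym[OF H iso] by (auto simp: is_iso_def)
  then have fh: "f \<in> hom H' H" and fb: "bij_betw f (carrier H') (carrier H)" by (auto simp: iso_def)
  have h: "\<phi> \<in> hom H (AutoGroup N)" using act by (simp add: group_action_by_auts_def)
  have act': "group_action_by_auts H' N (\<phi> \<circ> f)"
    unfolding group_action_by_auts_def using fh h by (rule hom_compose)
  have "(\<lambda>(y, x). (y, f x)) \<in> iso (semidirect N (\<phi> \<circ> f) H') (semidirect N \<phi> H)"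
  proof (rule isoI)
    show "(\<lambda>(y, x). (y, f x)) \<in> hom (semidirect N (\<phi> \<circ> f) H') (semidirect N \<phi> H)"
      by (rule homI) (use fh in \<open>auto simp: semidirect_def hom_def\<close>)
    show "bij_betw (\<lambda>(y, x). (y, f x)) (carrier (semidirect N (\<phi> \<circ> f) H')) (carrier (semidirect N \<phi> H))"
      using bij_betw_map_prod[OF bij_betw_id fb, of "carrier N"]
      by (simp add: semidirect_def map_prod_def)
  qed
  then have "semidirect N \<phi> H \<cong> semidirect N (\<phi> \<circ> f) H'"
    using group.iso_sym[OF group_semidirect[OF act' N H']] by (auto simp: is_iso_def)
  then show ?thesis using act' by blast
qed

lemma BijGroup_carrier: "carrier (BijGroup S) = Bij S"
  and BijGroup_mult: "f \<in> Bij S \<Longrightarrow> g \<in> Bij S \<Longrightarrow> f \<otimes>\<^bsub>BijGroup S\<^esub> g = compose S f g"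
  and BijGroup_one: "\<one>\<^bsub>BijGroup S\<^esub> = (\<lambda>x\<in>S. x)"
  by (auto simp: BijGroup_def)

lemma Bij_UNIV: "f \<in> Bij UNIV \<longleftrightarrow> bij f"
  by (simp add: Bij_def)

section \<open>The root system of type F4\<close>

lemma vector_4 [simp]:
  "(vector [a, b, c, d] :: 'a::zero ^ 4) $ 1 = a" "(vector [a, b, c, d] :: 'a ^ 4) $ 2 = b"
  "(vector [a, b, c, d] :: 'a ^ 4) $ 3 = c" "(vector [a, b, c, d] :: 'a ^ 4) $ 4 = d"
  by (simp_all add: vector_def)

lemma all_3: "(\<forall>i::3. P i) \<longleftrightarrow> P 0 \<and> P 1 \<and> P 2"
proof -
  have "(3::3) = 0" by simp
  show ?thesis unfolding forall_3 \<open>(3::3) = 0\<close> by auto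
qed

lemma cases_3 [case_names 0 1 2]: "(i = 0 \<Longrightarrow> P) \<Longrightarrow> (i = 1 \<Longrightarrow> P) \<Longrightarrow> (i = 2 \<Longrightarrow> P) \<Longrightarrow> P" for i :: 3
proof -
  have "(3::3) = 0" by simp
  then show "(i = 0 \<Longrightarrow> P) \<Longrightarrow> (i = 1 \<Longrightarrow> P) \<Longrightarrow> (i = 2 \<Longrightarrow> P) \<Longrightarrow> P"
    using exhaust_3[of i] by auto
qed

lemma vec4_eq_iff: "x = y \<longleftrightarrow> x $ 1 = y $ 1 \<and> x $ 2 = y $ 2 \<and> x $ 3 = y $ 3 \<and> x $ 4 = y $ 4"
  for x y :: "'a ^ 4"
  by (simp add: vec_eq_iff forall_4)

lemmas deg_simps = deg_u_def deg_a_def deg_g_def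

text \<open>The invariant form in the basis a1, a2, g1, g2, scaled so that short roots have norm 1.
  By \<open>root_norm_frame\<close> it is the sum of the squares of half the frame coordinates,
  hence positive definite.\<close>

definition root_norm :: "int ^ 4 \<Rightarrow> int" where
  "root_norm v = (v $ 1)\<^sup>2 + (v $ 2)\<^sup>2 + (v $ 3)\<^sup>2 + (v $ 4)\<^sup>2
     - v $ 1 * v $ 2 + v $ 1 * v $ 4 - v $ 2 * v $ 3 - v $ 3 * v $ 4"

text \<open>
  Twice the coordinates with respect to the orthonormal frame of the degrees of e1, u0, u1, u2
  in the copy 0.
\<close>

definition frame :: "int ^ 4 \<Rightarrow> int ^ 4" where
  "frame v = vector [- v $ 1 - v $ 2 + v $ 3 - v $ 4, - v $ 1 + v $ 2 - v $ 3 - v $ 4,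
                     - v $ 1 + v $ 2 + v $ 3 - v $ 4, - v $ 1 + v $ 2 - v $ 3 + v $ 4]"

definition unframe :: "int ^ 4 \<Rightarrow> int ^ 4" where
  "unframe w = vector [(- w $ 1 - w $ 4) div 2, (w $ 3 - w $ 1) div 2, (w $ 3 - w $ 2) div 2,
                       (w $ 4 - w $ 2) div 2]"

text \<open>The image of \<open>frame\<close>: halved, these are the vectors whose coordinates are
  all integers or all halves of odd integers. It is also the condition under which the divisions in
  \<open>unframe\<close> are exact.\<close>

definition same_parity :: "int ^ 4 \<Rightarrow> bool" where
  "same_parity w \<longleftrightarrow> (\<forall>i j. even (w $ i - w $ j))"

lemma same_parity_frame: "same_parity (frame v)"
  by (simp add: same_parity_def frame_def forall_4)

lemma unframe_frame [simp]: "unframe (frame v) = v"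
  by (simp add: unframe_def frame_def vec4_eq_iff)

lemma same_parityE:
  assumes "same_parity w"
  obtains x a b c where "w = vector [x, x + 2 * a, x + 2 * b, x + 2 * c]"
proof -
  have "\<exists>a. w $ j = w $ 1 + 2 * a" for j
  proof -
    have "even (w $ j - w $ 1)" using assms by (simp add: same_parity_def)
    then obtain a where "w $ j - w $ 1 = 2 * a" by (rule evenE)
    then show ?thesis by (intro exI[of _ a]) simp
  qed
  then obtain a b c where "w $ 2 = w $ 1 + 2 * a" "w $ 3 = w $ 1 + 2 * b" "w $ 4 = w $ 1 + 2 * c"
    by meson
  then have "w = vector [w $ 1, w $ 1 + 2 * a, w $ 1 + 2 * b, w $ 1 + 2 * c]"
    by (simp add: vec4_eq_iff)
  then show ?thesis by (rule that)
qed

lemma unframe_same_parity: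
  "unframe (vector [x, x + 2 * a, x + 2 * b, x + 2 * c]) = vector [- x - c, b, b - a, c - a]"
proof -
  have "(- x - (x + 2 * c)) div 2 = - x - c" "(x + 2 * b - x) div 2 = b"
    "(x + 2 * b - (x + 2 * a)) div 2 = b - a" "(x + 2 * c - (x + 2 * a)) div 2 = c - a"
    by presburger+
  then show ?thesis by (simp add: unframe_def vec4_eq_iff)
qed

lemma frame_unframe: "same_parity w \<Longrightarrow> frame (unframe w) = w"
proof -
  assume "same_parity w"
  then obtain x a b c where "w = vector [x, x + 2 * a, x + 2 * b, x + 2 * c]" by (rule same_parityE)
  then show ?thesis by (simp only: unframe_same_parity) (simp add: frame_def vec4_eq_iff)
qed

lemma frame_add: "frame (v + w) = frame v + frame w"
  by (simp add: frame_def vec4_eq_iff)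

lemma frame_eq_iff: "frame v = frame w \<longleftrightarrow> v = w"
  by (metis unframe_frame)

lemma root_norm_frame: "4 * root_norm v = (\<Sum>j\<in>UNIV. (frame v $ j)\<^sup>2)"
  by (simp add: root_norm_def frame_def sum_4 power2_eq_square algebra_simps)

lemma root_norm_nonneg: "root_norm v \<ge> 0"
  using root_norm_frame[of v] sum_nonneg[of UNIV "\<lambda>j. (frame v $ j)\<^sup>2"] by simp

lemma root_norm_eq_0: "root_norm v = 0 \<longleftrightarrow> v = 0"
proof
  assume "root_norm v = 0"
  then have "(\<Sum>j\<in>UNIV. (frame v $ j)\<^sup>2) = 0" using root_norm_frame[of v] by simp
  then have "\<forall>j. frame v $ j = 0" by (simp add: sum_nonneg_eq_0_iff)
  then have "frame v = frame 0" by (simp add: vec_eq_iff frame_def forall_4)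
  then show "v = 0" by (simp only: frame_eq_iff)
qed (simp add: root_norm_def)

definition root_form :: "int ^ 4 \<Rightarrow> int ^ 4 \<Rightarrow> int" where
  "root_form v w = root_norm (v + w) - root_norm v - root_norm w"

lemma root_norm_add: "root_norm (v + w) = root_norm v + root_norm w + root_form v w"
  by (simp add: root_form_def)

lemma root_norm_diff: "root_norm (v - w) = root_norm v + root_norm w - root_form v w"
  by (simp add: root_form_def root_norm_def power2_eq_square algebra_simps)

lemma root_form_expand: "root_form v w = 2 * (v $ 1 * w $ 1 + v $ 2 * w $ 2 + v $ 3 * w $ 3 + v $ 4 * w $ 4)
    - v $ 1 * w $ 2 - v $ 2 * w $ 1 + v $ 1 * w $ 4 + v $ 4 * w $ 1 - v $ 2 * w $ 3 - v $ 3 * w $ 2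
    - v $ 3 * w $ 4 - v $ 4 * w $ 3"
  by (simp add: root_form_def root_norm_def power2_eq_square algebra_simps)

lemma all_oct_basis: "(\<forall>b. P b) \<longleftrightarrow> P Oe1 \<and> P Oe2 \<and> (\<forall>j. P (Ou j)) \<and> (\<forall>j. P (Ov j))"
  by (metis oct_basis.exhaust)

lemma root_norm_deg_iota: "root_norm (deg_iota i b) = 1"
proof -
  have "\<forall>i b. root_norm (deg_iota i b) = 1"
    unfolding all_oct_basis all_3 by (simp add: deg_simps root_norm_def)
  then show ?thesis by blast
qed

text \<open>Four integers of equal parity whose squares add up to 4 are either one 2 or -2 and three
  0, or four entries 1 or -1. This leaves 8 + 16 vectors, as many as there are degrees in the three
  copies.\<close>

lemma deg_iota_surj:
  assumes "root_norm v = 1"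
  shows "\<exists>i b. v = deg_iota i b"
proof -
  obtain x a b c where w: "frame v = vector [x, x + 2 * a, x + 2 * b, x + 2 * c]"
    using same_parityE[OF same_parity_frame] by blast
  have q: "x\<^sup>2 + (x + 2 * a)\<^sup>2 + (x + 2 * b)\<^sup>2 + (x + 2 * c)\<^sup>2 = 4"
    using root_norm_frame[of v] assms by (simp add: sum_4 w)
  have bd: "y = -2 \<or> y = -1 \<or> y = 0 \<or> y = 1 \<or> y = 2" if "y\<^sup>2 \<le> 4" for y :: int
  proof -
    have "y\<^sup>2 \<le> 2\<^sup>2" using that by simp
    then show ?thesis unfolding abs_le_square_iff[symmetric] by auto
  qed
  note nn = zero_le_power2[of x] zero_le_power2[of "x + 2 * a"] zero_le_power2[of "x + 2 * b"]
    zero_le_power2[of "x + 2 * c"]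
  have xs: "x = -2 \<or> x = -1 \<or> x = 0 \<or> x = 1 \<or> x = 2" by (rule bd) (use q nn in linarith)
  have "(x + 2 * a)\<^sup>2 \<le> 4" "(x + 2 * b)\<^sup>2 \<le> 4" "(x + 2 * c)\<^sup>2 \<le> 4"
    using q nn by linarith+
  note bds = this[THEN bd]
  \<comment> \<open>The 24 solutions in the parameters of \<open>same_parityE\<close>, where the
    frame coordinates are x, x + 2a, x + 2b and x + 2c.\<close>
  let ?T = "{(-2,1,1,1), (2,-1,-1,-1),
      (0,1,0,0), (0,-1,0,0), (0,0,1,0), (0,0,-1,0), (0,0,0,1), (0,0,0,-1)} \<union>
      {-1} \<times> {0, 1} \<times> {0, 1} \<times> {0, 1} \<union> {1} \<times> {0, -1} \<times> {0, -1} \<times> {0, -1 :: int}"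
  have t1: "(x, a, b, c) \<in> ?T" if "x = -2 \<or> x = 2"
  proof -
    have "x\<^sup>2 = 4" using that by auto
    then have "(x + 2 * a)\<^sup>2 = 0" "(x + 2 * b)\<^sup>2 = 0" "(x + 2 * c)\<^sup>2 = 0"
      using q nn by linarith+
    then have "x + 2 * a = 0" "x + 2 * b = 0" "x + 2 * c = 0" by simp_all
    then have "x = -2 \<and> a = 1 \<and> b = 1 \<and> c = 1 \<or> x = 2 \<and> a = -1 \<and> b = -1 \<and> c = -1"
      using that by linarith
    then show ?thesis by (elim disjE) simp_all
  qed
  have t2: "(x, a, b, c) \<in> ?T" if x: "x = -1 \<or> x = 1"
  proof -
    have o: "y = 0 \<or> y = - x" if "x + 2 * y \<in> {-2, -1, 0, 1, 2}" for y
    proof -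
      have "odd (x + 2 * y)" using x by (elim disjE) simp_all
      then have "x + 2 * y = -1 \<or> x + 2 * y = 1" using that by (elim insertE emptyE) simp_all
      then show ?thesis using x by linarith
    qed
    have "a = 0 \<or> a = - x" "b = 0 \<or> b = - x" "c = 0 \<or> c = - x" by (rule o; use bds in simp)+
    then show ?thesis using x by (elim disjE) simp_all
  qed
  have t3: "(x, a, b, c) \<in> ?T" if x: "x = 0"
  proof -
    have o: "y = -1 \<or> y = 0 \<or> y = 1" if "2 * y \<in> {-2, -1, 0, 1, 2}" for y :: int
      using that unfolding insert_iff empty_iff by presburger
    have "a = -1 \<or> a = 0 \<or> a = 1" "b = -1 \<or> b = 0 \<or> b = 1" "c = -1 \<or> c = 0 \<or> c = 1"
      by (rule o; use bds x in simp)+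
    moreover have "a\<^sup>2 + b\<^sup>2 + c\<^sup>2 = 1" using q x by (simp add: power_mult_distrib)
    ultimately have "(a, b, c) \<in> {(1,0,0), (-1,0,0), (0,1,0), (0,-1,0), (0,0,1), (0,0,-1)}"
      by (elim disjE; simp)
    then show ?thesis using x by (elim insertE emptyE Pair_inject; simp)
  qed
  have t: "(x, a, b, c) \<in> ?T"
    using xs by (elim disjE) (rule t1 t2 t3; simp)+
  have v: "v = vector [- x - c, b, b - a, c - a]"
    using unframe_frame[of v] by (simp add: w unframe_same_parity)
  have "\<not> (\<forall>i b. v \<noteq> deg_iota i b)"
    unfolding all_oct_basis all_3 v using t
    by (elim UnE insertE emptyE SigmaE Pair_inject; simp add: deg_simps vec4_eq_iff)
  then show ?thesis by blast
qed

lemma additive_int_scale: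
  fixes f :: "int ^ 'n \<Rightarrow> int ^ 'm"
  assumes "\<And>x y. f (x + y) = f x + f y"
  shows "f (k *s x) = k *s f x"
proof -
  have f0: "f 0 = 0" using assms[of 0 0] by simp
  have fm: "f (- y) = - f y" for y using assms[of y "- y"] f0 by (simp add: eq_neg_iff_add_eq_0 add.commute)
  have n: "f (int n *s x) = int n *s f x" for n
    by (induction n) (simp_all add: f0 assms vector_sadd_rdistrib)
  show ?thesis
  proof (cases k rule: int_cases2)
    case (nonpos m)
    have "f (- (int m *s x)) = - (int m *s f x)" unfolding fm n ..
    then show ?thesis unfolding nonpos vector_sneg_minus1 by simp
  qed (use n in simp)
qed

lemma vec4_expand: "v = v $ 1 *s axis 1 1 + v $ 2 *s axis 2 1 + v $ 3 *s axis 3 1 + v $ 4 *s axis 4 1"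
  for v :: "'a::comm_ring_1 ^ 4"
  by (simp add: vec4_eq_iff axis_def)

lemma additive_expand:
  fixes f :: "int ^ 4 \<Rightarrow> int ^ 'm"
  assumes "\<And>x y. f (x + y) = f x + f y"
  shows "f v = v $ 1 *s f (axis 1 1) + v $ 2 *s f (axis 2 1) + v $ 3 *s f (axis 3 1) + v $ 4 *s f (axis 4 1)"
  by (subst vec4_expand) (simp only: assms additive_int_scale[of f, OF assms])

lemma additive_matrix:
  fixes f :: "int ^ 4 \<Rightarrow> int ^ 4"
  assumes "\<And>x y. f (x + y) = f x + f y"
  shows "matrix f *v v = f v"
  by (subst additive_expand[of f, OF assms])
    (simp add: vec_eq_iff matrix_def matrix_vector_mult_def sum_4 mult.commute)

lemma root_norm_comb: "root_norm (x *s a + y *s b + z *s c + t *s d) =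
    x\<^sup>2 * root_norm a + y\<^sup>2 * root_norm b + z\<^sup>2 * root_norm c + t\<^sup>2 * root_norm d
    + x * y * root_form a b + x * z * root_form a c + x * t * root_form a d
    + y * z * root_form b c + y * t * root_form b d + z * t * root_form c d"
  unfolding root_form_expand root_norm_def power2_eq_square
  by (simp only: vector_add_component vector_smult_component) algebra

text \<open>The Gram matrix of the canonical basis is recovered from short vectors. All basis
  vectors are short; a short sum forces the product -1, a short difference the product 1. If an
  orthogonal pair has product b after applying f, then 2 + b and 2 - b are norms different from 0
  and 1, hence both at least 2, and b = 0.\<close>

lemma root_norm_preserved:
  assumes add: "\<And>x y. f (x + y) = f x + f y" and inj: "\<And>v. f v = 0 \<Longrightarrow> v = 0"
    and short: "\<And>v. root_norm (f v) = 1 \<longleftrightarrow> root_norm v = 1"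
  shows "root_norm (f v) = root_norm v"
proof -
  let ?e = "\<lambda>j. axis j 1 :: int ^ 4"
  have f0: "f 0 = 0" using add[of 0 0] by simp
  have diff: "f (x - y) = f x - f y" for x y using add[of "x - y" y] by simp
  have n: "root_norm (f (?e j)) = 1" for j
    using short[of "?e j"] exhaust_4[of j] by (auto simp: root_norm_def axis_def)
  have plus: "root_form (f (?e i)) (f (?e j)) = -1" if "root_norm (?e i + ?e j) = 1" for i j
    using that short[of "?e i + ?e j"] n by (simp add: root_form_def add)
  have minus: "root_form (f (?e i)) (f (?e j)) = 1" if "root_norm (?e i - ?e j) = 1" for i j
    using that short[of "?e i - ?e j"] n by (simp add: root_norm_diff diff)
  have zero: "root_form (f (?e i)) (f (?e j)) = 0"
    if "root_norm (?e i + ?e j) = 2" "root_norm (?e i - ?e j) = 2" for i j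
  proof -
    let ?b = "root_form (f (?e i)) (f (?e j))"
    have p: "root_norm (f (?e i + ?e j)) = 2 + ?b" and m: "root_norm (f (?e i - ?e j)) = 2 - ?b"
      using n by (simp_all add: add diff root_norm_add root_norm_diff)
    have "root_norm (f (?e i + ?e j)) \<noteq> 1" "root_norm (f (?e i - ?e j)) \<noteq> 1"
      using that short by simp_all
    moreover have "root_norm (f x) \<noteq> 0" if "root_norm x = 2" for x
      using inj[of x] root_norm_eq_0[of "f x"] root_norm_eq_0[of x] that by auto
    note this[OF that(1)] this[OF that(2)]
    moreover have "root_norm (f (?e i + ?e j)) \<ge> 0" "root_norm (f (?e i - ?e j)) \<ge> 0"
      by (rule root_norm_nonneg)+
    ultimately show ?thesis using p m by linarith
  qed
  have "root_form (f (?e 1)) (f (?e 2)) = -1" "root_form (f (?e 2)) (f (?e 3)) = -1"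
    "root_form (f (?e 3)) (f (?e 4)) = -1" "root_form (f (?e 1)) (f (?e 4)) = 1"
    "root_form (f (?e 1)) (f (?e 3)) = 0" "root_form (f (?e 2)) (f (?e 4)) = 0"
    by (rule plus minus zero; simp add: root_norm_def axis_def)+
  then show ?thesis
    by (subst additive_expand[of f, OF add]) (simp add: root_norm_comb n, simp add: root_norm_def)
qed

text \<open>The class of v modulo the vectors of even norm, labelled by the copy whose degrees it
  contains. The zero class also receives the value 2, so the label is meaningful for odd norm
  only.\<close>

definition copy_of :: "int ^ 4 \<Rightarrow> 3" where
  "copy_of v = (if odd (v $ 1 + v $ 3) then (if odd (v $ 2 + v $ 4) then 0 else 1) else 2)"

text \<open>Modulo 2 the norm depends only on s = v1 + v3 and t = v2 + v4, as s^2 + s t + t^2, and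
  over the field with two elements this form vanishes only at the origin.\<close>

lemma even_root_norm: "even (root_norm v) \<longleftrightarrow> even (v $ 1 + v $ 3) \<and> even (v $ 2 + v $ 4)"
proof -
  have "root_norm v = (v $ 1 + v $ 3)\<^sup>2 + (v $ 2 + v $ 4)\<^sup>2 - (v $ 1 + v $ 3) * (v $ 2 + v $ 4)
      - 2 * (v $ 1 * v $ 3 + v $ 2 * v $ 4 - v $ 1 * v $ 4)"
    by (simp add: root_norm_def power2_eq_square algebra_simps)
  then show ?thesis by simp blast
qed

text \<open>Expressing equality of classes by the norm of a difference makes it evident that
  isometries permute the classes.\<close>

lemma copy_of_eq_iff:
  "odd (root_norm v) \<Longrightarrow> odd (root_norm w) \<Longrightarrow> copy_of v = copy_of w \<longleftrightarrow> even (root_norm (v - w))"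
  by (simp add: even_root_norm copy_of_def) presburger

lemma copy_of_deg_iota: "copy_of (deg_iota i b) = i"
proof -
  have "\<forall>i b. copy_of (deg_iota i b) = i"
    unfolding all_oct_basis all_3 by (simp add: deg_simps copy_of_def)
  then show ?thesis by blast
qed

lemma deg_iota_inj: "deg_iota i b = deg_iota j c \<longleftrightarrow> i = j \<and> b = c"
proof -
  have "\<forall>i b c. deg_iota i b = deg_iota i c \<longrightarrow> b = c"
    unfolding all_oct_basis all_3 by (simp add: deg_simps vec4_eq_iff)
  then show ?thesis using copy_of_deg_iota by metis
qed

section \<open>The isometry group of the root lattice\<close>

declare deg_iota.simps [simp del]

text \<open>The full isometry group of the lattice, which \<open>weyl_image_f4\<close> identifies
  with the Weyl group of f4.\<close>

definition isometries :: "(int ^ 4 \<Rightarrow> int ^ 4) set" where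
  "isometries = {f. bij f \<and> (\<forall>x y. f (x + y) = f x + f y) \<and> (\<forall>v. root_norm (f v) = root_norm v)}"

text \<open>Positive definiteness yields injectivity, so a right inverse is all that has to be
  supplied.\<close>

lemma isometryI:
  assumes "\<And>x y. f (x + y) = f x + f y" "\<And>v. root_norm (f v) = root_norm v" "\<And>v. f (g v) = v"
  shows "f \<in> isometries"
proof -
  have d: "f (x - y) = f x - f y" for x y using assms(1)[of "x - y" y] by simp
  have "x = y" if "f x = f y" for x y
    using that assms(2)[of "x - y"] root_norm_eq_0[of "x - y"] root_norm_eq_0[of 0] by (simp add: d)
  then have "inj f" by (rule injI)
  moreover have "surj f" using assms(3) by (metis surjI)
  ultimately show ?thesis using assms by (simp add: isometries_def bij_def)
qed

lemma isometry_add: "f \<in> isometries \<Longrightarrow> f (x + y) = f x + f y"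
  and isometry_norm: "f \<in> isometries \<Longrightarrow> root_norm (f v) = root_norm v"
  and isometry_bij: "f \<in> isometries \<Longrightarrow> bij f"
  by (auto simp: isometries_def)

lemma isometry_inj: "f \<in> isometries \<Longrightarrow> f x = f y \<longleftrightarrow> x = y"
  using isometry_bij[of f] by (auto simp: bij_def inj_def)

lemma isometry_zero: "f \<in> isometries \<Longrightarrow> f 0 = 0"
  using isometry_add[of f 0 0] by simp

lemma isometry_diff: "f \<in> isometries \<Longrightarrow> f (x - y) = f x - f y"
  using isometry_add[of f "x - y" y] by simp

lemma isometry_uminus: "f \<in> isometries \<Longrightarrow> f (- y) = - f y"
  using isometry_diff[of f 0 y] isometry_zero[of f] by simp

lemma isometry_scale: "f \<in> isometries \<Longrightarrow> f (k *s y) = k *s f y"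
  by (rule additive_int_scale) (rule isometry_add)

lemma isometry_comp: "f \<in> isometries \<Longrightarrow> g \<in> isometries \<Longrightarrow> f \<circ> g \<in> isometries"
  by (simp add: isometries_def bij_comp)

lemma isometry_id: "id \<in> isometries"
  by (simp add: isometries_def)

lemma isometry_inv:
  assumes f: "f \<in> isometries"
  shows "inv' f \<in> isometries"
proof -
  have s: "f (inv' f v) = v" for v using isometry_bij[OF f] by (simp add: bij_is_surj surj_f_inv_f)
  have "inv' f (x + y) = inv' f x + inv' f y" for x y
    using isometry_inj[OF f, of "inv' f (x + y)" "inv' f x + inv' f y"] by (simp add: isometry_add[OF f] s)
  moreover have "root_norm (inv' f v) = root_norm v" for v
    using isometry_norm[OF f, of "inv' f v"] by (simp add: s)
  ultimately show ?thesis using isometry_bij[OF f] by (simp add: isometries_def bij_imp_bij_inv)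
qed

definition isom_group :: "(int ^ 4 \<Rightarrow> int ^ 4) monoid" where
  "isom_group = \<lparr>carrier = isometries, monoid.mult = (\<circ>), one = id\<rparr>"

lemma isom_group_simps [simp]: "carrier isom_group = isometries"
  "f \<otimes>\<^bsub>isom_group\<^esub> g = f \<circ> g" "\<one>\<^bsub>isom_group\<^esub> = id"
  by (simp_all add: isom_group_def)

lemma inv_comp_isometry: "f \<in> isometries \<Longrightarrow> inv' f \<circ> f = id" "f \<in> isometries \<Longrightarrow> f \<circ> inv' f = id"
  using isometry_bij[of f] by (auto simp: bij_def surj_iff)

lemma group_isom_group: "group isom_group"
proof (rule groupI)
  fix f assume "f \<in> carrier isom_group"
  then show "\<exists>g \<in> carrier isom_group. g \<otimes>\<^bsub>isom_group\<^esub> f = \<one>\<^bsub>isom_group\<^esub>"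
    using isometry_inv inv_comp_isometry by auto
qed (auto simp: isometry_comp isometry_id comp_assoc)

lemma inv_isom_group: "f \<in> isometries \<Longrightarrow> inv\<^bsub>isom_group\<^esub> f = inv' f"
  by (rule group.inv_equality[OF group_isom_group]) (simp_all add: inv_comp_isometry isometry_inv)

text \<open>The action on the three nonzero classes. By \<open>copy_of_isometry\<close> any vector
  of odd norm in the class could replace the degree of e1.\<close>

definition copy_perm :: "(int ^ 4 \<Rightarrow> int ^ 4) \<Rightarrow> 3 \<Rightarrow> 3" where
  "copy_perm f i = copy_of (f (deg_iota i Oe1))"

lemma copy_of_isometry:
  assumes f: "f \<in> isometries" and v: "odd (root_norm v)"
  shows "copy_of (f v) = copy_perm f (copy_of v)"
proof -
  let ?d = "deg_iota (copy_of v) Oe1"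
  have "even (root_norm (v - ?d))"
    using copy_of_eq_iff[OF v, of ?d] by (simp add: copy_of_deg_iota root_norm_deg_iota)
  then have "even (root_norm (f v - f ?d))"
    by (simp add: isometry_norm[OF f] flip: isometry_diff[OF f])
  then show ?thesis
    using v by (simp add: copy_perm_def copy_of_eq_iff isometry_norm[OF f] root_norm_deg_iota)
qed

lemma copy_perm_comp:
  assumes "f \<in> isometries" "g \<in> isometries"
  shows "copy_perm (f \<circ> g) = copy_perm f \<circ> copy_perm g"
proof
  fix i
  have "copy_perm (f \<circ> g) i = copy_of (f (g (deg_iota i Oe1)))" by (simp add: copy_perm_def)
  also have "\<dots> = copy_perm f (copy_of (g (deg_iota i Oe1)))"
    using assms by (intro copy_of_isometry) (simp_all add: isometry_norm root_norm_deg_iota)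
  finally show "copy_perm (f \<circ> g) i = (copy_perm f \<circ> copy_perm g) i" by (simp add: copy_perm_def)
qed

lemma copy_perm_id: "copy_perm id = id"
  by (rule ext) (simp add: copy_perm_def copy_of_deg_iota)

lemma copy_perm_bij:
  assumes f: "f \<in> isometries"
  shows "bij (copy_perm f)"
proof (rule o_bij)
  show "copy_perm (inv' f) \<circ> copy_perm f = id" "copy_perm f \<circ> copy_perm (inv' f) = id"
    using f isometry_inv[OF f]
    by (simp_all add: copy_perm_id inv_comp_isometry flip: copy_perm_comp)
qed

lemma copy_perm_eq_idI:
  assumes "f \<in> isometries" "\<And>v. even (root_norm (f v - v))"
  shows "copy_perm f = id"
proof
  fix i
  have "copy_of (f (deg_iota i Oe1)) = copy_of (deg_iota i Oe1)"
    using assms by (subst copy_of_eq_iff) (simp_all add: isometry_norm root_norm_deg_iota)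
  then show "copy_perm f i = id i" by (simp add: copy_perm_def copy_of_deg_iota)
qed

text \<open>The kernel of the action on the copies. It turns out to consist of the permutations and
  even sign changes of the frame, which form the Weyl group of type D4 of the long roots.\<close>

definition copy_fixing :: "(int ^ 4 \<Rightarrow> int ^ 4) set" where
  "copy_fixing = {f \<in> isometries. copy_perm f = id}"

subsection \<open>Signed permutations of the frame\<close>

text \<open>The inverse of p in the coordinates makes the frame vector j go to the frame vector p j,
  so that \<open>perm_map\<close> is multiplicative in p.\<close>

definition perm_map :: "(4 \<Rightarrow> 4) \<Rightarrow> int ^ 4 \<Rightarrow> int ^ 4" where
  "perm_map p v = unframe (\<chi> k. frame v $ inv' p k)"

definition sign_map :: "int ^ 4 \<Rightarrow> int ^ 4 \<Rightarrow> int ^ 4" where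
  "sign_map e v = unframe (\<chi> k. e $ k * frame v $ k)"

lemma frame_perm_map: "frame (perm_map p v) = (\<chi> k. frame v $ inv' p k)"
  unfolding perm_map_def by (rule frame_unframe) (use same_parity_frame in \<open>simp add: same_parity_def\<close>)

lemma frame_sign_map:
  assumes "\<And>k. e $ k = 1 \<or> e $ k = -1"
  shows "frame (sign_map e v) = (\<chi> k. e $ k * frame v $ k)"
  unfolding sign_map_def
proof (rule frame_unframe)
  have "even (x * a - y * b)" if "x = 1 \<or> x = -1" "y = 1 \<or> y = -1" "even (a - b)" for x y a b :: int
    using that by (elim disjE) simp_all
  then have "even (e $ i * frame v $ i - e $ j * frame v $ j)" for i j
    using same_parity_frame[of v] assms unfolding same_parity_def by blast
  then show "same_parity (\<chi> k. e $ k * frame v $ k)" by (simp add: same_parity_def)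
qed

lemma frame_eqI: "frame v = frame w \<Longrightarrow> v = w"
  by (simp add: frame_eq_iff)

lemma perm_map_comp: "bij p \<Longrightarrow> bij q \<Longrightarrow> perm_map (p \<circ> q) = perm_map p \<circ> perm_map q"
  by (rule ext, rule frame_eqI) (simp add: frame_perm_map o_inv_distrib)

lemma perm_map_isometry:
  assumes "bij p"
  shows "perm_map p \<in> isometries"
proof (rule isometryI)
  show "perm_map p (x + y) = perm_map p x + perm_map p y" for x y
    by (rule frame_eqI) (simp add: frame_perm_map frame_add vec_eq_iff)
  show "perm_map p (perm_map (inv' p) v) = v" for v
    by (rule frame_eqI) (use assms in \<open>simp add: frame_perm_map vec_eq_iff inv_inv_eq bij_is_surj surj_f_inv_f\<close>)
  have "(\<Sum>j\<in>UNIV. (frame v $ inv' p j)\<^sup>2) = (\<Sum>j\<in>UNIV. (frame v $ j)\<^sup>2)" for v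
    using sum.reindex_bij_betw[OF bij_imp_bij_inv[OF assms], of "\<lambda>j. (frame v $ j)\<^sup>2"] by simp
  then show "root_norm (perm_map p v) = root_norm v" for v
    using root_norm_frame[of "perm_map p v"] root_norm_frame[of v] by (simp add: frame_perm_map)
qed

lemma sign_map_comp:
  assumes "\<And>k. e $ k = 1 \<or> e $ k = -1" "\<And>k. e' $ k = 1 \<or> e' $ k = -1"
  shows "sign_map e (sign_map e' v) = sign_map (\<chi> k. e $ k * e' $ k) v"
proof -
  have "(e $ k * e' $ k = 1) \<or> (e $ k * e' $ k = -1)" for k
    using assms(1)[of k] assms(2)[of k] by (elim disjE) simp_all
  then have c: "frame (sign_map (\<chi> k. e $ k * e' $ k) v) = (\<chi> k. (\<chi> k. e $ k * e' $ k) $ k * frame v $ k)"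
    by (intro frame_sign_map) simp
  show ?thesis
    by (rule frame_eqI) (simp add: frame_sign_map[OF assms(1)] frame_sign_map[OF assms(2)] c mult.assoc)
qed

lemma sign_map_isometry:
  assumes e: "\<And>k. e $ k = 1 \<or> e $ k = -1"
  shows "sign_map e \<in> isometries"
proof (rule isometryI)
  have e2: "(e $ k)\<^sup>2 = 1" for k using e[of k] by (elim disjE) simp_all
  have ee: "e $ k * (e $ k * x) = x" for k x using e[of k] by (elim disjE) simp_all
  show "sign_map e (x + y) = sign_map e x + sign_map e y" for x y
    by (rule frame_eqI) (simp add: frame_sign_map[OF e] frame_add vec_eq_iff distrib_left)
  show "sign_map e (sign_map e v) = v" for v
    by (rule frame_eqI) (simp add: frame_sign_map[OF e] vec_eq_iff ee)
  show "root_norm (sign_map e v) = root_norm v" for v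
    using root_norm_frame[of "sign_map e v"] root_norm_frame[of v]
    by (simp add: frame_sign_map[OF e] power_mult_distrib e2)
qed

text \<open>Here the norm is the sum of the squares of the coordinates of x, which has the parity of
  their sum.\<close>

lemma even_root_norm_frame:
  assumes "frame u = 2 *s x" "even (\<Sum>k\<in>UNIV. x $ k)"
  shows "even (root_norm u)"
proof -
  have "4 * root_norm u = 4 * (\<Sum>k\<in>UNIV. (x $ k)\<^sup>2)"
    unfolding root_norm_frame assms by (simp add: power_mult_distrib sum_distrib_left)
  then have "root_norm u = (\<Sum>k\<in>UNIV. (x $ k)\<^sup>2)" by simp
  then show ?thesis using assms(2) by (simp add: sum_4)
qed

lemma frame_diff: "frame (v - w) = frame v - frame w"
  by (simp add: frame_def vec4_eq_iff)

lemma frame_uminus: "frame (- v) = - frame v"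
  by (simp add: frame_def vec4_eq_iff)

text \<open>A permutation changes each frame coordinate by an even number, and the halves of these
  changes still add up to 0, so every vector keeps its class.\<close>

lemma perm_map_copy_fixing:
  assumes p: "bij p"
  shows "perm_map p \<in> copy_fixing"
proof -
  have "even (root_norm (perm_map p v - v))" for v
  proof -
    let ?d = "\<lambda>k. frame v $ inv' p k - frame v $ k"
    have ev: "even (?d k)" for k
      using same_parity_frame[of v] by (simp add: same_parity_def)
    have "(\<Sum>k\<in>UNIV. ?d k) = 0"
      using sum.reindex_bij_betw[OF bij_imp_bij_inv[OF p], of "\<lambda>j. frame v $ j"]
      by (simp add: sum_subtractf)
    moreover have "(\<Sum>k\<in>UNIV. ?d k) = 2 * (\<Sum>k\<in>UNIV. ?d k div 2)"
      using ev by (simp add: sum_distrib_left)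
    ultimately have "(\<Sum>k\<in>UNIV. ?d k div 2) = 0" by simp
    moreover have "frame (perm_map p v - v) = 2 *s (\<chi> k. ?d k div 2)"
      using ev by (simp add: frame_diff frame_perm_map vec_eq_iff)
    ultimately show ?thesis by (intro even_root_norm_frame[of _ "\<chi> k. ?d k div 2"]) simp_all
  qed
  then show ?thesis
    using perm_map_isometry[OF p] copy_perm_eq_idI by (simp add: copy_fixing_def)
qed

text \<open>The fourth sign is the product of the other three, which makes the number of sign
  changes even. The arguments are read modulo 2 to match \<open>integer_mod_group\<close>.\<close>

definition sign_vec :: "int \<times> int \<times> int \<Rightarrow> int ^ 4" where
  "sign_vec = (\<lambda>(a, b, c). let s = (\<lambda>x. if even x then 1 else -1) in
     vector [s a, s b, s c, s a * s b * s c])"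

lemma sign_vec_sign: "sign_vec t $ k = 1 \<or> sign_vec t $ k = -1"
proof -
  have "\<forall>k. sign_vec t $ k = 1 \<or> sign_vec t $ k = -1"
    by (cases t) (simp add: forall_4 sign_vec_def Let_def)
  then show ?thesis by blast
qed

lemma sign_vec_ex:
  assumes "\<And>k. e $ k = 1 \<or> e $ k = -1" "e $ 1 * e $ 2 * e $ 3 * e $ 4 = 1"
  shows "\<exists>a b c. a \<in> {0, 1} \<and> b \<in> {0, 1} \<and> c \<in> {0, 1} \<and> e = sign_vec (a, b, c)"
proof -
  define s :: "int \<Rightarrow> int" where "s x = (if x = 1 then 0 else 1)" for x
  have "e = sign_vec (s (e $ 1), s (e $ 2), s (e $ 3))"
    using assms(1)[of 1] assms(1)[of 2] assms(1)[of 3] assms(1)[of 4] assms(2)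
    by (elim disjE) (simp_all add: sign_vec_def Let_def s_def vec4_eq_iff)
  then show ?thesis by (intro exI[of _ "s (e $ 1)"] exI[of _ "s (e $ 2)"] exI[of _ "s (e $ 3)"]) (simp add: s_def)
qed

text \<open>Half the change is minus the coordinate at each negated position. The number of these
  positions is even and all frame coordinates have the same parity, so the half-changes have an even
  sum.\<close>

lemma sign_map_copy_fixing: "sign_map (sign_vec t) \<in> copy_fixing"
proof -
  let ?e = "sign_vec t"
  have "even (root_norm (sign_map ?e v - v))" for v
  proof -
    let ?x = "\<chi> k. (if ?e $ k = 1 then 0 else - frame v $ k)"
    have "(frame (sign_map ?e v - v)) $ k = (2 *s ?x) $ k" for k
      using sign_vec_sign[of t k] by (elim disjE) (simp_all add: frame_diff frame_sign_map sign_vec_sign)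
    then have "frame (sign_map ?e v - v) = 2 *s ?x" by (simp only: vec_eq_iff) simp
    moreover have "even (frame v $ i) = even (frame v $ 1)" for i
      using same_parity_frame[of v] by (simp add: same_parity_def)
    note this[of 2] this[of 3] this[of 4]
    then have "even (\<Sum>k\<in>UNIV. ?x $ k)"
    proof (cases t)
      case (fields a b c)
      then show ?thesis
        using \<open>even (frame v $ 2) = _\<close> \<open>even (frame v $ 3) = _\<close> \<open>even (frame v $ 4) = _\<close>
        by (cases "even a"; cases "even b"; cases "even c") (simp_all add: sum_4 sign_vec_def)
    qed
    ultimately show ?thesis by (rule even_root_norm_frame)
  qed
  then show ?thesis
    using sign_map_isometry[OF sign_vec_sign] copy_perm_eq_idI by (simp add: copy_fixing_def)
qed

definition frame_root :: "4 \<Rightarrow> int ^ 4" where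
  "frame_root j = unframe (2 *s axis j 1)"

lemma frame_frame_root: "frame (frame_root j) = 2 *s axis j 1"
  unfolding frame_root_def by (rule frame_unframe) (simp add: same_parity_def axis_def)

lemma frame_deg_iota_0: "\<exists>j s. (s = 1 \<or> s = -1) \<and> frame (deg_iota 0 b) = (2 * s) *s axis j 1"
proof -
  have "\<forall>b. frame (deg_iota 0 b) = 2 *s axis 1 1 \<or> frame (deg_iota 0 b) = (-2) *s axis 1 1 \<or>
    frame (deg_iota 0 b) = 2 *s axis 2 1 \<or> frame (deg_iota 0 b) = (-2) *s axis 2 1 \<or>
    frame (deg_iota 0 b) = 2 *s axis 3 1 \<or> frame (deg_iota 0 b) = (-2) *s axis 3 1 \<or>
    frame (deg_iota 0 b) = 2 *s axis 4 1 \<or> frame (deg_iota 0 b) = (-2) *s axis 4 1"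
    unfolding all_oct_basis all_3 by (simp add: deg_iota.simps deg_simps frame_def vec4_eq_iff axis_def)
  then consider j where "frame (deg_iota 0 b) = 2 *s axis j 1" | j where "frame (deg_iota 0 b) = (-2) *s axis j 1"
    by metis
  then show ?thesis
  proof cases
    case (1 j) then show ?thesis by (intro exI[of _ j] exI[of _ 1]) simp
  next
    case (2 j) then show ?thesis by (intro exI[of _ j] exI[of _ "-1"]) simp
  qed
qed

text \<open>The short vectors in the class of copy 0 are the frame vectors and their negatives, so
  an isometry fixing this class is a signed permutation of the frame. That it also fixes the class
  of copy 1 makes the product of the signs 1.\<close>

lemma copy_fixing_decompose:
  assumes "f \<in> copy_fixing"
  shows "\<exists>a b c p. a \<in> {0, 1} \<and> b \<in> {0, 1} \<and> c \<in> {0, 1} \<and> bij p \<and>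
    f = sign_map (sign_vec (a, b, c)) \<circ> perm_map p"
proof -
  have f: "f \<in> isometries" and fid: "copy_perm f = id" using assms by (auto simp: copy_fixing_def)
  have r: "root_norm (frame_root j) = 1" for j
    using root_norm_frame[of "frame_root j"] exhaust_4[of j]
    by (auto simp: frame_frame_root sum_4 axis_def)
  have "\<exists>k s. (s = 1 \<or> s = -1) \<and> frame (f (frame_root j)) = (2 * s) *s axis k 1" for j
  proof -
    have "copy_of (frame_root j) = 0"
      using exhaust_4[of j] by (auto simp: frame_root_def unframe_def copy_of_def axis_def)
    then have "copy_of (f (frame_root j)) = 0" using copy_of_isometry[OF f, of "frame_root j"] r fid by simp
    moreover obtain i b where b: "f (frame_root j) = deg_iota i b"
      using deg_iota_surj[of "f (frame_root j)"] r isometry_norm[OF f] by metis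
    ultimately have "i = 0" by (simp add: copy_of_deg_iota)
    then show ?thesis using frame_deg_iota_0[of b] b by metis
  qed
  then obtain p s where s: "\<And>j. s j = 1 \<or> s j = -1"
    and ps: "\<And>j. frame (f (frame_root j)) = (2 * s j) *s axis (p j) (1::int)"
    by metis
  \<comment> \<open>Only the double of v is guaranteed to be an integral combination of the frame
    vectors.\<close>
  have fr: "v + v = frame v $ 1 *s frame_root 1 + frame v $ 2 *s frame_root 2
      + frame v $ 3 *s frame_root 3 + frame v $ 4 *s frame_root 4" for v
    by (simp add: vec4_eq_iff frame_root_def unframe_def axis_def frame_def)
  have fs: "frame (k *s v) = k *s frame v" for k v
    by (rule additive_int_scale) (rule frame_add)
  have ff: "frame (f v) $ k = (\<Sum>j\<in>UNIV. frame v $ j * s j * (if p j = k then 1 else 0))" for v k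
  proof -
    have "2 * frame (f v) $ k = frame (f (v + v)) $ k"
      by (simp only: isometry_add[OF f] frame_add vector_add_component mult_2)
    also have "\<dots> = (\<Sum>j\<in>UNIV. frame v $ j * (2 * s j * (if p j = k then 1 else 0)))"
      unfolding fr by (simp add: isometry_add[OF f] isometry_scale[OF f] frame_add fs ps sum_4 axis_def)
    also have "\<dots> = 2 * (\<Sum>j\<in>UNIV. frame v $ j * s j * (if p j = k then 1 else 0))"
      by (simp add: sum_distrib_left mult_ac)
    finally show ?thesis by simp
  qed
  have "inj p"
  proof (rule injI)
    fix j j' assume e: "p j = p j'"
    have "frame (f (frame_root j)) = frame (f (frame_root j')) \<or>
        frame (f (frame_root j)) = frame (f (- frame_root j'))"
      unfolding isometry_uminus[OF f] frame_uminus ps e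
      using s[of j] s[of j'] by (elim disjE) (simp_all add: vec_eq_iff)
    then have "frame_root j = frame_root j' \<or> frame_root j = - frame_root j'"
      by (simp only: isometry_inj[OF f] frame_eq_iff)
    then have "frame (frame_root j) = frame (frame_root j') \<or> frame (frame_root j) = - frame (frame_root j')"
      by (elim disjE) (simp_all add: frame_uminus)
    then have "frame (frame_root j) $ j = frame (frame_root j') $ j \<or>
        frame (frame_root j) $ j = - (frame (frame_root j') $ j)"
      by (elim disjE) simp_all
    then show "j = j'"
      unfolding frame_frame_root by (cases "j = j'") (simp_all add: axis_def)
  qed
  then have p: "bij p" by (simp add: bij_def finite_UNIV_inj_surj)
  define e :: "int ^ 4" where "e = (\<chi> k. s (inv' p k))"
  have e: "e $ k = 1 \<or> e $ k = -1" for k using s by (simp add: e_def)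
  have fe: "frame (f v) $ k = e $ k * frame v $ inv' p k" for v k
  proof -
    have "p j = k \<longleftrightarrow> j = inv' p k" for j using p by (metis bij_inv_eq_iff)
    then show ?thesis
      unfolding ff by (simp add: e_def if_distrib[of "times _"] mult.commute cong: if_cong)
  qed
  have fcomp: "f = sign_map e \<circ> perm_map p"
    by (rule ext, rule frame_eqI) (simp add: vec_eq_iff fe frame_sign_map[OF e] frame_perm_map)
  moreover have "e $ 1 * e $ 2 * e $ 3 * e $ 4 = 1"
  proof -
    \<comment> \<open>All frame coordinates of this degree are -1, so its image has frame
      coordinates -e, and the class of that vector reveals the product of the signs.\<close>
    let ?a = "deg_iota 1 Oe1"
    have "copy_of (f ?a) = 1"
      using copy_of_isometry[OF f, of ?a] fid by (simp add: root_norm_deg_iota copy_of_deg_iota)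
    moreover have "frame ?a $ k = -1" for k
      using exhaust_4[of k] by (auto simp: frame_def deg_iota.simps deg_simps)
    then have fa: "frame (f ?a) = - e" by (simp add: vec_eq_iff fe)
    have "f ?a = unframe (- e)" by (simp flip: fa)
    ultimately have "copy_of (unframe (- e)) = 1" by simp
    moreover have "w * x * y * z = 1" if "copy_of (unframe (- vector [w, x, y, z])) = 1"
        "w = 1 \<or> w = -1" "x = 1 \<or> x = -1" "y = 1 \<or> y = -1" "z = 1 \<or> z = -1" for w x y z :: int
      using that(2-5) that(1) by (elim disjE) (simp_all add: copy_of_def unframe_def)
    moreover have "e = vector [e $ 1, e $ 2, e $ 3, e $ 4]" by (simp add: vec4_eq_iff)
    ultimately show ?thesis using e by metis
  qed
  ultimately show ?thesis using sign_vec_ex[of e] e p by metis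
qed

subsection \<open>The semidirect decomposition\<close>

lemma subgroup_copy_fixing: "subgroup copy_fixing isom_group"
proof (rule group.subgroupI[OF group_isom_group])
  show "copy_fixing \<subseteq> carrier isom_group" by (auto simp: copy_fixing_def)
  show "copy_fixing \<noteq> {}" using isometry_id copy_perm_id by (auto simp: copy_fixing_def)
  fix f assume f: "f \<in> copy_fixing"
  then have "copy_perm (inv' f) = copy_perm (inv' f \<circ> f)"
    by (subst copy_perm_comp) (auto simp: copy_fixing_def isometry_inv)
  then show "inv\<^bsub>isom_group\<^esub> f \<in> copy_fixing"
    using f by (simp add: copy_fixing_def inv_isom_group isometry_inv inv_comp_isometry copy_perm_id)
  fix g assume "g \<in> copy_fixing"
  then show "f \<otimes>\<^bsub>isom_group\<^esub> g \<in> copy_fixing"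
    using f by (simp add: copy_fixing_def isometry_comp copy_perm_comp)
qed

abbreviation copy_fixing_group where "copy_fixing_group \<equiv> isom_group\<lparr>carrier := copy_fixing\<rparr>"

lemma group_copy_fixing: "group copy_fixing_group"
  using subgroup.subgroup_is_group[OF subgroup_copy_fixing group_isom_group] .

text \<open>\<open>sym_group n\<close> permutes an initial segment of the natural numbers and fixes
  everything else; conjugation by the enumeration e carries this to the bijections of a finite
  type.\<close>

lemma sym_group_iso_BijGroup:
  assumes "bij_betw e {1..n} (UNIV :: 'a set)"
  shows "sym_group n \<cong> BijGroup (UNIV :: 'a set)"
proof -
  define S where "S = {1..n}"
  have e: "bij_betw e S UNIV" using assms by (simp only: S_def)
  have sym: "sym_group n = \<lparr>carrier = {p. p permutes S}, monoid.mult = (\<circ>), one = id\<rparr>"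
    unfolding sym_group_def S_def ..
  define g where "g = inv_into S e"
  have ge: "g (e i) = i" if "i \<in> S" for i
    using e that by (simp add: g_def bij_betw_inv_into_left)
  have eg: "e (g k) = k" "g k \<in> S" for k
    using e bij_betw_inv_into_right[OF e] bij_betw_apply[OF bij_betw_inv_into[OF e]] by (auto simp: g_def)
  let ?F = "\<lambda>q k. e (q (g k))"
  have qin: "q i \<in> S" if "q permutes S" "i \<in> S" for q i
    using permutes_in_image[OF that(1)] that(2) by blast
  have b: "bij (?F q)" if q: "q permutes S" for q
  proof (rule o_bij)
    note qi = permutes_inv[OF q]
    show "?F (inv' q) \<circ> ?F q = id" "?F q \<circ> ?F (inv' q) = id"
      using q by (auto simp: fun_eq_iff ge qin[OF q] qin[OF qi] eg permutes_inverses)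
  qed
  have "?F \<in> iso (sym_group n) (BijGroup (UNIV :: 'a set))"
  proof (rule isoI)
    show "?F \<in> hom (sym_group n) (BijGroup (UNIV :: 'a set))"
      by (rule homI)
        (simp_all add: sym BijGroup_carrier BijGroup_mult Bij_UNIV b compose_def fun_eq_iff ge qin eg)
    show "bij_betw ?F (carrier (sym_group n)) (carrier (BijGroup (UNIV :: 'a set)))"
    proof (rule bij_betw_imageI)
      show "inj_on ?F (carrier (sym_group n))"
      proof (rule inj_onI)
        fix q q' assume q: "q \<in> carrier (sym_group n)" "q' \<in> carrier (sym_group n)" "?F q = ?F q'"
        have "q i = q' i" for i
        proof (cases "i \<in> S")
          case True
          then have "e (q i) = e (q' i)" using fun_cong[OF q(3), of "e i"] by (simp add: ge)
          then have eqq: "g (e (q i)) = g (e (q' i))" by (rule arg_cong)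
          have "q i \<in> S" "q' i \<in> S" using q(1,2) True qin by (simp_all add: sym)
          then show ?thesis using eqq by (simp only: ge)
        next
          case False
          then have "q i = i" "q' i = i" using q(1,2) by (auto simp: sym permutes_not_in)
          then show ?thesis by simp
        qed
        then show "q = q'" by auto
      qed
      show "?F ` carrier (sym_group n) = carrier (BijGroup (UNIV :: 'a set))"
      proof (intro equalityI subsetI)
        fix p :: "'a \<Rightarrow> 'a" assume "p \<in> carrier (BijGroup UNIV)"
        then have p: "bij p" by (simp add: BijGroup_carrier Bij_UNIV)
        define q where "q i = (if i \<in> S then g (p (e i)) else i)" for i
        have "bij_betw (g \<circ> p \<circ> e) S S"
          using e p bij_betw_inv_into[OF e] unfolding g_def by (intro bij_betw_trans) auto
        then have "bij_betw q S S"
          by (rule bij_betw_cong[THEN iffD1, rotated]) (simp add: q_def)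
        then have "q permutes S" by (rule bij_imp_permutes) (auto simp: q_def)
        moreover have "p = ?F q" using eg by (auto simp: q_def fun_eq_iff)
        ultimately show "p \<in> ?F ` carrier (sym_group n)" by (auto simp: sym)
      qed (use b in \<open>auto simp: sym BijGroup_carrier Bij_UNIV\<close>)
    qed
  qed
  then show ?thesis by (auto simp: is_iso_def)
qed

lemma group_Z2_pow3: "group Z2_pow3"
  by (simp add: Z2_pow3_def DirProd_group)

lemma Z2_pow3_carrier: "carrier Z2_pow3 = {0, 1} \<times> {0, 1} \<times> {0, 1}"
proof -
  have "{0..<int 2} = {0, 1}" by auto
  then show ?thesis by (simp add: Z2_pow3_def DirProd_def carrier_integer_mod_group)
qed

lemma sign_vec_mult: "sign_vec (x \<otimes>\<^bsub>Z2_pow3\<^esub> y) = (\<chi> k. sign_vec x $ k * sign_vec y $ k)"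
proof -
  obtain a b c a' b' c' where "x = (a, b, c)" "y = (a', b', c')" by (metis prod_cases3)
  then show ?thesis
    by (cases "even a"; cases "even b"; cases "even c"; cases "even a'"; cases "even b'"; cases "even c'")
      (simp_all add: Z2_pow3_def DirProd_def sign_vec_def Let_def vec4_eq_iff)
qed

lemma sign_map_hom: "sign_map \<circ> sign_vec \<in> hom Z2_pow3 copy_fixing_group"
proof (rule homI)
  fix x y
  show "(sign_map \<circ> sign_vec) (x \<otimes>\<^bsub>Z2_pow3\<^esub> y) =
      (sign_map \<circ> sign_vec) x \<otimes>\<^bsub>copy_fixing_group\<^esub> (sign_map \<circ> sign_vec) y"
    by (rule ext) (simp add: sign_vec_mult sign_map_comp[OF sign_vec_sign sign_vec_sign])
qed (simp add: sign_map_copy_fixing)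

lemma sign_map_inj:
  assumes e: "\<And>k. e $ k = 1 \<or> e $ k = -1" and e': "\<And>k. e' $ k = 1 \<or> e' $ k = -1"
    and eq: "sign_map e = sign_map e'"
  shows "e = e'"
proof -
  let ?a = "deg_iota 1 Oe1"
  have "frame ?a $ k = -1" for k
    using exhaust_4[of k] by (auto simp: frame_def deg_iota.simps deg_simps)
  moreover have "frame (sign_map e ?a) = frame (sign_map e' ?a)" using eq by simp
  ultimately show ?thesis
    unfolding frame_sign_map[OF e] frame_sign_map[OF e'] by (simp add: vec_eq_iff)
qed

lemma sign_map_sign_vec_inj: "inj_on (sign_map \<circ> sign_vec) (carrier Z2_pow3)"
proof (rule inj_onI)
  fix x y assume "x \<in> carrier Z2_pow3" "y \<in> carrier Z2_pow3"
    "(sign_map \<circ> sign_vec) x = (sign_map \<circ> sign_vec) y"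
  moreover then have "sign_vec x = sign_vec y"
    using sign_map_inj[OF sign_vec_sign sign_vec_sign] by (simp add: comp_def)
  ultimately show "x = y"
    by (cases x; cases y) (auto simp: Z2_pow3_carrier sign_vec_def Let_def vec4_eq_iff)
qed

lemma perm_map_id: "perm_map id = id"
  by (rule ext, rule frame_eqI) (simp add: frame_perm_map vec_eq_iff)

lemma perm_map_frame_root:
  assumes p: "bij p"
  shows "perm_map p (frame_root j) = frame_root (p j)"
proof (rule frame_eqI)
  have "inv' p k = j \<longleftrightarrow> k = p j" for k using p by (metis bij_inv_eq_iff)
  then show "frame (perm_map p (frame_root j)) = frame (frame_root (p j))"
    by (auto simp: frame_perm_map frame_frame_root vec_eq_iff axis_def)
qed

lemma frame_root_inj:
  assumes "frame_root j = frame_root k"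
  shows "j = k"
proof -
  have "(2 *s axis j (1::int)) $ j = (2 *s axis k (1::int)) $ j"
    using assms by (simp only: flip: frame_frame_root)
  then show ?thesis by (simp add: axis_def split: if_splits)
qed

lemma perm_map_inj: "bij p \<Longrightarrow> bij q \<Longrightarrow> perm_map p = perm_map q \<Longrightarrow> p = q"
  by (rule ext, rule frame_root_inj) (simp flip: perm_map_frame_root)

text \<open>A sign change keeps each frame vector on its own line. Hence sign changes and
  permutations of the frame meet only in the identity.\<close>

lemma sign_map_frame_root:
  assumes "\<And>k. e $ k = 1 \<or> e $ k = -1" "sign_map e (frame_root j) = frame_root k"
  shows "j = k"
proof -
  have "frame (sign_map e (frame_root j)) $ k = 2" using assms(2) by (simp add: frame_frame_root axis_def)
  then show ?thesis
    by (auto simp: frame_sign_map[OF assms(1)] frame_frame_root axis_def split: if_splits)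
qed

text \<open>The even sign changes provide the normal factor and the permutations of the frame its
  complement.\<close>

lemma copy_fixing_semidirect:
  "\<exists>\<psi>. group_action_by_auts (sym_group 4) Z2_pow3 \<psi> \<and>
    semidirect Z2_pow3 \<psi> (sym_group 4) \<cong> copy_fixing_group"
proof -
  have "bij_betw of_nat {1..4} (UNIV :: 4 set)"
  proof -
    have "{1..4::nat} = {1, 2, 3, 4}" by auto
    then have im: "of_nat ` {1..4} = (UNIV :: 4 set)" by (simp add: UNIV_4)
    then have "inj_on (of_nat :: nat \<Rightarrow> 4) {1..4}" by (intro eq_card_imp_inj_on) simp_all
    then show ?thesis using im by (rule bij_betw_imageI)
  qed
  then obtain F where "F \<in> iso (sym_group 4) (BijGroup (UNIV :: 4 set))"
    using sym_group_iso_BijGroup by (force simp: is_iso_def)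
  then have F: "F \<in> hom (sym_group 4) (BijGroup (UNIV :: 4 set))"
    and Fb: "bij_betw F (carrier (sym_group 4)) (carrier (BijGroup (UNIV :: 4 set)))"
    by (auto simp: iso_def)
  have bF: "bij (F q)" if "q \<in> carrier (sym_group 4)" for q
    using hom_in_carrier[OF F that] by (simp add: BijGroup_carrier Bij_UNIV)
  let ?n = "sign_map \<circ> sign_vec" and ?h = "\<lambda>q. perm_map (F q)"
  have h: "?h \<in> hom (sym_group 4) copy_fixing_group"
  proof (rule homI)
    fix q q' assume q: "q \<in> carrier (sym_group 4)" "q' \<in> carrier (sym_group 4)"
    have "F (q \<otimes>\<^bsub>sym_group 4\<^esub> q') = F q \<circ> F q'"
      using hom_mult[OF F q] bF[OF q(1)] bF[OF q(2)]
      by (simp add: BijGroup_mult Bij_UNIV compose_def fun_eq_iff)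
    then show "?h (q \<otimes>\<^bsub>sym_group 4\<^esub> q') = ?h q \<otimes>\<^bsub>copy_fixing_group\<^esub> ?h q'"
      by (simp add: perm_map_comp bF q)
  qed (simp add: perm_map_copy_fixing bF)
  have inv: "inv\<^bsub>copy_fixing_group\<^esub> f = inv' f" if "f \<in> copy_fixing" for f
    using group.m_inv_consistent[OF group_isom_group subgroup_copy_fixing that] that inv_isom_group[of f]
    by (simp add: copy_fixing_def)
  show ?thesis
  proof (rule semidirect_of_homs[OF group_Z2_pow3 sym_group_is_group group_copy_fixing sign_map_hom
        sign_map_sign_vec_inj h])
    show "inj_on ?h (carrier (sym_group 4))"
      using perm_map_inj bF bij_betw_imp_inj_on[OF Fb] by (simp add: inj_on_def)
  next
    fix q x assume q: "q \<in> carrier (sym_group 4)" and x: "x \<in> carrier Z2_pow3"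
    let ?f = "perm_map (F q) \<circ> sign_map (sign_vec x) \<circ> inv' (perm_map (F q))"
    note fx = perm_map_copy_fixing[OF bF[OF q]] sign_map_copy_fixing[of x]
    have "perm_map (F q) \<circ> sign_map (sign_vec x) \<in> copy_fixing"
      using subgroup.m_closed[OF subgroup_copy_fixing fx] by simp
    moreover have "inv' (perm_map (F q)) \<in> copy_fixing"
      using subgroup.m_inv_closed[OF subgroup_copy_fixing fx(1)]
        inv_isom_group[OF perm_map_isometry[OF bF[OF q]]] by simp
    ultimately have "?f \<in> copy_fixing"
      using subgroup.m_closed[OF subgroup_copy_fixing] by fastforce
    then obtain a b c p where t: "a \<in> {0, 1}" "b \<in> {0, 1}" "c \<in> {0, 1}"
      and p: "bij p" and fe: "?f = sign_map (sign_vec (a, b, c)) \<circ> perm_map p"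
      using copy_fixing_decompose by metis
    \<comment> \<open>The conjugate of a sign change is again a signed permutation of the frame.
      Since it sends each frame vector to itself up to sign, its permutation part is
      trivial.\<close>
    have "p j = j" for j
    proof -
      define i where "i = inv' (F q) j"
      have i: "F q i = j" using bF[OF q] by (simp add: i_def bij_is_surj surj_f_inv_f)
      have "perm_map (F q) (frame_root i) = frame_root j" using perm_map_frame_root[OF bF[OF q]] i by simp
      then have ie: "inv' (perm_map (F q)) (frame_root j) = frame_root i"
        by (metis bij_inv_eq_iff[OF isometry_bij[OF perm_map_isometry[OF bF[OF q]]]])
      then have fj: "?f (frame_root j) = perm_map (F q) (sign_map (sign_vec x) (frame_root i))"
        by (simp only: comp_apply)
      have sf: "frame (sign_map (sign_vec x) (frame_root i)) = (2 * sign_vec x $ i) *s axis i 1"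
        by (auto simp: frame_sign_map[OF sign_vec_sign] frame_frame_root vec_eq_iff axis_def)
      have ki: "inv' (F q) k = i \<longleftrightarrow> k = j" for k using bF[OF q] i by (metis bij_inv_eq_iff)
      have "frame (?f (frame_root j)) = (2 * sign_vec x $ i) *s axis j 1"
        unfolding fj frame_perm_map sf by (simp add: vec_eq_iff axis_def ki)
      moreover have "frame (?f (frame_root j)) = (2 * sign_vec (a, b, c) $ p j) *s axis (p j) 1"
        unfolding fe by (auto simp: perm_map_frame_root[OF p] frame_sign_map[OF sign_vec_sign]
            frame_frame_root vec_eq_iff axis_def)
      ultimately have "((2 * sign_vec x $ i) *s axis j 1) $ j = ((2 * sign_vec (a, b, c) $ p j) *s axis (p j) 1) $ j"
        by simp
      then show "p j = j"
        using sign_vec_sign[of x i] by (auto simp: axis_def split: if_splits)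
    qed
    then have "p = id" by (simp add: fun_eq_iff)
    then have "perm_map p = id" by (simp only: perm_map_id)
    then have "?f = sign_map (sign_vec (a, b, c))" using fe by simp
    then show "?h q \<otimes>\<^bsub>copy_fixing_group\<^esub> ?n x \<otimes>\<^bsub>copy_fixing_group\<^esub> inv\<^bsub>copy_fixing_group\<^esub> (?h q)
        \<in> ?n ` carrier Z2_pow3"
      using t by (auto simp: inv fx Z2_pow3_carrier intro!: image_eqI[of _ _ "(a, b, c)"])
  next
    fix q x assume q: "q \<in> carrier (sym_group 4)" and e: "?n x = ?h q"
    have "F q j = j" for j
      using sign_map_frame_root[OF sign_vec_sign, of x j "F q j"] fun_cong[OF e, of "frame_root j"]
      by (simp add: perm_map_frame_root[OF bF[OF q]])
    then have "F q = \<one>\<^bsub>BijGroup UNIV\<^esub>" by (auto simp: BijGroup_one fun_eq_iff)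
    then have "F q = F \<one>\<^bsub>sym_group 4\<^esub>"
      using hom_one[OF F sym_group_is_group group_BijGroup] by simp
    then show "q = \<one>\<^bsub>sym_group 4\<^esub>"
      using bij_betw_imp_inj_on[OF Fb] q group.is_monoid[OF sym_group_is_group] monoid.one_closed
      by (metis inj_onD)
  next
    fix f assume "f \<in> carrier copy_fixing_group"
    then obtain a b c p where t: "a \<in> {0, 1}" "b \<in> {0, 1}" "c \<in> {0, 1}" "bij p"
      and fe: "f = sign_map (sign_vec (a, b, c)) \<circ> perm_map p"
      using copy_fixing_decompose[of f] by auto
    moreover obtain q where "q \<in> carrier (sym_group 4)" "p = F q"
      using bij_betw_imp_surj_on[OF Fb] t(4) by (force simp: BijGroup_carrier Bij_UNIV)
    ultimately show "\<exists>y\<in>carrier Z2_pow3. \<exists>x\<in>carrier (sym_group 4). f = ?n y \<otimes>\<^bsub>copy_fixing_group\<^esub> ?h x"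
      by (intro bexI[of _ "(a, b, c)"] bexI[of _ q]) (auto simp: Z2_pow3_carrier)
  qed
qed

lemma f4_s_apply:
  "f4_s1 *v v = vector [- v $ 2 + v $ 3 - v $ 4, v $ 1 - v $ 2 + v $ 3, v $ 3, v $ 4]"
  "f4_s2 *v v = vector [- v $ 1 + v $ 2 - v $ 4, v $ 2, v $ 3, v $ 4]"
  "f4_s3 *v v = vector [v $ 3 - v $ 4, v $ 2, v $ 1 + v $ 4, v $ 4]"
  "f4_s4 *v v = vector [v $ 1 - v $ 3 + v $ 4, v $ 2 - v $ 3, - v $ 4, v $ 3 - v $ 4]"
  by (simp_all add: f4_s1_def f4_s2_def f4_s3_def f4_s4_def matrix_vector_mult_def vec4_eq_iff sum_4)

text \<open>s1 and s4 have order three, s2 and s3 order two, which provides the inverses given to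
  \<open>isometryI\<close>. Geometrically s2 is the reflection in the short root a1 and s3 the one
  in the long root a1 - g1.\<close>

lemma f4_s_isometry: "(*v) f4_s1 \<in> isometries" "(*v) f4_s2 \<in> isometries"
  "(*v) f4_s3 \<in> isometries" "(*v) f4_s4 \<in> isometries"
proof -
  show "(*v) f4_s1 \<in> isometries"
    by (rule isometryI[of _ "\<lambda>v. f4_s1 *v (f4_s1 *v v)"])
      (simp_all add: f4_s_apply vec4_eq_iff root_norm_def power2_eq_square algebra_simps)
  show "(*v) f4_s2 \<in> isometries"
    by (rule isometryI[of _ "\<lambda>v. f4_s2 *v v"])
      (simp_all add: f4_s_apply vec4_eq_iff root_norm_def power2_eq_square algebra_simps)
  show "(*v) f4_s3 \<in> isometries"
    by (rule isometryI[of _ "\<lambda>v. f4_s3 *v v"])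
      (simp_all add: f4_s_apply vec4_eq_iff root_norm_def power2_eq_square algebra_simps)
  show "(*v) f4_s4 \<in> isometries"
    by (rule isometryI[of _ "\<lambda>v. f4_s4 *v (f4_s4 *v v)"])
      (simp_all add: f4_s_apply vec4_eq_iff root_norm_def power2_eq_square algebra_simps)
qed

text \<open>
  The isometries that permute the three degrees of each u_j form a complement of the subgroup
  fixing the three copies.
\<close>

definition u_stabilizer :: "(int ^ 4 \<Rightarrow> int ^ 4) set" where
  "u_stabilizer = {f \<in> isometries. \<forall>i j. f (deg_u i j) = deg_u (copy_perm f i) j}"

lemma u_stabilizer_comp: "f \<in> u_stabilizer \<Longrightarrow> g \<in> u_stabilizer \<Longrightarrow> f \<circ> g \<in> u_stabilizer"
  by (simp add: u_stabilizer_def isometry_comp copy_perm_comp)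

lemma u_stabilizer_id: "id \<in> u_stabilizer"
  by (simp add: u_stabilizer_def isometry_id copy_perm_id)

text \<open>The degrees of the u_j generate the lattice: the canonical basis consists of such
  degrees and differences of them. An element of the complement is therefore known from its
  permutation of the copies.\<close>

lemma u_stabilizer_eqI:
  assumes f: "f \<in> u_stabilizer" and g: "g \<in> u_stabilizer" and eq: "copy_perm f = copy_perm g"
  shows "f = g"
proof
  fix v
  have fi: "f \<in> isometries" "g \<in> isometries" using f g by (auto simp: u_stabilizer_def)
  have u: "f (deg_u i j) = g (deg_u i j)" for i j using f g eq by (simp add: u_stabilizer_def)
  have a: "axis 1 1 = deg_u 2 2 - deg_u 0 2" "axis 2 1 = deg_u 0 1 - deg_u 1 1"
    "axis 3 1 = deg_u 1 1" "axis 4 1 = deg_u 2 2"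
    by (simp_all add: deg_simps vec4_eq_iff axis_def)
  have "f (axis k 1) = g (axis k 1)" for k
    using exhaust_4[of k] by (elim disjE) (simp_all add: a isometry_diff[OF fi(1)] isometry_diff[OF fi(2)] u)
  then show "f v = g v"
    by (subst (1 2) additive_expand) (simp_all add: isometry_add[OF fi(1)] isometry_add[OF fi(2)])
qed

lemma copy_perm_s1: "copy_perm ((*v) f4_s1) = (\<lambda>i. i + 1)" and s1_u: "(*v) f4_s1 \<in> u_stabilizer"
proof -
  have "\<forall>i. copy_perm ((*v) f4_s1) i = i + 1"
    unfolding all_3 by (simp add: copy_perm_def f4_s_apply deg_iota.simps deg_simps copy_of_def)
  then show c: "copy_perm ((*v) f4_s1) = (\<lambda>i. i + 1)" by (simp add: fun_eq_iff)
  have "\<forall>i j. f4_s1 *v deg_u i j = deg_u (i + 1) j"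
    unfolding all_3 by (simp add: f4_s_apply deg_simps vec4_eq_iff)
  then show "(*v) f4_s1 \<in> u_stabilizer" using f4_s_isometry c by (simp add: u_stabilizer_def)
qed

lemma copy_perm_s2: "copy_perm ((*v) f4_s2) = (\<lambda>i. 2 - i)" and s2_u: "(*v) f4_s2 \<in> u_stabilizer"
proof -
  have "\<forall>i. copy_perm ((*v) f4_s2) i = 2 - i"
    unfolding all_3 by (simp add: copy_perm_def f4_s_apply deg_iota.simps deg_simps copy_of_def)
  then show c: "copy_perm ((*v) f4_s2) = (\<lambda>i. 2 - i)" by (simp add: fun_eq_iff)
  have "\<forall>i j. f4_s2 *v deg_u i j = deg_u (2 - i) j"
    unfolding all_3 by (simp add: f4_s_apply deg_simps vec4_eq_iff)
  then show "(*v) f4_s2 \<in> u_stabilizer" using f4_s_isometry c by (simp add: u_stabilizer_def)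
qed

text \<open>Words with positive exponents: as the generators have finite order, these already form
  the generated group, and an induction over words only has to treat compositions.\<close>

inductive_set s_words :: "(int ^ 4 \<Rightarrow> int ^ 4) set" where
  s_words_id: "id \<in> s_words"
| s_words_1: "(*v) f4_s1 \<in> s_words"
| s_words_2: "(*v) f4_s2 \<in> s_words"
| s_words_3: "(*v) f4_s3 \<in> s_words"
| s_words_4: "(*v) f4_s4 \<in> s_words"
| s_words_comp: "f \<in> s_words \<Longrightarrow> g \<in> s_words \<Longrightarrow> f \<circ> g \<in> s_words"

lemma u_stabilizer_surj:
  assumes q: "bij (q :: 3 \<Rightarrow> 3)"
  shows "\<exists>f \<in> u_stabilizer \<inter> s_words. copy_perm f = q"
proof -
  let ?r = "(*v) f4_s1" and ?t = "(*v) f4_s2"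
  have ui: "f \<in> u_stabilizer \<Longrightarrow> f \<in> isometries" for f by (simp add: u_stabilizer_def)
  have rot: "\<exists>f \<in> u_stabilizer \<inter> s_words. copy_perm f = (\<lambda>i. i + k)" for k
  proof (cases k rule: cases_3)
    case 0
    then show ?thesis
      using u_stabilizer_id copy_perm_id s_words_id by (intro bexI[of _ id]) (auto simp: fun_eq_iff)
  next
    case 1
    then show ?thesis using copy_perm_s1 s1_u s_words_1 by (intro bexI[of _ ?r]) auto
  next
    case 2
    have "copy_perm (?r \<circ> ?r) = (\<lambda>i. i + 2)"
      using copy_perm_comp[OF ui[OF s1_u] ui[OF s1_u]] by (simp add: copy_perm_s1 fun_eq_iff)
    then show ?thesis
      using 2 u_stabilizer_comp[OF s1_u s1_u] s_words_comp[OF s_words_1 s_words_1] by blast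
  qed
  have "q 0 \<noteq> q 1" "q 0 \<noteq> q 2" "q 1 \<noteq> q 2"
    using q by (auto simp: bij_def inj_eq)
  \<comment> \<open>Every permutation of the integers modulo 3 has the form i + k or -i + k.\<close>
  then have "(\<forall>i. q i = i + q 0) \<or> (\<forall>i. q i = - i + q 0)"
    unfolding all_3
    by (cases "q 0" rule: cases_3; cases "q 1" rule: cases_3; cases "q 2" rule: cases_3) simp_all
  moreover obtain f where f: "f \<in> u_stabilizer" "f \<in> s_words" "copy_perm f = (\<lambda>i. i + q 0)"
    using rot[of "q 0"] by blast
  \<comment> \<open>s2 sends copy i to copy 2 - i, so a translation by q 0 - 2 has to follow
    it.\<close>
  moreover obtain f' where f': "f' \<in> u_stabilizer" "f' \<in> s_words" "copy_perm f' = (\<lambda>i. i + (q 0 - 2))"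
    using rot[of "q 0 - 2"] by blast
  moreover have "copy_perm (f' \<circ> ?t) = (\<lambda>i. - i + q 0)"
    using copy_perm_comp[OF ui[OF f'(1)] ui[OF s2_u]] f'(3) copy_perm_s2 by (simp add: fun_eq_iff)
  ultimately show ?thesis
    using u_stabilizer_comp[OF f'(1) s2_u] s_words_comp[OF f'(2) s_words_2] by (metis IntI ext)
qed

lemma isometry_decompose:
  assumes f: "f \<in> isometries"
  shows "\<exists>g \<in> copy_fixing. \<exists>h \<in> u_stabilizer \<inter> s_words. copy_perm h = copy_perm f \<and> f = g \<circ> h"
proof -
  obtain h where h: "h \<in> u_stabilizer \<inter> s_words" "copy_perm h = copy_perm f"
    using u_stabilizer_surj[OF copy_perm_bij[OF f]] by blast
  then have hi: "h \<in> isometries" by (simp add: u_stabilizer_def)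
  have "copy_perm (f \<circ> inv' h) = copy_perm h \<circ> copy_perm (inv' h)"
    using f isometry_inv[OF hi] h by (simp add: copy_perm_comp)
  also have "\<dots> = copy_perm (h \<circ> inv' h)"
    using hi isometry_inv[OF hi] by (simp add: copy_perm_comp)
  finally have "f \<circ> inv' h \<in> copy_fixing"
    using f isometry_inv[OF hi] by (simp add: copy_fixing_def isometry_comp inv_comp_isometry[OF hi] copy_perm_id)
  moreover have "f = (f \<circ> inv' h) \<circ> h" by (simp add: comp_assoc inv_comp_isometry[OF hi])
  ultimately show ?thesis using h by blast
qed

text \<open>Explicit words, verified on the frame coordinates of an arbitrary vector. Together with
  \<open>sign_words\<close> they reach all permutations and even sign changes of the frame, hence
  all of \<open>copy_fixing\<close>.\<close>

lemma transposition_words: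
  "perm_map (Transposition.transpose 1 2) = (*v) f4_s4 \<circ> ((*v) f4_s4 \<circ> ((*v) f4_s1 \<circ> ((*v) f4_s1 \<circ> ((*v) f4_s3 \<circ> ((*v) f4_s4 \<circ> (*v) f4_s1)))))"
  "perm_map (Transposition.transpose 1 3) = (*v) f4_s1 \<circ> ((*v) f4_s1 \<circ> ((*v) f4_s3 \<circ> (*v) f4_s1))"
  "perm_map (Transposition.transpose 1 4) = (*v) f4_s4 \<circ> ((*v) f4_s1 \<circ> ((*v) f4_s1 \<circ> ((*v) f4_s3 \<circ> ((*v) f4_s4 \<circ> ((*v) f4_s4 \<circ> (*v) f4_s1)))))"
  "perm_map (Transposition.transpose 2 3) = (*v) f4_s3 \<circ> ((*v) f4_s4 \<circ> ((*v) f4_s4 \<circ> ((*v) f4_s3 \<circ> ((*v) f4_s4 \<circ> (*v) f4_s3))))"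
  "perm_map (Transposition.transpose 2 4) = (*v) f4_s4 \<circ> ((*v) f4_s3 \<circ> ((*v) f4_s4 \<circ> ((*v) f4_s4 \<circ> ((*v) f4_s3 \<circ> ((*v) f4_s4 \<circ> (*v) f4_s3)))))"
  "perm_map (Transposition.transpose 3 4) = (*v) f4_s3 \<circ> ((*v) f4_s4 \<circ> ((*v) f4_s3 \<circ> ((*v) f4_s4 \<circ> ((*v) f4_s4 \<circ> (*v) f4_s3))))"
  by (rule ext, rule frame_eqI, subst frame_perm_map, simp add: vec4_eq_iff f4_s_apply frame_def Transposition.transpose_def)+

lemma sign_words:
  "sign_map (sign_vec (1, 0, 0)) = (*v) f4_s4 \<circ> ((*v) f4_s3 \<circ> ((*v) f4_s1 \<circ> ((*v) f4_s1 \<circ> ((*v) f4_s3 \<circ> ((*v) f4_s4 \<circ> ((*v) f4_s4 \<circ> (*v) f4_s1))))))"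
  "sign_map (sign_vec (0, 1, 0)) = (*v) f4_s4 \<circ> ((*v) f4_s2 \<circ> ((*v) f4_s3 \<circ> ((*v) f4_s4 \<circ> ((*v) f4_s4 \<circ> ((*v) f4_s3 \<circ> ((*v) f4_s4 \<circ> (*v) f4_s2))))))"
  "sign_map (sign_vec (0, 0, 1)) = (*v) f4_s4 \<circ> ((*v) f4_s2 \<circ> ((*v) f4_s3 \<circ> ((*v) f4_s4 \<circ> ((*v) f4_s3 \<circ> (*v) f4_s2))))"
  by (rule ext, rule frame_eqI, subst frame_sign_map[OF sign_vec_sign], simp add: vec4_eq_iff f4_s_apply frame_def sign_vec_def)+

lemma perm_map_words:
  assumes "bij p"
  shows "perm_map p \<in> s_words"
proof -
  note c = s_words_comp s_words_1 s_words_2 s_words_3 s_words_4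
  have t: "perm_map (Transposition.transpose a b) \<in> s_words" if "a \<noteq> b" for a b
    using that exhaust_4[of a] exhaust_4[of b]
    by (elim disjE) (simp_all add: transposition_words c Transposition.transpose_commute[of 2 1] Transposition.transpose_commute[of 3 1]
        Transposition.transpose_commute[of 4 1] Transposition.transpose_commute[of 3 2] Transposition.transpose_commute[of 4 2] Transposition.transpose_commute[of 4 3])
  have "p permutes UNIV" by (rule bij_imp_permutes) (use assms in auto)
  then show ?thesis using finite_class.finite_UNIV
  proof (induction rule: permutes_induct)
    case id
    show ?case using s_words_id by (simp only: perm_map_id)
  next
    case (swap a b p)
    then show ?case using t s_words_comp by (subst perm_map_comp) (auto simp: permutes_bij)
  qed
qed

lemma sign_map_words:
  assumes "a \<in> {0, 1}" "b \<in> {0, 1}" "c \<in> {0, 1}"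
  shows "sign_map (sign_vec (a, b, c)) \<in> s_words"
proof -
  note c = s_words_comp s_words_1 s_words_2 s_words_3 s_words_4
  have g: "sign_map (sign_vec (1, 0, 0)) \<in> s_words" "sign_map (sign_vec (0, 1, 0)) \<in> s_words"
    "sign_map (sign_vec (0, 0, 1)) \<in> s_words"
    unfolding sign_words by (intro c)+
  have one: "sign_map (sign_vec (0, 0, 0)) = id"
    by (rule ext, rule frame_eqI, subst frame_sign_map[OF sign_vec_sign])
      (simp add: vec4_eq_iff sign_vec_def)
  have m: "sign_map (sign_vec (x \<otimes>\<^bsub>Z2_pow3\<^esub> y)) = sign_map (sign_vec x) \<circ> sign_map (sign_vec y)" for x y
    by (rule ext) (simp add: sign_vec_mult sign_map_comp[OF sign_vec_sign sign_vec_sign])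
  have t: "sign_map (sign_vec (a, 0, 0)) \<in> s_words" "sign_map (sign_vec (0, b, 0)) \<in> s_words"
    "sign_map (sign_vec (0, 0, c)) \<in> s_words"
    using assms g s_words_id one by auto
  have "(a, b, c) = (a, 0, 0) \<otimes>\<^bsub>Z2_pow3\<^esub> ((0, b, 0) \<otimes>\<^bsub>Z2_pow3\<^esub> (0, 0, c))"
    using assms by (auto simp: Z2_pow3_def DirProd_def)
  then show ?thesis using t by (simp only: m s_words_comp)
qed

text \<open>Of the two factors of an isometry, the one in \<open>copy_fixing\<close> is a word by
  the explicit lists, and the one permuting the copies is a word by
  \<open>u_stabilizer_surj\<close>.\<close>

theorem isometries_eq_words: "isometries = s_words"
proof (intro equalityI subsetI)
  fix f assume "f \<in> isometries"
  then obtain g h where g: "g \<in> copy_fixing" and h: "h \<in> s_words" and f: "f = g \<circ> h"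
    using isometry_decompose by blast
  obtain a b c p where "a \<in> {0, 1}" "b \<in> {0, 1}" "c \<in> {0, 1}" "bij p"
    "g = sign_map (sign_vec (a, b, c)) \<circ> perm_map p"
    using copy_fixing_decompose[OF g] by blast
  then have "g \<in> s_words" using sign_map_words perm_map_words s_words_comp by blast
  then show "f \<in> s_words" unfolding f using h by (rule s_words_comp)
next
  fix f assume "f \<in> s_words"
  then show "f \<in> isometries"
    by induction (simp_all only: isometry_id f4_s_isometry isometry_comp)
qed

text \<open>The normal factor is \<open>copy_fixing\<close>; its complement
  \<open>u_stabilizer\<close> is mapped bijectively by \<open>copy_perm\<close> to the permutations
  of the three copies.\<close>

lemma isom_group_semidirect:
  "\<exists>\<psi> \<theta>. group_action_by_auts (sym_group 4) Z2_pow3 \<psi> \<and>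
     group_action_by_auts (sym_group 3) (semidirect Z2_pow3 \<psi> (sym_group 4)) \<theta> \<and>
     semidirect (semidirect Z2_pow3 \<psi> (sym_group 4)) \<theta> (sym_group 3) \<cong> isom_group"
proof -
  obtain \<psi> where act: "group_action_by_auts (sym_group 4) Z2_pow3 \<psi>"
    and iso: "semidirect Z2_pow3 \<psi> (sym_group 4) \<cong> copy_fixing_group"
    using copy_fixing_semidirect by blast
  let ?N = "semidirect Z2_pow3 \<psi> (sym_group 4)"
  obtain n where "n \<in> iso ?N copy_fixing_group" using iso by (auto simp: is_iso_def)
  then have nh: "n \<in> hom ?N copy_fixing_group" and nb: "bij_betw n (carrier ?N) copy_fixing"
    by (auto simp: iso_def)
  have n: "n \<in> hom ?N isom_group"
    using nh by (auto simp: hom_def copy_fixing_def)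
  have "bij_betw of_nat {1..3} (UNIV :: 3 set)"
  proof -
    have "{1..3::nat} = {1, 2, 3}" by auto
    then have im: "of_nat ` {1..3} = (UNIV :: 3 set)" by (simp add: UNIV_3)
    then have "inj_on (of_nat :: nat \<Rightarrow> 3) {1..3}" by (intro eq_card_imp_inj_on) simp_all
    then show ?thesis using im by (rule bij_betw_imageI)
  qed
  then obtain F where "F \<in> iso (sym_group 3) (BijGroup (UNIV :: 3 set))"
    using sym_group_iso_BijGroup by (force simp: is_iso_def)
  then have F: "F \<in> hom (sym_group 3) (BijGroup (UNIV :: 3 set))"
    and Fb: "bij_betw F (carrier (sym_group 3)) (carrier (BijGroup (UNIV :: 3 set)))"
    by (auto simp: iso_def)
  have bF: "bij (F q)" if "q \<in> carrier (sym_group 3)" for q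
    using hom_in_carrier[OF F that] by (simp add: BijGroup_carrier Bij_UNIV)
  \<comment> \<open>By \<open>u_stabilizer_eqI\<close> there is only one lift to choose from, and
    for this reason the choice is multiplicative.\<close>
  define h where "h q = (SOME f. f \<in> u_stabilizer \<and> copy_perm f = F q)" for q
  have "h q \<in> u_stabilizer \<and> copy_perm (h q) = F q" if "q \<in> carrier (sym_group 3)" for q
  proof -
    have "\<exists>f. f \<in> u_stabilizer \<and> copy_perm f = F q" using u_stabilizer_surj[OF bF[OF that]] by blast
    then show ?thesis unfolding h_def by (rule someI_ex)
  qed
  then have hu: "h q \<in> u_stabilizer" and hF: "copy_perm (h q) = F q" if "q \<in> carrier (sym_group 3)" for q
    using that by auto
  have hi: "h q \<in> isometries" if "q \<in> carrier (sym_group 3)" for q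
    using hu[OF that] by (simp add: u_stabilizer_def)
  have hh: "h \<in> hom (sym_group 3) isom_group"
  proof (rule homI)
    fix q q' assume q: "q \<in> carrier (sym_group 3)" "q' \<in> carrier (sym_group 3)"
    have m: "q \<otimes>\<^bsub>sym_group 3\<^esub> q' \<in> carrier (sym_group 3)"
      using q group.is_monoid[OF sym_group_is_group] by (simp add: monoid.m_closed)
    have "F (q \<otimes>\<^bsub>sym_group 3\<^esub> q') = F q \<circ> F q'"
      using hom_mult[OF F q] bF[OF q(1)] bF[OF q(2)]
      by (simp add: BijGroup_mult Bij_UNIV compose_def fun_eq_iff)
    then have "h (q \<otimes>\<^bsub>sym_group 3\<^esub> q') = h q \<circ> h q'"
      by (intro u_stabilizer_eqI) (simp_all add: hu m q u_stabilizer_comp hF copy_perm_comp hi)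
    then show "h (q \<otimes>\<^bsub>sym_group 3\<^esub> q') = h q \<otimes>\<^bsub>isom_group\<^esub> h q'" by simp
  qed (simp add: hi)
  have "\<exists>\<theta>. group_action_by_auts (sym_group 3) ?N \<theta> \<and> semidirect ?N \<theta> (sym_group 3) \<cong> isom_group"
  proof (rule semidirect_of_homs[OF group_semidirect[OF act group_Z2_pow3 sym_group_is_group]
        sym_group_is_group group_isom_group n bij_betw_imp_inj_on[OF nb] hh])
    show "inj_on h (carrier (sym_group 3))"
    proof (rule inj_onI)
      fix x y assume xy: "x \<in> carrier (sym_group 3)" "y \<in> carrier (sym_group 3)" "h x = h y"
      then have "F x = F y" using hF by metis
      then show "x = y" using bij_betw_imp_inj_on[OF Fb] xy by (auto dest: inj_onD)
    qed
  next
    fix q y assume q: "q \<in> carrier (sym_group 3)" and y: "y \<in> carrier ?N"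
    have ny: "n y \<in> copy_fixing" using nb y by (rule bij_betw_apply)
    then have nyi: "n y \<in> isometries" "copy_perm (n y) = id" by (auto simp: copy_fixing_def)
    let ?g = "h q \<circ> n y \<circ> inv' (h q)"
    have "copy_perm ?g = copy_perm (h q \<circ> inv' (h q))"
      using hi[OF q] isometry_inv[OF hi[OF q]] nyi by (simp add: copy_perm_comp isometry_comp)
    then have "?g \<in> copy_fixing"
      using hi[OF q] isometry_inv[OF hi[OF q]] nyi inv_comp_isometry[OF hi[OF q]]
      by (simp add: copy_fixing_def isometry_comp copy_perm_id)
    then show "h q \<otimes>\<^bsub>isom_group\<^esub> n y \<otimes>\<^bsub>isom_group\<^esub> inv\<^bsub>isom_group\<^esub> (h q) \<in> n ` carrier ?N"
      using bij_betw_imp_surj_on[OF nb] by (simp add: inv_isom_group[OF hi[OF q]])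
  next
    fix q y assume q: "q \<in> carrier (sym_group 3)" and y: "y \<in> carrier ?N" and e: "n y = h q"
    have "copy_perm (n y) = id" using bij_betw_apply[OF nb y] by (simp add: copy_fixing_def)
    then have "F q = id" using hF[OF q] e by simp
    then have "F q = F \<one>\<^bsub>sym_group 3\<^esub>"
      using hom_one[OF F sym_group_is_group group_BijGroup] by (simp add: BijGroup_one fun_eq_iff)
    then show "q = \<one>\<^bsub>sym_group 3\<^esub>"
      using bij_betw_imp_inj_on[OF Fb] q group.is_monoid[OF sym_group_is_group] monoid.one_closed
      by (metis inj_onD)
  next
    fix f assume "f \<in> carrier isom_group"
    then have f: "f \<in> isometries" by simp
    obtain g k where g: "g \<in> copy_fixing" and k: "k \<in> u_stabilizer" "copy_perm k = copy_perm f" "f = g \<circ> k"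
      using isometry_decompose[OF f] by blast
    obtain q where q: "q \<in> carrier (sym_group 3)" "F q = copy_perm f"
      using bij_betw_imp_surj_on[OF Fb] copy_perm_bij[OF f] by (force simp: BijGroup_carrier Bij_UNIV)
    have "h q = k" using hu[OF q(1)] hF[OF q(1)] k q by (intro u_stabilizer_eqI) simp_all
    moreover have "g \<in> n ` carrier ?N" using g unfolding bij_betw_imp_surj_on[OF nb] .
    then obtain y where "y \<in> carrier ?N" "n y = g" by (elim imageE) simp
    ultimately have "y \<in> carrier ?N \<and> f = n y \<otimes>\<^bsub>isom_group\<^esub> h q" using k(3) by (simp only: isom_group_simps simp_thms)
    then show "\<exists>y\<in>carrier ?N. \<exists>x\<in>carrier (sym_group 3). f = n y \<otimes>\<^bsub>isom_group\<^esub> h x"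
      using q(1) by blast
  qed
  then show ?thesis using act by blast
qed

subsection \<open>Matrices of isometries\<close>

lemma GL4Z_simps: "A \<otimes>\<^bsub>GL4Z\<^esub> B = A ** B" "\<one>\<^bsub>GL4Z\<^esub> = mat 1"
  by (simp_all add: GL4Z_def)

lemma group_GL4Z: "group GL4Z"
proof (rule groupI)
  fix A assume "A \<in> carrier GL4Z"
  then obtain B where "A ** B = mat 1" "B ** A = mat 1" by (auto simp: GL4Z_def invertible_def)
  then show "\<exists>B \<in> carrier GL4Z. B \<otimes>\<^bsub>GL4Z\<^esub> A = \<one>\<^bsub>GL4Z\<^esub>"
    by (intro bexI[of _ B]) (auto simp: GL4Z_def invertible_def)
next
  fix A A' assume "A \<in> carrier GL4Z" "A' \<in> carrier GL4Z"
  then obtain B B' where "A ** B = mat 1" "B ** A = mat 1" "A' ** B' = mat 1" "B' ** A' = mat 1"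
    by (auto simp: GL4Z_def invertible_def)
  then have "A ** (A' ** B') ** B = mat 1" "B' ** (B ** A) ** A' = mat 1"
    by (simp_all add: matrix_mul_lid matrix_mul_rid)
  then have "A ** A' ** (B' ** B) = mat 1" "B' ** B ** (A ** A') = mat 1"
    by (simp_all only: matrix_mul_assoc)
  then show "A \<otimes>\<^bsub>GL4Z\<^esub> A' \<in> carrier GL4Z" by (auto simp: GL4Z_def invertible_def)
next
  show "\<one>\<^bsub>GL4Z\<^esub> \<in> carrier GL4Z"
    by (auto simp: GL4Z_def invertible_def matrix_mul_lid intro!: exI[of _ "mat 1"])
qed (auto simp: GL4Z_def matrix_mul_assoc matrix_mul_lid)

lemma matrix_isometry: "f \<in> isometries \<Longrightarrow> matrix f *v v = f v"
  by (rule additive_matrix) (rule isometry_add)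

lemma matrix_eqI: "(\<And>v. A *v v = B *v v) \<Longrightarrow> A = B" for A B :: "int ^ 4 ^ 4"
  by (simp add: matrix_eq)

lemma matrix_comp:
  "f \<in> isometries \<Longrightarrow> g \<in> isometries \<Longrightarrow> matrix (f \<circ> g) = matrix f ** matrix g"
  by (rule matrix_eqI) (simp add: matrix_isometry isometry_comp flip: matrix_vector_mul_assoc)

lemma matrix_id: "matrix (id :: int ^ 4 \<Rightarrow> int ^ 4) = mat 1"
  by (rule matrix_eqI) (simp add: matrix_isometry isometry_id)

lemma matrix_matrix: "(*v) A \<in> isometries \<Longrightarrow> matrix ((*v) A) = A" for A :: "int ^ 4 ^ 4"
  by (rule matrix_eqI) (simp add: matrix_isometry)

lemma subgroup_matrix_isometries: "subgroup (matrix ` isometries) GL4Z"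
proof (rule group.subgroupI[OF group_GL4Z])
  have m: "matrix f ** matrix (inv' f) = mat 1" "matrix (inv' f) ** matrix f = mat 1"
    if "f \<in> isometries" for f
    using that isometry_inv[OF that] inv_comp_isometry[OF that]
    by (simp_all add: matrix_id flip: matrix_comp)
  then show sub: "matrix ` isometries \<subseteq> carrier GL4Z" by (force simp: GL4Z_def invertible_def)
  show "matrix ` isometries \<noteq> {}" using isometry_id by blast
  fix A assume "A \<in> matrix ` isometries"
  then obtain f where f: "f \<in> isometries" "A = matrix f" by blast
  have "inv\<^bsub>GL4Z\<^esub> A = matrix (inv' f)"
    using m[OF f(1)] f sub isometry_inv[OF f(1)]
    by (intro group.inv_equality[OF group_GL4Z]) (auto simp: GL4Z_def)
  then show "inv\<^bsub>GL4Z\<^esub> A \<in> matrix ` isometries" using isometry_inv[OF f(1)] by blast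
  fix B assume "B \<in> matrix ` isometries"
  then obtain g where "g \<in> isometries" "B = matrix g" by blast
  then show "A \<otimes>\<^bsub>GL4Z\<^esub> B \<in> matrix ` isometries"
    using f isometry_comp by (auto simp: GL4Z_def simp flip: matrix_comp)
qed

lemma matrix_isometries_generate:
  "matrix ` isometries = generate GL4Z {f4_s1, f4_s2, f4_s3, f4_s4}"
proof (intro equalityI)
  have "{f4_s1, f4_s2, f4_s3, f4_s4} \<subseteq> matrix ` isometries"
    using f4_s_isometry matrix_matrix by (metis empty_subsetI image_eqI insert_subset)
  then show "generate GL4Z {f4_s1, f4_s2, f4_s3, f4_s4} \<subseteq> matrix ` isometries"
    using group.generate_subgroup_incl[OF group_GL4Z] subgroup_matrix_isometries by blast
  have "f \<in> isometries \<and> matrix f \<in> generate GL4Z {f4_s1, f4_s2, f4_s3, f4_s4}" if "f \<in> s_words" for f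
    using that
  proof induction
    case s_words_id
    show ?case unfolding matrix_id using generate.one[of GL4Z] isometry_id by (simp only: GL4Z_simps simp_thms)
  next
    case (s_words_comp f g)
    then show ?case using generate.eng[of "matrix f" GL4Z _ "matrix g"]
      by (simp only: matrix_comp isometry_comp GL4Z_simps simp_thms)
  qed (simp_all add: f4_s_isometry matrix_matrix generate.incl)
  then show "matrix ` isometries \<subseteq> generate GL4Z {f4_s1, f4_s2, f4_s3, f4_s4}"
    by (auto simp: isometries_eq_words)
qed

lemma isom_group_matrix_iso: "isom_group \<cong> GL4Z\<lparr>carrier := matrix ` isometries\<rparr>"
proof -
  have "inj_on matrix isometries"
  proof (rule inj_onI, rule ext)
    fix f g v assume "f \<in> isometries" "g \<in> isometries" "matrix f = matrix g"
    then show "f v = g v" using matrix_isometry[of f v] matrix_isometry[of g v] by simp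
  qed
  then have "matrix \<in> iso isom_group (GL4Z\<lparr>carrier := matrix ` isometries\<rparr>)"
    by (auto simp: iso_def hom_def bij_betw_def matrix_comp GL4Z_def)
  then show ?thesis by (auto simp: is_iso_def)
qed

section \<open>The symmetric composition algebra on the octonions\<close>

lemma mod3_simps [simp]: "(3::3) = 0" "(4::3) = 1"
  by simp_all

lemma UNIV_oct_basis: "(UNIV :: oct_basis set) = {Oe1, Oe2, Ou 0, Ou 1, Ou 2, Ov 0, Ov 1, Ov 2}"
proof -
  have "\<forall>b. b \<in> {Oe1, Oe2, Ou 0, Ou 1, Ou 2, Ov 0, Ov 1, Ov 2}"
    unfolding all_oct_basis all_3 by simp
  then show ?thesis by blast
qed

lemma sum_oct_basis: "(\<Sum>b\<in>UNIV. f b) = f Oe1 + (f Oe2 + (f (Ou 0) + (f (Ou 1) + (f (Ou 2) +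
    (f (Ov 0) + (f (Ov 1) + f (Ov 2)))))))" for f :: "oct_basis \<Rightarrow> 'a::comm_monoid_add"
  unfolding UNIV_oct_basis by simp

lemma UNIV_3': "(UNIV :: 3 set) = {0, 1, 2}"
proof -
  have "\<forall>i::3. i \<in> {0, 1, 2}" unfolding all_3 by simp
  then show ?thesis by blast
qed

lemma sum_3': "(\<Sum>i\<in>UNIV. f i) = f 0 + (f 1 + f (2::3))" for f :: "3 \<Rightarrow> 'a::comm_monoid_add"
  unfolding UNIV_3' by simp

lemma oct_eq_iff: "x = y \<longleftrightarrow> x $ Oe1 = y $ Oe1 \<and> x $ Oe2 = y $ Oe2 \<and> x $ Ou 0 = y $ Ou 0 \<and>
    x $ Ou 1 = y $ Ou 1 \<and> x $ Ou 2 = y $ Ou 2 \<and> x $ Ov 0 = y $ Ov 0 \<and> x $ Ov 1 = y $ Ov 1 \<and>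
    x $ Ov 2 = y $ Ov 2" for x y :: "'a ^ oct_basis"
  unfolding vec_eq_iff all_oct_basis all_3 by blast

lemma axis_oct [simp]: "axis a x $ b = (if b = a then x else 0)"
  by (simp add: axis_def)

lemma q8_coords: "q8 x y = x $ Oe1 * y $ Oe2 + x $ Oe2 * y $ Oe1 + x $ Ou 0 * y $ Ov 0 + x $ Ou 1 * y $ Ov 1
    + x $ Ou 2 * y $ Ov 2 + x $ Ov 0 * y $ Ou 0 + x $ Ov 1 * y $ Ou 1 + x $ Ov 2 * y $ Ou 2"
  by (simp add: polar_def oct_norm_def sum_3' algebra_simps)

lemma oct_conj_coords: "oct_conj x $ Oe1 = x $ Oe2" "oct_conj x $ Oe2 = x $ Oe1"
    "oct_conj x $ Ou i = - x $ Ou i" "oct_conj x $ Ov i = - x $ Ov i"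
  by (simp_all add: oct_conj_def q8_coords oct_one_def)

lemma S8_coords:
  "S8_mult x y $ Oe1 = x $ Oe2 * y $ Oe2 - (x $ Ou 0 * y $ Ov 0 + x $ Ou 1 * y $ Ov 1 + x $ Ou 2 * y $ Ov 2)"
  "S8_mult x y $ Oe2 = x $ Oe1 * y $ Oe1 - (x $ Ov 0 * y $ Ou 0 + x $ Ov 1 * y $ Ou 1 + x $ Ov 2 * y $ Ou 2)"
  "S8_mult x y $ Ou k = - x $ Oe2 * y $ Ou k - x $ Ou k * y $ Oe1
     + x $ Ov (k + 1) * y $ Ov (k + 2) - x $ Ov (k + 2) * y $ Ov (k + 1)"
  "S8_mult x y $ Ov k = - x $ Oe1 * y $ Ov k - x $ Ov k * y $ Oe2
     + x $ Ou (k + 1) * y $ Ou (k + 2) - x $ Ou (k + 2) * y $ Ou (k + 1)"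
proof -
  show "S8_mult x y $ Oe1 = x $ Oe2 * y $ Oe2 - (x $ Ou 0 * y $ Ov 0 + x $ Ou 1 * y $ Ov 1 + x $ Ou 2 * y $ Ov 2)"
    by (simp add: S8_mult_def oct_mult_def sum_oct_basis oct_conj_coords)
  show "S8_mult x y $ Oe2 = x $ Oe1 * y $ Oe1 - (x $ Ov 0 * y $ Ou 0 + x $ Ov 1 * y $ Ou 1 + x $ Ov 2 * y $ Ou 2)"
    by (simp add: S8_mult_def oct_mult_def sum_oct_basis oct_conj_coords)
  have "\<forall>k. S8_mult x y $ Ou k = - x $ Oe2 * y $ Ou k - x $ Ou k * y $ Oe1
     + x $ Ov (k + 1) * y $ Ov (k + 2) - x $ Ov (k + 2) * y $ Ov (k + 1)"
    unfolding all_3 by (simp add: S8_mult_def oct_mult_def sum_oct_basis oct_conj_coords)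
  then show "S8_mult x y $ Ou k = - x $ Oe2 * y $ Ou k - x $ Ou k * y $ Oe1
     + x $ Ov (k + 1) * y $ Ov (k + 2) - x $ Ov (k + 2) * y $ Ov (k + 1)" by blast
  have "\<forall>k. S8_mult x y $ Ov k = - x $ Oe1 * y $ Ov k - x $ Ov k * y $ Oe2
     + x $ Ou (k + 1) * y $ Ou (k + 2) - x $ Ou (k + 2) * y $ Ou (k + 1)"
    unfolding all_3 by (simp add: S8_mult_def oct_mult_def sum_oct_basis oct_conj_coords)
  then show "S8_mult x y $ Ov k = - x $ Oe1 * y $ Ov k - x $ Ov k * y $ Oe2
     + x $ Ou (k + 1) * y $ Ou (k + 2) - x $ Ou (k + 2) * y $ Ou (k + 1)" by blast
qed

abbreviation star :: "'k::field oct \<Rightarrow> 'k oct \<Rightarrow> 'k oct" (infixl "\<star>" 70) where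
  "x \<star> y \<equiv> S8_mult x y"

lemma star_add: "(x + y) \<star> z = x \<star> z + y \<star> z" "x \<star> (y + z) = x \<star> y + x \<star> z"
  by (simp_all add: oct_eq_iff S8_coords algebra_simps)

lemma star_scale: "(c *s x) \<star> y = c *s (x \<star> y)" "x \<star> (c *s y) = c *s (x \<star> y)"
  by (simp_all add: oct_eq_iff S8_coords algebra_simps)

lemma star_minus: "(- x) \<star> y = - (x \<star> y)" "x \<star> (- y) = - (x \<star> y)"
  "(x - z) \<star> y = x \<star> y - z \<star> y" "x \<star> (y - z) = x \<star> y - x \<star> z"
  by (simp_all add: oct_eq_iff S8_coords algebra_simps)

lemma star_zero [simp]: "0 \<star> y = 0" "x \<star> 0 = 0"
  by (simp_all add: oct_eq_iff S8_coords)

lemma q8_add: "q8 (x + y) z = q8 x z + q8 y z" "q8 x (y + z) = q8 x y + q8 x z"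
  by (simp_all add: q8_coords algebra_simps)

lemma q8_scale: "q8 (c *s x) y = c * q8 x y" "q8 x (c *s y) = c * q8 x y"
  by (simp_all add: q8_coords algebra_simps)

lemma q8_minus: "q8 (- x) y = - q8 x y" "q8 x (- y) = - q8 x y"
  "q8 (x - z) y = q8 x y - q8 z y" "q8 x (y - z) = q8 x y - q8 x z"
  by (simp_all add: q8_coords algebra_simps)

lemma q8_zero [simp]: "q8 0 y = 0" "q8 x 0 = 0"
  by (simp_all add: q8_coords)

lemma q8_sym: "q8 x y = q8 y x"
  by (simp add: q8_coords algebra_simps)

text \<open>Linearization of (x \<star> y) \<star> x = q(x) y. Together with its mirror image
  \<open>star_flip_right\<close> and with \<open>q8_assoc\<close> it expresses that S8 is a
  symmetric composition algebra; \<open>t8_tri8\<close> rests on these identities.\<close>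

lemma star_flip_left: "(x \<star> y) \<star> z + (z \<star> y) \<star> x = q8 x z *s y"
  by (simp add: oct_eq_iff S8_coords q8_coords algebra_simps)

lemma star_flip_right: "x \<star> (y \<star> z) + z \<star> (y \<star> x) = q8 x z *s y"
  by (simp add: oct_eq_iff S8_coords q8_coords algebra_simps)

lemma q8_assoc: "q8 (x \<star> y) z = q8 x (y \<star> z)"
  by (simp add: S8_coords q8_coords algebra_simps)

text \<open>The dual basis with respect to the polar form, see \<open>q8_axis_dual\<close>; dual
  basis vectors have opposite degrees.\<close>

fun dual :: "oct_basis \<Rightarrow> oct_basis" where
  "dual Oe1 = Oe2" | "dual Oe2 = Oe1" | "dual (Ou i) = Ov i" | "dual (Ov i) = Ou i"

lemma dual_dual [simp]: "dual (dual b) = b"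
  by (cases b) simp_all

lemma q8_axis: "q8 (axis b 1) x = x $ dual b"
proof -
  have "\<forall>b. q8 (axis b 1) x = x $ dual b"
    unfolding all_oct_basis all_3 by (simp add: q8_coords)
  then show ?thesis by blast
qed

lemma q8_eqI: "(\<And>z. q8 z x = q8 z y) \<Longrightarrow> x = y"
  unfolding vec_eq_iff by (metis q8_axis dual_dual)

lemma q8_axis_dual: "q8 (axis b 1) (axis c 1) = (if c = dual b then 1 else 0)"
  using dual_dual by (auto simp: q8_axis)

definition lin :: "('k::field ^ 'n \<Rightarrow> 'k ^ 'm) \<Rightarrow> bool" where
  "lin f \<longleftrightarrow> (\<forall>x y. f (x + y) = f x + f y) \<and> (\<forall>c x. f (c *s x) = c *s f x)"

lemma linear_iff_lin: "Vector_Spaces.linear (*s) (*s) f \<longleftrightarrow> lin f"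
  by (simp add: Vector_Spaces.linear_iff lin_def vec.vector_space_axioms)

lemma linD: "lin f \<Longrightarrow> f (x + y) = f x + f y" "lin f \<Longrightarrow> f (c *s x) = c *s f x"
  by (auto simp: lin_def)

lemma lin_zero: "lin f \<Longrightarrow> f 0 = 0"
  using linD(2)[of f 0 0] by simp

lemma lin_minus: "lin f \<Longrightarrow> f (- x) = - f x" "lin f \<Longrightarrow> f (x - y) = f x - f y"
proof -
  assume f: "lin f"
  have m: "f (- z) = - f z" for z using linD(2)[OF f, of "-1" z] by simp
  then show "f (- x) = - f x" .
  show "f (x - y) = f x - f y" using linD(1)[OF f, of x "- y"] m by simp
qed

lemma lin_sum: "lin f \<Longrightarrow> f (\<Sum>a\<in>S. g a) = (\<Sum>a\<in>S. f (g a))"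
  by (induction S rule: infinite_finite_induct) (simp_all add: lin_zero linD)

lemma lin_expand: "lin f \<Longrightarrow> f x = (\<Sum>a\<in>UNIV. x $ a *s f (axis a 1))"
  using lin_sum[of f "\<lambda>a. x $ a *s axis a 1" UNIV] by (simp add: basis_expansion linD)

section \<open>The triality Lie algebra of the octonions\<close>

abbreviation tri8 :: "(3 \<Rightarrow> 'k::field oct \<Rightarrow> 'k oct) set" where
  "tri8 \<equiv> tri S8_mult q8"

abbreviation t8 :: "'k::field oct \<Rightarrow> 'k oct \<Rightarrow> 3 \<Rightarrow> 'k oct \<Rightarrow> 'k oct" where
  "t8 \<equiv> tri_t S8_mult q8"

lemma tri8_lin: "d \<in> tri8 \<Longrightarrow> lin (d i)"
  and tri8_skew: "d \<in> tri8 \<Longrightarrow> q8 (d i x) y = - q8 x (d i y)"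
  and tri8_0: "d \<in> tri8 \<Longrightarrow> d 0 (x \<star> y) = d 1 x \<star> y + x \<star> d 2 y"
  by (auto simp: tri_def orth_lie_def linear_iff_lin eq_neg_iff_add_eq_0)

text \<open>Pairing with z and moving all maps to the other argument, by skewness and associativity
  of the form, turns the relation for (a, b, c) into the one for (b, c, a). The triality relation at
  index 0 thus yields it at every index.\<close>

lemma tri8_rotate:
  assumes d: "\<And>i. lin (d i)" "\<And>i x y. q8 (d i x) y = - q8 x (d i y)"
    and r: "\<And>x y. d a (x \<star> y) = d b x \<star> y + x \<star> d c y"
  shows "d b (x \<star> y) = d c x \<star> y + x \<star> d a y"
proof (rule q8_eqI)
  fix z
  have "q8 (d a (z \<star> x)) y = q8 (d b z \<star> x) y + q8 (z \<star> d c x) y"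
    by (simp add: r q8_add)
  then have "- q8 z (x \<star> d a y) = - q8 z (d b (x \<star> y)) + q8 z (d c x \<star> y)"
    by (simp add: d q8_assoc)
  then show "q8 z (d b (x \<star> y)) = q8 z (d c x \<star> y + x \<star> d a y)"
    by (simp add: q8_add algebra_simps)
qed

lemma tri8_mult:
  assumes "d \<in> tri8"
  shows "d i (x \<star> y) = d (i + 1) x \<star> y + x \<star> d (i + 2) y"
proof -
  note l = tri8_lin[OF assms] tri8_skew[OF assms]
  note r0 = tri8_0[OF assms]
  note r1 = tri8_rotate[OF l r0]
  note r2 = tri8_rotate[OF l r1]
  have "\<forall>i x y. d i (x \<star> y) = d (i + 1) x \<star> y + x \<star> d (i + 2) y"
    unfolding all_3 using r0 r1 r2 by simp
  then show ?thesis by blast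
qed

lemma tri8_iff: "d \<in> tri8 \<longleftrightarrow> (\<forall>i. lin (d i)) \<and> (\<forall>i x y. q8 (d i x) y = - q8 x (d i y)) \<and>
    (\<forall>i x y. d i (x \<star> y) = d (i + 1) x \<star> y + x \<star> d (i + 2) y)"
proof
  assume "d \<in> tri8"
  then show "(\<forall>i. lin (d i)) \<and> (\<forall>i x y. q8 (d i x) y = - q8 x (d i y)) \<and>
    (\<forall>i x y. d i (x \<star> y) = d (i + 1) x \<star> y + x \<star> d (i + 2) y)"
    using tri8_lin tri8_skew tri8_mult by blast
next
  assume r: "(\<forall>i. lin (d i)) \<and> (\<forall>i x y. q8 (d i x) y = - q8 x (d i y)) \<and>
    (\<forall>i x y. d i (x \<star> y) = d (i + 1) x \<star> y + x \<star> d (i + 2) y)"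
  then have "d 0 (x \<star> y) = d (0 + 1) x \<star> y + x \<star> d (0 + 2) y" for x y by blast
  then show "d \<in> tri8" using r
    by (simp add: tri_def orth_lie_def linear_iff_lin eq_neg_iff_add_eq_0)
qed

lemma theta_tri8: "d \<in> tri8 \<Longrightarrow> theta i d \<in> tri8"
  unfolding tri8_iff theta_def by (simp add: algebra_simps)

lemma t8_simps: "t8 x y 0 = (\<lambda>z. q8 x z *s y - q8 y z *s x)"
  "t8 x y 1 = (\<lambda>z. (q8 x y / 2) *s z - (y \<star> z) \<star> x)"
  "t8 x y 2 = (\<lambda>z. (q8 x y / 2) *s z - x \<star> (z \<star> y))"
  by (simp_all add: tri_t_def fun_eq_iff)

text \<open>Skewness of components 1 and 2 reduces to \<open>k1\<close> and \<open>k2\<close>, and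
  the triality relation to three instances of the flip identities, all without coordinates.\<close>

lemma t8_tri8: "t8 x y \<in> tri8" for x y :: "'k::field_char_0 oct"
proof -
  let ?d = "t8 x y"
  have l: "\<forall>i. lin (?d i)"
    unfolding all_3 t8_simps
    by (simp add: lin_def q8_add q8_scale star_add star_scale vector_add_ldistrib vector_sub_rdistrib
        vector_sadd_rdistrib vector_smult_assoc vector_ssub_ldistrib mult_ac)
  have k: "\<forall>i x y. q8 (?d i x) y = - q8 x (?d i y)"
  proof -
    have k1: "q8 ((y \<star> u) \<star> x) v + q8 u ((y \<star> v) \<star> x) = q8 x y * q8 u v" for u v
    proof -
      have "q8 u ((y \<star> v) \<star> x) = q8 (u \<star> (y \<star> v)) x" by (simp add: q8_assoc)
      also have "u \<star> (y \<star> v) = q8 u v *s y - v \<star> (y \<star> u)"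
        using star_flip_right[of u y v] by (simp add: eq_diff_eq)
      also have "q8 (q8 u v *s y - v \<star> (y \<star> u)) x = q8 u v * q8 y x - q8 ((y \<star> u) \<star> x) v"
        by (simp add: q8_minus q8_scale q8_assoc[of v] q8_sym[of v])
      finally show ?thesis by (simp add: q8_sym[of y x])
    qed
    have k2: "q8 (x \<star> (u \<star> y)) v + q8 u (x \<star> (v \<star> y)) = q8 x y * q8 u v" for u v
    proof -
      have "q8 u (x \<star> (v \<star> y)) = q8 ((u \<star> x) \<star> v) y" by (simp add: q8_assoc)
      also have "(u \<star> x) \<star> v = q8 u v *s x - (v \<star> x) \<star> u"
        using star_flip_left[of u x v] by (simp add: eq_diff_eq)
      also have "q8 (q8 u v *s x - (v \<star> x) \<star> u) y = q8 u v * q8 x y - q8 (x \<star> (u \<star> y)) v"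
        by (simp add: q8_minus q8_scale q8_assoc[of "v \<star> x"] q8_assoc[of v] q8_sym[of v "x \<star> (u \<star> y)"])
      finally show ?thesis by simp
    qed
    have h: "c / 2 * p - a = - (c / 2 * p - b)" if "a + b = c * p" for a b c p :: 'k
      using that by (simp add: algebra_simps flip: add_divide_distrib)
    show ?thesis
      unfolding all_3 t8_simps q8_minus q8_scale
    proof (intro conjI allI)
      fix u v
      show "q8 x u * q8 y v - q8 y u * q8 x v = - (q8 x v * q8 u y - q8 y v * q8 u x)"
        by (simp add: q8_sym[of u])
      show "q8 x y / 2 * q8 u v - q8 ((y \<star> u) \<star> x) v = - (q8 x y / 2 * q8 u v - q8 u ((y \<star> v) \<star> x))"
        by (rule h[OF k1])
      show "q8 x y / 2 * q8 u v - q8 (x \<star> (u \<star> y)) v = - (q8 x y / 2 * q8 u v - q8 u (x \<star> (v \<star> y)))"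
        by (rule h[OF k2])
    qed
  qed
  have m: "?d 0 (u \<star> v) = ?d 1 u \<star> v + u \<star> ?d 2 v" for u v
  proof -
    have 1: "((y \<star> u) \<star> x) \<star> v = q8 y (u \<star> v) *s x - (v \<star> x) \<star> (y \<star> u)"
      using star_flip_left[of "y \<star> u" x v] by (simp add: q8_assoc eq_diff_eq)
    have 2: "(v \<star> x) \<star> (y \<star> u) + u \<star> (y \<star> (v \<star> x)) = q8 x (u \<star> v) *s y"
      using star_flip_right[of "v \<star> x" y u] q8_assoc[of v x u] q8_assoc[of x u v] q8_sym[of v "x \<star> u"] by simp
    have 3: "u \<star> (y \<star> (v \<star> x)) + u \<star> (x \<star> (v \<star> y)) = q8 x y *s (u \<star> v)"
      using arg_cong[OF star_flip_right[of y v x], of "star u"] by (simp add: q8_sym[of y x] star_scale star_add)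
    have "?d 1 u \<star> v + u \<star> ?d 2 v = q8 x y *s (u \<star> v) - ((y \<star> u) \<star> x) \<star> v - u \<star> (x \<star> (v \<star> y))"
    proof -
      have "(q8 x y / 2) *s w + (q8 x y / 2) *s w = q8 x y *s w" for w :: "'k oct"
        by (simp flip: vector_sadd_rdistrib)
      then show ?thesis by (simp add: t8_simps star_minus star_scale algebra_simps)
    qed
    also have "\<dots> = (q8 x y *s (u \<star> v) - u \<star> (x \<star> (v \<star> y))) - q8 y (u \<star> v) *s x + (v \<star> x) \<star> (y \<star> u)"
      by (simp add: 1)
    also have "q8 x y *s (u \<star> v) - u \<star> (x \<star> (v \<star> y)) = u \<star> (y \<star> (v \<star> x))"
      by (simp flip: 3)
    also have "u \<star> (y \<star> (v \<star> x)) - q8 y (u \<star> v) *s x + (v \<star> x) \<star> (y \<star> u) = ?d 0 (u \<star> v)"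
      unfolding t8_simps using 2 by (simp add: algebra_simps)
    finally show ?thesis by simp
  qed
  show ?thesis
    using l k m by (simp add: tri_def orth_lie_def linear_iff_lin eq_neg_iff_add_eq_0)
qed

text \<open>
  Comparing both sides at the unit shows that d2 (1) lies in the nucleus, hence is a scalar, and
  skew symmetry makes it vanish.
\<close>

lemma tri8_zero:
  fixes d :: "3 \<Rightarrow> 'k::field_char_0 oct \<Rightarrow> 'k oct"
  assumes d: "d \<in> tri8" and z: "\<And>x. d 0 x = 0"
  shows "d = 0"
proof -
  have 0: "d 1 x \<star> y + x \<star> d 2 y = 0" for x y
    using tri8_0[OF d, of x y] z by simp
  note sk = tri8_skew[OF d]
  let ?e = "oct_one :: 'k oct"
  define a where "a = d 2 ?e"
  \<comment> \<open>The octonion unit is a para-unit of S8: multiplication by it is conjugation, so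
    multiplying twice gives back x.\<close>
  have star_e: "(x \<star> ?e) \<star> ?e = x" "?e \<star> (?e \<star> x) = x" for x
    by (simp_all add: oct_eq_iff S8_coords oct_one_def)
  have d1: "d 1 x = - ((x \<star> a) \<star> ?e)" for x
  proof -
    have "d 1 x \<star> ?e = - (x \<star> a)" using 0[of x ?e] by (simp add: a_def eq_neg_iff_add_eq_0)
    then have "(d 1 x \<star> ?e) \<star> ?e = - ((x \<star> a) \<star> ?e)" by (simp add: star_minus)
    then show ?thesis by (simp add: star_e)
  qed
  have d2: "d 2 y = - (?e \<star> (d 1 ?e \<star> y))" for y
  proof -
    have "?e \<star> d 2 y = - (d 1 ?e \<star> y)" using 0[of ?e y] by (simp add: eq_neg_iff_add_eq_0 add.commute)
    then have "?e \<star> (?e \<star> d 2 y) = - (?e \<star> (d 1 ?e \<star> y))" by (simp add: star_minus)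
    then show ?thesis by (simp add: star_e)
  qed
  \<comment> \<open>With d1 and d2 expressed by a, an associativity condition on a remains.
    Evaluating it at u_i and u_(i+1) isolates the coordinates of a.\<close>
  have n: "((x \<star> a) \<star> ?e) \<star> y = x \<star> (?e \<star> (((?e \<star> a) \<star> ?e) \<star> y))" for x y
    using 0[of x y] unfolding d2[of y] d1[of x] d1[of ?e] by (simp add: star_minus eq_neg_iff_add_eq_0)
  have u2: "a $ Ou 2 = 0"
    using arg_cong[OF n[of "axis (Ou 0) 1" "axis (Ou 1) 1"], of "\<lambda>w. w $ Oe1"] by (simp add: S8_coords oct_one_def)
  have v0: "a $ Ov 0 = 0"
    using arg_cong[OF n[of "axis (Ou 0) 1" "axis (Ou 1) 1"], of "\<lambda>w. w $ Ou 1"] by (simp add: S8_coords oct_one_def)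
  have u0: "a $ Ou 0 = 0"
    using arg_cong[OF n[of "axis (Ou 1) 1" "axis (Ou 2) 1"], of "\<lambda>w. w $ Oe1"] by (simp add: S8_coords oct_one_def)
  have v1: "a $ Ov 1 = 0"
    using arg_cong[OF n[of "axis (Ou 1) 1" "axis (Ou 2) 1"], of "\<lambda>w. w $ Ou 2"] by (simp add: S8_coords oct_one_def)
  have u1: "a $ Ou 1 = 0"
    using arg_cong[OF n[of "axis (Ou 2) 1" "axis (Ou 0) 1"], of "\<lambda>w. w $ Oe1"] by (simp add: S8_coords oct_one_def)
  have v2: "a $ Ov 2 = 0"
    using arg_cong[OF n[of "axis (Ou 2) 1" "axis (Ou 0) 1"], of "\<lambda>w. w $ Ou 0"] by (simp add: S8_coords oct_one_def)
  have "a $ Oe1 = a $ Oe2"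
    using arg_cong[OF n[of "axis (Ou 0) 1" "axis (Ou 1) 1"], of "\<lambda>w. w $ Ov 2"] by (simp add: S8_coords oct_one_def)
  moreover have "a $ Oe1 + a $ Oe2 = 0"
  proof -
    have "q8 a ?e = 0" using sk[of 2 ?e ?e] by (simp add: a_def q8_sym[of "?e" "d 2 ?e"] eq_neg_iff_add_eq_0 flip: mult_2)
    then show ?thesis by (simp add: q8_coords oct_one_def)
  qed
  ultimately have "a $ Oe1 = 0" "a $ Oe2 = 0" by (simp_all flip: mult_2)
  then have "a = 0" unfolding oct_eq_iff using u0 u1 u2 v0 v1 v2 by simp
  then have "d 1 x = 0" for x by (simp add: d1)
  moreover then have "d 2 y = 0" for y by (simp add: d2)
  ultimately have "\<forall>i x. d i x = 0" unfolding all_3 using z by simp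
  then show ?thesis by (simp add: fun_eq_iff)
qed

section \<open>Coordinates on g(S8, S2)\<close>

lemma sum_2': "(\<Sum>i\<in>UNIV. f i) = f 1 + f (2::2)" for f :: "2 \<Rightarrow> 'a::comm_monoid_add"
  by (simp add: UNIV_2)

lemma vec2_eq_iff: "x = y \<longleftrightarrow> x $ 1 = y $ 1 \<and> x $ 2 = y $ 2" for x y :: "'a ^ 2"
  by (simp add: vec_eq_iff forall_2)

lemma vector_2' [simp]: "(vector [a, b] :: 'a::zero ^ 2) $ 1 = a" "(vector [a, b] :: 'a ^ 2) $ 2 = b"
  by (simp_all add: vector_def)

lemma axis_2 [simp]: "axis a x $ b = (if b = (a::2) then x else 0)"
  by (simp add: axis_def)

lemma sum_pairs_UNIV: "(\<Sum>(a, b)\<in>UNIV. f a b) = (\<Sum>a\<in>UNIV. \<Sum>b\<in>UNIV. f a b)"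
  for f :: "'a::finite \<Rightarrow> 'b::finite \<Rightarrow> 'c::comm_monoid_add"
  by (simp add: sum.cartesian_product)

lemma q2_coords: "q2 x y = x $ 1 * y $ 2 + x $ 2 * y $ 1"
  by (simp add: polar_def S2_norm_def algebra_simps)

lemma S2_mult_coords: "S2_mult x y $ 1 = x $ 2 * y $ 2" "S2_mult x y $ 2 = x $ 1 * y $ 1"
  by (simp_all add: S2_mult_def S2_swap_def)

text \<open>Skew endomorphisms of the hyperbolic plane are of the form diag(c, -c), so tri(S2)
  becomes a set of scalar triples; by \<open>tri2_iff\<close> the triality relation amounts to their
  sum being 0.\<close>

definition tri2_elem :: "(3 \<Rightarrow> 'k::field) \<Rightarrow> 3 \<Rightarrow> 'k ^ 2 \<Rightarrow> 'k ^ 2" where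
  "tri2_elem c i z = vector [c i * z $ 1, - c i * z $ 2]"

definition tri2_scalars :: "(3 \<Rightarrow> 'k::field) set" where
  "tri2_scalars = {c. c 0 + c 1 + c 2 = 0}"

lemma tri2_elem_mem: "c \<in> tri2_scalars \<Longrightarrow> tri2_elem c \<in> tri S2_mult q2"
proof -
  assume "c \<in> tri2_scalars"
  then have c: "c 0 = - c 1 - c 2" by (simp add: tri2_scalars_def eq_neg_iff_add_eq_0 algebra_simps)
  have "lin (tri2_elem c i)" for i
    by (simp add: lin_def tri2_elem_def vec2_eq_iff algebra_simps)
  then show ?thesis
    by (simp add: tri_def orth_lie_def linear_iff_lin tri2_elem_def q2_coords vec2_eq_iff
        S2_mult_coords c algebra_simps)
qed

lemma tri2_iff:
  fixes d :: "3 \<Rightarrow> 'k::field_char_0 ^ 2 \<Rightarrow> 'k ^ 2"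
  shows "d \<in> tri S2_mult q2 \<longleftrightarrow> (\<exists>c \<in> tri2_scalars. d = tri2_elem c)"
proof
  assume d: "d \<in> tri S2_mult q2"
  have l: "lin (d i)" and sk: "q2 (d i x) y + q2 x (d i y) = 0" for i x y
    using d by (auto simp: tri_def orth_lie_def linear_iff_lin)
  let ?e = "\<lambda>a. axis a 1 :: 'k ^ 2"
  define c where "c i = d i (?e 1) $ 1" for i
  have z: "d i (?e 1) $ 2 = 0" "d i (?e 2) $ 1 = 0" "d i (?e 2) $ 2 = - c i" for i
    using sk[of i "?e 1" "?e 1"] sk[of i "?e 2" "?e 2"] sk[of i "?e 1" "?e 2"]
    by (simp_all add: q2_coords c_def eq_neg_iff_add_eq_0 add.commute flip: mult_2)
  have dz: "d i x = vector [c i * x $ 1, - c i * x $ 2]" for i x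
    unfolding lin_expand[OF l, of _ x] sum_2' by (simp add: vec2_eq_iff z c_def)
  have "d 0 (S2_mult (?e 1) (?e 1)) = S2_mult (d 1 (?e 1)) (?e 1) + S2_mult (?e 1) (d 2 (?e 1))"
    using d by (simp add: tri_def)
  then have "- c 0 = c 1 + c 2" by (simp add: vec2_eq_iff dz S2_mult_coords)
  then have "c \<in> tri2_scalars" by (simp add: tri2_scalars_def eq_neg_iff_add_eq_0 neg_eq_iff_add_eq_0 add.assoc)
  moreover have "d = tri2_elem c" by (simp add: fun_eq_iff dz tri2_elem_def)
  ultimately show "\<exists>c \<in> tri2_scalars. d = tri2_elem c" by blast
qed (auto intro: tri2_elem_mem)

text \<open>Coordinates on the Lie algebra: x i and y i are the parts of copy i along the two
  idempotents of S2, and c parametrizes the tri(S2) part. Brackets, degrees and automorphisms are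
  all computed in this form.\<close>

definition gel :: "(3 \<Rightarrow> 'k::field oct \<Rightarrow> 'k oct) \<Rightarrow> (3 \<Rightarrow> 'k) \<Rightarrow> (3 \<Rightarrow> 'k oct) \<Rightarrow> (3 \<Rightarrow> 'k oct) \<Rightarrow> 'k gvec" where
  "gel d c x y = (d, tri2_elem c, \<lambda>i. \<chi> p. if snd p = 1 then x i $ fst p else y i $ fst p)"

lemma gel_eq_iff: "gel d c x y = gel d' c' x' y' \<longleftrightarrow> d = d' \<and> c = c' \<and> x = x' \<and> y = y'"
proof
  assume eq: "gel d c x y = gel d' c' x' y'"
  then have "d = d'" and t: "tri2_elem c = tri2_elem c'"
    and z: "(\<lambda>i. \<chi> p. if snd p = (1::2) then x i $ fst p else y i $ fst p) =
      (\<lambda>i. \<chi> p. if snd p = 1 then x' i $ fst p else y' i $ fst p)"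
    unfolding gel_def by (simp_all only: prod.inject)
  have "c i = c' i" for i
    using arg_cong[OF fun_cong[OF fun_cong[OF t, of i], of "axis 1 1"], of "\<lambda>v. v $ 1"]
    by (simp add: tri2_elem_def)
  moreover have "x i $ a = x' i $ a" for i a
    using arg_cong[OF fun_cong[OF z, of i], of "\<lambda>v. v $ (a, 1)"] by simp
  moreover have "y i $ a = y' i $ a" for i a
    using arg_cong[OF fun_cong[OF z, of i], of "\<lambda>v. v $ (a, 2)"] by simp
  ultimately show "d = d' \<and> c = c' \<and> x = x' \<and> y = y'"
    using \<open>d = d'\<close> by (simp add: fun_eq_iff vec_eq_iff)
qed simp

lemma two_neq_one: "(2::2) = 1 \<longleftrightarrow> False"
  by simp

lemma tens_coords: "(z :: 'k tens) = (\<chi> p. if snd p = 1 then (\<chi> a. z $ (a, 1)) $ fst p else (\<chi> a. z $ (a, 2)) $ fst p)"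
proof -
  have "z $ (a, b) = (if b = 1 then z $ (a, 1) else z $ (a, 2))" for a and b :: 2
    using exhaust_2[of b] by (elim disjE) simp_all
  then have "z $ p = (\<chi> p. if snd p = 1 then (\<chi> a. z $ (a, 1)) $ fst p else (\<chi> a. z $ (a, 2)) $ fst p) $ p" for p
    unfolding vec_lambda_beta by (metis prod.collapse)
  then show ?thesis unfolding vec_eq_iff by blast
qed

lemma g_carrier: "alg_carrier (g_S8_S2 :: ('k::field_char_0, 'k gvec) algebra_struct) =
    {gel d c x y |d c x y. d \<in> tri8 \<and> c \<in> tri2_scalars}"
proof (intro equalityI subsetI)
  fix w :: "'k gvec" assume "w \<in> alg_carrier g_S8_S2"
  moreover obtain d d' z where w: "w = (d, d', z)" by (metis prod_cases3)
  ultimately have d: "d \<in> tri8" "d' \<in> tri S2_mult q2"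
    by (simp_all add: g_S8_S2_def)
  then obtain c where c: "c \<in> tri2_scalars" "d' = tri2_elem c" unfolding tri2_iff by (elim bexE)
  have "w = gel d c (\<lambda>i. \<chi> a. z i $ (a, 1)) (\<lambda>i. \<chi> a. z i $ (a, 2))"
    unfolding w c gel_def by (intro arg_cong2[of _ _ _ _ Pair] refl ext) (rule tens_coords)
  then show "w \<in> {gel d c x y |d c x y. d \<in> tri8 \<and> c \<in> tri2_scalars}" using d(1) c(1) by blast
next
  fix w :: "'k gvec" assume "w \<in> {gel d c x y |d c x y. d \<in> tri8 \<and> c \<in> tri2_scalars}"
  then obtain d c x y where "w = gel d c x y" "d \<in> tri8" "c \<in> tri2_scalars" by blast
  then show "w \<in> alg_carrier g_S8_S2" by (simp add: g_S8_S2_def gel_def tri2_elem_mem)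
qed

lemma gel_add: "gel d c x y + gel d' c' x' y' = gel (d + d') (c + c') (x + x') (y + y')"
  by (simp add: gel_def tri2_elem_def vec2_eq_iff vec_eq_iff fun_eq_iff algebra_simps)

lemma gel_scale: "gscale k (gel d c x y) = gel (\<lambda>i v. k *s d i v) (\<lambda>i. k * c i) (\<lambda>i. k *s x i) (\<lambda>i. k *s y i)"
  by (simp add: gel_def gscale_def tri2_elem_def vec2_eq_iff vec_eq_iff fun_eq_iff algebra_simps)

lemma gel_zero: "0 = gel 0 0 0 0"
  by (simp add: gel_def zero_prod_def tri2_elem_def vec2_eq_iff vec_eq_iff fun_eq_iff)

lemma rho_gel: "rho (gel d c x y) = gel d (- c) y x"
proof -
  have "tensor_map id S2_swap z $ (a, b) = z $ (a, if b = 1 then 2 else 1)" for z :: "'a tens" and a b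
  proof -
    have "tensor_map id S2_swap z $ (a, b) =
        (\<Sum>a'\<in>UNIV. if a' = a then z $ (a, if b = 1 then 2 else 1) else 0)"
      unfolding tensor_map_def sum_pairs_UNIV sum_component
      by (rule sum.cong) (use exhaust_2[of b] in \<open>auto simp: sum_2' tensor_def S2_swap_def\<close>)
    then show ?thesis by simp
  qed
  then show ?thesis
    by (simp add: rho_def gel_def tri2_elem_def S2_swap_def vec2_eq_iff vec_eq_iff fun_eq_iff forall_2)
qed

text \<open>The scalars by which t of the two idempotents of S2 acts, as an element of tri(S2); see
  \<open>t2_axis\<close>.\<close>

definition tau :: "3 \<Rightarrow> 'k::field_char_0" where
  "tau i = (if i = 0 then -1 else 1 / 2)"

lemma bilin_expand:
  assumes "\<And>y. lin (\<lambda>x. B x y)" "\<And>x. lin (B x)"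
  shows "B x y = (\<Sum>a\<in>UNIV. \<Sum>b\<in>UNIV. (x $ a * y $ b) *s B (axis a 1) (axis b 1))"
proof -
  have "B x y = (\<Sum>a\<in>UNIV. x $ a *s B (axis a 1) y)" by (rule lin_expand[OF assms(1)])
  also have "\<dots> = (\<Sum>a\<in>UNIV. \<Sum>b\<in>UNIV. (x $ a * y $ b) *s B (axis a 1) (axis b 1))"
    by (rule sum.cong[OF refl], subst lin_expand[OF assms(2)])
      (simp add: vec.scale_sum_right vector_smult_assoc)
  finally show ?thesis .
qed

lemma star_expand: "x \<star> y = (\<Sum>a\<in>UNIV. \<Sum>b\<in>UNIV. (x $ a * y $ b) *s (axis a 1 \<star> axis b 1))"
  by (rule bilin_expand) (simp_all add: lin_def star_add star_scale)

lemma t8_lin: "lin (\<lambda>x. t8 x y i v)" "lin (\<lambda>y. t8 x y i v)"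
proof -
  have "\<forall>i. lin (\<lambda>x. t8 x y i v)"
    unfolding all_3 t8_simps lin_def q8_add q8_scale star_add star_scale
    by (simp add: vec_eq_iff add_divide_distrib algebra_simps)
  then show "lin (\<lambda>x. t8 x y i v)" by blast
  have "\<forall>i. lin (\<lambda>y. t8 x y i v)"
    unfolding all_3 t8_simps lin_def q8_add q8_scale star_add star_scale
    by (simp add: vec_eq_iff add_divide_distrib algebra_simps)
  then show "lin (\<lambda>y. t8 x y i v)" by blast
qed

lemma t8_expand: "t8 x y i v = (\<Sum>a\<in>UNIV. \<Sum>b\<in>UNIV. (x $ a * y $ b) *s t8 (axis a 1) (axis b 1) i v)"
  by (rule bilin_expand[of "\<lambda>x y. t8 x y i v"]) (rule t8_lin)+

lemma q8_expand: "q8 x y = (\<Sum>a\<in>UNIV. \<Sum>b\<in>UNIV. x $ a * y $ b * q8 (axis a 1) (axis b 1))"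
proof -
  have "(\<Sum>b\<in>UNIV. x $ a * y $ b * q8 (axis a 1) (axis b 1)) = x $ a * y $ dual a" for a
    by (simp add: q8_axis_dual if_distrib[of "times _"] cong: if_cong)
  then show ?thesis by (simp add: sum_oct_basis q8_coords algebra_simps)
qed

lemma t2_axis:
  "tri_t S2_mult q2 (axis 1 1) (axis 1 1) = 0"
  "tri_t S2_mult q2 (axis 2 1) (axis 2 1) = 0"
  "tri_t S2_mult q2 (axis 1 1) (axis 2 1) = tri2_elem tau"
  "tri_t S2_mult q2 (axis 2 1) (axis 1 1) = - tri2_elem tau"
  by (auto simp: tri_t_def fun_eq_iff tau_def tri2_elem_def q2_coords S2_mult_coords vec2_eq_iff field_simps)

lemma tensor_map_left:
  assumes "lin f"
  shows "tensor_map f id z $ (a, g) = f (\<chi> b. z $ (b, g)) $ a"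
proof -
  have "tensor_map f id z $ (a, g) = (\<Sum>b\<in>UNIV. z $ (b, g) * f (axis b 1) $ a)"
    unfolding tensor_map_def sum_pairs_UNIV sum_component
    by (rule sum.cong) (use exhaust_2[of g] in \<open>auto simp: sum_2' tensor_def\<close>)
  also have "\<dots> = f (\<chi> b. z $ (b, g)) $ a"
    by (subst lin_expand[OF assms]) (simp add: sum_component)
  finally show ?thesis .
qed

lemma tensor_map_right: "tensor_map id (tri2_elem c i) z $ (a, g) = (if g = 1 then c i else - c i) * z $ (a, g)"
proof -
  have "tensor_map id (tri2_elem c i) z $ (a, g) =
      (\<Sum>b\<in>UNIV. if b = a then (if g = 1 then c i else - c i) * z $ (a, g) else 0)"
    unfolding tensor_map_def sum_pairs_UNIV sum_component
    by (rule sum.cong) (use exhaust_2[of g] in \<open>auto simp: sum_2' tensor_def tri2_elem_def\<close>)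
  then show ?thesis by simp
qed

lemma tensor_mult_coords:
  "tensor_mult z w $ (a, g) = (if g = 1 then ((\<chi> b. z $ (b, 2)) \<star> (\<chi> b. w $ (b, 2))) $ a
     else ((\<chi> b. z $ (b, 1)) \<star> (\<chi> b. w $ (b, 1))) $ a)"
proof -
  have "tensor_mult z w $ (a, g) = (\<Sum>b\<in>UNIV. \<Sum>c\<in>UNIV.
      (if g = 1 then z $ (b, 2) * w $ (c, 2) else z $ (b, 1) * w $ (c, 1)) * (axis b 1 \<star> axis c 1) $ a)"
    unfolding tensor_mult_def sum_pairs_UNIV sum_component sum_2'
    by (rule sum.cong[OF refl]) (use exhaust_2[of g] in
      \<open>auto simp: sum_component sum_2' tensor_def S2_mult_coords sum.distrib algebra_simps\<close>)
  then show ?thesis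
    unfolding star_expand[of "\<chi> b. z $ (b, 2)"] star_expand[of "\<chi> b. z $ (b, 1)"]
    by (simp add: sum_component)
qed

definition gcoord1 where "gcoord1 z = (\<chi> b. z $ (b, 1::2))"
definition gcoord2 where "gcoord2 z = (\<chi> b. z $ (b, 2::2))"

lemma iota_br8_eq: "iota_br8 i z w j v = theta i (t8 (gcoord1 z) (gcoord2 w)) j v + theta i (t8 (gcoord2 z) (gcoord1 w)) j v"
  unfolding iota_br8_def sum_pairs_UNIV theta_def t8_expand[of "gcoord1 z" "gcoord2 w"] t8_expand[of "gcoord2 z" "gcoord1 w"]
  by (simp add: sum_2' q2_coords gcoord1_def gcoord2_def sum.distrib)

lemma iota_br2_eq: "iota_br2 i z w j v =
    tri2_elem (\<lambda>j. (q8 (gcoord1 z) (gcoord2 w) - q8 (gcoord2 z) (gcoord1 w)) * tau (j - i)) j v"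
  unfolding iota_br2_def sum_pairs_UNIV q8_expand[of "gcoord1 z" "gcoord2 w"] q8_expand[of "gcoord2 z" "gcoord1 w"]
  by (simp add: sum_2' theta_def t2_axis gcoord1_def gcoord2_def tri2_elem_def vec2_eq_iff sum_component
      sum_subtractf sum_distrib_right sum_distrib_left algebra_simps sum.distrib sum_negf)

lemma sum_fun_apply: "(\<Sum>i\<in>S. f i) v = (\<Sum>i\<in>S. f i v)" for f :: "'i \<Rightarrow> 'b \<Rightarrow> 'c::comm_monoid_add"
  by (induction S rule: infinite_finite_induct) simp_all

text \<open>The idempotents of S2 are isotropic, and the product of each with itself in S2 is the
  other one. Hence inside one copy only an x paired with a y reaches the tri parts, while products
  of two x parts land in the y part and conversely.\<close>

lemma gbracket_gel:
  assumes "d \<in> tri8" "e \<in> tri8"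
  shows "gbracket (gel d c x y) (gel e c' x' y') = gel
    (\<lambda>j v. d j (e j v) - e j (d j v) + (\<Sum>i\<in>UNIV. theta i (t8 (x i) (y' i)) j v + theta i (t8 (y i) (x' i)) j v))
    (\<lambda>j. \<Sum>i\<in>UNIV. (q8 (x i) (y' i) - q8 (y i) (x' i)) * tau (j - i))
    (\<lambda>k. d k (x' k) - e k (x k) + c k *s x' k - c' k *s x k + y (k + 1) \<star> y' (k + 2) - y' (k + 1) \<star> y (k + 2))
    (\<lambda>k. d k (y' k) - e k (y k) - c k *s y' k + c' k *s y k + x (k + 1) \<star> x' (k + 2) - x' (k + 1) \<star> x (k + 2))"
proof -
  let ?z = "\<lambda>x y i. \<chi> p. if snd p = (1::2) then x i $ fst p else y i $ fst p"
  have g: "gcoord1 (?z x y i) = x i" "gcoord2 (?z x y i) = y i" for x y :: "3 \<Rightarrow> 'a oct" and i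
    by (simp_all add: gcoord1_def gcoord2_def vec_eq_iff)
  have cm: "commutator (tri2_elem c j) (tri2_elem c' j) = 0" for j
    by (simp add: commutator_def fun_eq_iff tri2_elem_def vec2_eq_iff)
  note l = tri8_lin[OF assms(1)] tri8_lin[OF assms(2)]
  show ?thesis
    unfolding gel_def gbracket_def prod.case
  proof (intro arg_cong2[of _ _ _ _ Pair])
    show "(\<lambda>j. commutator (d j) (e j) + (\<Sum>i\<in>UNIV. iota_br8 i (?z x y i) (?z x' y' i) j)) =
      (\<lambda>j v. d j (e j v) - e j (d j v) + (\<Sum>i\<in>UNIV. theta i (t8 (x i) (y' i)) j v + theta i (t8 (y i) (x' i)) j v))"
      by (simp add: fun_eq_iff commutator_def sum_fun_apply iota_br8_eq g)
    show "(\<lambda>j. commutator (tri2_elem c j) (tri2_elem c' j) + (\<Sum>i\<in>UNIV. iota_br2 i (?z x y i) (?z x' y' i) j)) =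
      tri2_elem (\<lambda>j. \<Sum>i\<in>UNIV. (q8 (x i) (y' i) - q8 (y i) (x' i)) * tau (j - i))"
      unfolding cm
      by (simp add: fun_eq_iff sum_fun_apply iota_br2_eq g tri2_elem_def sum_3' vec2_eq_iff algebra_simps)
    show "(\<lambda>k. tensor_map (d k) id (?z x' y' k) - tensor_map (e k) id (?z x y k)
        + tensor_map id (tri2_elem c k) (?z x' y' k) - tensor_map id (tri2_elem c' k) (?z x y k)
        + tensor_mult (?z x y (k + 1)) (?z x' y' (k + 2)) - tensor_mult (?z x' y' (k + 1)) (?z x y (k + 2))) =
      ?z (\<lambda>k. d k (x' k) - e k (x k) + c k *s x' k - c' k *s x k + y (k + 1) \<star> y' (k + 2) - y' (k + 1) \<star> y (k + 2))
         (\<lambda>k. d k (y' k) - e k (y k) - c k *s y' k + c' k *s y k + x (k + 1) \<star> x' (k + 2) - x' (k + 1) \<star> x (k + 2))"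
      (is "?L = ?R")
    proof (rule ext)
      fix k
      have "?L k $ (a, g) = ?R k $ (a, g)" for a g
        unfolding vector_add_component vector_minus_component tensor_map_left[OF l(1)] tensor_map_left[OF l(2)]
          tensor_map_right tensor_mult_coords vec_lambda_beta fst_conv snd_conv if_True vec_nth_inverse
        using exhaust_2[of g] by (elim disjE) (simp_all only: if_True if_False two_neq_one vec_nth_inverse
            vector_add_component vector_minus_component vector_smult_component, simp_all)
      then show "?L k = ?R k" unfolding vec_eq_iff[of "?L k"] split_paired_All by blast
    qed
  qed
qed

section \<open>Homogeneous coordinates\<close>

definition oct_hom :: "3 \<Rightarrow> int ^ 4 \<Rightarrow> 'k::field oct \<Rightarrow> bool" where
  "oct_hom i v x \<longleftrightarrow> (\<forall>b. x $ b \<noteq> 0 \<longrightarrow> deg_iota i b = v)"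

lemma oct_hom_zero [simp]: "oct_hom i v 0"
  by (simp add: oct_hom_def)

lemma oct_hom_axis: "oct_hom i (deg_iota i b) (axis b k)"
  by (simp add: oct_hom_def)

lemma oct_hom_add: "oct_hom i v x \<Longrightarrow> oct_hom i v y \<Longrightarrow> oct_hom i v (x + y)"
  by (auto simp: oct_hom_def) (metis add.right_neutral)

lemma oct_hom_scale: "oct_hom i v x \<Longrightarrow> oct_hom i v (c *s x)"
  by (simp add: oct_hom_def)

lemma oct_hom_uminus: "oct_hom i v x \<Longrightarrow> oct_hom i v (- x)"
  by (simp add: oct_hom_def)

lemma oct_hom_diff: "oct_hom i v x \<Longrightarrow> oct_hom i v y \<Longrightarrow> oct_hom i v (x - y)"
  using oct_hom_add[OF _ oct_hom_uminus, of i v x y] by simp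

lemma deg_dual: "deg_iota i (dual b) = - deg_iota i b"
  by (cases b) (simp_all add: deg_iota.simps)

lemma oct_hom_q8:
  assumes "oct_hom i v x" "oct_hom i w y" "v + w \<noteq> 0"
  shows "q8 x y = 0"
proof -
  have "x $ b * y $ dual b = 0" for b
  proof (rule ccontr)
    assume "x $ b * y $ dual b \<noteq> 0"
    then have "deg_iota i b = v" "deg_iota i (dual b) = w" using assms by (auto simp: oct_hom_def)
    then have "w = - v" by (metis deg_dual)
    then show False using assms(3) by simp
  qed
  note this[of Oe1] this[of Oe2] this[of "Ou 0"] this[of "Ou 1"] this[of "Ou 2"]
    this[of "Ov 0"] this[of "Ov 1"] this[of "Ov 2"]
  then show ?thesis unfolding q8_coords dual.simps by (simp only: add_0_left)
qed

text \<open>One identity for each kind of term in \<open>S8_coords\<close>: the degrees are arranged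
  so that the product of copies i + 1 and i + 2 into copy i is graded.\<close>

lemma deg_star:
  "deg_iota (i + 1) Oe2 + deg_iota (i + 2) Oe2 = deg_iota i Oe1"
  "deg_iota (i + 1) Oe1 + deg_iota (i + 2) Oe1 = deg_iota i Oe2"
  "deg_iota (i + 1) (Ou k) + deg_iota (i + 2) (Ov k) = deg_iota i Oe1"
  "deg_iota (i + 1) (Ov k) + deg_iota (i + 2) (Ou k) = deg_iota i Oe2"
  "deg_iota (i + 1) Oe2 + deg_iota (i + 2) (Ou k) = deg_iota i (Ou k)"
  "deg_iota (i + 1) (Ou k) + deg_iota (i + 2) Oe1 = deg_iota i (Ou k)"
  "deg_iota (i + 1) Oe1 + deg_iota (i + 2) (Ov k) = deg_iota i (Ov k)"
  "deg_iota (i + 1) (Ov k) + deg_iota (i + 2) Oe2 = deg_iota i (Ov k)"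
  "deg_iota (i + 1) (Ov (k + 1)) + deg_iota (i + 2) (Ov (k + 2)) = deg_iota i (Ou k)"
  "deg_iota (i + 1) (Ov (k + 2)) + deg_iota (i + 2) (Ov (k + 1)) = deg_iota i (Ou k)"
  "deg_iota (i + 1) (Ou (k + 1)) + deg_iota (i + 2) (Ou (k + 2)) = deg_iota i (Ov k)"
  "deg_iota (i + 1) (Ou (k + 2)) + deg_iota (i + 2) (Ou (k + 1)) = deg_iota i (Ov k)"
  by (cases i rule: cases_3; cases k rule: cases_3;
      simp add: deg_iota.simps deg_simps vec4_eq_iff)+

lemma star_hom:
  assumes "oct_hom (i + 1) v x" "oct_hom (i + 2) w y"
  shows "oct_hom i (v + w) (x \<star> y)"
proof -
  have z: "x $ b * y $ c = 0"
    if "deg_iota (i + 1) b + deg_iota (i + 2) c = deg_iota i e" "deg_iota i e \<noteq> v + w" for b c e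
  proof (rule ccontr)
    assume "x $ b * y $ c \<noteq> 0"
    then have "deg_iota (i + 1) b = v" "deg_iota (i + 2) c = w" using assms by (auto simp: oct_hom_def)
    then show False using that by simp
  qed
  note zs = deg_star[THEN z]
  have "\<forall>e. deg_iota i e \<noteq> v + w \<longrightarrow> (x \<star> y) $ e = 0"
    unfolding all_oct_basis S8_coords by (simp add: zs)
  then show ?thesis by (auto simp: oct_hom_def)
qed

lemma star_hom':
  "oct_hom k v x \<Longrightarrow> oct_hom l w y \<Longrightarrow> k = i + 1 \<Longrightarrow> l = i + 2 \<Longrightarrow> oct_hom i (v + w) (x \<star> y)"
  by (simp add: star_hom)

definition end_hom :: "3 \<Rightarrow> int ^ 4 \<Rightarrow> ('k::field oct \<Rightarrow> 'k oct) \<Rightarrow> bool" where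
  "end_hom i v f \<longleftrightarrow> (\<forall>u z. oct_hom i u z \<longrightarrow> oct_hom i (v + u) (f z))"

text \<open>The degree of t is prescribed through copy 0 alone, but it governs all three components
  and their rotations: one component is built from the form, each of the others from two consecutive
  products.\<close>

lemma t8_hom:
  fixes x y :: "'k::field_char_0 oct"
  assumes x: "oct_hom i v x" and y: "oct_hom i w y"
  shows "end_hom j (v + w) (theta i (t8 x y) j)"
  unfolding end_hom_def
proof (intro allI impI)
  fix u and z :: "'k oct" assume z: "oct_hom j u z"
  have i: "i = i + 2 + 1" "i + 1 = i + 2 + 2" "i + 2 = i + 1 + 1" "i = i + 1 + 2"
    by (cases i rule: cases_3; simp)+
  consider "j = i" | "j = i + 1" | "j = i + 2"
    by (cases i rule: cases_3; cases j rule: cases_3) simp_all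
  then show "oct_hom j (v + w + u) (theta i (t8 x y) j z)"
  proof cases
    case 1
    have a: "oct_hom j (v + w + u) (q8 x z *s y)"
    proof (cases "v + u = 0")
      case True
      then have e: "v + w + u = w" by (metis add.assoc add.commute add.right_neutral)
      show ?thesis unfolding e using y 1 by (simp add: oct_hom_scale)
    qed (use oct_hom_q8[OF x, of u z] z 1 in simp)
    have b: "oct_hom j (v + w + u) (q8 y z *s x)"
    proof (cases "w + u = 0")
      case True
      then have e: "v + w + u = v" by (simp add: add.assoc)
      show ?thesis unfolding e using x 1 by (simp add: oct_hom_scale)
    qed (use oct_hom_q8[OF y, of u z] z 1 in simp)
    show ?thesis using oct_hom_diff[OF a b] by (simp add: theta_def 1 t8_simps)
  next
    case 2
    have q: "oct_hom j (v + w + u) ((q8 x y / 2) *s z)"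
      by (cases "v + w = 0") (use oct_hom_q8[OF x y] z in \<open>simp_all add: oct_hom_scale\<close>)
    have z': "oct_hom (i + 1) u z" using z by (simp only: 2)
    have "oct_hom (i + 1) ((w + u) + v) ((y \<star> z) \<star> x)"
      by (rule star_hom'[OF star_hom'[OF y z' i(1) i(2)] x i(3) i(4)])
    then have "oct_hom j (v + w + u) ((y \<star> z) \<star> x)" by (simp add: 2 ac_simps)
    then show ?thesis using oct_hom_diff[OF q] by (simp add: theta_def 2 t8_simps)
  next
    case 3
    have q: "oct_hom j (v + w + u) ((q8 x y / 2) *s z)"
      by (cases "v + w = 0") (use oct_hom_q8[OF x y] z in \<open>simp_all add: oct_hom_scale\<close>)
    have z': "oct_hom (i + 2) u z" using z by (simp only: 3)
    have "oct_hom (i + 2) (v + (u + w)) (x \<star> (z \<star> y))"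
      by (rule star_hom'[OF x star_hom'[OF z' y i(3) i(4)] i(1) i(2)])
    then have "oct_hom j (v + w + u) (x \<star> (z \<star> y))" by (simp add: 3 ac_simps)
    then show ?thesis using oct_hom_diff[OF q] by (simp add: theta_def 3 t8_simps)
  qed
qed

lemma tri8_zero_mem: "0 \<in> tri8" "(\<lambda>i v. 0) \<in> tri8"
  by (simp_all add: tri8_iff lin_def)

lemma tri8_add: "d \<in> tri8 \<Longrightarrow> e \<in> tri8 \<Longrightarrow> (\<lambda>i v. d i v + e i v) \<in> tri8"
  unfolding tri8_iff lin_def by (simp add: q8_add star_add vec.scale_right_distrib algebra_simps)

lemma tri8_plus: "d \<in> tri8 \<Longrightarrow> e \<in> tri8 \<Longrightarrow> d + e \<in> tri8"
  using tri8_add[of d e] by (simp add: plus_fun_def)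

lemma tri8_scale: "d \<in> tri8 \<Longrightarrow> (\<lambda>i v. k *s d i v) \<in> tri8"
  unfolding tri8_iff lin_def
  by (simp add: q8_scale star_scale vec.scale_right_distrib vector_smult_assoc mult.commute)

lemma tri8_sum: "(\<And>a. a \<in> S \<Longrightarrow> D a \<in> tri8) \<Longrightarrow> (\<lambda>i v. \<Sum>a\<in>S. D a i v) \<in> tri8"
proof (induction S rule: infinite_finite_induct)
  case (insert a S)
  then show ?case using tri8_add[of "D a" "\<lambda>i v. \<Sum>a\<in>S. D a i v"] by simp
qed (simp_all add: tri8_zero_mem)

lemma tri8_commutator:
  assumes "d \<in> tri8" "e \<in> tri8"
  shows "(\<lambda>i v. d i (e i v) - e i (d i v)) \<in> tri8"
proof -
  note l = tri8_lin[OF assms(1)] tri8_lin[OF assms(2)]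
  note k = tri8_skew[OF assms(1)] tri8_skew[OF assms(2)]
  note m = tri8_mult[OF assms(1)] tri8_mult[OF assms(2)]
  have "lin (\<lambda>v. d i (e i v) - e i (d i v))" for i
    unfolding lin_def by (simp add: linD[OF l(1)] linD[OF l(2)] vec.scale_right_diff_distrib algebra_simps)
  moreover have "d i (e i (x \<star> y)) - e i (d i (x \<star> y)) =
    (d (i + 1) (e (i + 1) x) - e (i + 1) (d (i + 1) x)) \<star> y + x \<star> (d (i + 2) (e (i + 2) y) - e (i + 2) (d (i + 2) y))"
    for i x y
    unfolding m(1)[of i x y] m(2)[of i x y] linD(1)[OF l(1)] linD(1)[OF l(2)] m star_minus
    by (simp add: algebra_simps)
  ultimately show ?thesis
    unfolding tri8_iff by (simp add: q8_minus k)
qed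

definition tri_coeff :: "(3 \<Rightarrow> 'k::field oct \<Rightarrow> 'k oct) \<Rightarrow> oct_basis \<Rightarrow> oct_basis \<Rightarrow> 'k" where
  "tri_coeff d b c = (d 0 (axis b 1)) $ c / 2"

lemma q8_sum_dual: "q8 x v = (\<Sum>c\<in>UNIV. x $ c * v $ dual c)"
  by (simp add: sum_oct_basis q8_coords)

text \<open>
  The derivation d - d' below has vanishing component 0, because a skew map f is half the sum of
  the maps sigma(b*, f b) over dual bases.
\<close>

lemma tri8_expand:
  fixes d :: "3 \<Rightarrow> 'k::field_char_0 oct \<Rightarrow> 'k oct"
  assumes d: "d \<in> tri8"
  shows "d = (\<lambda>i v. \<Sum>b\<in>UNIV. \<Sum>c\<in>UNIV. tri_coeff d b c *s t8 (axis (dual b) 1) (axis c 1) i v)"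
    (is "d = ?S")
proof -
  let ?D = "\<lambda>i v. d i v + (-1) *s ?S i v"
  have S: "?S \<in> tri8"
    by (intro tri8_sum tri8_scale t8_tri8)
  have D: "?D \<in> tri8" by (rule tri8_add[OF d tri8_scale[OF S, of "-1"]])
  have "?S 0 v = d 0 v" for v
  proof -
    have "?S 0 v $ a = d 0 v $ a" for a
    proof -
      have "?S 0 v $ a = (\<Sum>b\<in>UNIV. \<Sum>c\<in>UNIV. (d 0 (axis b 1) $ c / 2) *
          (v $ b * (if a = c then 1 else 0) - v $ dual c * (if a = dual b then 1 else 0)))"
        by (simp add: tri_coeff_def t8_simps q8_axis sum_component diff_divide_distrib algebra_simps)
      also have "\<dots> = (\<Sum>b\<in>UNIV. \<Sum>c\<in>UNIV. if a = c then (d 0 (axis b 1) $ c / 2) * v $ b else 0)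
          - (\<Sum>b\<in>UNIV. \<Sum>c\<in>UNIV. if a = dual b then (d 0 (axis b 1) $ c / 2) * v $ dual c else 0)"
        unfolding sum_subtractf[symmetric] by (intro sum.cong refl) (simp add: algebra_simps)
      also have "(\<Sum>b\<in>UNIV. \<Sum>c\<in>UNIV. if a = c then (d 0 (axis b 1) $ c / 2) * v $ b else 0) = d 0 v $ a / 2"
        by (subst (2) lin_expand[OF tri8_lin[OF d]]) (simp add: sum_component sum_divide_distrib mult.commute)
      also have "(\<Sum>b\<in>UNIV. \<Sum>c\<in>UNIV. if a = dual b then (d 0 (axis b 1) $ c / 2) * v $ dual c else 0) =
          (\<Sum>b\<in>UNIV. if b = dual a then (\<Sum>c\<in>UNIV. (d 0 (axis b 1) $ c / 2) * v $ dual c) else 0)"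
      proof (rule sum.cong[OF refl])
        fix b
        have "a = dual b \<longleftrightarrow> b = dual a" by (metis dual_dual)
        then show "(\<Sum>c\<in>UNIV. if a = dual b then (d 0 (axis b 1) $ c / 2) * v $ dual c else 0) =
          (if b = dual a then (\<Sum>c\<in>UNIV. (d 0 (axis b 1) $ c / 2) * v $ dual c) else 0)" by simp
      qed
      also have "\<dots> = q8 (d 0 (axis (dual a) 1)) v / 2"
      proof -
        have "(\<Sum>c\<in>UNIV. (x $ c / 2) * v $ dual c) = q8 x v / 2" for x
          by (simp add: q8_sum_dual sum_divide_distrib)
        then show ?thesis by simp
      qed
      also have "q8 (d 0 (axis (dual a) 1)) v = - (d 0 v $ a)"
        using tri8_skew[OF d, of 0 "axis (dual a) 1" v] by (simp add: q8_axis)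
      finally show ?thesis by simp
    qed
    then show ?thesis by (simp add: vec_eq_iff)
  qed
  then have "?D 0 v = 0" for v by simp
  then have "?D = 0" using tri8_zero[OF D] by blast
  then have "d i v + (-1) *s ?S i v = 0" for i v by (simp only: fun_eq_iff zero_fun_apply)
  then have "d i v = ?S i v" for i v by simp
  then show ?thesis by (intro ext)
qed

lemma tri8_hom_coeff:
  assumes "end_hom 0 v (d 0)" "tri_coeff d b c \<noteq> 0"
  shows "deg_iota 0 (dual b) + deg_iota 0 c = v"
proof -
  have "oct_hom 0 (v + deg_iota 0 b) (d 0 (axis b 1))"
    using assms(1) oct_hom_axis unfolding end_hom_def by blast
  then have "deg_iota 0 c = v + deg_iota 0 b" using assms(2) by (simp add: oct_hom_def tri_coeff_def)
  then show ?thesis by (simp add: deg_dual)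
qed

lemma oct_hom_sum: "(\<And>a. a \<in> S \<Longrightarrow> oct_hom i v (f a)) \<Longrightarrow> oct_hom i v (\<Sum>a\<in>S. f a)"
  by (induction S rule: infinite_finite_induct) (simp_all add: oct_hom_add)

text \<open>By \<open>tri8_hom_coeff\<close> d is a combination of elements t of degree v, and each
  of these is homogeneous in every copy. So homogeneity has to be required at index 0 only.\<close>

lemma tri8_hom_all:
  fixes d :: "3 \<Rightarrow> 'k::field_char_0 oct \<Rightarrow> 'k oct"
  assumes d: "d \<in> tri8" and h: "end_hom 0 v (d 0)"
  shows "end_hom j v (d j)"
  unfolding end_hom_def
proof (intro allI impI)
  fix u and z :: "'k oct" assume z: "oct_hom j u z"
  have "oct_hom j (v + u) (tri_coeff d b c *s t8 (axis (dual b) 1) (axis c 1) j z)" for b c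
  proof (cases "tri_coeff d b c = 0")
    case False
    have "end_hom j (deg_iota 0 (dual b) + deg_iota 0 c) (theta 0 (t8 (axis (dual b) 1) (axis c (1::'k))) j)"
      by (rule t8_hom) (rule oct_hom_axis)+
    then show ?thesis
      using z tri8_hom_coeff[OF h False] by (simp add: end_hom_def theta_def oct_hom_scale)
  qed simp
  then show "oct_hom j (v + u) (d j z)"
    by (subst tri8_expand[OF d]) (intro oct_hom_sum)
qed

section \<open>The grading by Z2 x Z^4\<close>

lemma module_gscale: "module (gscale :: 'k::field \<Rightarrow> 'k gvec \<Rightarrow> 'k gvec)"
  by unfold_locales
    (auto simp: gscale_def fun_eq_iff vec.scale_right_distrib vec.scale_left_distrib vector_smult_assoc)

lemma alg_scale_g [simp]: "alg_scale g_S8_S2 = gscale" "alg_mult g_S8_S2 = gbracket"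
  by (simp_all add: g_S8_S2_def)

lemma tri2_scalars_zero [simp]: "0 \<in> tri2_scalars"
  by (simp add: tri2_scalars_def)

lemma tri2_scalars_scale: "c \<in> tri2_scalars \<Longrightarrow> (\<lambda>i. k * c i) \<in> tri2_scalars"
  by (simp add: tri2_scalars_def flip: distrib_left)

lemma tri2_scalars_add:
  assumes "c \<in> tri2_scalars" "c' \<in> tri2_scalars"
  shows "c + c' \<in> tri2_scalars"
proof -
  have "(c + c') 0 + (c + c') 1 + (c + c') 2 = (c 0 + c 1 + c 2) + (c' 0 + c' 1 + c' 2)" by simp
  then show ?thesis using assms unfolding tri2_scalars_def mem_Collect_eq by simp
qed

lemma tri2_scalars_sum: "(\<And>a. a \<in> S \<Longrightarrow> K a \<in> tri2_scalars) \<Longrightarrow> (\<lambda>i. \<Sum>a\<in>S. K a i) \<in> tri2_scalars"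
proof (induction S rule: infinite_finite_induct)
  case (insert a S)
  then show ?case using tri2_scalars_add[of "K a" "\<lambda>i. \<Sum>a\<in>S. K a i"] by (simp add: plus_fun_def)
qed (simp_all add: tri2_scalars_def)

text \<open>A description by conditions on coordinates; \<open>Z4_component_eq\<close> identifies it
  with the span that defines the component. The tri(S2) part sits in degree 0.\<close>

definition Zc :: "int ^ 4 \<Rightarrow> 'k::field gvec set" where
  "Zc v = {gel d c x y |d c x y. d \<in> tri8 \<and> c \<in> tri2_scalars \<and> end_hom 0 v (d 0) \<and> (v \<noteq> 0 \<longrightarrow> c = 0) \<and>
     (\<forall>i. oct_hom i v (x i)) \<and> (\<forall>i. oct_hom i v (y i))}"

lemma gel_in_Zc: "gel d c x y \<in> Zc v \<longleftrightarrow> d \<in> tri8 \<and> c \<in> tri2_scalars \<and> end_hom 0 v (d 0) \<and> (v \<noteq> 0 \<longrightarrow> c = 0) \<and>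
     (\<forall>i. oct_hom i v (x i)) \<and> (\<forall>i. oct_hom i v (y i))"
  unfolding Zc_def mem_Collect_eq gel_eq_iff by blast

lemma ZcE:
  assumes "w \<in> Zc v"
  obtains d c x y where "w = gel d c x y" "d \<in> tri8" "c \<in> tri2_scalars" "end_hom 0 v (d 0)"
    "v \<noteq> 0 \<Longrightarrow> c = 0" "\<And>i. oct_hom i v (x i)" "\<And>i. oct_hom i v (y i)"
  using assms unfolding Zc_def by blast

lemma end_hom_zero: "end_hom i v (\<lambda>x. 0)" "end_hom i v 0"
  by (simp_all add: end_hom_def)

lemma end_hom_add: "end_hom i v f \<Longrightarrow> end_hom i v g \<Longrightarrow> end_hom i v (f + g)"
  by (simp add: end_hom_def oct_hom_add)

lemma end_hom_scale: "end_hom i v f \<Longrightarrow> end_hom i v (\<lambda>x. k *s f x)"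
  by (simp add: end_hom_def oct_hom_scale)

lemma Zc_subspace: "module.subspace gscale (Zc v :: 'k::field gvec set)"
proof -
  interpret module "gscale :: 'k \<Rightarrow> 'k gvec \<Rightarrow> 'k gvec" by (rule module_gscale)
  show ?thesis
    unfolding subspace_def
  proof (intro conjI ballI allI)
    show "0 \<in> (Zc v :: 'k gvec set)"
      unfolding gel_zero gel_in_Zc by (simp add: tri8_zero_mem end_hom_zero)
    fix w :: "'k gvec" assume "w \<in> Zc v"
    then obtain d c x y where w: "w = gel d c x y" and h: "gel d c x y \<in> Zc v" by (elim ZcE) (simp add: gel_in_Zc)
    show "gscale k w \<in> Zc v" for k
      using h unfolding w gel_scale gel_in_Zc
      by (simp add: tri8_scale tri2_scalars_scale end_hom_scale oct_hom_scale zero_fun_def)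
    fix w' :: "'k gvec" assume "w' \<in> Zc v"
    then obtain d' c' x' y' where w': "w' = gel d' c' x' y'" and h': "gel d' c' x' y' \<in> Zc v"
      by (elim ZcE) (simp add: gel_in_Zc)
    show "w + w' \<in> Zc v"
      using h h' unfolding w w' gel_add gel_in_Zc
      by (simp add: tri8_plus tri2_scalars_add end_hom_add oct_hom_add)
  qed
qed

lemma tri2_is_elem: "d \<in> tri S2_mult q2 \<Longrightarrow> \<exists>c \<in> tri2_scalars. in_tri2 d = gel 0 c 0 0"
  for d :: "3 \<Rightarrow> 'k::field_char_0 ^ 2 \<Rightarrow> 'k ^ 2"
  unfolding tri2_iff by (auto simp: in_tri2_def gel_def vec_eq_iff fun_eq_iff)

lemma in_tri8_gel: "in_tri8 d = gel d 0 0 0"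
  by (simp add: in_tri8_def gel_def tri2_elem_def vec_eq_iff forall_2 fun_eq_iff)

lemma iota_gel: "iota i (tensor x s) = gel 0 0 (\<lambda>j. if j = i then s $ 1 *s x else 0) (\<lambda>j. if j = i then s $ 2 *s x else 0)"
proof -
  have "tensor x s $ (a, b) = (if b = 1 then s $ 1 * x $ a else s $ 2 * x $ a)" for a b
    using exhaust_2[of b] by (auto simp: tensor_def)
  then show ?thesis
    by (simp add: iota_def gel_def tri2_elem_def vec2_eq_iff fun_eq_iff vec_eq_iff split_paired_All)
qed

lemma gel_sum: "(\<Sum>a\<in>S. gel (D a) (K a) (X a) (Y a)) = gel (\<lambda>i v. \<Sum>a\<in>S. D a i v) (\<lambda>i. \<Sum>a\<in>S. K a i) (\<lambda>i. \<Sum>a\<in>S. X a i) (\<lambda>i. \<Sum>a\<in>S. Y a i)"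
proof (induction S rule: infinite_finite_induct)
  case (insert a S)
  then show ?case by (simp add: gel_add plus_fun_def)
qed (simp_all add: gel_zero zero_fun_def)

text \<open>The tri(S8) part of an element of \<open>Zc v\<close> is a sum of generators by
  \<open>tri8_expand\<close>, where \<open>tri8_hom_coeff\<close> removes the terms of other
  degrees; the parts in the copies are expanded in the canonical basis.\<close>

lemma Z4_component_eq: "Z4_component v = (Zc v :: 'k::field_char_0 gvec set)"
proof -
  interpret module "gscale :: 'k \<Rightarrow> 'k gvec \<Rightarrow> 'k gvec" by (rule module_gscale)
  show ?thesis
    unfolding Z4_component_def
  proof (rule equalityI[OF span_minimal])
    show "Z4_generators v \<subseteq> (Zc v :: 'k gvec set)"
    proof
      fix w :: "'k gvec" assume "w \<in> Z4_generators v"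
      then consider (iota) i b s where "w = iota i (tensor (axis b 1) s)" "deg_iota i b = v"
        | (t2) d where "w = in_tri2 d" "d \<in> tri S2_mult q2" "v = 0"
        | (t8) b c where "w = in_tri8 (t8 (axis b 1) (axis c 1))" "deg_iota 0 b + deg_iota 0 c = v"
        unfolding Z4_generators_def by blast
      then show "w \<in> Zc v"
      proof cases
        case iota
        then show ?thesis
          using oct_hom_axis[of i b "1::'k"]
          by (auto simp: iota_gel gel_in_Zc tri8_zero_mem end_hom_zero oct_hom_scale)
      next
        case t2
        then obtain c where "c \<in> tri2_scalars" "w = gel 0 c 0 0" using tri2_is_elem by blast
        then show ?thesis using t2 by (simp add: gel_in_Zc tri8_zero_mem end_hom_zero)
      next
        case t8
        have "end_hom 0 v (theta 0 (tri_t S8_mult q8 (axis b 1) (axis c (1::'k))) 0)"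
          unfolding t8(2)[symmetric] by (rule t8_hom) (rule oct_hom_axis)+
        then show ?thesis unfolding t8(1) in_tri8_gel gel_in_Zc by (simp add: t8_tri8 theta_def)
      qed
    qed
    show "subspace (Zc v :: 'k gvec set)" by (rule Zc_subspace)
    show "(Zc v :: 'k gvec set) \<subseteq> span (Z4_generators v)"
    proof
      fix w :: "'k gvec" assume "w \<in> Zc v"
      then obtain d c x y where w: "w = gel d c x y" and d: "d \<in> tri8" and c: "c \<in> tri2_scalars"
        and h: "end_hom 0 v (d 0)" and vc: "v \<noteq> 0 \<Longrightarrow> c = 0"
        and x: "\<And>i. oct_hom i v (x i)" and y: "\<And>i. oct_hom i v (y i)" by (elim ZcE) blast
      have "gel d 0 0 0 \<in> span (Z4_generators v)"
      proof -
        have "gel d 0 0 0 = (\<Sum>b\<in>UNIV. \<Sum>e\<in>UNIV. gscale (tri_coeff d b e) (in_tri8 (t8 (axis (dual b) 1) (axis e 1))))"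
          unfolding in_tri8_gel gel_scale gel_sum by (subst tri8_expand[OF d]) (simp add: zero_fun_def)
        moreover have "gscale (tri_coeff d b e) (in_tri8 (t8 (axis (dual b) 1) (axis e 1))) \<in> span (Z4_generators v)" for b e
        proof (cases "tri_coeff d b e = 0")
          case False
          then have "in_tri8 (t8 (axis (dual b) 1) (axis e 1)) \<in> (Z4_generators v :: 'k gvec set)"
            using tri8_hom_coeff[OF h False] unfolding Z4_generators_def by blast
          then show ?thesis by (intro span_scale span_base)
        qed (simp add: span_zero)
        ultimately show ?thesis by (simp add: span_sum)
      qed
      moreover have "gel 0 c 0 0 \<in> span (Z4_generators v)"
      proof (cases "v = 0")
        case True
        have "gel 0 c 0 0 = in_tri2 (tri2_elem c)"
          by (simp add: in_tri2_def gel_def vec_eq_iff fun_eq_iff)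
        then have "gel 0 c 0 0 \<in> Z4_generators v"
          using True tri2_elem_mem[OF c] unfolding Z4_generators_def by blast
        then show ?thesis by (rule span_base)
      qed (use vc in \<open>simp add: span_zero flip: gel_zero\<close>)
      moreover have "gel 0 0 x y \<in> span (Z4_generators v)"
      proof -
        let ?g = "\<lambda>i b. iota i (tensor (axis b 1) (vector [x i $ b, y i $ b]))"
        have e: "(\<Sum>i\<in>UNIV. \<Sum>b\<in>UNIV. if j = i then z i $ b *s axis b (1::'k) else 0) = z j"
          for j and z :: "3 \<Rightarrow> 'k oct"
        proof -
          have "(\<Sum>i\<in>UNIV. \<Sum>b\<in>UNIV. if j = i then z i $ b *s axis b (1::'k) else 0)
              = (\<Sum>i\<in>UNIV. if j = i then (\<Sum>b\<in>UNIV. z i $ b *s axis b (1::'k)) else 0)"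
            by (rule sum.cong) auto
          then show ?thesis by (simp add: basis_expansion)
        qed
        have "gel 0 0 x y = (\<Sum>i\<in>UNIV. \<Sum>b\<in>UNIV. ?g i b)"
          unfolding iota_gel gel_sum vector_2' e by (simp add: zero_fun_def)
        moreover have "?g i b \<in> span (Z4_generators v)" for i b
        proof (cases "deg_iota i b = v")
          case True
          then have "?g i b \<in> Z4_generators v" unfolding Z4_generators_def by blast
          then show ?thesis by (rule span_base)
        next
          case False
          then have "x i $ b = 0" "y i $ b = 0" using x y by (auto simp: oct_hom_def)
          then have "?g i b = 0" by (simp add: iota_gel gel_zero zero_fun_def cong: if_cong)
          then show ?thesis by (simp add: span_zero)
        qed
        ultimately show ?thesis by (simp add: span_sum)
      qed
      moreover have "w = gel d 0 0 0 + gel 0 c 0 0 + gel 0 0 x y" by (simp add: w gel_add)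
      ultimately show "w \<in> span (Z4_generators v)" by (simp add: span_add)
    qed
  qed
qed

text \<open>The fixed vectors of \<open>rho\<close> in \<open>Zc v\<close>, with \<open>G1\<close>
  below for the eigenvalue -1: by \<open>rho_gel\<close> the map exchanges x and y and changes the
  sign of c.\<close>

definition G0 :: "int ^ 4 \<Rightarrow> 'k::field gvec set" where
  "G0 v = {gel d 0 x x |d x. d \<in> tri8 \<and> end_hom 0 v (d 0) \<and> (\<forall>i. oct_hom i v (x i))}"

definition G1 :: "int ^ 4 \<Rightarrow> 'k::field gvec set" where
  "G1 v = {gel 0 c x (- x) |c x. c \<in> tri2_scalars \<and> (v \<noteq> 0 \<longrightarrow> c = 0) \<and> (\<forall>i. oct_hom i v (x i))}"

lemma gel_uminus: "- gel d c x y = gel (- d) (- c) (- x) (- y)"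
  by (simp add: gel_def tri2_elem_def vec2_eq_iff vec_eq_iff fun_eq_iff)

lemma self_neg: "a = - a \<longleftrightarrow> a = 0" for a :: "'k::field_char_0"
proof
  assume "a = - a"
  then have "a + a = 0" by (simp add: eq_neg_iff_add_eq_0)
  then show "a = 0" by (simp flip: mult_2)
qed simp

lemma neg_eq_self: "- a = a \<longleftrightarrow> a = 0" for a :: "'k::field_char_0"
  unfolding self_neg[of a, symmetric] by (rule eq_commute)

lemma self_neg_vec: "a = - a \<longleftrightarrow> a = 0" for a :: "'k::field_char_0 ^ 'n"
  by (simp add: vec_eq_iff self_neg)

lemma rho_fixed: "rho (gel d c x y) = gel d c x y \<longleftrightarrow> c = 0 \<and> x = y"
  for d :: "3 \<Rightarrow> 'k::field_char_0 oct \<Rightarrow> 'k oct"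
  unfolding rho_gel gel_eq_iff by (auto simp: fun_eq_iff self_neg neg_eq_self)

lemma rho_anti: "rho (gel d c x y) = - gel d c x y \<longleftrightarrow> d = 0 \<and> y = - x"
  for d :: "3 \<Rightarrow> 'k::field_char_0 oct \<Rightarrow> 'k oct"
  unfolding rho_gel gel_eq_iff gel_uminus by (auto simp: fun_eq_iff self_neg_vec)

lemma Gamma3_0: "Gamma3 (0, v) = (G0 v :: 'k::field_char_0 gvec set)"
proof (intro equalityI subsetI)
  fix w :: "'k gvec" assume "w \<in> Gamma3 (0, v)"
  then have z: "w \<in> Zc v" and r: "rho w = w" by (simp_all add: Gamma3_def Z4_component_eq)
  from z obtain d c x y where "w = gel d c x y" "gel d c x y \<in> Zc v" by (elim ZcE) (simp add: gel_in_Zc)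
  moreover then have "c = 0" "x = y" using r by (simp_all add: rho_fixed)
  ultimately show "w \<in> G0 v" unfolding G0_def gel_in_Zc by blast
next
  fix w :: "'k gvec" assume "w \<in> G0 v"
  then obtain d x where "w = gel d 0 x x" "d \<in> tri8" "end_hom 0 v (d 0)" "\<forall>i. oct_hom i v (x i)"
    unfolding G0_def by blast
  then show "w \<in> Gamma3 (0, v)" by (simp add: Gamma3_def Z4_component_eq gel_in_Zc rho_fixed)
qed

lemma Gamma3_1: "Gamma3 (1, v) = (G1 v :: 'k::field_char_0 gvec set)"
proof (intro equalityI subsetI)
  fix w :: "'k gvec" assume "w \<in> Gamma3 (1, v)"
  then have z: "w \<in> Zc v" and r: "rho w = - w" by (simp_all add: Gamma3_def Z4_component_eq)
  from z obtain d c x y where "w = gel d c x y" "gel d c x y \<in> Zc v" by (elim ZcE) (simp add: gel_in_Zc)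
  moreover then have "d = 0" "y = - x" using r by (simp_all add: rho_anti)
  ultimately show "w \<in> G1 v" unfolding G1_def gel_in_Zc by blast
next
  fix w :: "'k gvec" assume "w \<in> G1 v"
  then obtain c x where "w = gel 0 c x (- x)" "c \<in> tri2_scalars" "v \<noteq> 0 \<longrightarrow> c = 0" "\<forall>i. oct_hom i v (x i)"
    unfolding G1_def by blast
  then show "w \<in> Gamma3 (1, v)"
    by (simp add: Gamma3_def Z4_component_eq gel_in_Zc rho_anti tri8_zero_mem end_hom_zero oct_hom_uminus)
qed

lemma f4_carrier: "alg_carrier (f4 :: ('k::field_char_0, 'k gvec) algebra_struct) = {gel d 0 x x |d x. d \<in> tri8}"
proof (intro equalityI subsetI)
  fix w :: "'k gvec" assume "w \<in> alg_carrier f4"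
  then have z: "w \<in> alg_carrier g_S8_S2" and r: "rho w = w" by (simp_all add: f4_def)
  from z obtain d c x y where "w = gel d c x y" "d \<in> tri8" unfolding g_carrier by blast
  moreover then have "c = 0" "x = y" using r by (simp_all add: rho_fixed)
  ultimately show "w \<in> {gel d 0 x x |d x. d \<in> tri8}" by blast
next
  fix w :: "'k gvec" assume "w \<in> {gel d 0 x x |d x. d \<in> tri8}"
  then obtain d x where w: "w = gel d 0 x x" "d \<in> tri8" by blast
  then have "w \<in> alg_carrier g_S8_S2" unfolding g_carrier using tri2_scalars_zero by blast
  then show "w \<in> alg_carrier f4" using w by (simp add: f4_def rho_fixed)
qed

lemma alg_scale_f4 [simp]: "alg_scale f4 = gscale" "alg_mult f4 = gbracket"
  by (simp_all add: f4_def)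

lemma f4_cartan_eq: "f4_cartan_grading v = (G0 v :: 'k::field_char_0 gvec set)"
proof -
  have "f4_cartan_grading v = (Gamma3 (0, v) \<inter> alg_carrier g_S8_S2 :: 'k gvec set)"
    unfolding f4_cartan_grading_def f4_def Gamma3_def by auto
  moreover have "(G0 v :: 'k gvec set) \<subseteq> alg_carrier g_S8_S2"
    unfolding G0_def g_carrier using tri2_scalars_zero by blast
  ultimately show ?thesis by (auto simp: Gamma3_0)
qed

lemma bracket_D_tri8:
  fixes d e :: "3 \<Rightarrow> 'k::field_char_0 oct \<Rightarrow> 'k oct"
  assumes "d \<in> tri8" "e \<in> tri8"
  shows "(\<lambda>j v. d j (e j v) - e j (d j v) + (\<Sum>i\<in>UNIV. theta i (t8 (x i) (y' i)) j v + theta i (t8 (y i) (x' i)) j v)) \<in> tri8"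
proof -
  have "(\<lambda>j v. \<Sum>i\<in>UNIV. theta i (t8 (x i) (y' i)) j v + theta i (t8 (y i) (x' i)) j v) \<in> tri8"
    by (rule tri8_sum) (rule tri8_add[OF theta_tri8[OF t8_tri8] theta_tri8[OF t8_tri8]])
  then show ?thesis using tri8_add[OF tri8_commutator[OF assms]] by simp
qed

lemma tau_scalars: "(\<lambda>j. tau (j - i)) \<in> tri2_scalars"
  by (cases i rule: cases_3) (simp_all add: tri2_scalars_def tau_def)

lemma bracket_C_scalars: "(\<lambda>j. \<Sum>i\<in>UNIV. s i * tau (j - i)) \<in> tri2_scalars"
  by (rule tri2_scalars_sum) (rule tri2_scalars_scale[OF tau_scalars])

lemma gel_in_g: "gel d c x y \<in> alg_carrier g_S8_S2 \<longleftrightarrow> d \<in> tri8 \<and> c \<in> tri2_scalars"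
  for d :: "3 \<Rightarrow> 'k::field_char_0 oct \<Rightarrow> 'k oct"
  unfolding g_carrier mem_Collect_eq gel_eq_iff by blast

lemma gbracket_carrier:
  fixes w w' :: "'k::field_char_0 gvec"
  assumes "w \<in> alg_carrier g_S8_S2" "w' \<in> alg_carrier g_S8_S2"
  shows "gbracket w w' \<in> alg_carrier g_S8_S2"
proof -
  obtain d c x y where w: "w = gel d c x y" "d \<in> tri8" using assms(1) unfolding g_carrier by blast
  obtain d' c' x' y' where w': "w' = gel d' c' x' y'" "d' \<in> tri8" using assms(2) unfolding g_carrier by blast
  show ?thesis
    unfolding w(1) w'(1) gbracket_gel[OF w(2) w'(2)] gel_in_g
    by (intro conjI bracket_D_tri8[OF w(2) w'(2)] bracket_C_scalars)
qed

lemma rho_gbracket: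
  fixes w w' :: "'k::field_char_0 gvec"
  assumes "w \<in> alg_carrier g_S8_S2" "w' \<in> alg_carrier g_S8_S2"
  shows "rho (gbracket w w') = gbracket (rho w) (rho w')"
proof -
  obtain d c x y where w: "w = gel d c x y" "d \<in> tri8" using assms(1) unfolding g_carrier by blast
  obtain d' c' x' y' where w': "w' = gel d' c' x' y'" "d' \<in> tri8" using assms(2) unfolding g_carrier by blast
  show ?thesis
    unfolding w(1) w'(1) gbracket_gel[OF w(2) w'(2)] rho_gel gel_eq_iff
    by (simp add: fun_eq_iff sum_3' algebra_simps)
qed

lemma end_hom_commutator:
  fixes f g :: "'k::field oct \<Rightarrow> 'k oct"
  assumes "end_hom j v f" "end_hom j w g"
  shows "end_hom j (v + w) (\<lambda>x. f (g x) - g (f x))"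
  unfolding end_hom_def
proof (intro allI impI)
  fix u and z :: "'k oct" assume z: "oct_hom j u z"
  have "oct_hom j (v + (w + u)) (f (g z))" "oct_hom j (w + (v + u)) (g (f z))"
    using assms z unfolding end_hom_def by blast+
  then have "oct_hom j (v + w + u) (f (g z))" "oct_hom j (v + w + u) (g (f z))" by (simp_all add: ac_simps)
  then show "oct_hom j (v + w + u) (f (g z) - g (f z))" by (rule oct_hom_diff)
qed

lemma end_hom_sum: "(\<And>a. a \<in> S \<Longrightarrow> end_hom i v (f a)) \<Longrightarrow> end_hom i v (\<lambda>x. \<Sum>a\<in>S. f a x)"
  unfolding end_hom_def by (blast intro: oct_hom_sum)

lemma gbracket_Zc:
  fixes a b :: "'k::field_char_0 gvec"
  assumes "a \<in> Zc v" "b \<in> Zc w"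
  shows "gbracket a b \<in> Zc (v + w)"
proof -
  obtain d c x y where a: "a = gel d c x y" and d: "d \<in> tri8" and h: "end_hom 0 v (d 0)"
    and vc: "v \<noteq> 0 \<Longrightarrow> c = 0" and x: "\<And>i. oct_hom i v (x i)" and y: "\<And>i. oct_hom i v (y i)"
    using assms(1) by (elim ZcE) blast
  obtain e c' x' y' where b: "b = gel e c' x' y'" and e: "e \<in> tri8" and h': "end_hom 0 w (e 0)"
    and wc: "w \<noteq> 0 \<Longrightarrow> c' = 0" and x': "\<And>i. oct_hom i w (x' i)" and y': "\<And>i. oct_hom i w (y' i)"
    using assms(2) by (elim ZcE) blast
  note dh = tri8_hom_all[OF d h] and eh = tri8_hom_all[OF e h']
  have s: "oct_hom k (v + w) (c k *s z)" if "oct_hom k w z" for k z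
    using that vc by (cases "v = 0") (simp_all add: oct_hom_scale)
  have s': "oct_hom k (v + w) (c' k *s z)" if "oct_hom k v z" for k z
    using that wc by (cases "w = 0") (simp_all add: oct_hom_scale)
  have dz: "oct_hom k (v + w) (d k z)" if "oct_hom k w z" for k z
    using dh that unfolding end_hom_def by blast
  have ez: "oct_hom k (v + w) (e k z)" if "oct_hom k v z" for k z
    using eh that unfolding end_hom_def by (metis add.commute)
  have st: "oct_hom k (v + w) (p (k + 1) \<star> q (k + 2))" "oct_hom k (v + w) (q (k + 1) \<star> p (k + 2))"
    if "\<And>i. oct_hom i v (p i)" "\<And>i. oct_hom i w (q i)" for k p q
  proof -
    show "oct_hom k (v + w) (p (k + 1) \<star> q (k + 2))" by (rule star_hom[OF that(1) that(2)])
    show "oct_hom k (v + w) (q (k + 1) \<star> p (k + 2))"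
      using star_hom[OF that(2) that(1)] by (metis add.commute)
  qed
  have "end_hom 0 (v + w) (\<lambda>z. \<Sum>i\<in>UNIV. theta i (t8 (x i) (y' i)) 0 z + theta i (t8 (y i) (x' i)) 0 z)"
  proof (rule end_hom_sum)
    fix i :: 3
    show "end_hom 0 (v + w) (\<lambda>z. theta i (t8 (x i) (y' i)) 0 z + theta i (t8 (y i) (x' i)) 0 z)"
      using end_hom_add[OF t8_hom[OF x y'] t8_hom[OF y x']] by (simp add: plus_fun_def)
  qed
  from end_hom_add[OF end_hom_commutator[OF h h'] this]
  have D: "end_hom 0 (v + w) (\<lambda>z. d 0 (e 0 z) - e 0 (d 0 z) +
      (\<Sum>i\<in>UNIV. theta i (t8 (x i) (y' i)) 0 z + theta i (t8 (y i) (x' i)) 0 z))"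
    by (simp add: plus_fun_def)
  have C: "(\<lambda>j. \<Sum>i\<in>UNIV. (q8 (x i) (y' i) - q8 (y i) (x' i)) * tau (j - i)) = 0" if "v + w \<noteq> 0"
    using oct_hom_q8[OF x y' that] oct_hom_q8[OF y x' that] by (simp add: fun_eq_iff)
  show ?thesis
    unfolding a b gbracket_gel[OF d e] gel_in_Zc
  proof (intro conjI allI impI, goal_cases)
    case 1
    show ?case by (rule bracket_D_tri8[OF d e])
  next
    case 2
    show ?case by (rule bracket_C_scalars)
  next
    case 3
    show ?case by (rule D)
  next
    case 4
    then show ?case by (rule C)
  next
    case (5 i)
    show ?case by (intro oct_hom_add oct_hom_diff dz ez s s' st x y x' y')
  next
    case (6 i)
    show ?case by (intro oct_hom_add oct_hom_diff dz ez s s' st x y x' y')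
  qed
qed

lemma Zc_carrier: "(Zc v :: 'k::field_char_0 gvec set) \<subseteq> alg_carrier g_S8_S2"
  unfolding Zc_def g_carrier by blast

lemma gbracket_uminus:
  fixes w w' :: "'k::field_char_0 gvec"
  assumes "w \<in> alg_carrier g_S8_S2" "w' \<in> alg_carrier g_S8_S2"
  shows "gbracket (- w) w' = - gbracket w w'" "gbracket w (- w') = - gbracket w w'"
proof -
  obtain d c x y where w: "w = gel d c x y" "d \<in> tri8" using assms(1) unfolding g_carrier by blast
  obtain d' c' x' y' where w': "w' = gel d' c' x' y'" "d' \<in> tri8" using assms(2) unfolding g_carrier by blast
  have u: "- d \<in> tri8" if "d \<in> tri8" for d :: "3 \<Rightarrow> 'k oct \<Rightarrow> 'k oct"
    using tri8_scale[OF that, of "-1"] by (simp add: fun_Compl_def)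
  have t: "t8 (- x) y i v = - t8 x y i v" "t8 x (- y) i v = - t8 x y i v" for x y :: "'k oct" and i v
    using lin_minus(1)[OF t8_lin(1)[of y i v], of x] lin_minus(1)[OF t8_lin(2)[of x i v], of y] by simp_all
  note l = lin_minus(1)[OF tri8_lin[OF w(2)]] lin_minus(1)[OF tri8_lin[OF w'(2)]]
  show "gbracket (- w) w' = - gbracket w w'"
    unfolding w(1) w'(1) gel_uminus gbracket_gel[OF w(2) w'(2)] gbracket_gel[OF u[OF w(2)] w'(2)] gel_eq_iff
    by (simp add: fun_eq_iff sum_3' theta_def t l star_minus q8_minus algebra_simps)
  show "gbracket w (- w') = - gbracket w w'"
    unfolding w(1) w'(1) gel_uminus gbracket_gel[OF w(2) w'(2)] gbracket_gel[OF w(2) u[OF w'(2)]] gel_eq_iff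
    by (simp add: fun_eq_iff sum_3' theta_def t l star_minus q8_minus algebra_simps)
qed

lemma Gamma3_iff: "w \<in> Gamma3 (k, v) \<longleftrightarrow> w \<in> Zc v \<and> rho w = (if k = 0 then w else - w)"
  for w :: "'k::field_char_0 gvec"
  by (simp add: Gamma3_def Z4_component_eq)

lemma gbracket_Gamma3:
  fixes a b :: "'k::field_char_0 gvec"
  assumes "a \<in> Gamma3 g" "b \<in> Gamma3 h"
  shows "gbracket a b \<in> Gamma3 (g + h)"
proof -
  obtain k v l w where g: "g = (k, v)" "h = (l, w)" by (metis surj_pair)
  have ab: "a \<in> Zc v" "b \<in> Zc w" and r: "rho a = (if k = 0 then a else - a)" "rho b = (if l = 0 then b else - b)"
    using assms unfolding g Gamma3_iff by auto
  have c: "a \<in> alg_carrier g_S8_S2" "b \<in> alg_carrier g_S8_S2" using ab Zc_carrier by blast+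
  have cm: "- b \<in> alg_carrier g_S8_S2"
    using ab Zc_subspace[of w] module.subspace_neg[OF module_gscale] Zc_carrier by blast
  have k: "k = 0 \<or> k = 1" "l = 0 \<or> l = 1" using exhaust_2[of k] exhaust_2[of l] by auto
  have "rho (gbracket a b) = (if k + l = 0 then gbracket a b else - gbracket a b)"
    unfolding rho_gbracket[OF c] r using k
    by (elim disjE) (simp_all add: gbracket_uminus c cm)
  then show ?thesis
    unfolding g Gamma3_iff add_Pair using gbracket_Zc[OF ab] by simp
qed

section \<open>Projections onto the homogeneous components\<close>

definition proj_oct :: "3 \<Rightarrow> int ^ 4 \<Rightarrow> 'k::field oct \<Rightarrow> 'k oct" where
  "proj_oct i v x = (\<chi> a. if deg_iota i a = v then x $ a else 0)"

text \<open>The terms of degree v in the expansion \<open>tri8_expand\<close>.\<close>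

definition proj_tri :: "int ^ 4 \<Rightarrow> (3 \<Rightarrow> 'k::field oct \<Rightarrow> 'k oct) \<Rightarrow> 3 \<Rightarrow> 'k oct \<Rightarrow> 'k oct" where
  "proj_tri v d = (\<lambda>i u. \<Sum>b\<in>UNIV. \<Sum>c\<in>UNIV.
     (if deg_iota 0 (dual b) + deg_iota 0 c = v then tri_coeff d b c else 0) *s t8 (axis (dual b) 1) (axis c 1) i u)"

text \<open>A finite set outside which all projections vanish. It is larger than the support:
  doubles of short roots belong to it, although their components are zero.\<close>

definition degrees :: "(int ^ 4) set" where
  "degrees = {0} \<union> range (\<lambda>(i, b). deg_iota i b) \<union> range (\<lambda>(b, c). deg_iota 0 (dual b) + deg_iota 0 c)"

lemma finite_degrees: "finite degrees"
  by (simp add: degrees_def)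

lemma proj_oct_hom: "oct_hom i v (proj_oct i v x)"
  by (simp add: oct_hom_def proj_oct_def)

lemma proj_oct_of_hom: "oct_hom i v x \<Longrightarrow> proj_oct i w x = (if w = v then x else 0)"
proof -
  assume h: "oct_hom i v x"
  have "proj_oct i w x $ a = (if w = v then x else 0) $ a" for a
    using h by (cases "x $ a = 0"; cases "w = v") (auto simp: oct_hom_def proj_oct_def)
  then show ?thesis unfolding vec_eq_iff by blast
qed

lemma proj_oct_sum: "(\<Sum>v\<in>degrees. proj_oct i v x) = x"
proof -
  have "deg_iota i a \<in> degrees" for a by (auto simp: degrees_def)
  then have "(\<Sum>v\<in>degrees. proj_oct i v x) $ a = x $ a" for a
    by (simp add: proj_oct_def sum_component finite_degrees)
  then show ?thesis unfolding vec_eq_iff by blast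
qed

lemma proj_oct_out: "v \<notin> degrees \<Longrightarrow> proj_oct i v x = 0"
proof -
  assume v: "v \<notin> degrees"
  have "deg_iota i a \<noteq> v" for a using v by (auto simp: degrees_def)
  then have "proj_oct i v x $ a = 0" for a by (simp add: proj_oct_def)
  then show ?thesis unfolding vec_eq_iff by simp
qed

lemma proj_oct_add: "proj_oct i v (x + y) = proj_oct i v x + proj_oct i v y"
  by (simp add: proj_oct_def vec_eq_iff)

lemma proj_oct_scale: "proj_oct i v (k *s x) = k *s proj_oct i v x"
  by (simp add: proj_oct_def vec_eq_iff)

lemma proj_oct_diff: "proj_oct i v (x - y) = proj_oct i v x - proj_oct i v y"
  by (simp add: proj_oct_def vec_eq_iff)

lemma proj_tri_tri8: "proj_tri v d \<in> tri8" for d :: "3 \<Rightarrow> 'k::field_char_0 oct \<Rightarrow> 'k oct"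
  unfolding proj_tri_def by (intro tri8_sum tri8_scale t8_tri8)

lemma proj_tri_hom: "end_hom 0 v (proj_tri v d 0)" for d :: "3 \<Rightarrow> 'k::field_char_0 oct \<Rightarrow> 'k oct"
  unfolding proj_tri_def
proof (intro end_hom_sum)
  fix b c
  have "end_hom 0 (deg_iota 0 (dual b) + deg_iota 0 c) (theta 0 (t8 (axis (dual b) 1) (axis c (1::'k))) 0)"
    by (rule t8_hom) (rule oct_hom_axis)+
  then show "end_hom 0 v (\<lambda>u. (if deg_iota 0 (dual b) + deg_iota 0 c = v then tri_coeff d b c else 0) *s
      t8 (axis (dual b) 1) (axis c 1) 0 u)"
    by (cases "deg_iota 0 (dual b) + deg_iota 0 c = v") (simp_all add: end_hom_scale theta_def end_hom_zero)
qed

lemma proj_tri_of_hom: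
  fixes d :: "3 \<Rightarrow> 'k::field_char_0 oct \<Rightarrow> 'k oct"
  assumes d: "d \<in> tri8" and h: "end_hom 0 v (d 0)"
  shows "proj_tri w d = (if w = v then d else 0)"
proof (cases "w = v")
  case True
  have "(if deg_iota 0 (dual b) + deg_iota 0 c = v then tri_coeff d b c else 0) = tri_coeff d b c" for b c
    using tri8_hom_coeff[of v d b c, OF h] by (cases "tri_coeff d b c = 0") simp_all
  then show ?thesis using tri8_expand[OF d] unfolding True proj_tri_def by simp
next
  case False
  have "(if deg_iota 0 (dual b) + deg_iota 0 c = w then tri_coeff d b c else 0) = 0" for b c
    using tri8_hom_coeff[of v d b c, OF h] False by (cases "tri_coeff d b c = 0") auto
  then have "proj_tri w d i u = 0" for i u unfolding proj_tri_def by (simp only: vec.scale_zero_left sum.neutral_const)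
  then show ?thesis using False by (simp add: fun_eq_iff)
qed

lemma proj_tri_sum:
  fixes d :: "3 \<Rightarrow> 'k::field_char_0 oct \<Rightarrow> 'k oct"
  assumes d: "d \<in> tri8"
  shows "(\<lambda>i u. \<Sum>v\<in>degrees. proj_tri v d i u) = d"
proof (intro ext)
  fix i u
  have dg: "deg_iota 0 (dual b) + deg_iota 0 c \<in> degrees" for b c by (auto simp: degrees_def)
  have "(\<Sum>v\<in>degrees. proj_tri v d i u) = (\<Sum>b\<in>UNIV. \<Sum>c\<in>UNIV. \<Sum>v\<in>degrees.
     (if deg_iota 0 (dual b) + deg_iota 0 c = v then tri_coeff d b c else 0) *s t8 (axis (dual b) 1) (axis c 1) i u)"
    unfolding proj_tri_def by (subst sum.swap, rule sum.cong[OF refl], rule sum.swap)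
  also have "\<dots> = (\<Sum>b\<in>UNIV. \<Sum>c\<in>UNIV. tri_coeff d b c *s t8 (axis (dual b) 1) (axis c 1) i u)"
    by (simp add: dg finite_degrees if_distrib[of "\<lambda>k. k *s _"] cong: if_cong)
  also have "\<dots> = d i u" by (subst (2) tri8_expand[OF d]) simp
  finally show "(\<Sum>v\<in>degrees. proj_tri v d i u) = d i u" .
qed

lemma proj_tri_out: "v \<notin> degrees \<Longrightarrow> proj_tri v d = 0"
proof -
  assume v: "v \<notin> degrees"
  have "deg_iota 0 (dual b) + deg_iota 0 c \<noteq> v" for b c using v by (auto simp: degrees_def)
  then show ?thesis by (simp add: proj_tri_def fun_eq_iff)
qed

lemma proj_tri_add: "proj_tri v (d + d') = proj_tri v d + proj_tri v d'"
proof (intro ext)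
  fix i u
  have "(if P then tri_coeff (d + d') b c else 0) = (if P then tri_coeff d b c else 0) + (if P then tri_coeff d' b c else 0)" for P b c
    by (simp add: tri_coeff_def add_divide_distrib)
  then show "proj_tri v (d + d') i u = (proj_tri v d + proj_tri v d') i u"
    by (simp only: proj_tri_def plus_fun_apply vector_sadd_rdistrib sum.distrib)
qed

definition gd :: "'k::field gvec \<Rightarrow> 3 \<Rightarrow> 'k oct \<Rightarrow> 'k oct" where "gd w = fst w"
definition gc :: "'k::field gvec \<Rightarrow> 3 \<Rightarrow> 'k" where "gc w i = fst (snd w) i (axis 1 1) $ 1"
definition gx :: "'k::field gvec \<Rightarrow> 3 \<Rightarrow> 'k oct" where "gx w i = (\<chi> a. snd (snd w) i $ (a, 1))"
definition gy :: "'k::field gvec \<Rightarrow> 3 \<Rightarrow> 'k oct" where "gy w i = (\<chi> a. snd (snd w) i $ (a, 2))"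

lemma gel_destruct [simp]: "gd (gel d c x y) = d" "gc (gel d c x y) = c" "gx (gel d c x y) = x" "gy (gel d c x y) = y"
  by (simp_all add: gd_def gc_def gx_def gy_def gel_def tri2_elem_def fun_eq_iff vec_eq_iff)

text \<open>Symmetrization under \<open>rho\<close> followed by projection to degree v;
  \<open>proj_odd\<close> is the antisymmetric counterpart.\<close>

definition proj_even :: "int ^ 4 \<Rightarrow> 'k::field_char_0 gvec \<Rightarrow> 'k gvec" where
  "proj_even v w = gel (proj_tri v (gd w)) 0 (\<lambda>i. proj_oct i v ((1 / 2) *s (gx w i + gy w i)))
     (\<lambda>i. proj_oct i v ((1 / 2) *s (gx w i + gy w i)))"

definition proj_odd :: "int ^ 4 \<Rightarrow> 'k::field_char_0 gvec \<Rightarrow> 'k gvec" where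
  "proj_odd v w = gel 0 (if v = 0 then gc w else 0) (\<lambda>i. proj_oct i v ((1 / 2) *s (gx w i - gy w i)))
     (- (\<lambda>i. proj_oct i v ((1 / 2) *s (gx w i - gy w i))))"

definition proj_G3 :: "G3 \<Rightarrow> 'k::field_char_0 gvec \<Rightarrow> 'k gvec" where
  "proj_G3 g w = (if fst g = 0 then proj_even (snd g) w else proj_odd (snd g) w)"

lemma ambient_g: "ambient_algebra (g_S8_S2 :: ('k::field_char_0, 'k gvec) algebra_struct)"
proof (intro ambient_algebra.intro ambient_algebra_axioms.intro)
  show m: "module (alg_scale (g_S8_S2 :: ('k, 'k gvec) algebra_struct))" using module_gscale by simp
  show "module.subspace (alg_scale g_S8_S2) (alg_carrier (g_S8_S2 :: ('k, 'k gvec) algebra_struct))"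
    unfolding module.subspace_def[OF m]
  proof (intro conjI ballI allI)
    show "0 \<in> alg_carrier (g_S8_S2 :: ('k, 'k gvec) algebra_struct)"
      unfolding gel_zero gel_in_g by (simp add: tri8_zero_mem)
    fix w :: "'k gvec" and k assume "w \<in> alg_carrier g_S8_S2"
    then obtain d c x y where w: "w = gel d c x y" "d \<in> tri8" "c \<in> tri2_scalars" unfolding g_carrier by blast
    show "alg_scale g_S8_S2 k w \<in> alg_carrier g_S8_S2"
      unfolding w alg_scale_g gel_scale gel_in_g using w by (simp add: tri8_scale tri2_scalars_scale)
    fix w' :: "'k gvec" assume "w' \<in> alg_carrier g_S8_S2"
    then obtain d' c' x' y' where w': "w' = gel d' c' x' y'" "d' \<in> tri8" "c' \<in> tri2_scalars" unfolding g_carrier by blast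
    show "w + w' \<in> alg_carrier g_S8_S2"
      unfolding w w' gel_add gel_in_g using w w' by (simp add: tri8_plus tri2_scalars_add)
  qed
qed (simp add: gbracket_carrier)

lemma f4_carrier_iff: "w \<in> alg_carrier f4 \<longleftrightarrow> w \<in> alg_carrier g_S8_S2 \<and> rho w = w"
  by (simp add: f4_def)

lemma rho_add:
  fixes w w' :: "'k::field_char_0 gvec"
  assumes "w \<in> alg_carrier g_S8_S2" "w' \<in> alg_carrier g_S8_S2"
  shows "rho (w + w') = rho w + rho w'"
proof -
  obtain d c x y where w: "w = gel d c x y" using assms(1) unfolding g_carrier by blast
  obtain d' c' x' y' where w': "w' = gel d' c' x' y'" using assms(2) unfolding g_carrier by blast
  show ?thesis unfolding w w' gel_add rho_gel gel_eq_iff by simp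
qed

lemma rho_scale:
  fixes w :: "'k::field_char_0 gvec"
  assumes "w \<in> alg_carrier g_S8_S2"
  shows "rho (gscale k w) = gscale k (rho w)"
proof -
  obtain d c x y where w: "w = gel d c x y" using assms unfolding g_carrier by blast
  show ?thesis unfolding w gel_scale rho_gel gel_eq_iff by (simp add: fun_eq_iff)
qed

lemma rho_zero: "rho 0 = (0 :: 'k::field_char_0 gvec)"
  by (simp add: gel_zero rho_gel)

lemma ambient_f4: "ambient_algebra (f4 :: ('k::field_char_0, 'k gvec) algebra_struct)"
proof (intro ambient_algebra.intro ambient_algebra_axioms.intro)
  interpret g: ambient_algebra "g_S8_S2 :: ('k, 'k gvec) algebra_struct" by (rule ambient_g)
  show m: "module (alg_scale (f4 :: ('k, 'k gvec) algebra_struct))" using module_gscale by simp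
  show "module.subspace (alg_scale f4) (alg_carrier (f4 :: ('k, 'k gvec) algebra_struct))"
    unfolding module.subspace_def[OF m]
  proof (intro conjI ballI allI)
    show "0 \<in> alg_carrier (f4 :: ('k, 'k gvec) algebra_struct)"
      using g.zero_C by (simp add: f4_carrier_iff rho_zero)
    fix w :: "'k gvec" and k assume w: "w \<in> alg_carrier f4"
    then show "alg_scale f4 k w \<in> alg_carrier f4"
      using g.scale_C[of w k] by (simp add: f4_carrier_iff rho_scale)
    fix w' :: "'k gvec" assume "w' \<in> alg_carrier f4"
    then show "w + w' \<in> alg_carrier f4"
      using w g.add_C[of w w'] by (simp add: f4_carrier_iff rho_add)
  qed
  show "alg_mult f4 x y \<in> alg_carrier f4"
    if "x \<in> alg_carrier f4" "y \<in> alg_carrier f4" for x y :: "'k gvec"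
    using that by (simp add: f4_carrier_iff gbracket_carrier rho_gbracket)
qed

lemma G0_iff: "gel d c x y \<in> G0 v \<longleftrightarrow> c = 0 \<and> y = x \<and> d \<in> tri8 \<and> end_hom 0 v (d 0) \<and> (\<forall>i. oct_hom i v (x i))"
  unfolding G0_def mem_Collect_eq gel_eq_iff by blast

lemma G1_iff: "gel d c x y \<in> G1 v \<longleftrightarrow> d = 0 \<and> y = - x \<and> c \<in> tri2_scalars \<and> (v \<noteq> 0 \<longrightarrow> c = 0) \<and> (\<forall>i. oct_hom i v (x i))"
  unfolding G1_def mem_Collect_eq gel_eq_iff by blast

lemma half_double: "(1 / 2) *s (x + x) = x" for x :: "'k::field_char_0 ^ 'n"
  by (simp add: vec_eq_iff)

lemma proj_oct_zero: "proj_oct i v 0 = 0"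
  by (simp add: proj_oct_def vec_eq_iff)

lemma proj_tri_zero: "proj_tri v 0 = 0"
  by (simp add: proj_tri_def tri_coeff_def fun_eq_iff cong: if_cong)

lemma proj_even_mem: "proj_even v w \<in> G0 v"
  unfolding proj_even_def G0_iff by (simp add: proj_tri_tri8 proj_tri_hom proj_oct_hom)

lemma proj_odd_mem: "w \<in> alg_carrier g_S8_S2 \<Longrightarrow> proj_odd v w \<in> G1 v"
  unfolding proj_odd_def G1_iff g_carrier by (auto simp: proj_oct_hom)

lemma proj_even_of_G0: "w \<in> G0 u \<Longrightarrow> proj_even v w = (if v = u then w else 0)"
proof -
  assume "w \<in> G0 u"
  then obtain d x where w: "w = gel d 0 x x" "d \<in> tri8" "end_hom 0 u (d 0)" "\<And>i. oct_hom i u (x i)"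
    unfolding G0_def by blast
  show ?thesis
    unfolding w(1) proj_even_def gel_destruct half_double proj_tri_of_hom[OF w(2,3)] proj_oct_of_hom[OF w(4)]
    by (simp add: gel_zero zero_fun_def)
qed

lemma proj_odd_of_G0: "w \<in> G0 u \<Longrightarrow> proj_odd v w = 0"
proof -
  assume "w \<in> G0 u"
  then obtain d x where w: "w = gel d 0 x x" unfolding G0_def by blast
  show ?thesis unfolding w proj_odd_def gel_zero gel_eq_iff by (simp add: fun_eq_iff proj_oct_zero)
qed

lemma proj_odd_of_G1: "w \<in> G1 u \<Longrightarrow> proj_odd v w = (if v = u then w else 0)"
proof -
  assume "w \<in> G1 u"
  then obtain c x where w: "w = gel 0 c x (- x)" "u \<noteq> 0 \<longrightarrow> c = 0" "\<And>i. oct_hom i u (x i)"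
    unfolding G1_def by blast
  have "gx w i - gy w i = x i + x i" for i by (simp add: w(1))
  then have "proj_odd v w = gel 0 (if v = 0 then c else 0) (\<lambda>i. proj_oct i v (x i)) (- (\<lambda>i. proj_oct i v (x i)))"
    unfolding proj_odd_def by (simp only: half_double) (simp add: w(1))
  then show ?thesis
    unfolding proj_oct_of_hom[OF w(3)] using w(2) by (auto simp: w(1) gel_zero gel_eq_iff fun_eq_iff)
qed

lemma proj_even_of_G1: "w \<in> G1 u \<Longrightarrow> proj_even v w = 0"
proof -
  assume "w \<in> G1 u"
  then obtain c x where w: "w = gel 0 c x (- x)" unfolding G1_def by blast
  show ?thesis
    unfolding w proj_even_def gel_zero gel_eq_iff by (simp add: fun_eq_iff proj_oct_zero proj_tri_zero)
qed

lemma proj_even_add: "w \<in> alg_carrier g_S8_S2 \<Longrightarrow> w' \<in> alg_carrier g_S8_S2 \<Longrightarrow> proj_even v (w + w') = proj_even v w + proj_even v w'"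
  and proj_odd_add: "w \<in> alg_carrier g_S8_S2 \<Longrightarrow> w' \<in> alg_carrier g_S8_S2 \<Longrightarrow> proj_odd v (w + w') = proj_odd v w + proj_odd v w'"
proof -
  assume "w \<in> alg_carrier g_S8_S2" "w' \<in> alg_carrier g_S8_S2"
  then obtain d c x y d' c' x' y' where w: "w = gel d c x y" "w' = gel d' c' x' y'" unfolding g_carrier by blast
  show "proj_even v (w + w') = proj_even v w + proj_even v w'"
    unfolding w gel_add proj_even_def gel_destruct gel_eq_iff
    by (simp add: fun_eq_iff proj_tri_add proj_oct_add proj_oct_scale vec.scale_right_distrib algebra_simps)
  show "proj_odd v (w + w') = proj_odd v w + proj_odd v w'"
    unfolding w gel_add proj_odd_def gel_destruct gel_eq_iff
    by (simp add: fun_eq_iff proj_oct_add proj_oct_diff proj_oct_scale vec.scale_right_distrib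
        vec.scale_right_diff_distrib algebra_simps)
qed

lemma zero_in_degrees: "0 \<in> degrees"
  by (simp add: degrees_def)

lemma proj_even_out: "v \<notin> degrees \<Longrightarrow> proj_even v w = 0"
  unfolding proj_even_def gel_zero gel_eq_iff by (simp add: proj_tri_out proj_oct_out fun_eq_iff)

lemma proj_odd_out: "v \<notin> degrees \<Longrightarrow> proj_odd v w = 0"
  unfolding proj_odd_def gel_zero gel_eq_iff using zero_in_degrees by (auto simp: proj_oct_out fun_eq_iff)

lemma proj_even_sum:
  assumes "d \<in> tri8"
  shows "(\<Sum>v\<in>degrees. proj_even v (gel d c x y)) = gel d 0 (\<lambda>i. (1 / 2) *s (x i + y i)) (\<lambda>i. (1 / 2) *s (x i + y i))"
  unfolding proj_even_def gel_destruct gel_sum proj_tri_sum[OF assms] proj_oct_sum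
  by (simp add: zero_fun_def)

lemma proj_odd_sum:
  "(\<Sum>v\<in>degrees. proj_odd v (gel d c x y)) = gel 0 c (\<lambda>i. (1 / 2) *s (x i - y i)) (- (\<lambda>i. (1 / 2) *s (x i - y i)))"
proof -
  have "(\<Sum>v\<in>degrees. (if v = 0 then c else 0) i) = c i" for i
  proof -
    have "(\<Sum>v\<in>degrees. (if v = 0 then c else 0) i) = (\<Sum>v\<in>degrees. if v = 0 then c i else 0)"
      by (rule sum.cong) auto
    then show ?thesis using zero_in_degrees by (simp add: finite_degrees)
  qed
  then show ?thesis
    unfolding proj_odd_def gel_destruct gel_sum uminus_apply sum_negf proj_oct_sum
    by (simp add: gel_eq_iff fun_eq_iff)
qed

lemma Gamma3_cases: "Gamma3 g = (if fst g = 0 then G0 (snd g) else G1 (snd g) :: 'k::field_char_0 gvec set)"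
proof -
  obtain k v where g: "g = (k, v)" by fastforce
  show ?thesis using exhaust_2[of k] Gamma3_0[of v] Gamma3_1[of v] by (auto simp: g)
qed

lemma Gamma3_Zc: "Gamma3 g \<subseteq> (Zc (snd g) :: 'k::field_char_0 gvec set)"
  by (cases g) (auto simp: Gamma3_iff)

lemma Gamma3_subspace: "module.subspace gscale (Gamma3 g :: 'k::field_char_0 gvec set)"
proof -
  interpret module "gscale :: 'k \<Rightarrow> 'k gvec \<Rightarrow> 'k gvec" by (rule module_gscale)
  obtain k v where g: "g = (k, v)" by fastforce
  note s = Zc_subspace[of v, where ?'k = 'k, unfolded subspace_def]
  have c: "w \<in> Zc v \<Longrightarrow> w \<in> alg_carrier g_S8_S2" for w :: "'k gvec" using Zc_carrier by blast
  show ?thesis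
    unfolding g subspace_def
  proof (intro conjI ballI allI)
    show "0 \<in> (Gamma3 (k, v) :: 'k gvec set)" using s by (simp add: Gamma3_iff rho_zero)
    fix w :: "'k gvec" and r assume w: "w \<in> Gamma3 (k, v)"
    then have wz: "w \<in> Zc v" by (simp add: Gamma3_iff)
    have "gscale r (- w) = - gscale r w" by (rule scale_minus_right)
    then show "gscale r w \<in> Gamma3 (k, v)"
      using w s rho_scale[OF c[OF wz]] by (simp add: Gamma3_iff)
    fix w' :: "'k gvec" assume w': "w' \<in> Gamma3 (k, v)"
    then have wz': "w' \<in> Zc v" by (simp add: Gamma3_iff)
    show "w + w' \<in> Gamma3 (k, v)"
      using w w' s rho_add[OF c[OF wz] c[OF wz']] by (simp add: Gamma3_iff)
  qed
qed

theorem group_grading_g: "group_grading (g_S8_S2 :: ('k::field_char_0, 'k gvec) algebra_struct) Gamma3"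
proof -
  interpret ambient_algebra "g_S8_S2 :: ('k, 'k gvec) algebra_struct" by (rule ambient_g)
  show ?thesis
  proof (rule group_gradingI[where P = proj_G3 and F = "{0, 1} \<times> degrees"])
    show "subspace (Gamma3 g)" for g using Gamma3_subspace[of g] by simp
    show "Gamma3 g \<subseteq> C" for g using Gamma3_Zc Zc_carrier by blast
    show "finite ({0, 1} \<times> degrees :: G3 set)" using finite_degrees by simp
    show "proj_G3 g x \<in> Gamma3 g" if "x \<in> C" for x g
      unfolding proj_G3_def Gamma3_cases using proj_odd_mem[OF that] by (simp add: proj_even_mem)
    show "alg_mult g_S8_S2 x y \<in> Gamma3 (g + h)" if "x \<in> Gamma3 g" "y \<in> Gamma3 h" for x y :: "'k gvec" and g h
      using gbracket_Gamma3[OF that] by simp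
    show "proj_G3 g x = 0" if "x \<in> C" "g \<notin> {0, 1} \<times> degrees" for x g
    proof -
      have "fst g \<in> {0, 1}" using exhaust_2[of "fst g"] by auto
      then have "snd g \<notin> degrees" using that(2) by (cases g) auto
      then show ?thesis by (simp add: proj_G3_def proj_even_out proj_odd_out)
    qed
    show "proj_G3 g (x + y) = proj_G3 g x + proj_G3 g y" if "x \<in> C" "y \<in> C" for x y g
      using proj_even_add[OF that] proj_odd_add[OF that] by (simp add: proj_G3_def)
    show "proj_G3 g x = (if g = h then x else 0)" if "x \<in> Gamma3 h" for x g h
    proof -
      have "fst g = 0 \<or> fst g = 1" "fst h = 0 \<or> fst h = 1" using exhaust_2[of "fst g"] exhaust_2[of "fst h"] by auto
      then show ?thesis
        using that unfolding Gamma3_cases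
        by (elim disjE) (simp_all add: proj_G3_def prod_eq_iff proj_even_of_G0 proj_odd_of_G0 proj_even_of_G1 proj_odd_of_G1)
    qed
    show "(\<Sum>g\<in>{0, 1} \<times> degrees. proj_G3 g x) = x" if xC: "x \<in> C" for x
    proof -
      obtain d c x1 x2 where x: "x = gel d c x1 x2" "d \<in> tri8" using xC unfolding g_carrier by blast
      have "(\<Sum>g\<in>{0, 1} \<times> degrees. proj_G3 g x) = (\<Sum>k\<in>{0, 1}. \<Sum>v\<in>degrees. proj_G3 (k, v) x)"
        by (simp only: sum.cartesian_product split_def prod.collapse)
      also have "\<dots> = (\<Sum>v\<in>degrees. proj_even v x) + (\<Sum>v\<in>degrees. proj_odd v x)"
        by (simp add: proj_G3_def)
      also have "\<dots> = x"
        unfolding x(1) proj_even_sum[OF x(2)] proj_odd_sum gel_add gel_eq_iff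
        by (simp add: fun_eq_iff vec_eq_iff field_simps)
      finally show ?thesis .
    qed
  qed
qed

theorem group_grading_f4: "group_grading (f4 :: ('k::field_char_0, 'k gvec) algebra_struct) f4_cartan_grading"
proof -
  interpret ambient_algebra "f4 :: ('k, 'k gvec) algebra_struct" by (rule ambient_f4)
  have eq: "(f4_cartan_grading v :: 'k gvec set) = Gamma3 (0, v)" for v by (simp add: f4_cartan_eq Gamma3_0)
  have cg: "x \<in> alg_carrier g_S8_S2" if "x \<in> C" for x using that by (simp add: f4_carrier_iff)
  show ?thesis
  proof (rule group_gradingI[where P = proj_even and F = degrees])
    show "subspace (f4_cartan_grading g)" for g using Gamma3_subspace[of "(0, g)"] by (simp add: eq)
    show "f4_cartan_grading g \<subseteq> C" for g
    proof
      fix w :: "'k gvec" assume "w \<in> f4_cartan_grading g"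
      then have "w \<in> Zc g" "rho w = w" by (simp_all add: eq Gamma3_iff)
      then show "w \<in> C" using subsetD[OF Zc_carrier, of w g] by (simp add: f4_carrier_iff)
    qed
    show "alg_mult f4 x y \<in> f4_cartan_grading (g + h)" if "x \<in> f4_cartan_grading g" "y \<in> f4_cartan_grading h" for x y :: "'k gvec" and g h
      using gbracket_Gamma3[OF that[unfolded eq]] by (simp add: eq)
    show "proj_even g x \<in> f4_cartan_grading g" for x g by (simp add: f4_cartan_eq proj_even_mem)
    show "proj_even g x = (if g = h then x else 0)" if "x \<in> f4_cartan_grading h" for x g h
      using that by (simp add: f4_cartan_eq proj_even_of_G0)
    show "proj_even g (x + y) = proj_even g x + proj_even g y" if "x \<in> C" "y \<in> C" for x y g
      using proj_even_add[OF that[THEN cg]] .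
    show "(\<Sum>g\<in>degrees. proj_even g x) = x" if xC: "x \<in> C" for x
    proof -
      obtain d x1 where x: "x = gel d 0 x1 x1" "d \<in> tri8" using xC unfolding f4_carrier by blast
      show ?thesis unfolding x(1) proj_even_sum[OF x(2)] half_double ..
    qed
  qed (simp_all add: finite_degrees proj_even_out)
qed

section \<open>Fineness and universality\<close>

definition copy_at :: "3 \<Rightarrow> 'k::field oct \<Rightarrow> 3 \<Rightarrow> 'k oct" where
  "copy_at i x j = (if j = i then x else 0)"

text \<open>The element iota_i(b tensor 1), while \<open>odd_root\<close> is iota_i(b tensor (e1 -
  e2)) with the idempotents e1, e2 of S2. By \<open>even_line\<close> and \<open>odd_line\<close>
  they span the components at the short roots.\<close>

definition even_root :: "3 \<Rightarrow> oct_basis \<Rightarrow> 'k::field gvec" where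
  "even_root i b = gel 0 0 (copy_at i (axis b 1)) (copy_at i (axis b 1))"

definition odd_root :: "3 \<Rightarrow> oct_basis \<Rightarrow> 'k::field gvec" where
  "odd_root i b = gel 0 0 (copy_at i (axis b 1)) (- copy_at i (axis b 1))"

lemma oct_hom_copy_at: "oct_hom j (deg_iota i b) (copy_at i (axis b 1) j)"
  by (simp add: copy_at_def oct_hom_axis)

lemma even_root_mem: "even_root i b \<in> (Gamma3 (0, deg_iota i b) :: 'k::field_char_0 gvec set)"
  unfolding Gamma3_0 even_root_def G0_iff by (simp add: tri8_zero_mem end_hom_zero oct_hom_copy_at)

lemma odd_root_mem: "odd_root i b \<in> (Gamma3 (1, deg_iota i b) :: 'k::field_char_0 gvec set)"
  unfolding Gamma3_1 odd_root_def G1_iff by (simp add: oct_hom_copy_at)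

lemma copy_at_eq_0: "copy_at i x = 0 \<longleftrightarrow> x = 0"
  by (auto simp: copy_at_def fun_eq_iff)

lemma root_nonzero: "even_root i b \<noteq> (0 :: 'a::field gvec)" "odd_root i b \<noteq> (0 :: 'a gvec)"
proof -
  have "axis b 1 $ b \<noteq> (0 :: 'a)" by simp
  then have "axis b (1 :: 'a) \<noteq> 0" by (metis zero_index)
  then have "copy_at i (axis b (1 :: 'a)) \<noteq> 0" by (simp add: copy_at_eq_0)
  then show "even_root i b \<noteq> (0 :: 'a gvec)" "odd_root i b \<noteq> (0 :: 'a gvec)"
    unfolding even_root_def odd_root_def gel_zero gel_eq_iff by simp_all
qed

lemma t8_zero: "t8 0 y i v = 0" "t8 x 0 i v = 0"
  using lin_zero[OF t8_lin(1)[of y i v]] lin_zero[OF t8_lin(2)[of x i v]] .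

lemma theta_zero: "theta i (t8 0 y) j v = 0" "theta i (t8 x 0) j v = 0"
  by (simp_all add: theta_def t8_zero)

lemma star_copy_same: "copy_at i x (k + 1) \<star> copy_at i y (k + 2) = 0"
  by (cases i rule: cases_3; cases k rule: cases_3) (simp_all add: copy_at_def)

lemma bracket_same_copy:
  fixes x y x' y' :: "'k::field_char_0 oct"
  shows
  "gbracket (gel 0 0 (copy_at i x) (copy_at i y)) (gel 0 0 (copy_at i x') (copy_at i y')) =
   gel (\<lambda>j v. theta i (t8 x y') j v + theta i (t8 y x') j v) (\<lambda>j. (q8 x y' - q8 y x') * tau (j - i)) 0 0"
proof -
  have s: "(\<Sum>k\<in>UNIV. f k) = f i" if "\<And>k. k \<noteq> i \<Longrightarrow> f k = 0" for f :: "3 \<Rightarrow> 'b::comm_monoid_add"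
    using sum.mono_neutral_right[of UNIV "{i}" f] that by simp
  have "(\<Sum>k\<in>UNIV. theta k (t8 (copy_at i x k) (copy_at i y' k)) j v + theta k (t8 (copy_at i y k) (copy_at i x' k)) j v)
      = theta i (t8 x y') j v + theta i (t8 y x') j v" for j v
    by (subst s) (simp_all add: copy_at_def theta_zero)
  moreover have "(\<Sum>k\<in>UNIV. (q8 (copy_at i x k) (copy_at i y' k) - q8 (copy_at i y k) (copy_at i x' k)) * tau (j - k))
      = (q8 x y' - q8 y x') * tau (j - i)" for j
    by (subst s) (simp_all add: copy_at_def)
  ultimately show ?thesis
    unfolding gbracket_gel[OF tri8_zero_mem(1) tri8_zero_mem(1)] gel_eq_iff
    by (simp add: fun_eq_iff star_copy_same)
qed

lemma bracket_next_copy: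
  fixes x y :: "'k::field_char_0 oct"
  shows
  "gbracket (gel 0 0 (copy_at (i + 1) x) (copy_at (i + 1) x)) (gel 0 0 (copy_at (i + 2) y) (copy_at (i + 2) y)) =
   gel 0 0 (copy_at i (x \<star> y)) (copy_at i (x \<star> y))"
proof -
  have n: "(k::3) = i + 2 \<Longrightarrow> k \<noteq> i + 1" for k by auto
  have z: "copy_at (i + 2) y (k + 1) \<star> copy_at (i + 1) x (k + 2) = 0" for k
    by (cases i rule: cases_3; cases k rule: cases_3) (simp_all add: copy_at_def)
  have p: "copy_at (i + 1) x (k + 1) \<star> copy_at (i + 2) y (k + 2) = copy_at i (x \<star> y) k" for k
    by (simp add: copy_at_def)
  have d: "copy_at (i + 1) u k = 0 \<or> copy_at (i + 2) v k = 0" for k u v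
    by (simp add: copy_at_def)
  have t: "theta k (t8 (copy_at (i + 1) x k) (copy_at (i + 2) y k)) j v = 0" for k j v
    using d[of x k y] by (elim disjE) (simp_all only: theta_zero)
  show ?thesis
    unfolding gbracket_gel[OF tri8_zero_mem(1) tri8_zero_mem(1)] gel_eq_iff
    by (simp add: fun_eq_iff z p t)
qed

lemma bracket_tri8:
  fixes x y :: "'k::field_char_0 oct"
  assumes "d \<in> tri8"
  shows "gbracket (gel d 0 0 0) (gel 0 0 (copy_at i x) (copy_at i y)) = gel 0 0 (copy_at i (d i x)) (copy_at i (d i y))"
  unfolding gbracket_gel[OF assms tri8_zero_mem(1)] gel_eq_iff
  by (auto simp: fun_eq_iff copy_at_def theta_zero lin_zero[OF tri8_lin[OF assms]])

lemma bracket_tri2: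
  fixes x y :: "'k::field_char_0 oct"
  shows
  "gbracket (gel 0 c 0 0) (gel 0 0 (copy_at i x) (copy_at i y)) = gel 0 0 (copy_at i (c i *s x)) (copy_at i (- c i *s y))"
  unfolding gbracket_gel[OF tri8_zero_mem(1) tri8_zero_mem(1)] gel_eq_iff
  by (auto simp: fun_eq_iff copy_at_def theta_zero)

text \<open>Integer multiples in an arbitrary abelian group, used to write a homomorphism on Z^4 by
  its values on the canonical basis.\<close>

definition zmul :: "int \<Rightarrow> 'a::ab_group_add \<Rightarrow> 'a" where
  "zmul n x = (if n \<ge> 0 then (\<Sum>i<nat n. x) else - (\<Sum>i<nat (- n). x))"

lemma zmul_0 [simp]: "zmul 0 x = 0" and zmul_1 [simp]: "zmul 1 x = x"
  by (simp_all add: zmul_def)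

lemma zmul_add_1: "zmul (n + 1) x = zmul n x + x"
proof (cases "n \<ge> 0")
  case True
  then have "nat (n + 1) = Suc (nat n)" by simp
  then show ?thesis using True by (simp add: zmul_def)
next
  case False
  then have s: "nat (- n) = Suc (nat (- (n + 1)))" by simp
  show ?thesis
  proof (cases "n + 1 = 0")
    case True
    then have "n = -1" by simp
    then show ?thesis by (simp add: zmul_def)
  next
    case ne: False
    then show ?thesis using False s by (simp add: zmul_def)
  qed
qed

lemma zmul_add: "zmul (m + n) x = zmul m x + zmul n x"
proof (induction n rule: int_induct[where k = 0])
  case base
  then show ?case by simp
next
  case (step1 n)
  then show ?case using zmul_add_1[of "m + n" x] zmul_add_1[of n x] by (simp add: add.assoc)
next
  case (step2 n)
  then show ?case using zmul_add_1[of "m + (n - 1)" x] zmul_add_1[of "n - 1" x]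
    by (simp add: algebra_simps)
qed

lemma zmul_minus_1 [simp]: "zmul (- 1) x = - x"
  by (simp add: zmul_def)

definition zcomb :: "'h::ab_group_add \<Rightarrow> 'h \<Rightarrow> 'h \<Rightarrow> 'h \<Rightarrow> int ^ 4 \<Rightarrow> 'h" where
  "zcomb a b c d v = zmul (v $ 1) a + zmul (v $ 2) b + zmul (v $ 3) c + zmul (v $ 4) d"

lemma zcomb_add: "zcomb a b c d (v + w) = zcomb a b c d v + zcomb a b c d w"
  by (simp add: zcomb_def zmul_add algebra_simps)

lemma additive_zmul:
  fixes f :: "int ^ 4 \<Rightarrow> 'h::ab_group_add"
  assumes "\<And>x y. f (x + y) = f x + f y"
  shows "f (n *s x) = zmul n (f x)"
proof (induction n rule: int_induct[where k = 0])
  case base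
  then show ?case using assms[of 0 0] by simp
next
  case (step1 n)
  then show ?case using assms[of "n *s x" x] by (simp add: zmul_add_1 vector_sadd_rdistrib)
next
  case (step2 n)
  have "f (n *s x) = f ((n - 1) *s x) + f x"
    using assms[of "(n - 1) *s x" x] by (simp add: vector_ssub_ldistrib vec_eq_iff algebra_simps)
  then show ?case using step2 zmul_add_1[of "n - 1" "f x"] by simp
qed

lemma additive_eq_zcomb:
  fixes f :: "int ^ 4 \<Rightarrow> 'h::ab_group_add"
  assumes "\<And>x y. f (x + y) = f x + f y"
  shows "f v = zcomb (f (axis 1 1)) (f (axis 2 1)) (f (axis 3 1)) (f (axis 4 1)) v"
  unfolding zcomb_def by (subst vec4_expand) (simp only: assms additive_zmul[of f, OF assms])

text \<open>
  A family of homogeneous subspaces containing the root vectors behaves, on the root vectors, like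
  a homomorphism of the root lattice: this is read off from nonzero brackets.
\<close>

locale graded_family =
  fixes B :: "'h::ab_group_add \<Rightarrow> 'k::field_char_0 gvec set" and \<beta> :: "3 \<Rightarrow> oct_basis \<Rightarrow> 'h"
  assumes disjoint: "\<And>w g h. w \<in> B g \<Longrightarrow> w \<in> B h \<Longrightarrow> w \<noteq> 0 \<Longrightarrow> g = h"
    and mult: "\<And>a b g h. a \<in> B g \<Longrightarrow> b \<in> B h \<Longrightarrow> gbracket a b \<in> B (g + h)"
    and subsp: "\<And>g. module.subspace gscale (B g)"
    and even_roots: "\<And>i b. even_root i b \<in> B (\<beta> i b)"
begin

lemma zeroB: "0 \<in> B g" and addB: "a \<in> B g \<Longrightarrow> b \<in> B g \<Longrightarrow> a + b \<in> B g" and scaleB: "a \<in> B g \<Longrightarrow> gscale k a \<in> B g"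
  using subsp[of g] by (auto simp: module.subspace_def[OF module_gscale])

lemma sumB: "(\<And>a. a \<in> S \<Longrightarrow> f a \<in> B g) \<Longrightarrow> (\<Sum>a\<in>S. f a) \<in> B g"
  by (induction S rule: infinite_finite_induct) (simp_all add: zeroB addB)

lemma scaled_even_root:
  assumes "k \<noteq> 0" "gel 0 0 (copy_at i (k *s axis b 1)) (copy_at i (k *s axis b 1)) \<in> B g"
  shows "g = \<beta> i b"
proof -
  have "gscale (1 / k) (gel 0 0 (copy_at i (k *s axis b 1)) (copy_at i (k *s axis b 1))) = even_root i b"
    unfolding gel_scale even_root_def gel_eq_iff
    using assms(1) by (simp add: fun_eq_iff copy_at_def vec_eq_iff)
  then have "even_root i b \<in> B g" using scaleB[OF assms(2), of "1 / k"] by simp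
  then show ?thesis using disjoint[OF _ even_roots root_nonzero(1)] by blast
qed

text \<open>The bracket of root vectors from copies i + 1 and i + 2 is a nonzero multiple of a root
  vector of copy i, so the degrees add up.\<close>

lemma beta_star:
  assumes "k \<noteq> 0" "axis b 1 \<star> axis c 1 = k *s axis e (1::'k)"
  shows "\<beta> i e = \<beta> (i + 1) b + \<beta> (i + 2) c"
proof -
  have "gel 0 0 (copy_at i (k *s axis e 1)) (copy_at i (k *s axis e 1)) \<in> B (\<beta> (i + 1) b + \<beta> (i + 2) c)"
    using mult[OF even_roots[of "i + 1" b] even_roots[of "i + 2" c]]
    unfolding even_root_def bracket_next_copy assms(2) .
  from scaled_even_root[OF assms(1) this] show ?thesis by simp
qed

lemma tri8_root_mem: "gel (theta i (t8 (axis b 1) (axis c 1))) 0 0 0 \<in> B (\<beta> i b + \<beta> i c)"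
proof -
  have "gbracket (even_root i b) (even_root i c) \<in> B (\<beta> i b + \<beta> i c)" by (rule mult[OF even_roots even_roots])
  then have "gscale (1 / 2) (gbracket (even_root i b) (even_root i c)) \<in> B (\<beta> i b + \<beta> i c)" by (rule scaleB)
  then show ?thesis
    unfolding even_root_def bracket_same_copy gel_scale half_double
    by (simp add: zero_fun_def)
qed

text \<open>The element t of b and its dual has degree
  \<open>\<beta> i b + \<beta> i (dual b)\<close>, and it sends b to -b. As it preserves the line of
  b, this degree is 0.\<close>

lemma beta_dual: "\<beta> i (dual b) = - \<beta> i b"
proof -
  have t: "theta i (t8 (axis b 1) (axis (dual b) 1)) i (axis b 1) = (-1) *s axis b (1::'k)"
    by (cases b) (simp_all add: theta_def t8_simps q8_axis_dual)
  have m: "theta i (t8 (axis b 1) (axis (dual b) (1::'k))) \<in> tri8" by (rule theta_tri8[OF t8_tri8])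
  have "gel 0 0 (copy_at i ((-1) *s axis b 1)) (copy_at i ((-1) *s axis b 1)) \<in> B (\<beta> i b + \<beta> i (dual b) + \<beta> i b)"
    using mult[OF tri8_root_mem[of i b "dual b"] even_roots[of i b]]
    unfolding even_root_def bracket_tri8[OF m] t .
  then have "\<beta> i b + \<beta> i (dual b) + \<beta> i b = \<beta> i b" by (rule scaled_even_root[rotated]) simp
  then show ?thesis by (simp add: eq_neg_iff_add_eq_0 add.commute)
qed

text \<open>Prescribed on the four root vectors whose degrees are the canonical basis a1, a2, g1,
  g2.\<close>

definition \<phi> :: "int ^ 4 \<Rightarrow> 'h" where
  "\<phi> = zcomb (\<beta> 1 Oe1) (\<beta> 2 Oe1) (\<beta> 1 (Ou 1)) (\<beta> 2 (Ou 2))"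

lemma phi_add: "\<phi> (v + w) = \<phi> v + \<phi> w"
  by (simp add: \<phi>_def zcomb_add)

lemma phi_zero: "\<phi> 0 = 0"
  using phi_add[of 0 0] by simp

lemma phi_uminus: "\<phi> (- v) = - \<phi> v"
  using phi_add[of v "- v"] by (simp add: phi_zero eq_neg_iff_add_eq_0 add.commute)

text \<open>The agreement spreads from the four basis degrees: duals give negatives, e1 \<star> e1 =
  e2 reaches the idempotents in copy 0, u1 \<star> u2 = v0 reaches u0 in copy 0, and products of u_k
  with an idempotent carry u_k from copy k to the other two copies.\<close>

lemma phi_deg: "\<phi> (deg_iota i b) = \<beta> i b"
proof -
  have dual: "\<phi> (deg_iota i (dual b)) = \<beta> i (dual b)" if "\<phi> (deg_iota i b) = \<beta> i b" for i b
    using that by (simp add: deg_dual phi_uminus beta_dual)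
  have star: "\<phi> (deg_iota i e) = \<beta> i e"
    if "\<phi> (deg_iota (i + 1) b) = \<beta> (i + 1) b" "\<phi> (deg_iota (i + 2) c) = \<beta> (i + 2) c"
      "k \<noteq> 0" "axis b 1 \<star> axis c 1 = k *s axis e (1::'k)"
      "deg_iota (i + 1) b + deg_iota (i + 2) c = deg_iota i e" for i b c e k
    using that(1,2) beta_star[OF that(3,4), of i] phi_add[of "deg_iota (i + 1) b" "deg_iota (i + 2) c"] that(5) by simp
  have base: "\<phi> (deg_iota 1 Oe1) = \<beta> 1 Oe1" "\<phi> (deg_iota 2 Oe1) = \<beta> 2 Oe1"
    "\<phi> (deg_iota 1 (Ou 1)) = \<beta> 1 (Ou 1)" "\<phi> (deg_iota 2 (Ou 2)) = \<beta> 2 (Ou 2)"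
    by (simp_all add: \<phi>_def zcomb_def deg_iota.simps deg_simps)
  have s1: "axis Oe1 1 \<star> axis Oe1 1 = 1 *s axis Oe2 (1::'k)"
    and s2: "axis (Ou 1) 1 \<star> axis (Ou 2) 1 = 1 *s axis (Ov 0) (1::'k)"
    by (simp_all add: oct_eq_iff S8_coords)
  have s3: "axis (Ou k) 1 \<star> axis Oe1 1 = (-1) *s axis (Ou k) (1::'k)"
    and s4: "axis Oe2 1 \<star> axis (Ou k) 1 = (-1) *s axis (Ou k) (1::'k)" for k
    by (cases k rule: cases_3; simp add: oct_eq_iff S8_coords)+
  have "\<phi> (deg_iota 0 Oe2) = \<beta> 0 Oe2"
    by (rule star[of 0 Oe1 Oe1 1]) (use base s1 deg_star(2)[of 0] in simp_all)
  from dual[OF this] have e1: "\<phi> (deg_iota i Oe1) = \<beta> i Oe1" for i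
    using base by (cases i rule: cases_3) simp_all
  have e2: "\<phi> (deg_iota i Oe2) = \<beta> i Oe2" for i using dual[OF e1[of i]] by simp
  have "\<phi> (deg_iota 0 (Ov 0)) = \<beta> 0 (Ov 0)"
    by (rule star[of 0 "Ou 1" "Ou 2" 1]) (use base s2 deg_star(11)[of 0 0] in simp_all)
  from dual[OF this] have g: "\<phi> (deg_iota i (Ou i)) = \<beta> i (Ou i)" for i
    using base by (cases i rule: cases_3) simp_all
  have u1: "\<phi> (deg_iota i (Ou (i + 1))) = \<beta> i (Ou (i + 1))" for i
    by (rule star[of i "Ou (i + 1)" Oe1 "-1"]) (use g[of "i + 1"] e1 s3 deg_star(6)[of i "i + 1"] in simp_all)
  have u2: "\<phi> (deg_iota i (Ou (i + 2))) = \<beta> i (Ou (i + 2))" for i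
    by (rule star[of i Oe2 "Ou (i + 2)" "-1"]) (use g[of "i + 2"] e2 s4 deg_star(5)[of i "i + 2"] in simp_all)
  have u: "\<phi> (deg_iota i (Ou k)) = \<beta> i (Ou k)" for i k
  proof -
    consider "k = i" | "k = i + 1" | "k = i + 2" by (cases i rule: cases_3; cases k rule: cases_3) simp_all
    then show ?thesis by cases (simp_all only: g u1 u2)
  qed
  then have "\<phi> (deg_iota i (Ov k)) = \<beta> i (Ov k)" for i k using dual[OF u[of i k]] by simp
  then show ?thesis using e1 e2 u by (cases b) simp_all
qed

lemma root_sum_mem:
  assumes "\<And>i. oct_hom i v (x i)"
  shows "gel 0 0 x x \<in> B (\<phi> v)"
proof -
  have e: "(\<Sum>i\<in>UNIV. \<Sum>b\<in>UNIV. x i $ b *s copy_at i (axis b (1::'k)) j) = x j" for j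
  proof -
    have "(\<Sum>i\<in>UNIV. \<Sum>b\<in>UNIV. x i $ b *s copy_at i (axis b (1::'k)) j)
        = (\<Sum>i\<in>UNIV. if j = i then (\<Sum>b\<in>UNIV. x i $ b *s axis b (1::'k)) else 0)"
      by (rule sum.cong) (auto simp: copy_at_def)
    then show ?thesis by (simp add: basis_expansion)
  qed
  have "gel 0 0 x x = (\<Sum>i\<in>UNIV. \<Sum>b\<in>UNIV. gscale (x i $ b) (even_root i b))"
    unfolding even_root_def gel_scale gel_sum e by (simp add: zero_fun_def)
  moreover have "gscale (x i $ b) (even_root i b) \<in> B (\<phi> v)" for i b
  proof (cases "x i $ b = 0")
    case True
    then show ?thesis using zeroB by (simp add: module.scale_zero_left[OF module_gscale])
  next
    case False
    then have "deg_iota i b = v" using assms by (simp add: oct_hom_def)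
    then show ?thesis using scaleB[OF even_roots[of i b]] by (simp flip: phi_deg)
  qed
  ultimately show ?thesis by (simp add: sumB)
qed

lemma tri_part_mem:
  assumes d: "d \<in> tri8" and h: "end_hom 0 v (d 0)"
  shows "gel d 0 0 0 \<in> B (\<phi> v)"
proof -
  have "gel d 0 0 0 = (\<Sum>b\<in>UNIV. \<Sum>c\<in>UNIV. gscale (tri_coeff d b c) (gel (theta 0 (t8 (axis (dual b) 1) (axis c 1))) 0 0 0))"
    unfolding gel_scale gel_sum by (subst tri8_expand[OF d]) (simp add: zero_fun_def theta_def)
  moreover have "gscale (tri_coeff d b c) (gel (theta 0 (t8 (axis (dual b) 1) (axis c 1))) 0 0 0) \<in> B (\<phi> v)" for b c
  proof (cases "tri_coeff d b c = 0")
    case True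
    then show ?thesis using zeroB by (simp add: module.scale_zero_left[OF module_gscale])
  next
    case False
    then have "\<phi> v = \<beta> 0 (dual b) + \<beta> 0 c"
      using tri8_hom_coeff[of v d b c, OF h] phi_add[of "deg_iota 0 (dual b)" "deg_iota 0 c"] by (simp add: phi_deg)
    then show ?thesis using scaleB[OF tri8_root_mem[of 0 "dual b" c]] by simp
  qed
  ultimately show ?thesis by (simp add: sumB)
qed

lemma even_part_mem: "G0 v \<subseteq> B (\<phi> v)"
proof
  fix w :: "'k gvec" assume "w \<in> G0 v"
  then obtain d x where w: "w = gel d 0 x x" "d \<in> tri8" "end_hom 0 v (d 0)" "\<And>i. oct_hom i v (x i)"
    unfolding G0_def by blast
  have "w = gel d 0 0 0 + gel 0 0 x x" by (simp add: w(1) gel_add)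
  then show "w \<in> B (\<phi> v)" using addB[OF tri_part_mem[OF w(2,3)] root_sum_mem[OF w(4)]] by simp
qed

end

lemma copy_at_uminus: "- copy_at i x = copy_at i (- x)"
  by (simp add: copy_at_def fun_eq_iff)

lemma tau_nonzero: "tau i \<noteq> 0"
  by (simp add: tau_def)

text \<open>The odd root vectors contribute a single new degree \<open>\<eta>\<close>, that of the
  tri(S2) part. This part exchanges even and odd root vectors, so adding \<open>\<eta>\<close> twice
  changes nothing; this is where the factor Z2 comes from.\<close>

locale graded_family_odd = graded_family B \<beta>
  for B :: "'h::ab_group_add \<Rightarrow> 'k::field_char_0 gvec set" and \<beta> :: "3 \<Rightarrow> oct_basis \<Rightarrow> 'h" +
  fixes \<gamma> :: "3 \<Rightarrow> oct_basis \<Rightarrow> 'h"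
  assumes odd_roots: "\<And>i b. odd_root i b \<in> B (\<gamma> i b)"
begin

lemma scale_cancel: "k \<noteq> 0 \<Longrightarrow> gscale k w \<in> B g \<Longrightarrow> w \<in> B g"
  using scaleB[of "gscale k w" g "1 / k"]
  by (simp add: module.scale_scale[OF module_gscale] module.scale_one[OF module_gscale])

text \<open>The element t of the two idempotents of S2, rotated to copy i. Up to a factor it is the
  bracket of an even and an odd root vector, which gives it a degree.\<close>

definition \<kappa> :: "3 \<Rightarrow> 'k gvec" where
  "\<kappa> i = gel 0 (\<lambda>j. tau (j - i)) 0 0"

lemma kappa_mem: "\<kappa> i \<in> B (\<beta> i Oe1 + \<gamma> i Oe2)"
proof -
  have "gbracket (even_root i Oe1) (odd_root i Oe2) = gscale (-2) (\<kappa> i)"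
    unfolding even_root_def odd_root_def copy_at_uminus bracket_same_copy \<kappa>_def gel_scale gel_eq_iff
    by (simp add: fun_eq_iff q8_minus q8_axis_dual theta_def lin_minus(1)[OF t8_lin(2)])
  then have "gscale (-2) (\<kappa> i) \<in> B (\<beta> i Oe1 + \<gamma> i Oe2)"
    using mult[OF even_roots odd_roots, of i Oe1 i Oe2] by simp
  then show ?thesis by (rule scale_cancel[rotated]) simp
qed

definition \<eta> :: 'h where "\<eta> = \<beta> 0 Oe1 + \<gamma> 0 Oe2"

text \<open>All values of \<open>tau\<close> are nonzero, so \<open>\<kappa> i\<close> carries the
  even root vector of any copy to a nonzero multiple of the odd one.\<close>

lemma gamma_eq: "\<gamma> j b = \<beta> i Oe1 + \<gamma> i Oe2 + \<beta> j b"
proof -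
  have "gbracket (\<kappa> i) (even_root j b) = gscale (tau (j - i)) (odd_root j b)"
    unfolding even_root_def odd_root_def copy_at_uminus \<kappa>_def bracket_tri2 gel_scale gel_eq_iff
    by (simp add: fun_eq_iff copy_at_def)
  then have "odd_root j b \<in> B (\<beta> i Oe1 + \<gamma> i Oe2 + \<beta> j b)"
    using mult[OF kappa_mem even_roots, of i j b] scale_cancel[OF tau_nonzero] by simp
  then show ?thesis using disjoint[OF odd_roots _ root_nonzero(2)] by blast
qed

lemma beta_eq: "\<beta> j b = \<eta> + \<gamma> j b"
proof -
  have "gbracket (\<kappa> 0) (odd_root j b) = gscale (tau (j - 0)) (even_root j b)"
    unfolding even_root_def odd_root_def copy_at_uminus \<kappa>_def bracket_tri2 gel_scale gel_eq_iff
    by (simp add: fun_eq_iff copy_at_def)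
  then have "even_root j b \<in> B (\<beta> 0 Oe1 + \<gamma> 0 Oe2 + \<gamma> j b)"
    using mult[OF kappa_mem odd_roots, of 0 j b] scale_cancel[OF tau_nonzero] by simp
  then show ?thesis unfolding \<eta>_def using disjoint[OF even_roots _ root_nonzero(1)] by blast
qed

lemma eta_eq: "\<beta> i Oe1 + \<gamma> i Oe2 = \<eta>"
  using gamma_eq[of 0 Oe1 i] gamma_eq[of 0 Oe1 0] by (simp add: \<eta>_def)

lemma eta_double: "\<eta> + \<eta> = 0"
  using beta_eq[of 0 Oe1] gamma_eq[of 0 Oe1 0] by (simp add: \<eta>_def[symmetric] add.assoc[symmetric])

definition \<Phi> :: "G3 \<Rightarrow> 'h" where
  "\<Phi> s = (if fst s = 0 then 0 else \<eta>) + \<phi> (snd s)"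

lemma Phi_add: "\<Phi> (s + t) = \<Phi> s + \<Phi> t"
proof -
  have "fst s = 0 \<or> fst s = 1" "fst t = 0 \<or> fst t = 1" using exhaust_2[of "fst s"] exhaust_2[of "fst t"] by auto
  moreover have "\<eta> + (\<eta> + x) = x" for x using eta_double by (simp flip: add.assoc)
  ultimately show ?thesis
    by (elim disjE) (simp_all add: \<Phi>_def phi_add algebra_simps)
qed

lemma odd_part_mem: "G1 v \<subseteq> B (\<eta> + \<phi> v)"
proof
  fix w :: "'k gvec" assume "w \<in> G1 v"
  then obtain c x where w: "w = gel 0 c x (- x)" "c \<in> tri2_scalars" "v \<noteq> 0 \<Longrightarrow> c = 0" "\<And>i. oct_hom i v (x i)"
    unfolding G1_def by blast
  have "gel 0 c 0 0 \<in> B (\<eta> + \<phi> v)"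
  proof (cases "v = 0")
    case True
    have c: "c 0 = - c 1 - c 2"
    proof -
      have "c 0 + (c 1 + c 2) = 0" using w(2) by (simp add: tri2_scalars_def add.assoc)
      then show ?thesis by (simp add: eq_neg_iff_add_eq_0 algebra_simps)
    qed
    \<comment> \<open>On triples of sum 0 the matrix with entries tau (j - i) acts as -3/2: its
      diagonal gives -c j, and the other two entries together give half of -c j. Hence the factor
      -2/3.\<close>
    have cj: "c j = (\<Sum>i\<in>UNIV. - (2 / 3) * c i * tau (j - i))" for j
    proof -
      have t: "tau (j - i) = (if i = j then - 1 else 1 / 2 :: 'k)" for i j
        by (simp add: tau_def eq_commute[of i j])
      show ?thesis
        unfolding sum_3' t by (rule cases_3[of j]) (simp_all add: c algebra_simps mod3_simps)
    qed
    have "gel 0 c 0 0 = (\<Sum>i\<in>UNIV. gscale (- (2 / 3) * c i) (\<kappa> i))"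
      unfolding \<kappa>_def gel_scale gel_sum gel_eq_iff
      by (intro conjI ext; (simp; fail)?; rule trans[OF cj]; simp)
    moreover have "gscale (- (2 / 3) * c i) (\<kappa> i) \<in> B \<eta>" for i
      using scaleB[OF kappa_mem[of i]] by (simp add: eta_eq)
    ultimately have "gel 0 c 0 0 \<in> B \<eta>" by (metis (no_types, lifting) sumB)
    then show ?thesis unfolding True phi_zero by simp
  next
    case False
    then have "c = 0" by (rule w(3))
    then show ?thesis using zeroB by (simp add: gel_zero)
  qed
  moreover have "gel 0 0 x (- x) \<in> B (\<eta> + \<phi> v)"
  proof -
    have e: "(\<Sum>i\<in>UNIV. \<Sum>b\<in>UNIV. x i $ b *s copy_at i (axis b (1::'k)) j) = x j" for j
    proof -
      have "(\<Sum>i\<in>UNIV. \<Sum>b\<in>UNIV. x i $ b *s copy_at i (axis b (1::'k)) j)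
          = (\<Sum>i\<in>UNIV. if j = i then (\<Sum>b\<in>UNIV. x i $ b *s axis b (1::'k)) else 0)"
        by (rule sum.cong) (auto simp: copy_at_def)
      then show ?thesis by (simp add: basis_expansion)
    qed
    have "gel 0 0 x (- x) = (\<Sum>i\<in>UNIV. \<Sum>b\<in>UNIV. gscale (x i $ b) (odd_root i b))"
      unfolding odd_root_def gel_scale gel_sum e gel_eq_iff
      by (simp add: fun_eq_iff sum_negf e)
    moreover have "gscale (x i $ b) (odd_root i b) \<in> B (\<eta> + \<phi> v)" for i b
    proof (cases "x i $ b = 0")
      case True
      then show ?thesis using zeroB by (simp add: module.scale_zero_left[OF module_gscale])
    next
      case False
      then have "deg_iota i b = v" using w(4) by (simp add: oct_hom_def)
      then have "\<gamma> i b = \<eta> + \<phi> v" using gamma_eq[of i b 0] phi_deg[of i b] by (simp add: \<eta>_def)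
      then show ?thesis using scaleB[OF odd_roots[of i b]] by simp
    qed
    ultimately show ?thesis by (simp only:) (intro sumB)
  qed
  moreover have "w = gel 0 c 0 0 + gel 0 0 x (- x)" by (simp add: w(1) gel_add)
  ultimately show "w \<in> B (\<eta> + \<phi> v)" using addB by simp
qed

lemma Gamma3_mem: "Gamma3 s \<subseteq> B (\<Phi> s)"
  unfolding Gamma3_cases \<Phi>_def using even_part_mem odd_part_mem by simp

end

lemma graded_g: "graded_algebra g_S8_S2 (Gamma3 :: G3 \<Rightarrow> 'k::field_char_0 gvec set)"
  by (intro graded_algebra.intro graded_algebra_axioms.intro ambient_g group_grading_g)

lemma graded_f4: "graded_algebra f4 (f4_cartan_grading :: int ^ 4 \<Rightarrow> 'k::field_char_0 gvec set)"
  by (intro graded_algebra.intro graded_algebra_axioms.intro ambient_f4 group_grading_f4)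

lemma root_supp:
  "(0, deg_iota i b) \<in> grading_supp (Gamma3 :: G3 \<Rightarrow> 'k::field_char_0 gvec set)"
  "(1, deg_iota i b) \<in> grading_supp (Gamma3 :: G3 \<Rightarrow> 'k gvec set)"
  "deg_iota i b \<in> grading_supp (f4_cartan_grading :: int ^ 4 \<Rightarrow> 'k gvec set)"
proof -
  show "(0, deg_iota i b) \<in> grading_supp (Gamma3 :: G3 \<Rightarrow> 'k gvec set)"
    unfolding graded_algebra.supp_comp_ex[OF graded_g] using even_root_mem root_nonzero(1) by (rule bexI[rotated])
  show "(1, deg_iota i b) \<in> grading_supp (Gamma3 :: G3 \<Rightarrow> 'k gvec set)"
    unfolding graded_algebra.supp_comp_ex[OF graded_g] using odd_root_mem root_nonzero(2) by (rule bexI[rotated])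
  show "deg_iota i b \<in> grading_supp (f4_cartan_grading :: int ^ 4 \<Rightarrow> 'k gvec set)"
    unfolding graded_algebra.supp_comp_ex[OF graded_f4] f4_cartan_eq Gamma3_0[symmetric]
    using even_root_mem root_nonzero(1) by (rule bexI[rotated])
qed

lemma axis_deg: "axis 1 1 = deg_iota 1 Oe1" "axis 2 1 = deg_iota 2 Oe1"
  "axis 3 1 = deg_iota 1 (Ou 1)" "axis 4 1 = deg_iota 2 (Ou 2)"
  by (simp_all add: deg_iota.simps deg_simps vec4_eq_iff axis_def)

lemma lattice_hom_eqI:
  fixes f g :: "int ^ 4 \<Rightarrow> 'h::ab_group_add"
  assumes "\<And>x y. f (x + y) = f x + f y" "\<And>x y. g (x + y) = g x + g y"
    "\<And>i b. f (deg_iota i b) = g (deg_iota i b)"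
  shows "f = g"
proof
  fix v
  show "f v = g v"
    unfolding additive_eq_zcomb[of f v, OF assms(1)] additive_eq_zcomb[of g v, OF assms(2)] axis_deg assms(3) ..
qed

text \<open>The degrees of the root vectors generate Z2 x Z^4: the even ones contain the canonical
  basis of Z^4, and (1, 0) is the difference of an odd and an even degree over the same short
  root.\<close>

lemma G3_hom_eqI:
  fixes f g :: "G3 \<Rightarrow> 'h::ab_group_add"
  assumes f: "\<And>x y. f (x + y) = f x + f y" and g: "\<And>x y. g (x + y) = g x + g y"
    and e: "\<And>i b. f (0, deg_iota i b) = g (0, deg_iota i b)" "\<And>i b. f (1, deg_iota i b) = g (1, deg_iota i b)"
  shows "f = g"
proof
  have l: "(\<lambda>v. f (0, v)) = (\<lambda>v. g (0, v))"
    by (rule lattice_hom_eqI) (use f[of "(0, _)" "(0, _)"] g[of "(0, _)" "(0, _)"] e in simp_all)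
  have "f (1, 0) + f (0, deg_iota 0 Oe1) = g (1, 0) + g (0, deg_iota 0 Oe1)"
    using f[of "(1, 0)" "(0, deg_iota 0 Oe1)"] g[of "(1, 0)" "(0, deg_iota 0 Oe1)"] e by simp
  then have o: "f (1, 0) = g (1, 0)" using e by simp
  fix s :: G3
  obtain k v where s: "s = (k, v)" by fastforce
  have "k = 0 \<or> k = 1" using exhaust_2[of k] by auto
  then show "f s = g s"
    using fun_cong[OF l, of v] o f[of "(1, 0)" "(0, v)"] g[of "(1, 0)" "(0, v)"] by (elim disjE) (simp_all add: s)
qed

text \<open>A realization B has the same components under other labels. The labels of the components
  that contain root vectors satisfy the assumptions of \<open>graded_family_odd\<close>, whose
  \<open>\<Phi>\<close> is the required homomorphism; uniqueness is
  \<open>G3_hom_eqI\<close>.\<close>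

theorem universal_group_g:
  "universal_group TYPE('h::ab_group_add) (g_S8_S2 :: ('k::field_char_0, 'k gvec) algebra_struct) Gamma3"
  unfolding universal_group_def
proof (intro conjI allI impI)
  show "group_grading (g_S8_S2 :: ('k, 'k gvec) algebra_struct) Gamma3" by (rule group_grading_g)
  fix B :: "'h \<Rightarrow> 'k gvec set"
  assume "group_grading g_S8_S2 B \<and> hom_components B = hom_components (Gamma3 :: G3 \<Rightarrow> 'k gvec set)"
  then have gr: "group_grading g_S8_S2 B" and hc: "hom_components B = hom_components (Gamma3 :: G3 \<Rightarrow> 'k gvec set)"
    by auto
  interpret B: graded_algebra g_S8_S2 B
    by (intro graded_algebra.intro graded_algebra_axioms.intro ambient_g gr)
  interpret A: graded_algebra g_S8_S2 "Gamma3 :: G3 \<Rightarrow> 'k gvec set" by (rule graded_g)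
  have ex: "\<exists>h. B h = Gamma3 s" if "s \<in> grading_supp (Gamma3 :: G3 \<Rightarrow> 'k gvec set)" for s
  proof -
    have "Gamma3 s \<in> hom_components B" unfolding hc unfolding hom_components_def using that by (rule imageI)
    then show ?thesis unfolding hom_components_def by (elim imageE) (rule exI, rule sym)
  qed
  obtain \<beta> where b: "\<And>i b. B (\<beta> i b) = Gamma3 (0, deg_iota i b)" using ex[OF root_supp(1)] by metis
  obtain \<gamma> where c: "\<And>i b. B (\<gamma> i b) = Gamma3 (1, deg_iota i b)" using ex[OF root_supp(2)] by metis
  interpret F: graded_family_odd B \<beta> \<gamma>
  proof unfold_locales
    show "g = h" if "w \<in> B g" "w \<in> B h" "w \<noteq> 0" for w g h using B.comp_disjoint[OF that] .
    show "gbracket a b \<in> B (g + h)" if "a \<in> B g" "b \<in> B h" for a b g h using B.comp_mult[OF that] by simp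
    show "module.subspace gscale (B g)" for g using B.comp_subspace[of g] by simp
    show "even_root i b' \<in> B (\<beta> i b')" for i b' unfolding b by (rule even_root_mem)
    show "odd_root i b' \<in> B (\<gamma> i b')" for i b' unfolding c by (rule odd_root_mem)
  qed
  have val: "B h = Gamma3 s \<longleftrightarrow> h = F.\<Phi> s" if s: "s \<in> grading_supp (Gamma3 :: G3 \<Rightarrow> 'k gvec set)" for s h
  proof -
    obtain w :: "'k gvec" where w: "w \<in> Gamma3 s" "w \<noteq> 0" using s[unfolded A.supp_comp_ex] by blast
    then have "w \<in> B (F.\<Phi> s)" using F.Gamma3_mem by blast
    then have *: "B h = Gamma3 s \<Longrightarrow> h = F.\<Phi> s" for h using w B.comp_disjoint by blast
    obtain h0 where "B h0 = Gamma3 s" using ex[OF s] by blast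
    then show ?thesis using * by metis
  qed
  show "\<exists>!f. (\<forall>x y. f (x + y) = f x + f y) \<and> (\<forall>s\<in>grading_supp (Gamma3 :: G3 \<Rightarrow> 'k gvec set). B (f s) = Gamma3 s)"
  proof (rule ex1I[of _ F.\<Phi>])
    show "(\<forall>x y. F.\<Phi> (x + y) = F.\<Phi> x + F.\<Phi> y) \<and> (\<forall>s\<in>grading_supp (Gamma3 :: G3 \<Rightarrow> 'k gvec set). B (F.\<Phi> s) = Gamma3 s)"
      using F.Phi_add val by blast
    fix f assume f: "(\<forall>x y. f (x + y) = f x + f y) \<and> (\<forall>s\<in>grading_supp (Gamma3 :: G3 \<Rightarrow> 'k gvec set). B (f s) = Gamma3 s)"
    show "f = F.\<Phi>"
      by (rule G3_hom_eqI) (use f val root_supp in \<open>blast intro: F.Phi_add\<close>)+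
  qed
qed

lemma deg_iota_determines: "deg_iota j c = deg_iota i b \<Longrightarrow> j = i \<and> c = b"
  by (simp add: deg_iota_inj)

lemma hom_root_line:
  assumes "\<And>j. oct_hom j (deg_iota i b) (x j)"
  shows "x = copy_at i (x i $ b *s axis b 1)"
proof -
  have "x j $ c = copy_at i (x i $ b *s axis b 1) j $ c" for j c
  proof (cases "x j $ c = 0")
    case True
    then show ?thesis by (auto simp: copy_at_def)
  next
    case False
    then have "j = i" "c = b" using assms[of j] deg_iota_determines[of j c i b] by (auto simp: oct_hom_def)
    then show ?thesis by (simp add: copy_at_def)
  qed
  then show ?thesis unfolding fun_eq_iff vec_eq_iff by blast
qed

text \<open>Degrees in tri(S8) are sums of two degrees of copy 0, so they have even norm. As a
  consequence the components at short roots are lines.\<close>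

lemma odd_degree_tri8:
  fixes d :: "3 \<Rightarrow> 'k::field_char_0 oct \<Rightarrow> 'k oct"
  assumes d: "d \<in> tri8" and h: "end_hom 0 v (d 0)" and v: "odd (root_norm v)"
  shows "d = 0"
proof -
  have "tri_coeff d b c = 0" for b c
  proof (rule ccontr)
    assume "tri_coeff d b c \<noteq> 0"
    then have v': "v = deg_iota 0 (dual b) + deg_iota 0 c" by (rule tri8_hom_coeff[of v d b c, OF h, symmetric])
    have "even (root_norm (deg_iota 0 (dual b) - deg_iota 0 (dual c)))"
      using copy_of_eq_iff[of "deg_iota 0 (dual b)" "deg_iota 0 (dual c)"]
      by (simp only: root_norm_deg_iota copy_of_deg_iota odd_one simp_thms)
    then have "even (root_norm v)" unfolding v' deg_dual[of 0 c] by (simp only: diff_minus_eq_add)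
    then show False using v by (rule notE[rotated])
  qed
  then have "(\<lambda>i v. \<Sum>b\<in>UNIV. \<Sum>c\<in>UNIV. tri_coeff d b c *s t8 (axis (dual b) 1) (axis c 1) i v) = 0"
    by (simp add: fun_eq_iff)
  then show ?thesis by (rule trans[OF tri8_expand[OF d]])
qed

lemma even_line:
  fixes w :: "'k::field_char_0 gvec"
  assumes "w \<in> Gamma3 (0, deg_iota i b)"
  shows "\<exists>k. w = gscale k (even_root i b)"
proof -
  obtain d x where w: "w = gel d 0 x x" "d \<in> tri8" "end_hom 0 (deg_iota i b) (d 0)" "\<And>j. oct_hom j (deg_iota i b) (x j)"
    using assms unfolding Gamma3_0 G0_def by blast
  have "d = 0" using odd_degree_tri8[OF w(2,3)] by (simp add: root_norm_deg_iota)
  define k where "k = x i $ b"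
  have "x = copy_at i (k *s axis b 1)" unfolding k_def by (rule hom_root_line[OF w(4)])
  then have xk: "x = (\<lambda>j. k *s copy_at i (axis b 1) j)" by (simp add: copy_at_def fun_eq_iff)
  have "w = gscale k (even_root i b)"
    unfolding w(1) xk \<open>d = 0\<close> even_root_def gel_scale gel_eq_iff by (simp add: fun_eq_iff)
  then show ?thesis ..
qed

lemma odd_line:
  fixes w :: "'k::field_char_0 gvec"
  assumes "w \<in> Gamma3 (1, deg_iota i b)"
  shows "\<exists>k. w = gscale k (odd_root i b)"
proof -
  obtain c x where w: "w = gel 0 c x (- x)" "deg_iota i b \<noteq> 0 \<Longrightarrow> c = 0" "\<And>j. oct_hom j (deg_iota i b) (x j)"
    using assms unfolding Gamma3_1 G1_def by blast
  have "deg_iota i b \<noteq> 0" using root_norm_deg_iota[of i b] by (auto simp: root_norm_eq_0[THEN iffD2])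
  then have "c = 0" by (rule w(2))
  define k where "k = x i $ b"
  have "x = copy_at i (k *s axis b 1)" unfolding k_def by (rule hom_root_line[OF w(3)])
  then have xk: "x = (\<lambda>j. k *s copy_at i (axis b 1) j)" by (simp add: copy_at_def fun_eq_iff)
  have "w = gscale k (odd_root i b)"
    unfolding w(1) xk \<open>c = 0\<close> odd_root_def gel_scale gel_eq_iff by (simp add: fun_eq_iff)
  then show ?thesis ..
qed

lemma proj_G3_of_Gamma3:
  fixes x :: "'k::field_char_0 gvec"
  assumes "x \<in> Gamma3 h"
  shows "proj_G3 g x = (if g = h then x else 0)"
proof -
  have "fst g = 0 \<or> fst g = 1" "fst h = 0 \<or> fst h = 1" using exhaust_2[of "fst g"] exhaust_2[of "fst h"] by auto
  then show ?thesis
    using assms unfolding Gamma3_cases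
    by (elim disjE) (simp_all add: proj_G3_def prod_eq_iff proj_even_of_G0 proj_odd_of_G0 proj_even_of_G1 proj_odd_of_G1)
qed

lemma proj_G3_add:
  fixes x y :: "'k::field_char_0 gvec"
  assumes "x \<in> alg_carrier g_S8_S2" "y \<in> alg_carrier g_S8_S2"
  shows "proj_G3 g (x + y) = proj_G3 g x + proj_G3 g y"
  using proj_even_add[OF assms] proj_odd_add[OF assms] by (simp add: proj_G3_def)

text \<open>A refinement cannot split a line, so all root vectors stay homogeneous in B. Then
  \<open>Gamma3_mem\<close> puts each component of \<open>Gamma3\<close> inside a component of B,
  which leaves no room for a proper inclusion in the other direction.\<close>

theorem fine_grading_g:
  "fine_grading TYPE('h::ab_group_add) (g_S8_S2 :: ('k::field_char_0, 'k gvec) algebra_struct) Gamma3"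
  unfolding fine_grading_def
proof (intro conjI notI)
  show "group_grading (g_S8_S2 :: ('k, 'k gvec) algebra_struct) Gamma3" by (rule group_grading_g)
  assume "\<exists>B :: 'h \<Rightarrow> 'k gvec set. group_grading g_S8_S2 B \<and> proper_refinement B (Gamma3 :: G3 \<Rightarrow> 'k gvec set)"
  then obtain B :: "'h \<Rightarrow> 'k gvec set" where gr: "group_grading g_S8_S2 B"
    and pr: "proper_refinement B (Gamma3 :: G3 \<Rightarrow> 'k gvec set)" by blast
  interpret B: graded_algebra g_S8_S2 B
    by (intro graded_algebra.intro graded_algebra_axioms.intro ambient_g gr)
  interpret A: graded_algebra g_S8_S2 "Gamma3 :: G3 \<Rightarrow> 'k gvec set" by (rule graded_g)
  have sub: "\<exists>s. B h \<subseteq> Gamma3 s" for h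
  proof (cases "h \<in> grading_supp B")
    case True
    then have "B h \<in> hom_components B" unfolding hom_components_def by (rule imageI)
    then show ?thesis using pr unfolding proper_refinement_def hom_components_def by blast
  next
    case False
    then have "B h = {0}" by (simp add: grading_supp_def)
    then show ?thesis using A.comp_zero by auto
  qed
  have line: "\<exists>h. w \<in> B h"
    if w: "w \<in> Gamma3 s" and span: "\<And>w'. w' \<in> Gamma3 s \<Longrightarrow> \<exists>k. w' = gscale k w" and w0: "w \<noteq> 0" for w s
  proof (rule ccontr)
    assume no: "\<nexists>h. w \<in> B h"
    have wC: "w \<in> alg_carrier g_S8_S2" using w A.comp_carrier by blast
    obtain c where c: "finite {h. c h \<noteq> 0}" "\<And>h. c h \<in> B h" "w = (\<Sum>h | c h \<noteq> 0. c h)"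
      using B.decomposition[OF wC] by blast
    \<comment> \<open>Each \<open>c h\<close> lies in some component of \<open>Gamma3\<close>. If
      that is the component of w and \<open>c h\<close> is nonzero, it is a multiple of w and makes
      w homogeneous in B. Otherwise its projection is 0, and then so is that of w.\<close>
    have p: "proj_G3 s (c h) = 0" for h
    proof (rule ccontr)
      assume n: "proj_G3 s (c h) \<noteq> 0"
      obtain s' where s': "c h \<in> Gamma3 s'" using sub[of h] c(2)[of h] by blast
      have "proj_G3 s (c h) = (if s = s' then c h else 0)" by (rule proj_G3_of_Gamma3[OF s'])
      then have ss: "s = s'" "c h \<noteq> 0" using n by (auto split: if_splits)
      then obtain k where k: "c h = gscale k w" using span s' by blast
      then have "k \<noteq> 0" using ss(2) by (auto simp: module.scale_zero_left[OF module_gscale])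
      then have "w = gscale (1 / k) (c h)"
        by (simp add: k module.scale_scale[OF module_gscale] module.scale_one[OF module_gscale])
      moreover have "gscale (1 / k) (c h) \<in> B h"
        using B.subspace_scale[OF B.comp_subspace c(2)[of h], of "1 / k"] by simp
      ultimately show False using no by blast
    qed
    have cC: "c h \<in> alg_carrier g_S8_S2" for h using c(2) B.comp_carrier by blast
    have "(\<Sum>h\<in>S. c h) \<in> alg_carrier g_S8_S2 \<and> proj_G3 s (\<Sum>h\<in>S. c h) = 0" if "finite S" for S
      using that
    proof induction
      case empty
      have "proj_G3 s (0::'k gvec) = 0" using proj_G3_of_Gamma3[OF A.comp_zero, of s s] by simp
      then show ?case using B.zero_C by simp
    next
      case (insert h S)
      then show ?case using proj_G3_add[OF cC[of h], of "\<Sum>h\<in>S. c h" s] p B.add_C[OF cC[of h]] by simp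
    qed
    then have "proj_G3 s w = 0" using c(1,3) by simp
    then show False using proj_G3_of_Gamma3[OF w, of s] w0 by simp
  qed
  have "\<exists>h. even_root i b \<in> B h" for i b
  proof (rule line[OF even_root_mem _ root_nonzero(1)])
    fix w' :: "'k gvec" assume "w' \<in> Gamma3 (0, deg_iota i b)"
    then show "\<exists>k. w' = gscale k (even_root i b)" by (rule even_line)
  qed
  then obtain \<beta> where b: "\<And>i b. even_root i b \<in> B (\<beta> i b)" by metis
  have "\<exists>h. odd_root i b \<in> B h" for i b
  proof (rule line[OF odd_root_mem _ root_nonzero(2)])
    fix w' :: "'k gvec" assume "w' \<in> Gamma3 (1, deg_iota i b)"
    then show "\<exists>k. w' = gscale k (odd_root i b)" by (rule odd_line)
  qed
  then obtain \<gamma> where c: "\<And>i b. odd_root i b \<in> B (\<gamma> i b)" by metis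
  interpret F: graded_family_odd B \<beta> \<gamma>
  proof unfold_locales
    show "g = h" if "w \<in> B g" "w \<in> B h" "w \<noteq> 0" for w g h using B.comp_disjoint[OF that] .
    show "gbracket a b \<in> B (g + h)" if "a \<in> B g" "b \<in> B h" for a b g h using B.comp_mult[OF that] by simp
    show "module.subspace gscale (B g)" for g using B.comp_subspace[of g] by simp
  qed (rule b c)+
  obtain X Y where X: "X \<in> hom_components B" and Y: "Y \<in> hom_components (Gamma3 :: G3 \<Rightarrow> 'k gvec set)" and XY: "X \<subset> Y"
    using pr unfolding proper_refinement_def by blast
  obtain h where h: "X = B h" "h \<in> grading_supp B" using X unfolding hom_components_def by blast
  obtain s where s: "Y = Gamma3 s" using Y unfolding hom_components_def by blast
  obtain w where w: "w \<in> B h" "w \<noteq> 0" using h(2)[unfolded B.supp_comp_ex] by blast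
  have "w \<in> B (F.\<Phi> s)" using w XY F.Gamma3_mem[of s] unfolding h s by blast
  then have "h = F.\<Phi> s" using B.comp_disjoint[OF w(1) _ w(2)] by blast
  then show False using XY F.Gamma3_mem[of s] unfolding h s by blast
qed

text \<open>The argument for E6 with even root vectors only, over the group Z^4 that
  \<open>universal_graded_algebra\<close> asks for.\<close>

theorem universal_group_f4:
  "universal_group TYPE(int ^ 4) (f4 :: ('k::field_char_0, 'k gvec) algebra_struct) f4_cartan_grading"
  unfolding universal_group_def
proof (intro conjI allI impI)
  show "group_grading (f4 :: ('k, 'k gvec) algebra_struct) f4_cartan_grading" by (rule group_grading_f4)
  fix B :: "int ^ 4 \<Rightarrow> 'k gvec set"
  let ?A = "f4_cartan_grading :: int ^ 4 \<Rightarrow> 'k gvec set"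
  assume "group_grading f4 B \<and> hom_components B = hom_components ?A"
  then have gr: "group_grading f4 B" and hc: "hom_components B = hom_components ?A" by auto
  interpret B: graded_algebra f4 B
    by (intro graded_algebra.intro graded_algebra_axioms.intro ambient_f4 gr)
  interpret A: graded_algebra f4 ?A by (rule graded_f4)
  have ex: "\<exists>h. B h = ?A s" if "s \<in> grading_supp ?A" for s
  proof -
    have "?A s \<in> hom_components B" unfolding hc unfolding hom_components_def using that by (rule imageI)
    then show ?thesis unfolding hom_components_def by (elim imageE) (rule exI, rule sym)
  qed
  obtain \<beta> where b: "\<And>i b. B (\<beta> i b) = ?A (deg_iota i b)" using ex[OF root_supp(3)] by metis
  interpret F: graded_family B \<beta>
  proof unfold_locales
    show "g = h" if "w \<in> B g" "w \<in> B h" "w \<noteq> 0" for w g h using B.comp_disjoint[OF that] .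
    show "gbracket a b \<in> B (g + h)" if "a \<in> B g" "b \<in> B h" for a b g h using B.comp_mult[OF that] by simp
    show "module.subspace gscale (B g)" for g using B.comp_subspace[of g] by simp
    show "even_root i b' \<in> B (\<beta> i b')" for i b'
      unfolding b f4_cartan_eq Gamma3_0[symmetric] by (rule even_root_mem)
  qed
  have mem: "?A s \<subseteq> B (F.\<phi> s)" for s unfolding f4_cartan_eq by (rule F.even_part_mem)
  have val: "B h = ?A s \<longleftrightarrow> h = F.\<phi> s" if s: "s \<in> grading_supp ?A" for s h
  proof -
    obtain w where w: "w \<in> ?A s" "w \<noteq> 0" using s[unfolded A.supp_comp_ex] by blast
    then have "w \<in> B (F.\<phi> s)" using mem by blast
    then have *: "B h = ?A s \<Longrightarrow> h = F.\<phi> s" for h using w B.comp_disjoint by blast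
    obtain h0 where "B h0 = ?A s" using ex[OF s] by blast
    then show ?thesis using * by metis
  qed
  show "\<exists>!f. (\<forall>x y. f (x + y) = f x + f y) \<and> (\<forall>s\<in>grading_supp ?A. B (f s) = ?A s)"
  proof (rule ex1I[of _ F.\<phi>])
    show "(\<forall>x y. F.\<phi> (x + y) = F.\<phi> x + F.\<phi> y) \<and> (\<forall>s\<in>grading_supp ?A. B (F.\<phi> s) = ?A s)"
      using F.phi_add val by blast
    fix f assume f: "(\<forall>x y. f (x + y) = f x + f y) \<and> (\<forall>s\<in>grading_supp ?A. B (f s) = ?A s)"
    show "f = F.\<phi>"
      by (rule lattice_hom_eqI) (use f val root_supp in \<open>blast intro: F.phi_add\<close>)+
  qed
qed

section \<open>Automorphisms\<close>

text \<open>F and G are given on the whole ambient type, so F is first cut down to an extensional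
  map. Inclusions between components, for F and for its inverse G, combine to equalities.\<close>

lemma (in graded_algebra) induces_restrictI:
  assumes F: "\<And>x. x \<in> C \<Longrightarrow> F x \<in> C" and G: "\<And>x. x \<in> C \<Longrightarrow> G x \<in> C"
    and FG: "\<And>x. x \<in> C \<Longrightarrow> F (G x) = x" and GF: "\<And>x. x \<in> C \<Longrightarrow> G (F x) = x"
    and add: "\<And>x y. x \<in> C \<Longrightarrow> y \<in> C \<Longrightarrow> F (x + y) = F x + F y"
    and scale: "\<And>c x. x \<in> C \<Longrightarrow> F (alg_scale L c x) = alg_scale L c (F x)"
    and mult: "\<And>x y. x \<in> C \<Longrightarrow> y \<in> C \<Longrightarrow> F (alg_mult L x y) = alg_mult L (F x) (F y)"
    and \<alpha>: "bij \<alpha>" "\<And>s t. \<alpha> (s + t) = \<alpha> s + \<alpha> t"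
    and FA: "\<And>s. F ` A s \<subseteq> A (\<alpha> s)" and GA: "\<And>s. G ` A (\<alpha> s) \<subseteq> A s"
  shows "\<exists>f \<in> carrier (grading_auts L A). induces A f \<alpha>"
proof -
  define f where "f = restrict F C"
  have fF: "f x = F x" if "x \<in> C" for x using that by (simp add: f_def)
  have im: "f ` A s = A (\<alpha> s)" for s
  proof -
    have e: "f ` A s = F ` A s" using comp_carrier[of s] fF by (intro image_cong) auto
    have "A (\<alpha> s) \<subseteq> F ` A s"
    proof
      fix y assume y: "y \<in> A (\<alpha> s)"
      have "G y \<in> A s" using GA y by blast
      moreover have "y = F (G y)" using FG[of y] y comp_carrier[of "\<alpha> s"] by auto
      ultimately show "y \<in> F ` A s" by (rule rev_image_eqI)
    qed
    then show ?thesis using e FA by blast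
  qed
  have bij: "bij_betw f C C"
    by (rule bij_betw_byWitness[of _ G]) (use F G FG GF fF in auto)
  then have inj: "inj_on f C" by (rule bij_betw_imp_inj_on)
  have aut: "f \<in> algebra_auts L"
    unfolding algebra_auts_def Bij_def using bij add scale mult
    by (simp add: fF add_C scale_C mult_closed) (simp add: f_def)
  have f0: "f 0 = 0" using aut by (rule aut_zero)
  have supp: "\<alpha> s \<in> grading_supp A \<longleftrightarrow> s \<in> grading_supp A" for s
  proof -
    have "f ` A s = {0} \<longleftrightarrow> A s = {0}"
    proof
      assume *: "f ` A s = {0}"
      have "x = 0" if "x \<in> A s" for x
        by (rule inj_onD[OF inj]) (use * that comp_carrier[of s] zero_C f0 in auto)
      then show "A s = {0}" using comp_zero[of s] by blast
    qed (simp add: f0)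
    then show ?thesis by (simp add: grading_supp_def im)
  qed
  have "\<alpha> ` grading_supp A = grading_supp A"
  proof
    show "grading_supp A \<subseteq> \<alpha> ` grading_supp A"
    proof
      fix t assume t: "t \<in> grading_supp A"
      obtain s where "t = \<alpha> s" using bij_is_surj[OF \<alpha>(1)] by (rule surjE)
      then show "t \<in> \<alpha> ` grading_supp A" using t supp by blast
    qed
  qed (use supp in blast)
  then have "image f ` hom_components A = hom_components A"
    unfolding hom_components_def image_image im by (simp flip: image_image[of A \<alpha>])
  moreover have "inj_on (image f) (hom_components A)"
    using inj_on_image_Pow[OF inj] by (rule inj_on_subset) (use hom_comp_carrier in blast)
  ultimately have "f \<in> carrier (grading_auts L A)"
    unfolding grading_auts_carrier using aut by (simp add: bij_betw_def)
  moreover have "induces A f \<alpha>"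
    unfolding induces_def AutoGroup_additive_carrier using im \<alpha> by simp
  ultimately show ?thesis by blast
qed

text \<open>
  A triple of isometries compatible with the triality product up to a permutation of the three
  copies, which may reverse their cyclic order; then phi is an anti-homomorphism up to sign.
\<close>

locale oct_symmetry =
  fixes \<sigma> \<sigma>' :: "3 \<Rightarrow> 3" and \<phi> \<psi> :: "3 \<Rightarrow> 'k::field_char_0 oct \<Rightarrow> 'k oct" and f :: "int ^ 4 \<Rightarrow> int ^ 4"
  assumes lin_phi: "lin (\<phi> j)" and inv_phi: "\<phi> j (\<psi> j z) = z" "\<psi> j (\<phi> j z) = z"
    and perm: "\<sigma> (\<sigma>' j) = j" "\<sigma>' (\<sigma> j) = j"
    and q_phi: "q8 (\<phi> j x) (\<phi> j y) = q8 x y"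
    and t_phi: "\<phi> j (theta (\<sigma> i) (t8 x y) (\<sigma> j) z) = theta i (t8 (\<phi> i x) (\<phi> i y)) j (\<phi> j z)"
    and star_phi: "\<phi> k (u (\<sigma> k + 1) \<star> w (\<sigma> k + 2) - w (\<sigma> k + 1) \<star> u (\<sigma> k + 2)) =
       \<phi> (k + 1) (u (\<sigma> (k + 1))) \<star> \<phi> (k + 2) (w (\<sigma> (k + 2)))
         - \<phi> (k + 1) (w (\<sigma> (k + 1))) \<star> \<phi> (k + 2) (u (\<sigma> (k + 2)))"
    and deg_phi: "oct_hom (\<sigma> j) v z \<longleftrightarrow> oct_hom j (f v) (\<phi> j z)"
    and isom: "f \<in> isometries"
begin

lemma f_inv: "f (inv' f v) = v" "inv' f (f v) = v"
  using inv_comp_isometry[OF isom] by (simp_all add: fun_eq_iff)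

text \<open>The assumptions are symmetric under inversion, and the inverse symmetry supplies the
  second map for \<open>induces_restrictI\<close>.\<close>

lemma inverse: "oct_symmetry \<sigma>' \<sigma> (\<lambda>j. \<psi> (\<sigma>' j)) (\<lambda>j. \<phi> (\<sigma>' j)) (inv' f)"
proof
  fix i j k x y z v and u w :: "3 \<Rightarrow> 'k oct"
  show "lin (\<psi> (\<sigma>' j))"
    unfolding lin_def
  proof (intro conjI allI)
    fix a b :: "'k oct" and c :: 'k
    let ?p = "\<psi> (\<sigma>' j)"
    have "\<phi> (\<sigma>' j) (?p a + ?p b) = a + b" by (simp only: linD(1)[OF lin_phi] inv_phi)
    then show "?p (a + b) = ?p a + ?p b" using inv_phi(2)[of "\<sigma>' j" "?p a + ?p b"] by simp
    have "\<phi> (\<sigma>' j) (c *s ?p a) = c *s a" by (simp only: linD(2)[OF lin_phi] inv_phi)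
    then show "?p (c *s a) = c *s ?p a" using inv_phi(2)[of "\<sigma>' j" "c *s ?p a"] by simp
  qed
  show "\<psi> (\<sigma>' j) (\<phi> (\<sigma>' j) z) = z" "\<phi> (\<sigma>' j) (\<psi> (\<sigma>' j) z) = z" by (simp_all add: inv_phi)
  show "\<sigma>' (\<sigma> j) = j" "\<sigma> (\<sigma>' j) = j" by (simp_all add: perm)
  show "q8 (\<psi> (\<sigma>' j) x) (\<psi> (\<sigma>' j) y) = q8 x y"
    using q_phi[of "\<sigma>' j" "\<psi> (\<sigma>' j) x" "\<psi> (\<sigma>' j) y"] by (simp add: inv_phi)
  show "\<psi> (\<sigma>' j) (theta (\<sigma>' i) (t8 x y) (\<sigma>' j) z)
      = theta i (t8 (\<psi> (\<sigma>' i) x) (\<psi> (\<sigma>' i) y)) j (\<psi> (\<sigma>' j) z)"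
    using arg_cong[OF t_phi[of "\<sigma>' j" "\<sigma>' i" "\<psi> (\<sigma>' i) x" "\<psi> (\<sigma>' i) y" "\<psi> (\<sigma>' j) z"], of "\<psi> (\<sigma>' j)"]
    unfolding inv_phi perm by (rule sym)
  show "\<psi> (\<sigma>' k) (u (\<sigma>' k + 1) \<star> w (\<sigma>' k + 2) - w (\<sigma>' k + 1) \<star> u (\<sigma>' k + 2)) =
       \<psi> (\<sigma>' (k + 1)) (u (\<sigma>' (k + 1))) \<star> \<psi> (\<sigma>' (k + 2)) (w (\<sigma>' (k + 2)))
         - \<psi> (\<sigma>' (k + 1)) (w (\<sigma>' (k + 1))) \<star> \<psi> (\<sigma>' (k + 2)) (u (\<sigma>' (k + 2)))"
    using arg_cong[OF star_phi[of "\<sigma>' k" "\<lambda>j. \<psi> (\<sigma>' j) (u (\<sigma>' j))" "\<lambda>j. \<psi> (\<sigma>' j) (w (\<sigma>' j))"], of "\<psi> (\<sigma>' k)"]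
    unfolding inv_phi perm by (rule sym)
  show "oct_hom (\<sigma>' j) v z \<longleftrightarrow> oct_hom j (inv' f v) (\<psi> (\<sigma>' j) z)"
    using deg_phi[of "\<sigma>' j" "inv' f v" "\<psi> (\<sigma>' j) z"] unfolding inv_phi perm f_inv by (rule sym)
  show "inv' f \<in> isometries" by (rule isometry_inv[OF isom])
qed

definition gmap :: "'k gvec \<Rightarrow> 'k gvec" where
  "gmap w = gel (\<lambda>j z. \<phi> j (gd w (\<sigma> j) (\<psi> j z))) (\<lambda>j. gc w (\<sigma> j)) (\<lambda>j. \<phi> j (gx w (\<sigma> j))) (\<lambda>j. \<phi> j (gy w (\<sigma> j)))"

lemma gmap_gel:
  "gmap (gel d c x y) = gel (\<lambda>j z. \<phi> j (d (\<sigma> j) (\<psi> j z))) (\<lambda>j. c (\<sigma> j)) (\<lambda>j. \<phi> j (x (\<sigma> j))) (\<lambda>j. \<phi> j (y (\<sigma> j)))"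
  by (simp add: gmap_def)

lemma conj_t8: "\<phi> j (theta i (t8 x y) (\<sigma> j) (\<psi> j z)) = theta (\<sigma>' i) (t8 (\<phi> (\<sigma>' i) x) (\<phi> (\<sigma>' i) y)) j z"
  using t_phi[of j "\<sigma>' i" x y "\<psi> j z"] unfolding perm inv_phi .

text \<open>By \<open>tri8_expand\<close> it is enough that conjugation carries elements t to
  elements t, which is \<open>conj_t8\<close>; in this way triality of the conjugate comes from
  \<open>t8_tri8\<close>.\<close>

lemma conj_tri8:
  assumes d: "d \<in> tri8"
  shows "(\<lambda>j z. \<phi> j (d (\<sigma> j) (\<psi> j z))) \<in> tri8"
proof -
  have "\<phi> j (d (\<sigma> j) (\<psi> j z)) = (\<Sum>b\<in>UNIV. \<Sum>c\<in>UNIV. tri_coeff d b c *s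
      theta (\<sigma>' 0) (t8 (\<phi> (\<sigma>' 0) (axis (dual b) 1)) (\<phi> (\<sigma>' 0) (axis c 1))) j z)" for j z
  proof -
    have "d (\<sigma> j) (\<psi> j z) = (\<Sum>b\<in>UNIV. \<Sum>c\<in>UNIV. tri_coeff d b c *s
        theta 0 (t8 (axis (dual b) 1) (axis c 1)) (\<sigma> j) (\<psi> j z))"
      using fun_cong[OF fun_cong[OF tri8_expand[OF d]], of "\<sigma> j" "\<psi> j z"] by (simp add: theta_def)
    then show ?thesis by (simp add: lin_sum[OF lin_phi] linD(2)[OF lin_phi] conj_t8)
  qed
  then show ?thesis by (simp only:) (intro tri8_sum tri8_scale theta_tri8 t8_tri8)
qed

lemma bij_perm: "bij \<sigma>"
  by (rule o_bij[of \<sigma>']) (simp_all add: fun_eq_iff perm)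

lemma reindex: "(\<Sum>i\<in>UNIV. h i) = (\<Sum>i\<in>UNIV. h (\<sigma> i))"
  by (rule sum.reindex_bij_betw[OF bij_perm, symmetric])

text \<open>\<open>tau\<close> only distinguishes whether its argument is 0, so it is invariant
  under all permutations of the copies and not just under rotations.\<close>

lemma tau_perm: "tau (\<sigma> j - \<sigma> i) = (tau (j - i) :: 'k)"
  using perm(2)[of i] perm(2)[of j] by (auto simp: tau_def)

lemma phi_linear_combination:
  "\<phi> k (a - b + c *s p - c' *s r + s - t) = \<phi> k a - \<phi> k b + c *s \<phi> k p - c' *s \<phi> k r + \<phi> k (s - t)"
  by (simp add: linD[OF lin_phi] lin_minus(2)[OF lin_phi])

lemma phi_linear_combination':
  "\<phi> k (a - b - c *s p + c' *s r + s - t) = \<phi> k a - \<phi> k b - c *s \<phi> k p + c' *s \<phi> k r + \<phi> k (s - t)"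
  by (simp add: linD[OF lin_phi] lin_minus(2)[OF lin_phi])

lemma gmap_bracket:
  assumes "d \<in> tri8" "e \<in> tri8"
  shows "gmap (gbracket (gel d c x y) (gel e c' x' y')) = gbracket (gmap (gel d c x y)) (gmap (gel e c' x' y'))"
  unfolding gmap_gel gbracket_gel[OF assms] gbracket_gel[OF conj_tri8[OF assms(1)] conj_tri8[OF assms(2)]] gel_eq_iff
proof (intro conjI ext)
  fix j z
  show "\<phi> j (d (\<sigma> j) (e (\<sigma> j) (\<psi> j z)) - e (\<sigma> j) (d (\<sigma> j) (\<psi> j z))
      + (\<Sum>i\<in>UNIV. theta i (t8 (x i) (y' i)) (\<sigma> j) (\<psi> j z) + theta i (t8 (y i) (x' i)) (\<sigma> j) (\<psi> j z)))
    = \<phi> j (d (\<sigma> j) (\<psi> j (\<phi> j (e (\<sigma> j) (\<psi> j z))))) - \<phi> j (e (\<sigma> j) (\<psi> j (\<phi> j (d (\<sigma> j) (\<psi> j z)))))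
      + (\<Sum>i\<in>UNIV. theta i (t8 (\<phi> i (x (\<sigma> i))) (\<phi> i (y' (\<sigma> i)))) j z
          + theta i (t8 (\<phi> i (y (\<sigma> i))) (\<phi> i (x' (\<sigma> i)))) j z)"
    unfolding linD(1)[OF lin_phi] lin_minus(2)[OF lin_phi] lin_sum[OF lin_phi] conj_t8 inv_phi
    by (subst reindex) (simp only: perm)
next
  fix j
  show "(\<Sum>i\<in>UNIV. (q8 (x i) (y' i) - q8 (y i) (x' i)) * tau (\<sigma> j - i))
    = (\<Sum>i\<in>UNIV. (q8 (\<phi> i (x (\<sigma> i))) (\<phi> i (y' (\<sigma> i))) - q8 (\<phi> i (y (\<sigma> i))) (\<phi> i (x' (\<sigma> i)))) * tau (j - i))"
    unfolding q_phi by (subst reindex) (simp only: tau_perm)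
qed (simp_all only: phi_linear_combination phi_linear_combination' star_phi inv_phi add_diff_eq)

lemma gmap_add: "gmap (gel d c x y + gel e c' x' y') = gmap (gel d c x y) + gmap (gel e c' x' y')"
  unfolding gel_add gmap_gel gel_eq_iff by (simp add: fun_eq_iff linD[OF lin_phi])

lemma gmap_scale: "gmap (gscale k (gel d c x y)) = gscale k (gmap (gel d c x y))"
  unfolding gel_scale gmap_gel gel_eq_iff by (simp add: fun_eq_iff linD[OF lin_phi])

lemma gmap_G0: "gmap ` G0 v \<subseteq> G0 (f v)"
proof
  fix w assume "w \<in> gmap ` G0 v"
  then obtain d x where w: "w = gmap (gel d 0 x x)" "d \<in> tri8" "end_hom 0 v (d 0)" "\<And>i. oct_hom i v (x i)"
    unfolding G0_def by blast
  have "end_hom 0 (f v) (\<lambda>z. \<phi> 0 (d (\<sigma> 0) (\<psi> 0 z)))"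
    unfolding end_hom_def
  proof (intro allI impI)
    fix u and z :: "'k oct" assume "oct_hom 0 u z"
    then have "oct_hom (\<sigma> 0) (inv' f u) (\<psi> 0 z)" using deg_phi[of 0 "inv' f u" "\<psi> 0 z"] by (simp add: inv_phi f_inv)
    then have "oct_hom (\<sigma> 0) (v + inv' f u) (d (\<sigma> 0) (\<psi> 0 z))"
      using tri8_hom_all[OF w(2,3), of "\<sigma> 0"] unfolding end_hom_def by blast
    then show "oct_hom 0 (f v + u) (\<phi> 0 (d (\<sigma> 0) (\<psi> 0 z)))"
      unfolding deg_phi[of 0] isometry_add[OF isom] f_inv .
  qed
  moreover have "oct_hom j (f v) (\<phi> j (x (\<sigma> j)))" for j using deg_phi[of j v] w(4)[of "\<sigma> j"] by simp
  ultimately show "w \<in> G0 (f v)"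
    unfolding w(1) gmap_gel G0_iff using conj_tri8[OF w(2)] by (simp add: fun_eq_iff)
qed

lemma gmap_G1: "gmap ` G1 v \<subseteq> G1 (f v)"
proof
  fix w assume "w \<in> gmap ` G1 v"
  then obtain c x where w: "w = gmap (gel 0 c x (- x))" "c \<in> tri2_scalars" "v \<noteq> 0 \<Longrightarrow> c = 0" "\<And>i. oct_hom i v (x i)"
    unfolding G1_def by blast
  have "(\<lambda>j. c (\<sigma> j)) \<in> tri2_scalars"
    using w(2) reindex[of c] by (simp add: tri2_scalars_def sum_3' add.assoc)
  moreover have "(\<lambda>j. c (\<sigma> j)) = 0" if "f v \<noteq> 0"
  proof -
    have "v \<noteq> 0" using that isometry_zero[OF isom] by auto
    then show ?thesis using w(3) by (simp add: fun_eq_iff)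
  qed
  moreover have "oct_hom j (f v) (\<phi> j (x (\<sigma> j)))" for j using deg_phi[of j v] w(4)[of "\<sigma> j"] by simp
  ultimately show "w \<in> G1 (f v)"
    unfolding w(1) gmap_gel G1_iff
    by (simp add: fun_eq_iff lin_minus(1)[OF lin_phi] lin_zero[OF lin_phi])
qed

lemma gmap_Gamma3: "gmap ` Gamma3 s \<subseteq> Gamma3 (fst s, f (snd s))"
  unfolding Gamma3_cases using gmap_G0 gmap_G1 by simp

lemma gmap_carrier: "w \<in> alg_carrier g_S8_S2 \<Longrightarrow> gmap w \<in> alg_carrier g_S8_S2"
proof -
  assume "w \<in> alg_carrier g_S8_S2"
  then obtain d c x y where w: "w = gel d c x y" "d \<in> tri8" "c \<in> tri2_scalars" unfolding g_carrier by blast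
  have "(\<lambda>j. c (\<sigma> j)) \<in> tri2_scalars"
    using w(3) reindex[of c] by (simp add: tri2_scalars_def sum_3' add.assoc)
  then show ?thesis unfolding w(1) gmap_gel gel_in_g using conj_tri8[OF w(2)] by simp
qed

lemma gmap_f4: "w \<in> alg_carrier f4 \<Longrightarrow> gmap w \<in> alg_carrier f4"
proof -
  assume "w \<in> alg_carrier f4"
  then obtain d x where w: "w = gel d 0 x x" "d \<in> tri8" unfolding f4_carrier by blast
  show ?thesis unfolding w(1) gmap_gel f4_carrier using conj_tri8[OF w(2)] by (auto simp: zero_fun_def)
qed

lemma bij_lattice: "bij f" "bij (\<lambda>s :: G3. (fst s, f (snd s)))"
proof -
  show "bij f" using isom by (simp add: isometries_def)
  show "bij (\<lambda>s :: G3. (fst s, f (snd s)))"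
    by (rule o_bij[of "\<lambda>s. (fst s, inv' f (snd s))"]) (simp_all add: fun_eq_iff f_inv)
qed

lemma induced_g: "\<exists>F \<in> carrier (grading_auts g_S8_S2 (Gamma3 :: G3 \<Rightarrow> 'k gvec set)). induces Gamma3 F (\<lambda>s. (fst s, f (snd s)))"
  and induced_f4: "\<exists>F \<in> carrier (grading_auts f4 (f4_cartan_grading :: int ^ 4 \<Rightarrow> 'k gvec set)). induces f4_cartan_grading F f"
proof -
  interpret I: oct_symmetry \<sigma>' \<sigma> "\<lambda>j. \<psi> (\<sigma>' j)" "\<lambda>j. \<phi> (\<sigma>' j)" "inv' f" by (rule inverse)
  have gel: "\<exists>d c x y. w = gel d c x y \<and> d \<in> tri8" if "w \<in> alg_carrier g_S8_S2" for w :: "'k gvec"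
    using that unfolding g_carrier by blast
  have f4g: "w \<in> alg_carrier g_S8_S2" if "w \<in> alg_carrier f4" for w :: "'k gvec" using that by (simp add: f4_carrier_iff)
  have FG: "gmap (I.gmap w) = w" "I.gmap (gmap w) = w" if "w \<in> alg_carrier g_S8_S2" for w
    using gel[OF that] by (auto simp: gmap_gel I.gmap_gel inv_phi perm)
  have add: "gmap (v + w) = gmap v + gmap w" if "v \<in> alg_carrier g_S8_S2" "w \<in> alg_carrier g_S8_S2" for v w
    using gel[OF that(1)] gel[OF that(2)] by (auto simp: gmap_add)
  have scale: "gmap (gscale k w) = gscale k (gmap w)" if "w \<in> alg_carrier g_S8_S2" for k w
    using gel[OF that] by (auto simp: gmap_scale)
  have mult: "gmap (gbracket v w) = gbracket (gmap v) (gmap w)" if "v \<in> alg_carrier g_S8_S2" "w \<in> alg_carrier g_S8_S2" for v w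
    using gel[OF that(1)] gel[OF that(2)] by (auto simp: gmap_bracket)
  interpret g: graded_algebra g_S8_S2 "Gamma3 :: G3 \<Rightarrow> 'k gvec set" by (rule graded_g)
  interpret f4: graded_algebra f4 "f4_cartan_grading :: int ^ 4 \<Rightarrow> 'k gvec set" by (rule graded_f4)
  show "\<exists>F \<in> carrier (grading_auts g_S8_S2 (Gamma3 :: G3 \<Rightarrow> 'k gvec set)). induces Gamma3 F (\<lambda>s. (fst s, f (snd s)))"
  proof (rule g.induces_restrictI[of gmap I.gmap])
    show "I.gmap ` Gamma3 (fst s, f (snd s)) \<subseteq> Gamma3 s" for s
      using I.gmap_Gamma3[of "(fst s, f (snd s))"] by (simp add: f_inv)
  qed (use gmap_carrier I.gmap_carrier FG add scale mult gmap_Gamma3 bij_lattice in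
      \<open>simp_all add: isometry_add[OF isom] del: prod.collapse\<close>)
  show "\<exists>F \<in> carrier (grading_auts f4 (f4_cartan_grading :: int ^ 4 \<Rightarrow> 'k gvec set)). induces f4_cartan_grading F f"
  proof (rule f4.induces_restrictI[of gmap I.gmap])
    show "I.gmap ` f4_cartan_grading (f s) \<subseteq> f4_cartan_grading s" for s
      using I.gmap_G0[of "f s"] by (simp add: f_inv f4_cartan_eq)
    show "gmap ` f4_cartan_grading s \<subseteq> f4_cartan_grading (f s)" for s
      using gmap_G0[of s] by (simp add: f4_cartan_eq)
    show "gmap (alg_mult f4 x y) = alg_mult f4 (gmap x) (gmap y)" if "x \<in> alg_carrier f4" "y \<in> alg_carrier f4" for x y
      using mult[OF f4g[OF that(1)] f4g[OF that(2)]] by simp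
  qed (use gmap_f4 I.gmap_f4 FG add scale bij_lattice f4g in \<open>simp_all add: isometry_add[OF isom]\<close>)
qed

end

section \<open>Lifts of the four generating isometries\<close>

lemma oct_symmetryI_direct:
  fixes \<phi> \<psi> :: "3 \<Rightarrow> 'k::field_char_0 oct \<Rightarrow> 'k oct"
  assumes lin: "\<And>j. lin (\<phi> j)" and inv: "\<And>j z. \<phi> j (\<psi> j z) = z" "\<And>j z. \<psi> j (\<phi> j z) = z"
    and q: "\<And>j x y. q8 (\<phi> j x) (\<phi> j y) = q8 x y"
    and star: "\<And>j x y. \<phi> j (x \<star> y) = \<phi> (j + 1) x \<star> \<phi> (j + 2) y"
    and deg: "\<And>j v z. oct_hom (j + r) v z \<longleftrightarrow> oct_hom j (f v) (\<phi> j z)" and f: "f \<in> isometries"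
  shows "oct_symmetry (\<lambda>j. j + r) (\<lambda>j. j - r) \<phi> \<psi> f"
proof (unfold_locales)
  fix i j k x y z v and u w :: "3 \<Rightarrow> 'k oct"
  have t: "\<phi> (i + m) (t8 x y m z) = t8 (\<phi> i x) (\<phi> i y) m (\<phi> (i + m) z)" for m z
    by (rule cases_3[of m])
      (simp_all add: t8_simps lin_minus(2)[OF lin] linD(2)[OF lin] q star add.assoc)
  show "\<phi> j (theta (i + r) (t8 x y) (j + r) z) = theta i (t8 (\<phi> i x) (\<phi> i y)) j (\<phi> j z)"
    using t[of "j - i" z] by (simp add: theta_def)
  show "\<phi> k (u (k + r + 1) \<star> w (k + r + 2) - w (k + r + 1) \<star> u (k + r + 2)) =
       \<phi> (k + 1) (u (k + 1 + r)) \<star> \<phi> (k + 2) (w (k + 2 + r))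
         - \<phi> (k + 1) (w (k + 1 + r)) \<star> \<phi> (k + 2) (u (k + 2 + r))"
    by (simp add: lin_minus(2)[OF lin] star add.assoc add.commute[of r])
qed (rule lin inv q deg f | simp)+

text \<open>Reversing the cyclic order of the copies exchanges components 1 and 2 of t, which
  matches the exchange of the factors of the product. The minus sign is absorbed by the antisymmetry
  of the bracket between two copies.\<close>

lemma oct_symmetryI_reflected:
  fixes \<phi> \<psi> :: "3 \<Rightarrow> 'k::field_char_0 oct \<Rightarrow> 'k oct"
  assumes lin: "\<And>j. lin (\<phi> j)" and inv: "\<And>j z. \<phi> j (\<psi> j z) = z" "\<And>j z. \<psi> j (\<phi> j z) = z"
    and q: "\<And>j x y. q8 (\<phi> j x) (\<phi> j y) = q8 x y"
    and star: "\<And>j x y. \<phi> j (x \<star> y) = - (\<phi> (j + 1) y \<star> \<phi> (j + 2) x)"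
    and deg: "\<And>j v z. oct_hom (r - j) v z \<longleftrightarrow> oct_hom j (f v) (\<phi> j z)" and f: "f \<in> isometries"
  shows "oct_symmetry (\<lambda>j. r - j) (\<lambda>j. r - j) \<phi> \<psi> f"
proof (unfold_locales)
  fix i j k x y z v and u w :: "3 \<Rightarrow> 'k oct"
  have neg: "- 1 = (2::3)" "- 2 = (1::3)" by simp_all
  have t: "\<phi> (i + m) (t8 x y (- m) z) = t8 (\<phi> i x) (\<phi> i y) m (\<phi> (i + m) z)" for m z
    by (rule cases_3[of m])
      (simp_all add: neg t8_simps lin_minus[OF lin] linD(2)[OF lin] q star add.assoc star_minus)
  have "(r - j) - (r - i) = - (j - i)" by simp
  then show "\<phi> j (theta (r - i) (t8 x y) (r - j) z) = theta i (t8 (\<phi> i x) (\<phi> i y)) j (\<phi> j z)"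
    using t[of "j - i" z] by (simp add: theta_def)
  have s: "r - (k + 1) = r - k + 2" "r - (k + 2) = r - k + 1"
    using neg by (simp_all add: algebra_simps)
  show "\<phi> k (u (r - k + 1) \<star> w (r - k + 2) - w (r - k + 1) \<star> u (r - k + 2)) =
       \<phi> (k + 1) (u (r - (k + 1))) \<star> \<phi> (k + 2) (w (r - (k + 2)))
         - \<phi> (k + 1) (w (r - (k + 1))) \<star> \<phi> (k + 2) (u (r - (k + 2)))"
    unfolding s by (simp add: lin_minus(2)[OF lin] star)
qed (rule lin inv q deg f | simp)+

text \<open>For bijective p the basis vector with index p c goes to e c times the basis vector with
  index c.\<close>

definition monomial :: "(oct_basis \<Rightarrow> oct_basis) \<Rightarrow> (oct_basis \<Rightarrow> 'k) \<Rightarrow> 'k::field oct \<Rightarrow> 'k oct" where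
  "monomial p e z = (\<chi> c. e c * z $ p c)"

lemma monomial_nth [simp]: "monomial p e z $ c = e c * z $ p c"
  by (simp add: monomial_def)

lemma monomial_id: "monomial id (\<lambda>_. 1) x = x"
  by (simp add: vec_eq_iff)

lemma lin_monomial: "lin (monomial p e)"
  by (simp add: lin_def vec_eq_iff algebra_simps)

lemma monomial_hom:
  assumes "\<And>c. e c \<noteq> 0" "surj p" "\<And>c. f (deg_iota i (p c)) = deg_iota j c" "f \<in> isometries"
  shows "oct_hom i v z \<longleftrightarrow> oct_hom j (f v) (monomial p e z)"
proof -
  have "oct_hom j (f v) (monomial p e z) \<longleftrightarrow> (\<forall>c. z $ p c \<noteq> 0 \<longrightarrow> f (deg_iota i (p c)) = f v)"
    using assms(1) by (simp add: oct_hom_def assms(3))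
  also have "\<dots> \<longleftrightarrow> (\<forall>b \<in> range p. z $ b \<noteq> 0 \<longrightarrow> deg_iota i b = v)" by (simp add: isometry_inj[OF assms(4)])
  finally show ?thesis by (simp add: assms(2) oct_hom_def)
qed

fun basis_rotate :: "oct_basis \<Rightarrow> oct_basis" where
  "basis_rotate Oe1 = Oe1" | "basis_rotate Oe2 = Oe2" | "basis_rotate (Ou i) = Ou (i + 2)" | "basis_rotate (Ov i) = Ov (i + 2)"

fun basis_swap :: "oct_basis \<Rightarrow> oct_basis" where
  "basis_swap Oe1 = Oe2" | "basis_swap Oe2 = Oe1" | "basis_swap (Ou i) = Ou i" | "basis_swap (Ov i) = Ov i"

text \<open>Together with \<open>basis_swap\<close> these signs describe minus the octonion
  conjugation, which reverses products up to sign.\<close>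

fun basis_sign :: "oct_basis \<Rightarrow> 'k::field" where
  "basis_sign Oe1 = - 1" | "basis_sign Oe2 = - 1" | "basis_sign (Ou i) = 1" | "basis_sign (Ov i) = 1"

text \<open>The permutation of the basis of copy i that s3 induces on its degrees, as checked in
  \<open>symmetry_s3\<close>. The signs in \<open>exchange_sign\<close> depend on the copy and make
  the three maps respect the product.\<close>

fun basis_exchange :: "3 \<Rightarrow> oct_basis \<Rightarrow> oct_basis" where
  "basis_exchange i Oe1 = (if i = 0 then Ov 1 else if i = 1 then Ou 1 else Oe1)"
| "basis_exchange i Oe2 = (if i = 0 then Ou 1 else if i = 1 then Ov 1 else Oe2)"
| "basis_exchange i (Ou k) = (if i = 0 then (if k = 1 then Oe2 else Ou k)
     else if i = 1 then (if k = 1 then Oe1 else Ou k) else if k = 1 then Ou 1 else Ov (2 - k))"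
| "basis_exchange i (Ov k) = (if i = 0 then (if k = 1 then Oe1 else Ov k)
     else if i = 1 then (if k = 1 then Oe2 else Ov k) else if k = 1 then Ov 1 else Ou (2 - k))"

fun exchange_sign :: "3 \<Rightarrow> oct_basis \<Rightarrow> 'k::field" where
  "exchange_sign i (Ou k) = (if i = 2 \<or> k = i + i then 1 else - 1)"
| "exchange_sign i (Ov k) = (if i = 2 \<or> k = i + i then 1 else - 1)"
| "exchange_sign i e = - 1"

lemma basis_exchange_involution: "basis_exchange i (basis_exchange i c) = c"
proof -
  have "\<forall>i c. basis_exchange i (basis_exchange i c) = c" unfolding all_oct_basis all_3 by simp
  then show ?thesis by blast
qed

lemma exchange_sign_nonzero: "exchange_sign i c \<noteq> 0"
  by (cases c) simp_all

text \<open>s1 only rotates the copies. Because \<open>gmap\<close> takes copy j of the image from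
  copy \<open>\<sigma> j\<close>, the rotation by 1 appears as j + 2.\<close>

lemma symmetry_s1:
  "oct_symmetry (\<lambda>j. j + 2) (\<lambda>j. j - 2) (\<lambda>j. monomial id (\<lambda>_. 1)) (\<lambda>j. monomial id (\<lambda>_. 1 :: 'k::field_char_0)) ((*v) f4_s1)"
proof (rule oct_symmetryI_direct)
  show "lin (monomial id (\<lambda>_. 1 :: 'k))" by (rule lin_monomial)
  have "\<forall>j b. f4_s1 *v deg_iota (j + 2) b = deg_iota j b"
    unfolding all_oct_basis all_3 by (simp add: deg_iota.simps deg_simps f4_s_apply vec4_eq_iff)
  then show "oct_hom (j + 2) v z = oct_hom j (f4_s1 *v v) (monomial id (\<lambda>_. 1 :: 'k) z)" for j v z
    by (intro monomial_hom f4_s_isometry) simp_all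
qed (simp_all add: monomial_id f4_s_isometry)

lemma symmetry_s2:
  "oct_symmetry (\<lambda>j. 2 - j) (\<lambda>j. 2 - j) (\<lambda>j. monomial basis_swap basis_sign) (\<lambda>j. monomial basis_swap (basis_sign :: _ \<Rightarrow> 'k::field_char_0)) ((*v) f4_s2)"
proof (rule oct_symmetryI_reflected)
  show "lin (monomial basis_swap (basis_sign :: _ \<Rightarrow> 'k))" by (rule lin_monomial)
  have "\<forall>j b. f4_s2 *v deg_iota (2 - j) (basis_swap b) = deg_iota j b"
    unfolding all_oct_basis all_3 by (simp add: deg_iota.simps deg_simps f4_s_apply vec4_eq_iff)
  moreover have "\<forall>b. basis_swap (basis_swap b) = b" unfolding all_oct_basis all_3 by simp
  then have "surj basis_swap" by (intro surjI[of _ basis_swap]) simp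
  moreover have "basis_sign b \<noteq> (0 :: 'k)" for b by (cases b) simp_all
  ultimately show "oct_hom (2 - j) v z = oct_hom j (f4_s2 *v v) (monomial basis_swap (basis_sign :: _ \<Rightarrow> 'k) z)" for j v z
    by (intro monomial_hom f4_s_isometry) simp_all
  show "q8 (monomial basis_swap basis_sign x) (monomial basis_swap basis_sign y) = q8 x y" for x y :: "'k oct"
    by (simp add: q8_coords algebra_simps)
  show "monomial basis_swap basis_sign (x \<star> y) = - (monomial basis_swap basis_sign y \<star> monomial basis_swap basis_sign x)" for x y :: "'k oct"
    by (simp add: oct_eq_iff S8_coords algebra_simps)
qed (simp_all add: oct_eq_iff f4_s_isometry)

lemma symmetry_s3:
  "oct_symmetry (\<lambda>j. j + 0) (\<lambda>j. j - 0) (\<lambda>j. monomial (basis_exchange j) (exchange_sign j))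
    (\<lambda>j. monomial (basis_exchange j) (exchange_sign j :: _ \<Rightarrow> 'k::field_char_0)) ((*v) f4_s3)"
proof (rule oct_symmetryI_direct)
  show "lin (monomial (basis_exchange j) (exchange_sign j :: _ \<Rightarrow> 'k))" for j by (rule lin_monomial)
  have "\<forall>j b. f4_s3 *v deg_iota j (basis_exchange j b) = deg_iota j b"
    unfolding all_oct_basis all_3 by (simp add: deg_iota.simps deg_simps f4_s_apply vec4_eq_iff)
  moreover have "surj (basis_exchange j)" for j by (rule surjI[of _ "basis_exchange j"]) (rule basis_exchange_involution)
  ultimately show "oct_hom (j + 0) v z = oct_hom j (f4_s3 *v v) (monomial (basis_exchange j) (exchange_sign j :: _ \<Rightarrow> 'k) z)" for j v z
    by (intro monomial_hom f4_s_isometry exchange_sign_nonzero) simp_all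
  have "\<forall>j. q8 (monomial (basis_exchange j) (exchange_sign j) x) (monomial (basis_exchange j) (exchange_sign j) y) = q8 x y" for x y :: "'k oct"
    unfolding all_3 by (simp add: q8_coords algebra_simps)
  then show "q8 (monomial (basis_exchange j) (exchange_sign j) x) (monomial (basis_exchange j) (exchange_sign j) y) = q8 x y" for j and x y :: "'k oct"
    by blast
  have "\<forall>j. monomial (basis_exchange j) (exchange_sign j) (x \<star> y) = monomial (basis_exchange (j + 1)) (exchange_sign (j + 1)) x
      \<star> monomial (basis_exchange (j + 2)) (exchange_sign (j + 2)) y" for x y :: "'k oct"
    unfolding all_3 by (simp add: oct_eq_iff S8_coords algebra_simps)
  then show "monomial (basis_exchange j) (exchange_sign j) (x \<star> y) = monomial (basis_exchange (j + 1)) (exchange_sign (j + 1)) x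
      \<star> monomial (basis_exchange (j + 2)) (exchange_sign (j + 2)) y" for j and x y :: "'k oct" by blast
  have "\<forall>j. monomial (basis_exchange j) (exchange_sign j) (monomial (basis_exchange j) (exchange_sign j) z) = z" for z :: "'k oct"
    unfolding all_3 by (simp add: oct_eq_iff)
  then show "monomial (basis_exchange j) (exchange_sign j) (monomial (basis_exchange j) (exchange_sign j) z) = z"
    "monomial (basis_exchange j) (exchange_sign j) (monomial (basis_exchange j) (exchange_sign j) z) = z" for j and z :: "'k oct"
    by blast+
qed (rule f4_s_isometry)

lemma symmetry_s4:
  "oct_symmetry (\<lambda>j. j + 0) (\<lambda>j. j - 0) (\<lambda>j. monomial basis_rotate (\<lambda>_. 1))
    (\<lambda>j. monomial (basis_rotate \<circ> basis_rotate) (\<lambda>_. 1 :: 'k::field_char_0)) ((*v) f4_s4)"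
proof (rule oct_symmetryI_direct)
  show "lin (monomial basis_rotate (\<lambda>_. 1 :: 'k))" by (rule lin_monomial)
  have "\<forall>j b. f4_s4 *v deg_iota j (basis_rotate b) = deg_iota j b"
    unfolding all_oct_basis all_3 by (simp add: deg_iota.simps deg_simps f4_s_apply vec4_eq_iff)
  moreover have "\<forall>b. basis_rotate (basis_rotate (basis_rotate b)) = b" unfolding all_oct_basis all_3 by simp
  then have "surj basis_rotate" by (intro surjI[of _ "\<lambda>b. basis_rotate (basis_rotate b)"]) simp
  ultimately show "oct_hom (j + 0) v z = oct_hom j (f4_s4 *v v) (monomial basis_rotate (\<lambda>_. 1 :: 'k) z)" for j v z
    by (intro monomial_hom f4_s_isometry) simp_all
  show "monomial basis_rotate (\<lambda>_. 1) (x \<star> y) = monomial basis_rotate (\<lambda>_. 1) x \<star> monomial basis_rotate (\<lambda>_. 1) y" for x y :: "'k oct"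
    by (simp add: oct_eq_iff S8_coords algebra_simps)
  show "q8 (monomial basis_rotate (\<lambda>_. 1) x) (monomial basis_rotate (\<lambda>_. 1) y) = q8 x y" for x y :: "'k oct"
    by (simp add: q8_coords algebra_simps)
qed (simp_all add: oct_eq_iff f4_s_isometry)

text \<open>
  With gamma = i or -i the pair (x, x) is sent to a multiple of (x, -x), so such a map exchanges
  the two Z2-degrees on a copy.
\<close>

definition shear :: "(3 \<Rightarrow> 'k::field_char_0) \<Rightarrow> 'k gvec \<Rightarrow> 'k gvec" where
  "shear \<gamma> w = gel (gd w) (gc w) (\<lambda>j. \<gamma> j *s gx w j) (\<lambda>j. inverse (\<gamma> j) *s gy w j)"

lemma shear_gel: "shear \<gamma> (gel d c x y) = gel d c (\<lambda>j. \<gamma> j *s x j) (\<lambda>j. inverse (\<gamma> j) *s y j)"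
  by (simp add: shear_def)

lemma t8_inverse_scale:
  fixes x y :: "'k::field_char_0 oct"
  assumes "a \<noteq> 0"
  shows "t8 (a *s x) (inverse a *s y) j = t8 x y j" "t8 (inverse a *s x) (a *s y) j = t8 x y j"
proof -
  have h: "inverse a * (a * r) = r" "a * (inverse a * r) = r" "r * inverse a * a = r" "r * a * inverse a = r" for r
    using assms by simp_all
  have "\<forall>j. t8 (a *s x) (inverse a *s y) j = t8 x y j" "\<forall>j. t8 (inverse a *s x) (a *s y) j = t8 x y j"
    unfolding all_3 t8_simps using assms
    by (simp_all add: fun_eq_iff q8_scale star_scale h mult.commute[of _ "q8 _ _"])
  then show "t8 (a *s x) (inverse a *s y) j = t8 x y j" "t8 (inverse a *s x) (a *s y) j = t8 x y j" by blast+
qed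

text \<open>In the tri parts an x always meets a y, and the two factors cancel. Products of two x
  parts land in the y part, which is scaled inversely; this is the condition on \<gamma>.\<close>

lemma shear_bracket:
  fixes d e :: "3 \<Rightarrow> 'k::field_char_0 oct \<Rightarrow> 'k oct"
  assumes d: "d \<in> tri8" and e: "e \<in> tri8"
    and \<gamma>: "\<And>k. \<gamma> k \<noteq> 0" "\<And>k. \<gamma> (k + 1) * \<gamma> (k + 2) = inverse (\<gamma> k)"
  shows "shear \<gamma> (gbracket (gel d c x y) (gel e c' x' y')) = gbracket (shear \<gamma> (gel d c x y)) (shear \<gamma> (gel e c' x' y'))"
proof -
  have \<gamma>': "inverse (\<gamma> (k + 1)) * inverse (\<gamma> (k + 2)) = \<gamma> k" for k
    using arg_cong[OF \<gamma>(2)[of k], of inverse] by simp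
  have p: "(\<gamma> (k + 1) *s u) \<star> (\<gamma> (k + 2) *s v) = inverse (\<gamma> k) *s (u \<star> v)"
    "(inverse (\<gamma> (k + 1)) *s u) \<star> (inverse (\<gamma> (k + 2)) *s v) = \<gamma> k *s (u \<star> v)" for k u v
    by (simp_all only: star_scale vector_smult_assoc \<gamma>(2) \<gamma>'
        mult.commute[of "\<gamma> (k + 2)"] mult.commute[of "inverse (\<gamma> (k + 2))"])
  have q: "q8 (\<gamma> k *s u) (inverse (\<gamma> k) *s v) = q8 u v" "q8 (inverse (\<gamma> k) *s u) (\<gamma> k *s v) = q8 u v" for k u v
    using \<gamma>(1)[of k] by (simp_all add: q8_scale)
  have t: "theta i (t8 (\<gamma> k *s u) (inverse (\<gamma> k) *s v)) j z = theta i (t8 u v) j z"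
    "theta i (t8 (inverse (\<gamma> k) *s u) (\<gamma> k *s v)) j z = theta i (t8 u v) j z" for i j k u v z
    by (simp_all only: theta_def t8_inverse_scale[OF \<gamma>(1)])
  note l = linD(2)[OF tri8_lin[OF d]] linD(2)[OF tri8_lin[OF e]]
  show ?thesis
    unfolding shear_gel gbracket_gel[OF d e] gel_eq_iff
  proof (intro conjI ext)
    fix k
    show "\<gamma> k *s (d k (x' k) - e k (x k) + c k *s x' k - c' k *s x k + y (k + 1) \<star> y' (k + 2) - y' (k + 1) \<star> y (k + 2))
      = d k (\<gamma> k *s x' k) - e k (\<gamma> k *s x k) + c k *s (\<gamma> k *s x' k) - c' k *s (\<gamma> k *s x k)
        + (inverse (\<gamma> (k + 1)) *s y (k + 1)) \<star> (inverse (\<gamma> (k + 2)) *s y' (k + 2))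
        - (inverse (\<gamma> (k + 1)) *s y' (k + 1)) \<star> (inverse (\<gamma> (k + 2)) *s y (k + 2))"
      unfolding p l by (simp add: vec.scale_right_distrib vec.scale_right_diff_distrib mult.commute)
    show "inverse (\<gamma> k) *s (d k (y' k) - e k (y k) - c k *s y' k + c' k *s y k + x (k + 1) \<star> x' (k + 2) - x' (k + 1) \<star> x (k + 2))
      = d k (inverse (\<gamma> k) *s y' k) - e k (inverse (\<gamma> k) *s y k) - c k *s (inverse (\<gamma> k) *s y' k) + c' k *s (inverse (\<gamma> k) *s y k)
        + (\<gamma> (k + 1) *s x (k + 1)) \<star> (\<gamma> (k + 2) *s x' (k + 2))
        - (\<gamma> (k + 1) *s x' (k + 1)) \<star> (\<gamma> (k + 2) *s x (k + 2))"
      unfolding p l by (simp add: vec.scale_right_distrib vec.scale_right_diff_distrib mult.commute)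
  qed (simp_all only: t q)
qed

text \<open>If a^2 = -1, the values 1, a, -a multiply to 1, which is the condition in
  \<open>shear_bracket\<close>. Copy p keeps its Z2-degrees, and in each of the other two copies
  they are exchanged.\<close>

definition copy_scalar :: "3 \<Rightarrow> 'k \<Rightarrow> 3 \<Rightarrow> 'k::field_char_0" where
  "copy_scalar p a j = (if j = p then 1 else if j = p + 1 then a else - a)"

lemma copy_scalar_product:
  assumes a: "a * a = -1"
  shows "copy_scalar p a k \<noteq> 0" "copy_scalar p a (k + 1) * copy_scalar p a (k + 2) = inverse (copy_scalar p a k)"
    "inverse (copy_scalar p a k) = copy_scalar p (- a) k"
proof -
  have "a \<noteq> 0" using a by auto
  have i: "inverse a = - a" by (rule inverse_unique) (simp add: a)
  have *: "\<forall>m. copy_scalar p a (p + m) \<noteq> 0 \<and> copy_scalar p a (p + m + 1) * copy_scalar p a (p + m + 2) = inverse (copy_scalar p a (p + m))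
      \<and> inverse (copy_scalar p a (p + m)) = copy_scalar p (- a) (p + m)"
    unfolding all_3 using \<open>a \<noteq> 0\<close> by (simp add: copy_scalar_def i a add.assoc)
  then show "copy_scalar p a k \<noteq> 0" "copy_scalar p a (k + 1) * copy_scalar p a (k + 2) = inverse (copy_scalar p a k)"
    "inverse (copy_scalar p a k) = copy_scalar p (- a) k" using spec[OF *, of "k - p"] by simp_all
qed

text \<open>The change of Z2-degree that the shear with exceptional copy p causes on the component
  of degree v.\<close>

definition twist :: "3 \<Rightarrow> int ^ 4 \<Rightarrow> 2" where
  "twist p v = (if odd (root_norm v) \<and> copy_of v \<noteq> p then 1 else 0)"

lemma oct_hom_support:
  assumes "oct_hom j v x" "x \<noteq> 0"
  shows "odd (root_norm v)" "copy_of v = j"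
proof -
  obtain b where "x $ b \<noteq> 0" using assms(2) by (auto simp: vec_eq_iff)
  then have "v = deg_iota j b" using assms(1) by (auto simp: oct_hom_def)
  then show "odd (root_norm v)" "copy_of v = j" by (simp_all add: root_norm_deg_iota copy_of_deg_iota)
qed

lemma copy_scalar_twist:
  assumes a: "a * a = -1" and x: "\<And>j. oct_hom j v (x j)"
  shows "twist p v = 0 \<Longrightarrow> copy_scalar p a j *s x j = x j" "twist p v = 0 \<Longrightarrow> inverse (copy_scalar p a j) *s x j = x j"
    "twist p v \<noteq> 0 \<Longrightarrow> inverse (copy_scalar p a j) *s x j = - (copy_scalar p a j *s x j)"
proof -
  have i: "inverse a = - a" by (rule inverse_unique) (simp add: a)
  have s: "x j = 0 \<or> odd (root_norm v) \<and> copy_of v = j" using oct_hom_support[OF x[of j]] by blast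
  show "twist p v = 0 \<Longrightarrow> copy_scalar p a j *s x j = x j" "twist p v = 0 \<Longrightarrow> inverse (copy_scalar p a j) *s x j = x j"
    using s by (auto simp: twist_def copy_scalar_def split: if_splits)
  assume "twist p v \<noteq> 0"
  then have "copy_of v \<noteq> p" by (auto simp: twist_def)
  then show "inverse (copy_scalar p a j) *s x j = - (copy_scalar p a j *s x j)"
    using s by (auto simp: copy_scalar_def i)
qed

lemma shear_Gamma3:
  fixes a :: "'k::field_char_0"
  assumes a: "a * a = -1"
  shows "shear (copy_scalar p a) ` Gamma3 s \<subseteq> Gamma3 (fst s + twist p (snd s), snd s)"
proof
  fix w assume w: "w \<in> shear (copy_scalar p a) ` Gamma3 s"
  obtain k v where s: "s = (k, v)" by (rule prod.exhaust)
  let ?g = "copy_scalar p a"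
  have h: "oct_hom j v (?g j *s x j)" if "\<And>j. oct_hom j v (x j)" for x j using that oct_hom_scale by blast
  have odd: "odd (root_norm v) \<and> v \<noteq> 0" if "twist p v \<noteq> 0"
    using that by (auto simp: twist_def root_norm_eq_0[THEN iffD2] split: if_splits)
  have "w \<in> Gamma3 (k + twist p v, v)" if k: "k = 0"
  proof -
    obtain d x where x: "w = shear ?g (gel d 0 x x)" "d \<in> tri8" "end_hom 0 v (d 0)" "\<And>j. oct_hom j v (x j)"
      using w unfolding s k Gamma3_0 G0_def by blast
    show ?thesis
    proof (cases "twist p v = 0")
      case True
      then show ?thesis
        unfolding k x(1) shear_gel copy_scalar_twist(1,2)[OF a x(4) True] using x by (simp add: Gamma3_0 G0_iff)
    next
      case False
      then have t: "twist p v = 1" by (simp add: twist_def split: if_splits)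
      have "d = 0" using odd_degree_tri8[OF x(2,3)] odd[OF False] by blast
      then show ?thesis
        unfolding k x(1) shear_gel copy_scalar_twist(3)[OF a x(4) False] t
        using h[OF x(4)] by (simp add: Gamma3_1 G1_iff fun_eq_iff tri2_scalars_def)
    qed
  qed
  moreover have "w \<in> Gamma3 (k + twist p v, v)" if k: "k = 1"
  proof -
    obtain c x where x: "w = shear ?g (gel 0 c x (- x))" "c \<in> tri2_scalars" "v \<noteq> 0 \<Longrightarrow> c = 0" "\<And>j. oct_hom j v (x j)"
      using w unfolding s k Gamma3_1 G1_def by blast
    have m: "(- x) j = - x j" for j by simp
    have e: "(1::2) + 1 = 0" by simp
    show ?thesis
    proof (cases "twist p v = 0")
      case True
      then show ?thesis
        unfolding k x(1) shear_gel m vector_smult_rneg copy_scalar_twist(1,2)[OF a x(4) True] using x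
        by (simp add: Gamma3_1 G1_iff fun_eq_iff)
    next
      case False
      then have t: "twist p v = 1" by (simp add: twist_def split: if_splits)
      have "c = 0" using x(3) odd[OF False] by blast
      then show ?thesis
        unfolding k x(1) shear_gel m vector_smult_rneg copy_scalar_twist(3)[OF a x(4) False] t e
        using h[OF x(4)] tri8_zero_mem by (simp add: Gamma3_0 G0_iff fun_eq_iff end_hom_def zero_fun_def)
    qed
  qed
  moreover have "k = 0 \<or> k = 1" using exhaust_2[of k] by auto
  ultimately have "w \<in> Gamma3 (k + twist p v, v)" by blast
  then show "w \<in> Gamma3 (fst s + twist p (snd s), snd s)" by (simp add: s)
qed

text \<open>The homomorphisms from Z^4 to Z2 that vanish on the vectors of even norm. Their values
  on the canonical basis are a, b, a, b, which explains the shape of the row.\<close>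

definition shift :: "2 \<Rightarrow> 2 \<Rightarrow> int ^ 4 \<Rightarrow> 2" where
  "shift a b v = (if odd (v $ 1 + v $ 3) then a else 0) + (if odd (v $ 2 + v $ 4) then b else 0)"

lemma double_mod2 [simp]: "a + a = 0" "a + (a + b) = b" for a b :: 2
proof -
  show *: "a + a = 0" for a :: 2 using exhaust_2[of a] by auto
  show "a + (a + b) = b" by (simp only: add.assoc[symmetric] * add_0)
qed

lemma shift_add: "shift a b (v + w) = shift a b v + shift a b w"
proof -
  have p: "(if odd (m + n) then a else 0) = (if odd m then a else 0) + (if odd n then a else 0)" for m n :: int and a :: 2
    by simp
  show ?thesis unfolding shift_def by (simp only: vector_add_component p ac_simps)
qed

text \<open>The three twists exhaust the nonzero homomorphisms of this kind: p = 0, 1, 2 correspond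
  to (1, 1), (0, 1), (1, 0) as values of (a, b). In particular twists are additive.\<close>

lemma twist_shift: "twist p v = shift (if p = 1 then 0 else 1) (if p = 2 then 0 else 1) v"
proof -
  have "\<forall>p. twist p v = shift (if p = 1 then 0 else 1) (if p = 2 then 0 else 1) v"
    unfolding all_3 twist_def even_root_norm copy_of_def shift_def
    by (cases "odd (v $ 1 + v $ 3)"; cases "odd (v $ 2 + v $ 4)"; simp)
  then show ?thesis by blast
qed

lemma induced_shear:
  fixes a :: "'k::field_char_0"
  assumes a: "a * a = -1"
  shows "\<exists>F \<in> carrier (grading_auts g_S8_S2 (Gamma3 :: G3 \<Rightarrow> 'k gvec set)). induces Gamma3 F (\<lambda>s. (fst s + twist p (snd s), snd s))"
proof -
  interpret g: graded_algebra g_S8_S2 "Gamma3 :: G3 \<Rightarrow> 'k gvec set" by (rule graded_g)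
  have a': "(- a) * (- a) = -1" using a by simp
  \<comment> \<open>Since the inverse of a is -a, the second shear is inverse to the first.\<close>
  let ?F = "shear (copy_scalar p a)" and ?G = "shear (copy_scalar p (- a))"
  have gel: "\<exists>d c x y. w = gel d c x y \<and> d \<in> tri8 \<and> c \<in> tri2_scalars" if "w \<in> alg_carrier g_S8_S2" for w :: "'k gvec"
    using that unfolding g_carrier by blast
  have car: "shear \<gamma> w \<in> alg_carrier g_S8_S2" if "w \<in> alg_carrier g_S8_S2" for w and \<gamma> :: "3 \<Rightarrow> 'k"
    using gel[OF that] by (auto simp: shear_gel gel_in_g)
  have c: "copy_scalar p a j * copy_scalar p (- a) j = 1" for j
    using right_inverse[OF copy_scalar_product(1)[OF a]] unfolding copy_scalar_product(3)[OF a] .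
  then have c': "copy_scalar p (- a) j * copy_scalar p a j = 1" for j by (simp add: mult.commute)
  have FG: "?F (?G w) = w" "?G (?F w) = w" if "w \<in> alg_carrier g_S8_S2" for w
    using gel[OF that] by (auto simp: shear_gel gel_eq_iff fun_eq_iff c c' copy_scalar_product(3)[OF a] copy_scalar_product(3)[OF a'])
  show ?thesis
  proof (rule g.induces_restrictI[of ?F ?G])
    show "?F (x + y) = ?F x + ?F y" if "x \<in> alg_carrier g_S8_S2" "y \<in> alg_carrier g_S8_S2" for x y
      using gel[OF that(1)] gel[OF that(2)]
      by (auto simp: shear_gel gel_add gel_eq_iff fun_eq_iff vec.scale_right_distrib)
    show "?F (alg_scale g_S8_S2 c x) = alg_scale g_S8_S2 c (?F x)" if "x \<in> alg_carrier g_S8_S2" for c x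
      using gel[OF that] by (auto simp: shear_gel gel_scale gel_eq_iff fun_eq_iff mult.commute)
    show "?F (alg_mult g_S8_S2 x y) = alg_mult g_S8_S2 (?F x) (?F y)" if "x \<in> alg_carrier g_S8_S2" "y \<in> alg_carrier g_S8_S2" for x y
      using gel[OF that(1)] gel[OF that(2)] by (auto simp: shear_bracket copy_scalar_product[OF a])
    show "?F ` Gamma3 s \<subseteq> Gamma3 (fst s + twist p (snd s), snd s)" for s by (rule shear_Gamma3[OF a])
    show "?G ` Gamma3 (fst s + twist p (snd s), snd s) \<subseteq> Gamma3 s" for s
      using shear_Gamma3[OF a', of p "(fst s + twist p (snd s), snd s)"] by (simp add: add.assoc)
    show "bij (\<lambda>s :: G3. (fst s + twist p (snd s), snd s))"
      by (rule o_bij[of "\<lambda>s. (fst s + twist p (snd s), snd s)"]) (simp_all add: fun_eq_iff add.assoc)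
  qed (simp_all add: car FG twist_shift shift_add add_ac)
qed

section \<open>The Weyl groups\<close>

lemma universal_g: "universal_graded_algebra g_S8_S2 (Gamma3 :: G3 \<Rightarrow> 'k::field_char_0 gvec set)"
  by (intro universal_graded_algebra.intro universal_graded_algebra_axioms.intro graded_g universal_group_g)

lemma universal_f4: "universal_graded_algebra f4 (f4_cartan_grading :: int ^ 4 \<Rightarrow> 'k::field_char_0 gvec set)"
  by (intro universal_graded_algebra.intro universal_graded_algebra_axioms.intro graded_f4 universal_group_f4)

lemma (in universal_graded_algebra) weyl_image_supp:
  assumes "\<alpha> \<in> weyl_image L A"
  shows "\<alpha> s \<in> grading_supp A \<longleftrightarrow> s \<in> grading_supp A"
    and "bij \<alpha>" and "\<alpha> (s + t) = \<alpha> s + \<alpha> t"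
proof -
  obtain f where f: "f \<in> carrier Aut" "induces A f \<alpha>" using assms unfolding weyl_image_eq by blast
  show "bij \<alpha>" "\<alpha> (s + t) = \<alpha> s + \<alpha> t" using f(2) by (simp_all add: induces_def AutoGroup_additive_carrier)
  show "\<alpha> s \<in> grading_supp A \<longleftrightarrow> s \<in> grading_supp A"
  proof
    assume s: "\<alpha> s \<in> grading_supp A"
    then have "A (\<alpha> s) \<in> hom_components A" by (simp add: hom_components_def)
    moreover have "image f ` hom_components A = hom_components A"
      using f(1) unfolding grading_auts_carrier by (auto simp: bij_betw_def)
    ultimately obtain t where t: "t \<in> grading_supp A" "A (\<alpha> s) = f ` A t"
      unfolding hom_components_def by blast
    then have "A (\<alpha> s) = A (\<alpha> t)" using f(2) by (simp add: induces_def)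
    then have "\<alpha> s = \<alpha> t" using comp_eq_iff[OF s] by blast
    then have "s = t" using bij_is_inj[OF \<open>bij \<alpha>\<close>] by (rule injD[rotated])
    then show "s \<in> grading_supp A" using t(1) by simp
  qed (use f induces_supp in blast)
qed

lemma g_supp_0: "(0, v) \<in> grading_supp (Gamma3 :: G3 \<Rightarrow> 'k::field_char_0 gvec set)
    \<longleftrightarrow> v \<in> grading_supp (f4_cartan_grading :: int ^ 4 \<Rightarrow> 'k gvec set)"
  by (simp add: grading_supp_def Gamma3_0 f4_cartan_eq)

text \<open>The bracket of the two even root vectors is twice a rotated element t, which sends the
  dual of b to c and is therefore nonzero.\<close>

lemma root_sum_supp:
  assumes "c \<noteq> b" "c \<noteq> dual b"
  shows "deg_iota i b + deg_iota i c \<in> grading_supp (f4_cartan_grading :: int ^ 4 \<Rightarrow> 'k::field_char_0 gvec set)"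
proof -
  interpret g: graded_algebra g_S8_S2 "Gamma3 :: G3 \<Rightarrow> 'k gvec set" by (rule graded_g)
  let ?w = "gbracket (even_root i b) (even_root i c) :: 'k gvec"
  have "?w \<in> Gamma3 ((0, deg_iota i b) + (0, deg_iota i c))"
    using g.comp_mult[OF even_root_mem even_root_mem, of i b i c] by simp
  then have m: "?w \<in> Gamma3 (0, deg_iota i b + deg_iota i c)" by simp
  have "?w \<noteq> 0"
  proof
    assume "?w = 0"
    then have "(\<lambda>j v. theta i (t8 (axis b (1::'k)) (axis c 1)) j v + theta i (t8 (axis b 1) (axis c 1)) j v) = 0"
      unfolding even_root_def bracket_same_copy gel_zero gel_eq_iff by blast
    from fun_cong[OF fun_cong[OF this, of i], of "axis (dual b) 1"]
    have "theta i (t8 (axis b (1::'k)) (axis c 1)) i (axis (dual b) 1) + theta i (t8 (axis b 1) (axis c 1)) i (axis (dual b) 1) = 0"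
      unfolding zero_fun_apply .
    moreover have "dual b \<noteq> dual c" using assms(1) dual_dual by metis
    ultimately have "axis c (1::'k) + axis c 1 = 0"
      by (simp add: theta_def t8_simps q8_axis_dual)
    then have "(axis c (1::'k) + axis c 1) $ c = 0" by simp
    then show False by simp
  qed
  then have "(0, deg_iota i b + deg_iota i c) \<in> grading_supp (Gamma3 :: G3 \<Rightarrow> 'k gvec set)"
    unfolding g.supp_comp_ex using m by blast
  then show ?thesis by (simp add: g_supp_0)
qed

lemma root_norm_parallelogram: "root_norm (v + w) + root_norm (v - w) = 2 * root_norm v + 2 * root_norm w"
  by (simp add: root_norm_add root_norm_diff)

lemma root_norm_pos: "v \<noteq> 0 \<Longrightarrow> root_norm v \<ge> 1"
  using root_norm_nonneg[of v] root_norm_eq_0[of v] by linarith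

text \<open>A degree of tri(S8) is a sum of two short vectors of copy 0. Skewness kills the
  coefficient when they are equal, so their difference has positive even norm, at least 2, and the
  parallelogram law leaves at most 2 for the sum.\<close>

lemma f4_supp_norm:
  assumes "v \<in> grading_supp (f4_cartan_grading :: int ^ 4 \<Rightarrow> 'k::field_char_0 gvec set)"
  shows "root_norm v \<le> 2"
proof -
  interpret f4: graded_algebra f4 "f4_cartan_grading :: int ^ 4 \<Rightarrow> 'k gvec set" by (rule graded_f4)
  obtain w :: "'k gvec" where "w \<in> G0 v" "w \<noteq> 0"
    using assms[unfolded f4.supp_comp_ex] unfolding f4_cartan_eq by blast
  then obtain d x where w: "gel d 0 x x \<noteq> (0 :: 'k gvec)" "d \<in> tri8" "end_hom 0 v (d 0)" "\<And>i. oct_hom i v (x i)"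
    unfolding G0_def by blast
  show ?thesis
  proof (cases "x = 0")
    case False
    then obtain j where "x j \<noteq> 0" by (auto simp: fun_eq_iff)
    then obtain b where "x j $ b \<noteq> 0" by (auto simp: vec_eq_iff)
    then have "v = deg_iota j b" using w(4)[of j] by (auto simp: oct_hom_def)
    then show ?thesis by (simp add: root_norm_deg_iota)
  next
    case True
    have "\<exists>b c. tri_coeff d b c \<noteq> 0"
    proof (rule ccontr)
      assume "\<not> (\<exists>b c. tri_coeff d b c \<noteq> 0)"
      then have "(\<lambda>i v. \<Sum>b\<in>UNIV. \<Sum>c\<in>UNIV. tri_coeff d b c *s t8 (axis (dual b) 1) (axis c 1) i v) = 0"
        by (simp add: fun_eq_iff)
      then have "d = 0" by (rule trans[OF tri8_expand[OF w(2)]])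
      then show False using w(1) True gel_zero by metis
    qed
    then obtain b c where bc: "tri_coeff d b c \<noteq> 0" by blast
    have v: "deg_iota 0 (dual b) + deg_iota 0 c = v" by (rule tri8_hom_coeff[of v d b c, OF w(3) bc])
    have "d 0 (axis b 1) $ dual b = - (d 0 (axis b 1) $ dual b)"
      using tri8_skew[OF w(2), of 0 "axis b 1" "axis b 1"] unfolding q8_sym[of "d 0 (axis b 1)"] q8_axis .
    then have "tri_coeff d b (dual b) = 0" by (simp add: tri_coeff_def)
    then have "c \<noteq> dual b" using bc by auto
    then have "deg_iota 0 (dual b) - deg_iota 0 c \<noteq> 0" by (simp add: deg_iota_inj)
    then have "root_norm (deg_iota 0 (dual b) - deg_iota 0 c) \<ge> 1" by (rule root_norm_pos)
    moreover have "even (root_norm (deg_iota 0 (dual b) - deg_iota 0 c))"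
      using copy_of_eq_iff[of "deg_iota 0 (dual b)" "deg_iota 0 c"]
      by (simp only: root_norm_deg_iota copy_of_deg_iota odd_one simp_thms)
    ultimately have "root_norm (deg_iota 0 (dual b) - deg_iota 0 c) \<ge> 2" by presburger
    then show ?thesis
      using root_norm_parallelogram[of "deg_iota 0 (dual b)" "deg_iota 0 c"] by (simp add: root_norm_deg_iota v)
  qed
qed

lemma g_supp_1:
  assumes "(1, v) \<in> grading_supp (Gamma3 :: G3 \<Rightarrow> 'k::field_char_0 gvec set)" "v \<noteq> 0"
  shows "root_norm v = 1"
proof -
  interpret g: graded_algebra g_S8_S2 "Gamma3 :: G3 \<Rightarrow> 'k gvec set" by (rule graded_g)
  obtain w :: "'k gvec" where "w \<in> G1 v" "w \<noteq> 0"
    using assms(1)[unfolded g.supp_comp_ex Gamma3_1] by blast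
  then obtain c x where w: "gel 0 c x (- x) \<noteq> (0 :: 'k gvec)" "v \<noteq> 0 \<Longrightarrow> c = 0" "\<And>i. oct_hom i v (x i)"
    unfolding G1_def by blast
  have "x \<noteq> 0"
  proof
    assume "x = 0"
    then have "gel 0 c x (- x) = (0 :: 'k gvec)" unfolding w(2)[OF assms(2)] by (simp flip: gel_zero)
    then show False using w(1) by blast
  qed
  then obtain j where "x j \<noteq> 0" by (auto simp: fun_eq_iff)
  then obtain b where "x j $ b \<noteq> 0" by (auto simp: vec_eq_iff)
  then have "v = deg_iota j b" using w(3)[of j] by (auto simp: oct_hom_def)
  then show ?thesis by (simp add: root_norm_deg_iota)
qed

text \<open>Quantifying over k makes the condition insensitive to adding a constant to the
  Z2-coordinate, so it survives automorphisms that mix this coordinate with Z^4.\<close>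

lemma g_supp_short:
  assumes "v \<noteq> 0"
  shows "(\<forall>k. (k, v) \<in> grading_supp (Gamma3 :: G3 \<Rightarrow> 'k::field_char_0 gvec set)) \<longleftrightarrow> root_norm v = 1"
proof
  assume "root_norm v = 1"
  then obtain i b where v: "v = deg_iota i b" using deg_iota_surj by blast
  have k: "k = 0 \<or> k = 1" for k :: 2 using exhaust_2[of k] by auto
  have "(k, v) \<in> grading_supp (Gamma3 :: G3 \<Rightarrow> 'k gvec set)" for k
    unfolding v using k[of k] by (elim disjE) (simp_all only: root_supp(1,2))
  then show "\<forall>k. (k, v) \<in> grading_supp (Gamma3 :: G3 \<Rightarrow> 'k gvec set)" ..
qed (use g_supp_1 assms in blast)

text \<open>Support vectors have norm at most 2, so the parallelogram law for v + r and v - r bounds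
  the sum of the norms of v and r by 2, and both are 1. Conversely, for r take another degree of the
  same copy, neither equal nor opposite to v. The condition mentions only the support and addition,
  so induced automorphisms preserve it.\<close>

lemma f4_supp_short:
  defines "S \<equiv> grading_supp (f4_cartan_grading :: int ^ 4 \<Rightarrow> 'k::field_char_0 gvec set)"
  shows "root_norm v = 1 \<longleftrightarrow> v \<in> S \<and> v \<noteq> 0 \<and> (\<exists>r. r \<noteq> 0 \<and> v + r \<in> S \<and> v - r \<in> S)"
proof
  assume "root_norm v = 1"
  then obtain i b where v: "v = deg_iota i b" using deg_iota_surj by blast
  obtain c where c: "c \<noteq> b" "c \<noteq> dual b"
  proof (cases b)
    case Oe1 then show ?thesis using that[of "Ou 0"] by simp
  next
    case Oe2 then show ?thesis using that[of "Ou 0"] by simp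
  next
    case Ou then show ?thesis using that[of Oe1] by simp
  next
    case Ov then show ?thesis using that[of Oe1] by simp
  qed
  have d: "dual c \<noteq> b" "dual c \<noteq> dual b" using c dual_dual by metis+
  have nz: "deg_iota i e \<noteq> 0" for e
  proof
    assume "deg_iota i e = 0"
    then show False using root_norm_deg_iota[of i e] root_norm_eq_0[of "deg_iota i e"] by simp
  qed
  have "v + deg_iota i c \<in> S" unfolding S_def v by (rule root_sum_supp[OF c])
  moreover have "v - deg_iota i c \<in> S"
    using root_sum_supp[OF d, where ?'k = 'k, of i] unfolding S_def v deg_dual[of i c] by simp
  moreover have "v \<in> S" unfolding S_def v by (rule root_supp(3))
  ultimately show "v \<in> S \<and> v \<noteq> 0 \<and> (\<exists>r. r \<noteq> 0 \<and> v + r \<in> S \<and> v - r \<in> S)" using nz unfolding v by blast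
next
  assume *: "v \<in> S \<and> v \<noteq> 0 \<and> (\<exists>r. r \<noteq> 0 \<and> v + r \<in> S \<and> v - r \<in> S)"
  then obtain r where r: "r \<noteq> 0" "v + r \<in> S" "v - r \<in> S" by blast
  have "root_norm (v + r) \<le> 2" "root_norm (v - r) \<le> 2"
    by (rule f4_supp_norm[OF r(2)[unfolded S_def]] f4_supp_norm[OF r(3)[unfolded S_def]])+
  moreover have "root_norm r \<ge> 1" "root_norm v \<ge> 1" using r(1) * root_norm_pos by simp_all
  ultimately show "root_norm v = 1" using root_norm_parallelogram[of v r] by linarith
qed

lemma isometries_induct [consumes 1, case_names id s1 s2 s3 s4 comp]:
  assumes "f \<in> isometries" and "P id" "P ((*v) f4_s1)" "P ((*v) f4_s2)" "P ((*v) f4_s3)" "P ((*v) f4_s4)"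
    and "\<And>f g. P f \<Longrightarrow> P g \<Longrightarrow> P (f \<circ> g)"
  shows "P f"
  using assms(1) unfolding isometries_eq_words
proof induction
  case (s_words_comp f g)
  then show ?case using assms(7) by blast
qed (rule assms(2-6))+

text \<open>Induced automorphisms preserve short roots by \<open>f4_supp_short\<close>, hence are
  isometries by \<open>root_norm_preserved\<close>; conversely the image is a group that contains
  the four generators.\<close>

theorem weyl_image_f4:
  "weyl_image (f4 :: ('k::field_char_0, 'k gvec) algebra_struct) f4_cartan_grading = isometries"
proof (intro equalityI subsetI)
  interpret universal_graded_algebra f4 "f4_cartan_grading :: int ^ 4 \<Rightarrow> 'k gvec set" by (rule universal_f4)
  let ?W = "weyl_image (f4 :: ('k, 'k gvec) algebra_struct) f4_cartan_grading"
  fix \<alpha> assume a: "\<alpha> \<in> ?W"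
  note add = weyl_image_supp(3)[OF a]
  note supp = weyl_image_supp(1)[OF a]
  have b: "bij \<alpha>" by (rule weyl_image_supp(2)[OF a])
  have a0: "\<alpha> 0 = 0" using add[of 0 0] by simp
  have z: "\<alpha> v = 0 \<longleftrightarrow> v = 0" for v using a0 injD[OF bij_is_inj[OF b], of v 0] by auto
  have ex: "(\<exists>r. P r) \<longleftrightarrow> (\<exists>r. P (\<alpha> r))" for P using bij_is_surj[OF b] by (metis surjD)
  have diff: "\<alpha> (v - r) = \<alpha> v - \<alpha> r" for v r using add[of "v - r" r] by simp
  have short: "root_norm (\<alpha> v) = 1 \<longleftrightarrow> root_norm v = 1" for v
  proof -
    let ?S = "grading_supp (f4_cartan_grading :: int ^ 4 \<Rightarrow> 'k gvec set)"
    have "(\<exists>r. r \<noteq> 0 \<and> \<alpha> v + r \<in> ?S \<and> \<alpha> v - r \<in> ?S) \<longleftrightarrow> (\<exists>r. \<alpha> r \<noteq> 0 \<and> \<alpha> v + \<alpha> r \<in> ?S \<and> \<alpha> v - \<alpha> r \<in> ?S)"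
      by (rule ex)
    then show ?thesis unfolding f4_supp_short[where ?'k = 'k] by (simp add: z supp flip: add diff)
  qed
  have "root_norm (\<alpha> v) = root_norm v" for v by (rule root_norm_preserved[OF add _ short]) (simp add: z)
  then show "\<alpha> \<in> isometries" using b add by (simp add: isometries_def)
next
  interpret universal_graded_algebra f4 "f4_cartan_grading :: int ^ 4 \<Rightarrow> 'k gvec set" by (rule universal_f4)
  let ?W = "weyl_image (f4 :: ('k, 'k gvec) algebra_struct) f4_cartan_grading"
  note sub = subgroup_weyl_image
  fix f assume "f \<in> isometries"
  then show "f \<in> ?W"
  proof (induction rule: isometries_induct)
    case id
    show ?case using subgroup.one_closed[OF sub] unfolding AutoGroup_additive_one .
  next
    case (comp f g)
    show ?case
      using subgroup.m_closed[OF sub comp]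
      unfolding AutoGroup_additive_mult[OF subgroup.mem_carrier[OF sub comp(1)] subgroup.mem_carrier[OF sub comp(2)]] .
  qed (unfold weyl_image_eq, (use oct_symmetry.induced_f4 symmetry_s1 symmetry_s2 symmetry_s3 symmetry_s4 in blast)+)
qed

definition weyl_map :: "2 \<Rightarrow> 2 \<Rightarrow> (int ^ 4 \<Rightarrow> int ^ 4) \<Rightarrow> G3 \<Rightarrow> G3" where
  "weyl_map a b f s = (fst s + shift a b (snd s), f (snd s))"

lemma mod2_cases: "a = 0 \<or> a = 1" for a :: 2
  using exhaust_2[of a] by auto

lemma shift_zero [simp]: "shift 0 0 v = 0" "shift a b 0 = 0"
  by (simp_all add: shift_def)

lemma shift_plus: "shift a b v + shift a' b' v = shift (a + a') (b + b') v"
  by (simp add: shift_def)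

lemma shift_axis: "(\<chi> j. shift a b (axis j 1)) = vector [a, b, a, b]"
  by (simp add: vec4_eq_iff shift_def axis_def)

lemma weyl_map_comp: "weyl_map a b f \<circ> weyl_map a' b' id = weyl_map (a + a') (b + b') f"
  by (simp add: weyl_map_def fun_eq_iff shift_plus[symmetric] add_ac)

lemma weyl_map_0_comp: "weyl_map 0 0 f \<circ> weyl_map 0 0 g = weyl_map 0 0 (f \<circ> g)"
  by (simp add: weyl_map_def fun_eq_iff)

lemma weyl_map_id: "weyl_map 0 0 id = id"
  by (simp add: weyl_map_def fun_eq_iff)

lemma weyl_map_eq_iff: "weyl_map a b f = weyl_map a' b' f' \<longleftrightarrow> a = a' \<and> b = b' \<and> f = f'"
proof
  assume e: "weyl_map a b f = weyl_map a' b' f'"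
  have v: "shift a b v = shift a' b' v \<and> f v = f' v" for v
    using fun_cong[OF e, of "(0, v)"] by (simp add: weyl_map_def)
  then have "(\<chi> j. shift a b (axis j 1)) = (\<chi> j. shift a' b' (axis j 1))" by simp
  then show "a = a' \<and> b = b' \<and> f = f'" unfolding shift_axis using v by (simp add: vec4_eq_iff fun_eq_iff)
qed simp

lemma additive_shift:
  fixes h :: "int ^ 4 \<Rightarrow> 2"
  assumes add: "\<And>v w. h (v + w) = h v + h w"
    and eq: "h (axis 3 1) = h (axis 1 1)" "h (axis 4 1) = h (axis 2 1)"
  shows "h v = shift (h (axis 1 1)) (h (axis 2 1)) v"
proof (rule fun_cong[OF lattice_hom_eqI[of h "shift (h (axis 1 1)) (h (axis 2 1))"]])
  let ?s = "shift (h (axis 1 1)) (h (axis 2 1))"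
  have n: "(axis j 1 :: int ^ 4) $ i = (if i = j then 1 else 0)" for i j by (simp add: axis_def)
  have s: "?s (axis 1 1) = h (axis 1 1)" "?s (axis 2 1) = h (axis 2 1)" "?s (axis 3 1) = h (axis 3 1)" "?s (axis 4 1) = h (axis 4 1)"
    by (simp_all add: shift_def n eq)
  show "h (deg_iota i b) = ?s (deg_iota i b)" for i b
    unfolding additive_eq_zcomb[of h "deg_iota i b", OF add] additive_eq_zcomb[of ?s "deg_iota i b", OF shift_add] s ..
qed (rule add shift_add)+

theorem weyl_image_g:
  "weyl_image (g_S8_S2 :: ('k::{alg_closed_field, field_char_0}, 'k gvec) algebra_struct) Gamma3
    = {weyl_map a b f |a b f. f \<in> isometries}"
proof (intro equalityI subsetI)
  interpret universal_graded_algebra g_S8_S2 "Gamma3 :: G3 \<Rightarrow> 'k gvec set" by (rule universal_g)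
  let ?W = "weyl_image (g_S8_S2 :: ('k, 'k gvec) algebra_struct) Gamma3"
  let ?S = "grading_supp (Gamma3 :: G3 \<Rightarrow> 'k gvec set)"
  fix \<alpha> assume a: "\<alpha> \<in> ?W"
  note add = weyl_image_supp(3)[OF a]
  note supp = weyl_image_supp(1)[OF a]
  have b: "bij \<alpha>" by (rule weyl_image_supp(2)[OF a])
  have inj: "\<alpha> s = \<alpha> t \<longleftrightarrow> s = t" for s t using bij_is_inj[OF b] by (rule inj_eq)
  have a0: "\<alpha> 0 = 0" using add[of 0 0] by simp
  define h where "h v = fst (\<alpha> (0, v))" for v
  define f where "f v = snd (\<alpha> (0, v))" for v
  have hadd: "h (v + w) = h v + h w" and fadd: "f (v + w) = f v + f w" for v w
    using add[of "(0, v)" "(0, w)"] by (simp_all add: h_def f_def)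
  \<comment> \<open>An automorphism fixes (1, 0), the only element of order two in Z2 x Z^4.\<close>
  have one: "\<alpha> (1, 0) = (1, 0)"
  proof -
    have "\<alpha> (1, 0) + \<alpha> (1, 0) = 0" using add[of "(1, 0)" "(1, 0)"] a0 by (simp add: zero_prod_def)
    then have "snd (\<alpha> (1, 0)) + snd (\<alpha> (1, 0)) = 0" by (simp add: prod_eq_iff)
    then have z: "snd (\<alpha> (1, 0)) = 0" by (simp add: vec_eq_iff)
    have "\<alpha> (1, 0) \<noteq> 0" using inj[of "(1, 0)" 0] a0 by (simp add: zero_prod_def)
    then have "fst (\<alpha> (1, 0)) \<noteq> 0" using z by (simp add: prod_eq_iff)
    then have "fst (\<alpha> (1, 0)) = 1" using mod2_cases by blast
    then show ?thesis using z by (simp add: prod_eq_iff)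
  qed
  have val: "\<alpha> (k, v) = (k + h v, f v)" for k v
  proof -
    have e: "\<alpha> (0, v) = (h v, f v)" by (simp add: h_def f_def)
    have "\<alpha> (1, v) = (1 + h v, f v)" using add[of "(1, 0)" "(0, v)"] by (simp add: one e)
    then show ?thesis using mod2_cases[of k] e by (elim disjE) simp_all
  qed
  have z: "f v = 0 \<longleftrightarrow> v = 0" for v
  proof
    assume "f v = 0"
    then have "\<alpha> (h v, v) = \<alpha> 0" unfolding val a0 by (simp add: zero_prod_def)
    then show "v = 0" unfolding inj by (simp add: zero_prod_def)
  qed (use fadd[of 0 0] in simp)
  have all: "(\<forall>k. (k, f v) \<in> ?S) \<longleftrightarrow> (\<forall>k. (k, v) \<in> ?S)" for v
  proof -
    have "(k, f v) \<in> ?S \<longleftrightarrow> (k + h v, v) \<in> ?S" for k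
      using supp[of "(k + h v, v)"] by (simp add: val add.assoc)
    moreover have "(\<forall>k. P (k + h v)) \<longleftrightarrow> (\<forall>k. P k)" for P :: "2 \<Rightarrow> bool"
    proof
      assume p: "\<forall>k. P (k + h v)"
      show "\<forall>k. P k"
      proof
        fix k show "P k" using spec[OF p, of "k + h v"] by (simp add: add.assoc)
      qed
    qed blast
    ultimately show ?thesis by simp
  qed
  have short: "root_norm (f v) = 1 \<longleftrightarrow> root_norm v = 1" for v
  proof (cases "v = 0")
    case False
    then show ?thesis using g_supp_short[of "f v", where ?'k = 'k] g_supp_short[of v, where ?'k = 'k] all z by simp
  next
    case True
    then have "f v = v" using z[of v] by simp
    then show ?thesis by simp
  qed
  have n: "root_norm (f v) = root_norm v" for v by (rule root_norm_preserved[OF fadd _ short]) (simp add: z)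
  have "surj f"
  proof (rule surjI)
    fix w
    have "\<alpha> (inv' \<alpha> (0, w)) = (0, w)" using b by (simp add: bij_is_surj surj_f_inv_f)
    then show "f (snd (inv' \<alpha> (0, w))) = w" using val[of "fst (inv' \<alpha> (0, w))" "snd (inv' \<alpha> (0, w))"] by simp
  qed
  moreover have "inj f"
  proof (rule injI)
    fix v w assume "f v = f w"
    then have "f (v - w) = 0" using fadd[of "v - w" w] by simp
    then show "v = w" by (simp add: z)
  qed
  ultimately have iso: "f \<in> isometries" using fadd n by (simp add: isometries_def bij_def)
  \<comment> \<open>Over a long root only Z2-degree 0 occurs. A value 1 of h there would put an odd
    element over a vector of norm 2 into the support.\<close>
  have h0: "h (deg_iota i b + deg_iota i c) = 0" if "c \<noteq> b" "c \<noteq> dual b" "root_norm (deg_iota i b + deg_iota i c) = 2" for i b c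
  proof (rule ccontr)
    let ?v = "deg_iota i b + deg_iota i c"
    assume "h ?v \<noteq> 0"
    then have h1: "h ?v = 1" using mod2_cases by blast
    have "(0, ?v) \<in> ?S" unfolding g_supp_0 by (rule root_sum_supp[OF that(1,2)])
    then have "(1, f ?v) \<in> ?S" using supp[of "(0, ?v)"] by (simp add: val h1)
    moreover have "f ?v \<noteq> 0" using that(3) root_norm_eq_0[of ?v] by (auto simp: z)
    ultimately have "root_norm (f ?v) = 1" by (rule g_supp_1)
    then show False using that(3) n by simp
  qed
  \<comment> \<open>a1 - g1 and a2 - g2 are long roots, so h takes equal values on basis vectors 1
    and 3, and on 2 and 4.\<close>
  have e: "axis 1 1 - axis 3 1 = deg_iota 1 Oe1 + deg_iota 1 (Ov 1)" "axis 2 1 - axis 4 1 = deg_iota 2 Oe1 + deg_iota 2 (Ov 2)"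
    unfolding axis_deg by (simp_all add: deg_iota.simps)
  have "h (axis 1 1 - axis 3 1) = 0" unfolding e
    by (rule h0) (simp_all add: deg_iota.simps deg_simps root_norm_def)
  then have e1: "h (axis 3 1) = h (axis 1 1)" using hadd[of "axis 1 1 - axis 3 1" "axis 3 1"] by simp
  have "h (axis 2 1 - axis 4 1) = 0" unfolding e
    by (rule h0) (simp_all add: deg_iota.simps deg_simps root_norm_def)
  then have e2: "h (axis 4 1) = h (axis 2 1)" using hadd[of "axis 2 1 - axis 4 1" "axis 4 1"] by simp
  have "\<alpha> = weyl_map (h (axis 1 1)) (h (axis 2 1)) f"
  proof
    fix s
    show "\<alpha> s = weyl_map (h (axis 1 1)) (h (axis 2 1)) f s"
      using val[of "fst s" "snd s"] additive_shift[OF hadd e1 e2, of "snd s"] by (simp add: weyl_map_def)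
  qed
  then show "\<alpha> \<in> {weyl_map a b f |a b f. f \<in> isometries}" using iso by blast
next
  interpret universal_graded_algebra g_S8_S2 "Gamma3 :: G3 \<Rightarrow> 'k gvec set" by (rule universal_g)
  let ?W = "weyl_image (g_S8_S2 :: ('k, 'k gvec) algebra_struct) Gamma3"
  note sub = subgroup_weyl_image
  have closed: "\<alpha> \<circ> \<beta> \<in> ?W" if "\<alpha> \<in> ?W" "\<beta> \<in> ?W" for \<alpha> \<beta>
    using subgroup.m_closed[OF sub that]
    unfolding AutoGroup_additive_mult[OF subgroup.mem_carrier[OF sub that(1)] subgroup.mem_carrier[OF sub that(2)]] .
  have one: "id \<in> ?W" using subgroup.one_closed[OF sub] unfolding AutoGroup_additive_one .
  have ind: "weyl_map 0 0 f = (\<lambda>s. (fst s, f (snd s)))" for f by (simp add: weyl_map_def fun_eq_iff)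
  have "weyl_map 0 0 f \<in> ?W" if "f \<in> isometries" for f
    using that
  proof (induction rule: isometries_induct)
    case id
    show ?case using one unfolding weyl_map_id .
  next
    case (comp f g)
    show ?case using closed[OF comp] unfolding weyl_map_0_comp .
  qed (unfold weyl_image_eq ind, (use oct_symmetry.induced_g symmetry_s1 symmetry_s2 symmetry_s3 symmetry_s4 in blast)+)
  moreover have "weyl_map a b id \<in> ?W" for a b
  proof -
    \<comment> \<open>Algebraic closedness supplies the square root of -1 that the shears
      require.\<close>
    obtain i :: 'k where "i ^ 2 = -1" using nth_root_exists[of 2 "-1 :: 'k"] by auto
    then have i: "i * i = -1" by (simp add: power2_eq_square)
    have t: "weyl_map (if p = 1 then 0 else 1) (if p = 2 then 0 else 1) id \<in> ?W" for p :: 3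
      using induced_shear[OF i, of p] unfolding weyl_image_eq twist_shift weyl_map_def[abs_def] by simp
    show ?thesis
      using mod2_cases[of a] mod2_cases[of b] t[of 0] t[of 1] t[of 2] one weyl_map_id by auto
  qed
  moreover fix \<alpha> assume "\<alpha> \<in> {weyl_map a b f |a b f. f \<in> isometries}"
  then obtain a b f where "\<alpha> = weyl_map a b f" "f \<in> isometries" by blast
  ultimately show "\<alpha> \<in> ?W" using closed[of "weyl_map 0 0 f" "weyl_map a b id"] by (simp only: weyl_map_comp add_0)
qed

lemma G3_matrix_weyl_map:
  assumes "f \<in> isometries"
  shows "G3_matrix (weyl_map a b f) = Block 1 (vector [a, b, a, b]) 0 (matrix f)"
  unfolding G3_matrix_def weyl_map_def by (simp add: isometry_zero[OF assms] shift_axis matrix_def)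

lemma group_Z2_pow2: "group Z2_pow2"
  by (simp add: Z2_pow2_def DirProd_group)

lemma Z2_pow2_carrier: "carrier Z2_pow2 = {0, 1} \<times> {0, 1}"
proof -
  have "{0..<int 2} = {0, 1}" by auto
  then show ?thesis by (simp add: Z2_pow2_def DirProd_def carrier_integer_mod_group)
qed

text \<open>Elements acting trivially on the Z^4-coordinate form the normal factor, since
  conjugation keeps that action trivial. Those with a = b = 0 form the complement, indexed here by
  their matrices.\<close>

theorem weyl_group_semidirect:
  fixes k :: "'k::{alg_closed_field, field_char_0} itself"
  shows "\<exists>\<phi>. group_action_by_auts (GL4Z\<lparr>carrier := matrix ` isometries\<rparr>) Z2_pow2 \<phi> \<and>
    weyl_group (g_S8_S2 :: ('k, 'k gvec) algebra_struct) Gamma3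
      \<cong> semidirect Z2_pow2 \<phi> (GL4Z\<lparr>carrier := matrix ` isometries\<rparr>)"
proof -
  interpret universal_graded_algebra g_S8_S2 "Gamma3 :: G3 \<Rightarrow> 'k gvec set" by (rule universal_g)
  let ?W = "weyl_image (g_S8_S2 :: ('k, 'k gvec) algebra_struct) Gamma3"
  let ?G = "AutoGroup (additive_group :: G3 monoid)\<lparr>carrier := ?W\<rparr>"
  let ?H = "GL4Z\<lparr>carrier := matrix ` isometries\<rparr>"
  note W = weyl_image_g[where ?'k = 'k]
  have G: "group ?G" by (rule subgroup.subgroup_is_group[OF subgroup_weyl_image group_AutoGroup_additive])
  have H: "group ?H" by (rule subgroup.subgroup_is_group[OF subgroup_matrix_isometries group_GL4Z])
  have mult: "x \<otimes>\<^bsub>?G\<^esub> y = x \<circ> y" if "x \<in> ?W" "y \<in> ?W" for x y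
    using subgroup.mem_carrier[OF subgroup_weyl_image that(1)] subgroup.mem_carrier[OF subgroup_weyl_image that(2)]
    by (simp add: AutoGroup_additive_mult)
  have one: "\<one>\<^bsub>?G\<^esub> = id" by (simp add: AutoGroup_additive_one)
  have WI: "weyl_map a b f \<in> ?W" if "f \<in> isometries" for a b f unfolding W using that by blast
  define n where "n = (\<lambda>(x, y). weyl_map (of_int x) (of_int y) id :: G3 \<Rightarrow> G3)"
  define h where "h A = weyl_map 0 0 ((*v) A)" for A
  have hm: "h (matrix f) = weyl_map 0 0 f" if "f \<in> isometries" for f
    unfolding h_def using matrix_isometry[OF that] by (simp add: weyl_map_def fun_eq_iff)
  have nW: "n x \<in> ?W" for x unfolding n_def using WI[OF isometry_id] by (simp split: prod.split)
  have n_all: "weyl_map a b id \<in> n ` carrier Z2_pow2" for a b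
  proof -
    have "\<exists>x \<in> {0, 1}. of_int x = (a :: 2)" for a using mod2_cases[of a] by auto
    then obtain x y where "x \<in> {0, 1}" "y \<in> {0, 1}" "of_int x = a" "of_int y = b" by metis
    then show ?thesis unfolding Z2_pow2_carrier n_def by (intro image_eqI[of _ _ "(x, y)"]) auto
  qed
  have "\<exists>\<phi>. group_action_by_auts ?H Z2_pow2 \<phi> \<and> semidirect Z2_pow2 \<phi> ?H \<cong> ?G"
  proof (rule semidirect_of_homs[OF group_Z2_pow2 H G, of n h])
    show "n \<in> hom Z2_pow2 ?G"
    proof (rule homI)
      fix x y assume "x \<in> carrier Z2_pow2" "y \<in> carrier Z2_pow2"
      then have "n (x \<otimes>\<^bsub>Z2_pow2\<^esub> y) = n x \<circ> n y"
        unfolding Z2_pow2_carrier n_def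
        by (auto simp: Z2_pow2_def DirProd_def mult_integer_mod_group weyl_map_comp)
      then show "n (x \<otimes>\<^bsub>Z2_pow2\<^esub> y) = n x \<otimes>\<^bsub>?G\<^esub> n y" using mult[OF nW nW] by simp
    qed (simp add: nW)
    show "inj_on n (carrier Z2_pow2)"
      unfolding Z2_pow2_carrier n_def inj_on_def by (auto simp: weyl_map_eq_iff)
    show "h \<in> hom ?H ?G"
    proof (rule homI)
      fix A B assume "A \<in> carrier ?H" "B \<in> carrier ?H"
      then obtain f g where f: "f \<in> isometries" "A = matrix f" and g: "g \<in> isometries" "B = matrix g" by auto
      show "h (A \<otimes>\<^bsub>?H\<^esub> B) = h A \<otimes>\<^bsub>?G\<^esub> h B"
        using mult[OF WI[OF f(1), of 0 0] WI[OF g(1), of 0 0]] hm[OF isometry_comp[OF f(1) g(1)]]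
        by (simp add: f g hm GL4Z_simps matrix_comp weyl_map_0_comp)
    qed (auto simp: hm WI)
    show "inj_on h (carrier ?H)"
      by (rule inj_onI) (auto simp: hm weyl_map_eq_iff)
    show "h x \<otimes>\<^bsub>?G\<^esub> n y \<otimes>\<^bsub>?G\<^esub> inv\<^bsub>?G\<^esub> (h x) \<in> n ` carrier Z2_pow2"
      if x: "x \<in> carrier ?H" for x y
    proof -
      obtain f where f: "f \<in> isometries" "x = matrix f" using x by auto
      have hx: "h x = weyl_map 0 0 f" "h x \<in> carrier ?G" using f hm WI by simp_all
      let ?i = "inv\<^bsub>?G\<^esub> (h x)"
      have i: "?i \<in> carrier ?G" "h x \<otimes>\<^bsub>?G\<^esub> ?i = \<one>\<^bsub>?G\<^esub>"
        using group.inv_closed[OF G hx(2)] group.r_inv[OF G hx(2)] by simp_all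
      then have iW: "?i \<in> ?W" by simp
      have hW: "h x \<in> ?W" using hx(2) by simp
      have hn: "h x \<circ> n y \<in> ?W" using group.subgroup_self[OF G, THEN subgroup.m_closed, OF hx(2), of "n y"] nW mult[OF hW nW] by simp
      have e: "h x \<otimes>\<^bsub>?G\<^esub> n y \<otimes>\<^bsub>?G\<^esub> ?i = h x \<circ> n y \<circ> ?i"
        using mult[OF hW nW] mult[OF hn iW] by simp
      have r: "h x \<circ> ?i = id" using i(2) mult[OF hW iW] one by simp
      obtain a b g where g: "?i = weyl_map a b g" using iW unfolding W by blast
      have fg: "f (g v) = v" for v using fun_cong[OF r, of "(0, v)"] unfolding g unfolding hx(1) by (simp add: weyl_map_def)
      have "h x \<circ> n y \<circ> ?i \<in> ?W"
        using group.subgroup_self[OF G, THEN subgroup.m_closed, of "h x \<circ> n y" ?i] hn iW mult[OF hn iW] by simp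
      then obtain c d k where k: "h x \<circ> n y \<circ> ?i = weyl_map c d k" unfolding W by blast
      have "k v = v" for v
        using fun_cong[OF k, of "(0, v)"] unfolding g unfolding hx(1)
        by (simp add: n_def weyl_map_def fg split_beta)
      then have "k = id" by (simp add: fun_eq_iff)
      then show ?thesis unfolding e k using n_all by simp
    qed
    show "x = \<one>\<^bsub>?H\<^esub>" if x: "x \<in> carrier ?H" and eq: "n y = h x" for x y
    proof -
      obtain f where f: "f \<in> isometries" "x = matrix f" using x by auto
      have "weyl_map 0 0 f = weyl_map (of_int (fst y)) (of_int (snd y)) id"
        using eq unfolding f(2) hm[OF f(1)] by (simp add: n_def split_beta)
      then have "f = id" by (simp add: weyl_map_eq_iff)
      then show ?thesis using f(2) by (simp add: matrix_id GL4Z_simps)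
    qed
    show "\<exists>y \<in> carrier Z2_pow2. \<exists>x \<in> carrier ?H. g = n y \<otimes>\<^bsub>?G\<^esub> h x" if g: "g \<in> carrier ?G" for g
    proof -
      obtain a b f where f: "g = weyl_map a b f" "f \<in> isometries" using g W by auto
      have gW: "g \<in> ?W" using g by simp
      let ?i = "inv' f"
      \<comment> \<open>In \<open>weyl_map a b f\<close> the row is evaluated before f moves the
        vector, while the factorization wants it on the left. Composing with the inverse of f on the
        right exposes the row (c, d) that has to be used.\<close>
      have "weyl_map a b f \<circ> weyl_map 0 0 ?i \<in> ?W"
        using group.subgroup_self[OF G, THEN subgroup.m_closed, of g "weyl_map 0 0 ?i"] gW
          WI[OF isometry_inv[OF f(2)], of 0 0] mult[OF gW WI[OF isometry_inv[OF f(2)], of 0 0]] by (simp add: f(1))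
      then obtain c d k where k: "weyl_map a b f \<circ> weyl_map 0 0 ?i = weyl_map c d k" unfolding W by blast
      have fi: "f (?i v) = v" "?i (f v) = v" for v using inv_comp_isometry[OF f(2)] by (simp_all add: fun_eq_iff)
      have "k v = v" for v using fun_cong[OF k, of "(0, v)"] by (simp add: weyl_map_def fi)
      then have "k = id" by (simp add: fun_eq_iff)
      have "g = (weyl_map a b f \<circ> weyl_map 0 0 ?i) \<circ> weyl_map 0 0 f" by (simp add: f(1) fun_eq_iff weyl_map_def fi)
      then have e: "g = weyl_map c d id \<circ> h (matrix f)" unfolding k \<open>k = id\<close> hm[OF f(2)] .
      obtain y where y: "y \<in> carrier Z2_pow2" "n y = weyl_map c d id" using n_all[of c d] by (metis imageE)
      have "g = n y \<otimes>\<^bsub>?G\<^esub> h (matrix f)"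
        using mult[OF nW[of y] WI[OF f(2), of 0 0]] unfolding e y(2) hm[OF f(2)] by simp
      then show ?thesis using y(1) f(2) by auto
    qed
  qed
  then obtain \<phi> where act: "group_action_by_auts ?H Z2_pow2 \<phi>" and iso: "semidirect Z2_pow2 \<phi> ?H \<cong> ?G" by blast
  have "?G \<cong> semidirect Z2_pow2 \<phi> ?H"
    by (rule group.iso_sym[OF group_semidirect[OF act group_Z2_pow2 H] iso])
  then have "weyl_group (g_S8_S2 :: ('k, 'k gvec) algebra_struct) Gamma3 \<cong> semidirect Z2_pow2 \<phi> ?H"
    by (rule iso_trans[OF weyl_group_iso])
  then show ?thesis using act by blast
qed

theorem proposition5p3:
  shows "fine_grading TYPE('h::ab_group_add)
           (g_S8_S2 :: ('k::{alg_closed_field, field_char_0}, 'k gvec) algebra_struct) Gamma3 \<and>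
         universal_group TYPE('h)
           (g_S8_S2 :: ('k, 'k gvec) algebra_struct) Gamma3 \<and>
         weyl_identification (g_S8_S2 :: ('k, 'k gvec) algebra_struct) Gamma3 \<and>
         weyl_identification (f4 :: ('k, 'k gvec) algebra_struct) f4_cartan_grading \<and>
         G3_matrix ` weyl_image (g_S8_S2 :: ('k, 'k gvec) algebra_struct) Gamma3
           = {Block 1 (vector [a, b, a, b]) 0 A |A a b. A \<in> W_f4 TYPE('k)} \<and>
         W_f4 TYPE('k) = generate GL4Z {f4_s1, f4_s2, f4_s3, f4_s4} \<and>
         (\<exists>\<phi> \<psi> \<theta> \<omega>.
            group_action_by_auts (W_f4_group TYPE('k)) Z2_pow2 \<phi> \<and>
            group_action_by_auts (sym_group 4) Z2_pow3 \<psi> \<and>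
            group_action_by_auts (sym_group 3) (semidirect Z2_pow3 \<psi> (sym_group 4)) \<theta> \<and>
            group_action_by_auts
              (semidirect (semidirect Z2_pow3 \<psi> (sym_group 4)) \<theta> (sym_group 3)) Z2_pow2 \<omega> \<and>
            weyl_group (g_S8_S2 :: ('k, 'k gvec) algebra_struct) Gamma3
              \<cong> semidirect Z2_pow2 \<phi> (W_f4_group TYPE('k)) \<and>
            W_f4_group TYPE('k)
              \<cong> semidirect (semidirect Z2_pow3 \<psi> (sym_group 4)) \<theta> (sym_group 3) \<and>
            semidirect Z2_pow2 \<phi> (W_f4_group TYPE('k))
              \<cong> semidirect Z2_pow2 \<omega>
                   (semidirect (semidirect Z2_pow3 \<psi> (sym_group 4)) \<theta> (sym_group 3)))"
proof -
  note u = universal_graded_algebra.weyl_identification[OF universal_g[where ?'k = 'k]]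
    universal_graded_algebra.weyl_identification[OF universal_f4[where ?'k = 'k]]
  let ?H = "GL4Z\<lparr>carrier := matrix ` isometries\<rparr>"
  have W: "W_f4 TYPE('k) = matrix ` isometries" by (simp add: W_f4_def weyl_image_f4)
  have H: "group ?H" by (rule subgroup.subgroup_is_group[OF subgroup_matrix_isometries group_GL4Z])
  have m: "G3_matrix ` weyl_image (g_S8_S2 :: ('k, 'k gvec) algebra_struct) Gamma3
      = {Block 1 (vector [a, b, a, b]) 0 A |A a b. A \<in> W_f4 TYPE('k)}" (is "?L = ?R")
  proof (intro equalityI subsetI)
    fix X assume "X \<in> ?L"
    then obtain a b f where "X = G3_matrix (weyl_map a b f)" "f \<in> isometries" unfolding weyl_image_g by blast
    then show "X \<in> ?R" unfolding W using G3_matrix_weyl_map by blast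
  next
    fix X assume "X \<in> ?R"
    then obtain a b f where "f \<in> isometries" "X = Block 1 (vector [a, b, a, b]) 0 (matrix f)" unfolding W by blast
    then have "X = G3_matrix (weyl_map a b f)" "weyl_map a b f \<in> {weyl_map a b f |a b f. f \<in> isometries}"
      using G3_matrix_weyl_map[of f a b] by auto
    then show "X \<in> ?L" unfolding weyl_image_g by (rule image_eqI)
  qed
  obtain \<phi> where phi: "group_action_by_auts ?H Z2_pow2 \<phi>"
    "weyl_group (g_S8_S2 :: ('k, 'k gvec) algebra_struct) Gamma3 \<cong> semidirect Z2_pow2 \<phi> ?H"
    using weyl_group_semidirect[where ?'k = 'k] by blast
  obtain \<psi> \<theta> where psi: "group_action_by_auts (sym_group 4) Z2_pow3 \<psi>"
    "group_action_by_auts (sym_group 3) (semidirect Z2_pow3 \<psi> (sym_group 4)) \<theta>"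
    and iso: "semidirect (semidirect Z2_pow3 \<psi> (sym_group 4)) \<theta> (sym_group 3) \<cong> isom_group"
    using isom_group_semidirect by blast
  let ?K = "semidirect (semidirect Z2_pow3 \<psi> (sym_group 4)) \<theta> (sym_group 3)"
  have K: "group ?K"
    by (intro group_semidirect psi group_Z2_pow3 sym_group_is_group)
  have HK: "?H \<cong> ?K"
    by (rule group.iso_sym[OF K iso_trans[OF iso isom_group_matrix_iso]])
  obtain \<omega> where omega: "group_action_by_auts ?K Z2_pow2 \<omega>" "semidirect Z2_pow2 \<phi> ?H \<cong> semidirect Z2_pow2 \<omega> ?K"
    using semidirect_transport[OF phi(1) group_Z2_pow2 H K HK] by blast
  have Wg: "W_f4_group TYPE('k) = ?H" by (simp add: W_f4_group_def W)
  have gen: "W_f4 TYPE('k) = generate GL4Z {f4_s1, f4_s2, f4_s3, f4_s4}" unfolding W by (rule matrix_isometries_generate)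
  show ?thesis
    unfolding Wg by (intro conjI exI) (rule fine_grading_g universal_group_g u m gen phi psi omega HK)+
qed

end
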